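(* Let $\mathbf T=[a;b]\subset\mathbb R$, let $L:\mathbf T\to\mathbb R$ be a right-continuous function of finite variation, and let $(h_n)$, $(\rho_n)$, $(\widetilde\rho_n)$, $(x_n^0)$ be fixed sequences as described in the context. Suppose that for each Lipschitz continuous function $f:\mathbf T\times\mathbb R\to\mathbb R$ of bounded growth (i.e. $|f(t,x)|\le K(1+|x|)$ for all $t\in\mathbf T$, $x\in\mathbb R$, with some constant $K$) the sequence $x_n=x_n(f)$ of solutions of $$x_n(t+h_n)-x_n(t)=f_n(t,x_n(t))\,(L_n(t+h_n)-L_n(t)),\qquad x_n|_{[a;a+h_n)}=x_n^0,$$ converges in $\mathbf L_1(\mathbf T)$ as $n\to\infty$ (with $h_n\to0$). Let $x^0\in\mathbb R$ be the number (independent of $f$, and existing under these hypotheses) such that $\int_{\mathbf T}|x_n^0(\tau_t)-x^0|\,dt\to0$. (i) If $L$ is continuous, then for each such $f$ the limit of $x_n$ in $\mathbf L_1(\mathbf T)$ is (a.e. equal to) a solution of $$x(t)=x^0+\int_a^t f(s,x(s))\,dL^c(s)+\sum_{a<s\le t}\bigl(\varphi(\Delta L(s)f(s,\cdot),x(s-),1)-x(s-)\bigr),\quad t\in\mathbf T, \qquad ( * )$$ (where, $L$ being continuous, $L^c=L$ and the sum vanishes). (ii) If $L$ is discontinuous, then there exists a function $\sigma\in G$ such that $F_n(F_n^{-1}(u)-\delta h_n)\to\sigma(u)$ as $n\to\infty$ for all $\delta\in(0,1)$ and all continuity points $u\in[0,1]$ of $\sigma$, and for each such $f$ the limit of $x_n$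 in $\mathbf L_1(\mathbf T)$ is (a.e. equal to) a solution of $( * )$, where $\varphi$ is defined with the measure $\mu$ generated by $\sigma$.
   Context: Setting. $L$ is extended by $L(t)=L(b)$ for $t>b$ and $L(t)=L(a)$ for $t<a$. $(h_n)$ is a sequence with $h_n>0$, $h_n\to0$. $\rho_n\in C^\infty(\mathbb R)$, $\rho_n\ge0$, $\operatorname{supp}\rho_n\subseteq[0;1/n]$, $\int_0^{1/n}\rho_n(s)\,ds=1$; $\widetilde\rho_n\in C^\infty(\mathbb R^2)$, $\widetilde\rho_n\ge0$, $\operatorname{supp}\widetilde\rho_n\subseteq[0,1/n]^2$, $\int_{[0,1/n]^2}\widetilde\rho_n(u,v)\,du\,dv=1$. Put $$L_n(t)=\int_0^{1/n}L(t+s)\rho_n(s)\,ds,\qquad f_n(t,x)=\int_{[0,1/n]^2}f(t+u,x+v)\widetilde\rho_n(u,v)\,du\,dv,$$ where $f(t,x):=f(b,x)$ for $t>b$. The initial functions $x_n^0:[a;a+h_n)\to\mathbb R$ are restrictions of $C^\infty$ functions on $\mathbb R$ and do not depend on $f$. The recursion determines $x_n$ uniquely on $[a;\infty)\supset\mathbf T$. For $t\ge a$, $\tau_t\in[a;a+h_n)$ and $m_t\in\{0,1,2,\dots\}$ are defined by $t=\tau_t+m_th_n$ (they depend on $n$). $F_n:[-\infty;+\infty]\to[0;1]$ is $F_n(x)=\int_x^{1/n}\rho_n(s)\,ds$ (non-increasing, $F_n(-\infty)=1$, $F_n(+\infty)=0$), and $F_n^{-1}(u)=\sup\{x: F_n(x)=u\}$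 for $u\in[0;1]$. Class $G$: $\sigma:[0;1]\to[0;1]$ belongs to $G$ if there is a system of pairwise disjoint intervals $(a_i;b_i]\subseteq[0;1]$, $i\in I$, with $\sigma(u)=b_i$ for $u\in(a_i;b_i]$ and $\sigma(u)=u$ for $u\notin\bigcup_{i\in I}(a_i;b_i]$. Such $\sigma$ is nondecreasing and left-continuous; the measure $\mu$ generated by $\sigma$ is the Borel probability measure on $[0;1]$ with $\mu([0;u))=\sigma(u)$ for $u\in[0;1]$. $\Delta L(s)=L(s+)-L(s-)$, $L^c(t)=L(t)-\sum_{a<s\le t}\Delta L(s)$ is the continuous part of $L$, and $x(s-)$ is the left limit. For a Lipschitz function $z:\mathbb R\to\mathbb R$, $x\in\mathbb R$, and a Borel probability measure $\mu$ on $[0;1]$, $\varphi(z,x,\cdot)$ denotes the solution of $$\varphi(z,x,u)=x+\int_{[0;u)}z(\varphi(z,x,v))\,\mu(dv),\quad u\in[0;1].$$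
   Formalization: In (ii) the convergence to σ is claimed only if L is discontinuous somewhere in [a,b); for a jump only at b it can fail (L=1_{b}, x_n^0=0, ρ_n(s)=nρ(ns), h_n alternating n^{-2}, n^{-1/2}). There the limit still solves ( * ) for some σ∈G. *)

theory Defs
  imports "HOL-Probability.Probability"
begin

section \<open>Smooth functions and mollifiers\<close>

text \<open>\<open>C_k k g\<close>: \<open>g\<close> is \<open>k\<close> times continuously differentiable on the whole space;
  the directions in \<^const>\<open>Basis\<close> give the partial derivatives.\<close>

primrec C_k :: "nat \<Rightarrow> ('a::euclidean_space \<Rightarrow> real) \<Rightarrow> bool" where
  "C_k 0 g \<longleftrightarrow> continuous_on UNIV g"
| "C_k (Suc k) g \<longleftrightarrow> (\<forall>x. g differentiable (at x)) \<and>
     (\<forall>i\<in>Basis. C_k k (\<lambda>x. frechet_derivative g (at x) i))"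

definition C_infinity :: "('a::euclidean_space \<Rightarrow> real) \<Rightarrow> bool" where
  "C_infinity g \<longleftrightarrow> (\<forall>k. C_k k g)"

definition mollifier :: "'a::euclidean_space set \<Rightarrow> ('a \<Rightarrow> real) \<Rightarrow> bool" where
  "mollifier K \<rho> \<longleftrightarrow> C_infinity \<rho> \<and> (\<forall>s. \<rho> s \<ge> 0) \<and>
     closure {s. \<rho> s \<noteq> 0} \<subseteq> K \<and> (LINT s:K|lborel. \<rho> s) = 1"

section \<open>Functions of finite variation and Stieltjes integrals\<close>

text \<open>A finite increasing chain of points of \<open>S\<close> is given by the first \<open>n + 1\<close> values of a
  nondecreasing sequence in \<open>S\<close>.\<close>

definition variation_sums :: "real set \<Rightarrow> (real \<Rightarrow> real) \<Rightarrow> real set" where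
  "variation_sums S F =
     {(\<Sum>i<n. \<bar>F (p (Suc i)) - F (p i)\<bar>) | (n::nat) p. mono p \<and> range p \<subseteq> S}"

definition finite_variation_on :: "real set \<Rightarrow> (real \<Rightarrow> real) \<Rightarrow> bool" where
  "finite_variation_on S F \<longleftrightarrow> bdd_above (variation_sums S F)"

definition variation_fun :: "(real \<Rightarrow> real) \<Rightarrow> real \<Rightarrow> real" where
  "variation_fun F t = Sup (variation_sums {..t} F)"

text \<open>Lebesgue-Stieltjes integral with respect to a right-continuous \<open>F\<close> of finite variation on
  the line, using the decomposition \<open>F = V - (V - F)\<close> into nondecreasing right-continuous
  functions, where \<open>V\<close> is the variation function of \<open>F\<close>.\<close>

definition stieltjes_integrable :: "(real \<Rightarrow> real) \<Rightarrow> real set \<Rightarrow> (real \<Rightarrow> real) \<Rightarrow> bool" where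
  "stieltjes_integrable F A g \<longleftrightarrow>
     set_integrable (interval_measure (variation_fun F)) A g \<and>
     set_integrable (interval_measure (\<lambda>t. variation_fun F t - F t)) A g"

definition stieltjes_integral :: "(real \<Rightarrow> real) \<Rightarrow> real set \<Rightarrow> (real \<Rightarrow> real) \<Rightarrow> real" where
  "stieltjes_integral F A g =
     (LINT s:A|interval_measure (variation_fun F). g s)
     - (LINT s:A|interval_measure (\<lambda>t. variation_fun F t - F t). g s)"

definition extend :: "real \<Rightarrow> real \<Rightarrow> (real \<Rightarrow> real) \<Rightarrow> real \<Rightarrow> real" where
  "extend a b L t = (if t > b then L b else if t < a then L a else L t)"

definition jump :: "(real \<Rightarrow> real) \<Rightarrow> real \<Rightarrow> real" where
  "jump L s = Lim (at_right s) L - Lim (at_left s) L"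

definition cont_part :: "real \<Rightarrow> (real \<Rightarrow> real) \<Rightarrow> real \<Rightarrow> real" where
  "cont_part a L t = L t - (\<Sum>\<^sub>\<infinity>s\<in>{a<..t}. jump L s)"

section \<open>The difference scheme\<close>

definition mollify_L :: "real \<Rightarrow> real \<Rightarrow> (nat \<Rightarrow> real \<Rightarrow> real) \<Rightarrow> (real \<Rightarrow> real) \<Rightarrow> nat \<Rightarrow> real \<Rightarrow> real" where
  "mollify_L a b \<rho> L n t = (LINT s:{0..1 / real n}|lborel. extend a b L (t + s) * \<rho> n s)"

text \<open>\<open>min (t + u) b\<close> implements the convention \<open>f(t,x) = f(b,x)\<close> for \<open>t > b\<close>; only
  \<open>t \<ge> a\<close> is ever used.\<close>

definition mollify_f ::
  "real \<Rightarrow> (nat \<Rightarrow> real \<times> real \<Rightarrow> real) \<Rightarrow> (real \<times> real \<Rightarrow> real) \<Rightarrow> nat \<Rightarrow> real \<Rightarrow> real \<Rightarrow> real" where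
  "mollify_f b \<rho>2 f n t x =
     (LINT p:{0..1 / real n} \<times> {0..1 / real n}|lborel.
        f (min (t + fst p) b, x + snd p) * \<rho>2 n p)"

definition admissible :: "real \<Rightarrow> real \<Rightarrow> (real \<times> real \<Rightarrow> real) \<Rightarrow> bool" where
  "admissible a b f \<longleftrightarrow> (\<exists>C. C-lipschitz_on ({a..b} \<times> UNIV) f) \<and>
     (\<exists>K. \<forall>t\<in>{a..b}. \<forall>x. \<bar>f (t, x)\<bar> \<le> K * (1 + \<bar>x\<bar>))"

definition scheme_solution ::
  "real \<Rightarrow> real \<Rightarrow> (real \<Rightarrow> real) \<Rightarrow> (nat \<Rightarrow> real) \<Rightarrow> (nat \<Rightarrow> real \<Rightarrow> real) \<Rightarrow>
   (nat \<Rightarrow> real \<times> real \<Rightarrow> real) \<Rightarrow> (nat \<Rightarrow> real \<Rightarrow> real) \<Rightarrow> (real \<times> real \<Rightarrow> real) \<Rightarrow>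
   nat \<Rightarrow> (real \<Rightarrow> real) \<Rightarrow> bool" where
  "scheme_solution a b L h \<rho> \<rho>2 X0 f n x \<longleftrightarrow>
     (\<forall>t\<in>{a..<a + h n}. x t = X0 n t) \<and>
     (\<forall>t\<ge>a. x (t + h n) - x t =
        mollify_f b \<rho>2 f n t (x t) * (mollify_L a b \<rho> L n (t + h n) - mollify_L a b \<rho> L n t))"

text \<open>The decomposition \<open>t = tau a h t + m * h\<close> with \<open>m\<close> a natural number and
  \<open>tau a h t \<in> {a..<a + h}\<close>, for \<open>t \<ge> a\<close>.\<close>

definition tau :: "real \<Rightarrow> real \<Rightarrow> real \<Rightarrow> real" where
  "tau a h t = t - real (nat \<lfloor>(t - a) / h\<rfloor>) * h"

text \<open>The terms of the schemes are only specified for indices \<open>n \<ge> 1\<close>, hence the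
  eventuality; the first two conjuncts say that the functions belong to the space.\<close>

definition L1_converges :: "real set \<Rightarrow> (nat \<Rightarrow> real \<Rightarrow> real) \<Rightarrow> (real \<Rightarrow> real) \<Rightarrow> bool" where
  "L1_converges T X x \<longleftrightarrow>
     (\<forall>\<^sub>F n in sequentially. set_integrable lborel T (X n)) \<and> set_integrable lborel T x \<and>
     (\<lambda>n. LINT t:T|lborel. \<bar>X n t - x t\<bar>) \<longlonglongrightarrow> 0"

section \<open>The functions \<open>F_n\<close> and the class \<open>G\<close>\<close>

text \<open>The interval integral is oriented, so \<open>F_fun \<rho> n \<infinity> = 0\<close>.\<close>

definition F_fun :: "(nat \<Rightarrow> real \<Rightarrow> real) \<Rightarrow> nat \<Rightarrow> ereal \<Rightarrow> real" where
  "F_fun \<rho> n x = (LBINT s=x..ereal (1 / real n). \<rho> n s)"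

definition F_inv :: "(nat \<Rightarrow> real \<Rightarrow> real) \<Rightarrow> nat \<Rightarrow> real \<Rightarrow> ereal" where
  "F_inv \<rho> n u = Sup {x. F_fun \<rho> n x = u}"

definition class_G :: "(real \<Rightarrow> real) \<Rightarrow> bool" where
  "class_G \<sigma> \<longleftrightarrow>
     (\<exists>P :: (real \<times> real) set.
        (\<forall>(c, d)\<in>P. 0 \<le> c \<and> c < d \<and> d \<le> 1) \<and>
        disjoint_family_on (\<lambda>(c, d). {c<..d}) P \<and>
        (\<forall>(c, d)\<in>P. \<forall>u\<in>{c<..d}. \<sigma> u = d) \<and>
        (\<forall>u\<in>{0..1} - (\<Union>(c, d)\<in>P. {c<..d}). \<sigma> u = u))"

definition prob_on_unit :: "real measure \<Rightarrow> bool" where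
  "prob_on_unit \<mu> \<longleftrightarrow> prob_space \<mu> \<and> sets \<mu> = sets (restrict_space borel {0..1})"

definition generated_by :: "(real \<Rightarrow> real) \<Rightarrow> real measure \<Rightarrow> bool" where
  "generated_by \<sigma> \<mu> \<longleftrightarrow> prob_on_unit \<mu> \<and> (\<forall>u\<in>{0..1}. measure \<mu> {0..<u} = \<sigma> u)"

section \<open>The limit equation\<close>

definition phi_equation ::
  "real measure \<Rightarrow> (real \<Rightarrow> real) \<Rightarrow> real \<Rightarrow> (real \<Rightarrow> real) \<Rightarrow> bool" where
  "phi_equation \<mu> z x \<phi> \<longleftrightarrow> set_integrable \<mu> {0..<1} (\<lambda>v. z (\<phi> v)) \<and>
     (\<forall>u\<in>{0..1}. \<phi> u = x + (LINT v:{0..<u}|\<mu>. z (\<phi> v)))"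

text \<open>For Lipschitz \<open>z\<close> the solution exists and its values on \<open>{0..1}\<close> are unique. It is not
  unique as a function on the line, so the definite description is applied to its value at \<open>u\<close>.\<close>

definition phi :: "real measure \<Rightarrow> (real \<Rightarrow> real) \<Rightarrow> real \<Rightarrow> real \<Rightarrow> real" where
  "phi \<mu> z x u = (THE y. \<exists>\<phi>. phi_equation \<mu> z x \<phi> \<and> y = \<phi> u)"

definition jump_term ::
  "real measure \<Rightarrow> (real \<Rightarrow> real) \<Rightarrow> (real \<times> real \<Rightarrow> real) \<Rightarrow> (real \<Rightarrow> real) \<Rightarrow> real \<Rightarrow> real" where
  "jump_term \<mu> L f x s =
     phi \<mu> (\<lambda>y. jump L s * f (s, y)) (Lim (at_left s) x) 1 - Lim (at_left s) x"

text \<open>A solution of the limit equation on \<open>{a..b}\<close>. The first three conjuncts say that all the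
  expressions in the equation (left limits, Stieltjes integral, sum over jumps) make sense.
  The continuous part is continuous, so \<open>{a<..t}\<close> and \<open>{a..t}\<close> give the same integral.\<close>

definition limit_solution ::
  "real \<Rightarrow> real \<Rightarrow> (real \<Rightarrow> real) \<Rightarrow> real measure \<Rightarrow> (real \<times> real \<Rightarrow> real) \<Rightarrow> real \<Rightarrow>
   (real \<Rightarrow> real) \<Rightarrow> bool" where
  "limit_solution a b L \<mu> f x0 x \<longleftrightarrow>
     (let L' = extend a b L; Lc = cont_part a L' in
       (\<forall>s\<in>{a<..b}. \<exists>l. (x \<longlongrightarrow> l) (at_left s)) \<and>
       stieltjes_integrable Lc {a<..b} (\<lambda>s. f (s, x s)) \<and>
       jump_term \<mu> L' f x summable_on {a<..b} \<and>
       (\<forall>t\<in>{a..b}. x t = x0 + stieltjes_integral Lc {a<..t} (\<lambda>s. f (s, x s))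
          + (\<Sum>\<^sub>\<infinity>s\<in>{a<..t}. jump_term \<mu> L' f x s)))"

end

theory Submission imports Defs begin

text \<open>Along a grid of fixed phase the variation of the scheme is dominated by the variation of \<open>L\<close>,
  and for almost every phase a subsequence converges in \<open>L\<^sub>1\<close> and at the initial point. The limit
  \<open>y\<close> satisfies \<open>\<bar>y u - y t - f (t, y t) (L u - L t)\<bar> \<le> K ((u - t) + \<Delta>V) \<Delta>V\<close> with \<open>V\<close> the variation
  of \<open>L\<close>. If the jumps of \<open>y\<close> are those prescribed by the equation, then its right hand side satisfies
  the same bound, and a continuous function whose increments are of this order is constant.

  Across a jump of \<open>L\<close> at \<open>s\<close> the scheme is an Euler scheme on the partition formed by the numbers
  \<open>F_n (s - t_k)\<close>. If the map rounding up to that partition converges to \<open>\<sigma>\<close>, the Euler scheme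
  converges to the solution of \<open>\<psi> w = x + (\<integral>v\<in>{0..w}. z (\<psi> (\<pi> v)))\<close>, where \<open>\<pi>\<close> rounds down to a fixed
  point of \<open>\<sigma>\<close>, and \<open>\<psi> 1 = \<phi>(z, x, 1)\<close>. Conversely, for coefficients which are \<open>1 + \<epsilon> g\<close> at the jump
  the value after the jump is, to first order in \<open>\<epsilon>\<close>, a Riemann sum of \<open>g\<close> over the partition. Its
  limit therefore does not depend on the phase, and choosing \<open>g\<close> to be bumps shows that the
  functions \<open>F_n (F_n\<^sup>-\<^sup>1 u - \<delta> h_n)\<close> converge to a function that does not depend on \<open>\<delta>\<close>.\<close>

section \<open>Functions of finite variation\<close>

text \<open>The recursion only links points that differ by multiples of \<open>h n\<close>, so for
  each \<open>n\<close> it splits into independent recursions, one per phase in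
  \<open>{0..<1}\<close>, and nothing forces neighbouring phases to agree. Convergence in L1
  controls them on average only. Since translations are continuous in L1, it passes to evaluation on
  grids averaged over the phase, and a null set of bad phases is discarded. One good phase suffices,
  as the limit is common to all of them.

  The obstacle is a jump, where the quadratic bound is not small. The jumps of the limit are
  therefore treated apart, and it matters that \<open>V\<close> jumps by exactly
  \<open>|J s|\<close>: the rest of the variation near \<open>s\<close> is then negligible.

  A jump at \<open>b\<close> leaves no trace in L1, because the scheme meets it only within
  \<open>h n + 1 / n\<close> of \<open>b\<close>. The value of the solution at \<open>b\<close> is
  therefore set by the equation, and the convergence to \<sigma> is tied to jumps before
  \<open>b\<close>.

  Independence of \<delta> is used twice: shifting by \<open>h n / 2\<close> and then by
  \<open>h n / 4\<close> is one shift by \<open>3 * h n / 4\<close>, and this makes \<sigma>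
  idempotent, hence a member of class G.\<close>

lemma variation_sum_le:
  fixes F Z :: "real \<Rightarrow> real"
  assumes p: "mono (p :: nat \<Rightarrow> real)" "range p \<subseteq> S"
    and incr: "\<And>u v. u \<in> S \<Longrightarrow> v \<in> S \<Longrightarrow> u \<le> v \<Longrightarrow> \<bar>F v - F u\<bar> \<le> Z v - Z u"
  shows "(\<Sum>i<n. \<bar>F (p (Suc i)) - F (p i)\<bar>) \<le> Z (p n) - Z (p 0)"
proof -
  have "(\<Sum>i<n. \<bar>F (p (Suc i)) - F (p i)\<bar>) \<le> (\<Sum>i<n. Z (p (Suc i)) - Z (p i))"
    using p by (intro sum_mono incr) (auto simp: mono_def)
  also have "\<dots> = Z (p n) - Z (p 0)"
    using sum_lessThan_telescope[of "\<lambda>i. Z (p i)" n] by simp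
  finally show ?thesis .
qed

lemma variation_sums_mono: "S \<subseteq> T \<Longrightarrow> variation_sums S F \<subseteq> variation_sums T F"
  unfolding variation_sums_def by blast

lemma zero_in_variation_sums: "t \<in> S \<Longrightarrow> 0 \<in> variation_sums S F"
  unfolding variation_sums_def
  by (intro CollectI exI[of _ 0] exI[of _ "\<lambda>_. t"]) (auto simp: mono_def)

lemma finite_variation_dominated:
  fixes F Z :: "real \<Rightarrow> real"
  assumes "\<And>u v. u \<le> v \<Longrightarrow> \<bar>F v - F u\<bar> \<le> Z v - Z u" and bd: "\<And>u. 0 \<le> Z u \<and> Z u \<le> M"
  shows "finite_variation_on UNIV F"
  unfolding finite_variation_on_def variation_sums_def
proof (rule bdd_aboveI)
  fix x assume "x \<in> {(\<Sum>i<n. \<bar>F (p (Suc i)) - F (p i)\<bar>) | (n::nat) p. mono p \<and> range p \<subseteq> UNIV}"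
  then obtain n p where x: "x = (\<Sum>i<n. \<bar>F (p (Suc i)) - F (p i)\<bar>)" and p: "mono (p::nat \<Rightarrow> real)" by blast
  have "x \<le> Z (p n) - Z (p 0)"
    unfolding x by (rule variation_sum_le[OF p, of UNIV]) (use assms in auto)
  also have "\<dots> \<le> M" using bd[of "p n"] bd[of "p 0"] by linarith
  finally show "x \<le> M" .
qed

section \<open>The variation function: minimality and one-sided limits\<close>

locale finite_variation =
  fixes F :: "real \<Rightarrow> real"
  assumes fv: "finite_variation_on UNIV F"
begin

abbreviation "V \<equiv> variation_fun F"

lemma bdd: "bdd_above (variation_sums S F)"
  using fv bdd_above_mono[OF _ variation_sums_mono[of S UNIV F]]
  unfolding finite_variation_on_def by auto

lemma V_nonneg: "0 \<le> V t"
  unfolding variation_fun_def by (rule cSup_upper[OF zero_in_variation_sums bdd]) auto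

lemma V_bounded: "\<exists>M. \<forall>t. V t \<le> M"
proof -
  obtain M where M: "\<And>x. x \<in> variation_sums UNIV F \<Longrightarrow> x \<le> M"
    using bdd[of UNIV] by (auto simp: bdd_above_def)
  have "V t \<le> M" for t
    unfolding variation_fun_def
    by (rule cSup_least) (use zero_in_variation_sums[of t "{..t}"] M variation_sums_mono[of "{..t}" UNIV F] in auto)
  then show ?thesis by blast
qed

text \<open>\<open>Z\<close> has to dominate increments only between points of \<open>S\<close>.
  Choosing \<open>S\<close> with a gap next to a point later isolates the increment across that gap
  from the variation on both sides.\<close>

lemma V_leI:
  assumes incr: "\<And>u v. u \<in> S \<Longrightarrow> v \<in> S \<Longrightarrow> u \<le> v \<Longrightarrow> \<bar>F v - F u\<bar> \<le> Z v - Z u"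
    and "mono p" "range p \<subseteq> {..T} \<inter> S" "T \<in> S" "\<And>u. u \<in> S \<Longrightarrow> 0 \<le> Z u"
  shows "(\<Sum>i<n. \<bar>F (p (Suc i)) - F (p i)\<bar>) \<le> Z T"
proof -
  have pS: "\<And>i. p i \<in> S" "\<And>i. p i \<le> T" using assms(3) by auto
  have "(\<Sum>i<n. \<bar>F (p (Suc i)) - F (p i)\<bar>) \<le> Z (p n) - Z (p 0)"
    by (rule variation_sum_le[OF assms(2) _ incr, of S]) (use pS in auto)
  also have "\<dots> \<le> Z T"
    using incr[OF pS(1)[of n] assms(4) pS(2)[of n]] assms(5)[OF pS(1)[of 0]] by linarith
  finally show ?thesis .
qed

lemma incr_le_V:
  assumes "u \<le> v" shows "\<bar>F v - F u\<bar> \<le> V v - V u"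
proof -
  have "x \<le> V v - \<bar>F v - F u\<bar>" if x: "x \<in> variation_sums {..u} F" for x
  proof -
    obtain n and p :: "nat \<Rightarrow> real" where x: "x = (\<Sum>i<n. \<bar>F (p (Suc i)) - F (p i)\<bar>)"
      and p: "mono p" "range p \<subseteq> {..u}" using x unfolding variation_sums_def by blast
    define q where "q i = (if i \<le> n then p i else if i = Suc n then u else v)" for i
    have pu: "p i \<le> u" "p i \<le> v" for i using p(2) assms by (auto intro: order_trans[of "p i" u])
    have "mono q" using p(1) assms pu by (auto simp: mono_def q_def)
    moreover have "range q \<subseteq> {..v}" using pu assms by (auto simp: q_def)
    ultimately have "(\<Sum>i<Suc (Suc n). \<bar>F (q (Suc i)) - F (q i)\<bar>) \<in> variation_sums {..v} F"
      unfolding variation_sums_def by blast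
    then have "(\<Sum>i<Suc (Suc n). \<bar>F (q (Suc i)) - F (q i)\<bar>) \<le> V v"
      unfolding variation_fun_def by (rule cSup_upper[OF _ bdd])
    moreover have "(\<Sum>i<n. \<bar>F (q (Suc i)) - F (q i)\<bar>) = x"
      unfolding x by (rule sum.cong) (auto simp: q_def)
    ultimately show ?thesis by (simp add: q_def)
  qed
  then have "V u \<le> V v - \<bar>F v - F u\<bar>"
    unfolding variation_fun_def by (intro cSup_least) (use zero_in_variation_sums[of u "{..u}" F] in auto)
  then show ?thesis by linarith
qed

lemma V_mono: "u \<le> v \<Longrightarrow> V u \<le> V v"
  using incr_le_V[of u v] by linarith

lemma V_approx:
  assumes "e > 0"
  obtains n p where "mono (p :: nat \<Rightarrow> real)" "range p \<subseteq> {..t}"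
    "V t - e < (\<Sum>i<n. \<bar>F (p (Suc i)) - F (p i)\<bar>)"
proof -
  have "\<exists>x\<in>variation_sums {..t} F. V t - e < x"
    unfolding variation_fun_def
    by (subst less_cSup_iff[symmetric, OF _ bdd]) (use zero_in_variation_sums[of t "{..t}" F] assms in auto)
  then show ?thesis unfolding variation_sums_def using that by blast
qed

text \<open>Follow \<open>V\<close> up to \<open>u\<close> and \<open>Z\<close> from there on: the
  glued function still dominates the increments of \<open>F\<close>, so its value at
  \<open>v\<close> bounds the sum over a nearly optimal chain. Thus \<open>V\<close> is the smallest
  dominating function.\<close>

lemma V_incr_dominated:
  fixes Z :: "real \<Rightarrow> real"
  assumes Z: "\<And>u v. u \<le> v \<Longrightarrow> \<bar>F v - F u\<bar> \<le> Z v - Z u" and uv: "u \<le> v"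
  shows "V v - V u \<le> Z v - Z u"
proof (rule field_le_epsilon)
  fix e :: real assume "e > 0"
  then obtain n p where p: "mono (p :: nat \<Rightarrow> real)" "range p \<subseteq> {..v}"
    "V v - e < (\<Sum>i<n. \<bar>F (p (Suc i)) - F (p i)\<bar>)" by (rule V_approx)
  define Y where "Y x = (if x \<le> u then V x else V u + Z x - Z u)" for x
  have Zm: "x \<le> y \<Longrightarrow> Z x \<le> Z y" for x y using Z[of x y] by linarith
  have 1: "\<bar>F y - F x\<bar> \<le> Y y - Y x" if "x \<le> y" for x y
    using that incr_le_V[of x y] incr_le_V[of x u] Z[of u y] Z[of x y] by (auto simp: Y_def)
  have "(\<Sum>i<n. \<bar>F (p (Suc i)) - F (p i)\<bar>) \<le> Y v"
  proof (rule V_leI[where S=UNIV and Z=Y])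
    fix x show "0 \<le> Y x" using V_nonneg[of x] V_nonneg[of u] Zm[of u x] by (auto simp: Y_def)
  qed (use p 1 in auto)
  then show "V v - V u \<le> Z v - Z u + e" using p uv by (auto simp: Y_def split: if_splits)
qed

text \<open>A nearly optimal chain for \<open>V s\<close> has finitely many points, so none of them
  lies strictly between some \<open>m < s\<close> and \<open>s\<close>. For \<open>t\<close> in that
  gap the chain crosses from \<open>{..t}\<close> to \<open>s\<close> in a single step, which costs
  \<open>|F s - F t|\<close>; the rest costs at most \<open>V t\<close>.\<close>

lemma V_left_approx:
  assumes "e > 0"
  shows "\<forall>\<^sub>F t in at_left s. V s - V t \<le> \<bar>F s - F t\<bar> + e"
proof -
  obtain n p where p: "mono (p :: nat \<Rightarrow> real)" "range p \<subseteq> {..s}"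
    "V s - e < (\<Sum>i<n. \<bar>F (p (Suc i)) - F (p i)\<bar>)" using V_approx[OF assms] .
  define m where "m = Max (insert (s - 1) {p i | i. i \<le> n \<and> p i < s})"
  have fin: "finite {p i | i. i \<le> n \<and> p i < s}" by auto
  have m: "m < s" unfolding m_def using fin by (subst Max_less_iff) auto
  have pm: "p i \<le> m \<or> p i = s" if "i \<le> n" for i
  proof -
    have "p i \<le> s" using p by auto
    then show ?thesis unfolding m_def using fin that by (intro disjCI Max_ge) auto
  qed
  have "\<forall>\<^sub>F t in at_left s. t \<in> {m<..<s}" using m by (rule eventually_at_left_real)
  then show ?thesis
  proof eventually_elim
    case (elim t)
    define Y where "Y x = (if x \<le> t then V x else V t + \<bar>F s - F t\<bar>)" for x
    define S where "S = insert s {..t}"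
    have 1: "\<bar>F y - F x\<bar> \<le> Y y - Y x" if "x \<le> y" "x \<in> S" "y \<in> S" for x y
      using that elim incr_le_V[of x y] incr_le_V[of x t] by (auto simp: Y_def S_def)
    define q where "q i = p (min i n)" for i
    have "(\<Sum>i<n. \<bar>F (q (Suc i)) - F (q i)\<bar>) \<le> Y s"
    proof (rule V_leI[where S=S and Z=Y])
      show "mono q" using p unfolding q_def mono_def by (auto simp: min_def)
      have "q i \<le> t \<or> q i = s" for i using pm[of "min i n"] elim by (auto simp: q_def)
      then show "range q \<subseteq> {..s} \<inter> S" using elim by (force simp: S_def)
    qed (use 1 V_nonneg in \<open>auto simp: S_def Y_def\<close>)
    moreover have "(\<Sum>i<n. \<bar>F (q (Suc i)) - F (q i)\<bar>) = (\<Sum>i<n. \<bar>F (p (Suc i)) - F (p i)\<bar>)"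
      by (rule sum.cong) (auto simp: q_def)
    ultimately show ?case using p elim by (auto simp: Y_def)
  qed
qed

lemma V_right_approx:
  assumes "e > 0"
  shows "\<forall>\<^sub>F t in at_right s. V t - V s \<le> \<bar>F t - F s\<bar> + e"
proof -
  \<comment> \<open>The chain has to extend beyond the points \<open>t\<close> to the right of
    \<open>s\<close>; any fixed point after \<open>s\<close> would serve as its end.\<close>
  obtain n p where p: "mono (p :: nat \<Rightarrow> real)" "range p \<subseteq> {..s+1}"
    "V (s+1) - e < (\<Sum>i<n. \<bar>F (p (Suc i)) - F (p i)\<bar>)" using V_approx[OF assms] .
  define m where "m = Min (insert (s + 1) {p i | i. i \<le> n \<and> p i > s})"
  have fin: "finite {p i | i. i \<le> n \<and> p i > s}" by auto
  have m: "m > s" unfolding m_def using fin by (subst Min_gr_iff) auto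
  have ms: "m \<le> s + 1" unfolding m_def using fin by (intro Min_le) auto
  have pm: "p i \<ge> m \<or> p i \<le> s" if "i \<le> n" for i
    unfolding m_def using fin that by (intro disjCI Min_le) auto
  have "\<forall>\<^sub>F t in at_right s. t \<in> {s<..<m}" using m by (rule eventually_at_right_real)
  then show ?thesis
  proof eventually_elim
    case (elim t)
    define Y where "Y x = (if x \<le> s then V x else V s + \<bar>F t - F s\<bar> + V x - V t)" for x
    define S where "S = {..s} \<union> {t..}"
    have 1: "\<bar>F y - F x\<bar> \<le> Y y - Y x" if "x \<le> y" "x \<in> S" "y \<in> S" for x y
      using that elim incr_le_V[of x y] incr_le_V[of x s] incr_le_V[of t y] by (auto simp: Y_def S_def)
    define q where "q i = p (min i n)" for i
    have "(\<Sum>i<n. \<bar>F (q (Suc i)) - F (q i)\<bar>) \<le> Y (s+1)"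
    proof (rule V_leI[where S=S and Z=Y])
      show "mono q" using p unfolding q_def mono_def by (auto simp: min_def)
      have "q i \<le> s \<or> t \<le> q i" for i using pm[of "min i n"] elim by (auto simp: q_def)
      moreover have "q i \<le> s + 1" for i using p(2) by (auto simp: q_def)
      ultimately show "range q \<subseteq> {..s+1} \<inter> S" by (auto simp: S_def)
      fix x assume "x \<in> S" then show "0 \<le> Y x" using V_nonneg[of x] V_nonneg[of s] V_mono[of t x]
        by (auto simp: Y_def S_def)
    qed (use 1 elim ms in \<open>auto simp: S_def\<close>)
    moreover have "(\<Sum>i<n. \<bar>F (q (Suc i)) - F (q i)\<bar>) = (\<Sum>i<n. \<bar>F (p (Suc i)) - F (p i)\<bar>)"
      by (rule sum.cong) (auto simp: q_def)
    ultimately show ?case using p elim ms by (auto simp: Y_def)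
  qed
qed

lemma V_right_limit:
  assumes "(F \<longlongrightarrow> F s) (at_right s)" shows "(V \<longlongrightarrow> V s) (at_right s)"
proof (rule tendstoI)
  fix e :: real assume e: "e > 0"
  then have "\<forall>\<^sub>F t in at_right s. dist (F t) (F s) < e/2" using assms by (auto dest!: tendstoD[where e="e/2"])
  moreover have "\<forall>\<^sub>F t in at_right s. V t - V s \<le> \<bar>F t - F s\<bar> + e/3" using e by (intro V_right_approx) auto
  moreover have "\<forall>\<^sub>F t in at_right s. t > s" by (auto simp: eventually_at_filter)
  ultimately show "\<forall>\<^sub>F t in at_right s. dist (V t) (V s) < e"
  proof eventually_elim
    case (elim t)
    then show ?case using V_mono[of s t] e by (auto simp: dist_real_def)
  qed
qed

text \<open>The lower bound is the increment of \<open>F\<close> itself, the upper bound is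
  \<open>V_left_approx\<close>. Equality, and not only an inequality between the two jumps, is what
  leaves little variation near \<open>s\<close> after the jump has been subtracted.\<close>

lemma V_left_limit:
  assumes F: "(F \<longlongrightarrow> l) (at_left s)" shows "(V \<longlongrightarrow> V s - \<bar>F s - l\<bar>) (at_left s)"
proof (rule tendstoI)
  fix e :: real assume e: "e > 0"
  have "((\<lambda>t. \<bar>F s - F t\<bar>) \<longlongrightarrow> \<bar>F s - l\<bar>) (at_left s)" by (intro tendsto_intros F)
  then have "\<forall>\<^sub>F t in at_left s. dist \<bar>F s - F t\<bar> \<bar>F s - l\<bar> < e/2" using e by (auto dest!: tendstoD[where e="e/2"])
  moreover have "\<forall>\<^sub>F t in at_left s. V s - V t \<le> \<bar>F s - F t\<bar> + e/3" using e by (intro V_left_approx) auto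
  moreover have "\<forall>\<^sub>F t in at_left s. t < s" by (auto simp: eventually_at_filter)
  ultimately show "\<forall>\<^sub>F t in at_left s. dist (V t) (V s - \<bar>F s - l\<bar>) < e"
  proof eventually_elim
    case (elim t)
    then show ?case using incr_le_V[of t s] e unfolding dist_real_def by linarith
  qed
qed

text \<open>The nondecreasing bounded \<open>V\<close> has a supremum over \<open>{..<s}\<close>;
  beyond a point where \<open>V\<close> is within \<open>e\<close> of it, \<open>F\<close>
  oscillates by less than \<open>e\<close>, so its left filter is Cauchy.\<close>

lemma left_limit_exists: "\<exists>l. (F \<longlongrightarrow> l) (at_left s)"
proof -
  define M where "M = (SUP t\<in>{..<s}. V t)"
  obtain B where B: "\<And>t. V t \<le> B" using V_bounded by auto
  have bddV: "bdd_above (V ` {..<s})" using B by (auto intro!: bdd_aboveI)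
  have *: "\<exists>t0<s. \<forall>t\<in>{t0<..<s}. \<forall>t'\<in>{t0<..<s}. \<bar>F t - F t'\<bar> < e" if "e > 0" for e
  proof -
    have "M - e < M" using that by simp
    then obtain t0 where t0: "t0 < s" "M - e < V t0"
      unfolding M_def by (subst (asm) less_cSUP_iff[OF _ bddV]) auto
    have *: "V t \<le> M" if "t < s" for t unfolding M_def using that by (intro cSUP_upper bddV) auto
    have "\<bar>F t - F t'\<bar> < e" if "t0 < t" "t \<le> t'" "t' < s" for t t'
      using incr_le_V[of t t'] V_mono[of t0 t] *[of t'] t0 that by linarith
    then show ?thesis using t0 by (metis abs_minus_commute greaterThanLessThan_iff linear)
  qed
  then have "cauchy_filter (filtermap F (at_left s))"
    unfolding cauchy_filter_metric_filtermap
  proof (intro allI impI)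
    fix e :: real assume "e > 0"
    then obtain t0 where "t0 < s" "\<forall>t\<in>{t0<..<s}. \<forall>t'\<in>{t0<..<s}. \<bar>F t - F t'\<bar> < e"
      using * by blast
    then show "\<exists>P. eventually P (at_left s) \<and> (\<forall>x y. P x \<and> P y \<longrightarrow> dist (F x) (F y) < e)"
      by (intro exI[of _ "\<lambda>t. t \<in> {t0<..<s}"]) (use eventually_at_left_real[of t0 s] in \<open>auto simp: dist_real_def\<close>)
  qed
  then have "\<exists>l. filtermap F (at_left s) \<le> nhds l"
    using complete_UNIV[where 'a=real] unfolding complete_uniform
    by (elim allE[of _ "filtermap F (at_left s)"]) (auto simp: filtermap_bot_iff trivial_limit_at_left_real)
  then show ?thesis by (auto simp: filterlim_def)
qed

end

lemma infsum_abs_bound: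
  fixes g w :: "real \<Rightarrow> real"
  assumes g: "\<And>s. s \<in> A \<Longrightarrow> \<bar>g s\<bar> \<le> w s"
    and w: "\<And>S. finite S \<Longrightarrow> S \<subseteq> A \<Longrightarrow> sum w S \<le> D"
  shows "g summable_on A" "\<bar>infsum g A\<bar> \<le> D"
proof -
  have fin: "sum (\<lambda>s. \<bar>g s\<bar>) S \<le> D" if "finite S" "S \<subseteq> A" for S
  proof -
    have "sum (\<lambda>s. \<bar>g s\<bar>) S \<le> sum w S" using g that by (intro sum_mono) auto
    also have "\<dots> \<le> D" by (rule w[OF that])
    finally show ?thesis .
  qed
  have abs: "(\<lambda>s. \<bar>g s\<bar>) summable_on A"
  proof (rule nonneg_bdd_above_summable_on)
    show "bdd_above (sum (\<lambda>s. \<bar>g s\<bar>) ` {F. F \<subseteq> A \<and> finite F})"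
      using fin by (intro bdd_aboveI2[of _ _ D]) blast
  qed simp
  then show "g summable_on A" by (rule abs_summable_summable[of g A, unfolded real_norm_def])
  have "\<bar>infsum g A\<bar> \<le> infsum (\<lambda>s. \<bar>g s\<bar>) A"
    by (rule norm_infsum_bound[of g A, unfolded real_norm_def, OF abs])
  also have "\<dots> \<le> D" by (rule infsum_le_finite_sums[OF abs fin])
  finally show "\<bar>infsum g A\<bar> \<le> D" .
qed

lemma interval_measure_integral_bound:
  fixes G g :: "real \<Rightarrow> real"
  assumes G: "\<And>x y. x \<le> y \<Longrightarrow> G x \<le> G y" "\<And>x. continuous (at_right x) G"
    and g: "g \<in> borel_measurable borel" and tu: "t \<le> u"
    and b: "\<And>s. s \<in> {t<..u} \<Longrightarrow> \<bar>g s - c\<bar> \<le> e"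
  shows "set_integrable (interval_measure G) {t<..u} g"
    and "\<bar>(LINT s:{t<..u}|interval_measure G. g s) - c * (G u - G t)\<bar> \<le> e * (G u - G t)"
proof -
  let ?M = "interval_measure G"
  have em: "emeasure ?M {t<..u} = ennreal (G u - G t)"
    by (rule emeasure_interval_measure_Ioc[OF tu G])
  then have me: "measure ?M {t<..u} = G u - G t"
    using G(1)[OF tu] by (simp add: measure_def)
  have const: "set_integrable ?M {t<..u} (\<lambda>_. k)" for k :: real
    unfolding set_integrable_def using em by (auto intro!: integrable_mult_left integrable_real_indicator)
  have gc: "set_borel_measurable ?M {t<..u} (\<lambda>s. g s - c)"
    using g unfolding set_borel_measurable_def by auto
  have int: "set_integrable ?M {t<..u} (\<lambda>s. g s - c)"
    by (rule set_integrable_bound[OF const[of e] gc]) (use b in \<open>fastforce intro!: AE_I2\<close>)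
  from set_integral_add(1)[OF int const[of c]] show gi: "set_integrable ?M {t<..u} g" by simp
  have "(LINT s:{t<..u}|?M. g s) - c * (G u - G t) = (LINT s:{t<..u}|?M. g s - c)"
    using me by (subst set_integral_diff(2)[OF gi const]) (simp add: set_lebesgue_integral_def)
  also have "\<bar>\<dots>\<bar> \<le> (LINT s:{t<..u}|?M. \<bar>g s - c\<bar>)"
    using set_integral_norm_bound[OF int] by simp
  also have "\<dots> \<le> (LINT s:{t<..u}|?M. e)"
    by (rule set_integral_mono) (use const int b in \<open>auto intro: set_integrable_abs\<close>)
  also have "\<dots> = e * (G u - G t)" using me by (simp add: set_lebesgue_integral_def)
  finally show "\<bar>(LINT s:{t<..u}|?M. g s) - c * (G u - G t)\<bar> \<le> e * (G u - G t)" .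
qed

section \<open>Jumps and continuous part of a right-continuous path\<close>

locale bv_path = finite_variation F for F :: "real \<Rightarrow> real" +
  fixes a b :: real
  assumes ab: "a < b" and right_cont: "\<And>s. (F \<longlongrightarrow> F s) (at_right s)"
    and left_const: "\<And>t. t \<le> a \<Longrightarrow> F t = F a" and right_const: "\<And>t. t \<ge> b \<Longrightarrow> F t = F b"
begin

abbreviation "J \<equiv> jump F"
abbreviation "Fc \<equiv> cont_part a F"

lemma left_lim: "(F \<longlongrightarrow> F s - J s) (at_left s)"
proof -
  obtain l where l: "(F \<longlongrightarrow> l) (at_left s)" using left_limit_exists by blast
  have "Lim (at_left s) F = l" "Lim (at_right s) F = F s"
    using l right_cont by (auto intro: tendsto_Lim)
  then show ?thesis using l by (simp add: jump_def)
qed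

lemma V_right: "(V \<longlongrightarrow> V s) (at_right s)"
  by (rule V_right_limit[OF right_cont])

lemma V_left: "(V \<longlongrightarrow> V s - \<bar>J s\<bar>) (at_left s)"
  using V_left_limit[OF left_lim, of s] by simp

lemma jump_eqI:
  assumes "(F \<longlongrightarrow> F s) (at_left s)" shows "J s = 0"
  using tendsto_unique[OF _ left_lim assms] by simp

lemma jump_outside: "s \<le> a \<or> s > b \<Longrightarrow> J s = 0"
proof (rule jump_eqI)
  assume s: "s \<le> a \<or> s > b"
  have "\<forall>\<^sub>F t in at_left s. F t = F s"
    using s
  proof
    assume "s \<le> a"
    have "\<forall>\<^sub>F t in at_left s. t \<in> {s - 1<..<s}" by (rule eventually_at_left_real) simp
    then show ?thesis
    proof eventually_elim
      case (elim t)
      then show ?case using left_const[of t] left_const[of s] \<open>s \<le> a\<close> by simp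
    qed
  next
    assume "s > b"
    from eventually_at_left_real[OF this] show ?thesis
    proof eventually_elim
      case (elim t)
      then show ?case using right_const[of t] right_const[of s] by simp
    qed
  qed
  then show "(F \<longlongrightarrow> F s) (at_left s)" by (rule tendsto_eventually)
qed

lemma jump_le_V: "x < s \<Longrightarrow> \<bar>J s\<bar> \<le> V s - V x"
proof -
  assume "x < s"
  have "V x \<le> V s - \<bar>J s\<bar>"
    by (rule tendsto_lowerbound[OF V_left eventually_mono[OF eventually_at_left_real[OF \<open>x < s\<close>]]])
      (auto intro: V_mono)
  then show ?thesis by linarith
qed

lemma sum_jumps_le:
  assumes "finite A" "A \<subseteq> {t<..u}" "t \<le> u"
  shows "(\<Sum>s\<in>A. \<bar>J s\<bar>) \<le> V u - V t"
  using assms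
proof (induction A arbitrary: u rule: finite_linorder_max_induct)
  case empty then show ?case using V_mono by auto
next
  case (insert m A)
  define x where "x = Max (insert t A)"
  have x: "t \<le> x" "x < m" "A \<subseteq> {t<..x}"
    using insert by (auto simp: x_def)
  have "(\<Sum>s\<in>insert m A. \<bar>J s\<bar>) \<le> (V m - V x) + (V x - V t)"
    using insert jump_le_V[OF x(2)] insert.IH[OF x(3,1)] by (subst sum.insert) auto
  also have "\<dots> \<le> V u - V t" using V_mono[of m u] insert by auto
  finally show ?case .
qed

lemma sum_jumps_less:
  assumes "finite A" "A \<subseteq> {t<..<u}" "t < u"
  shows "(\<Sum>s\<in>A. \<bar>J s\<bar>) \<le> V u - \<bar>J u\<bar> - V t"
proof -
  have "(\<Sum>s\<in>insert u A. \<bar>J s\<bar>) \<le> V u - V t"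
    using assms by (intro sum_jumps_le) auto
  moreover have "(\<Sum>s\<in>insert u A. \<bar>J s\<bar>) = \<bar>J u\<bar> + (\<Sum>s\<in>A. \<bar>J s\<bar>)"
    using assms by (intro sum.insert) auto
  ultimately show ?thesis by linarith
qed

lemma jump_dominated:
  fixes g :: "real \<Rightarrow> real"
  assumes g: "\<And>s. s \<in> {t<..u} \<Longrightarrow> \<bar>g s\<bar> \<le> K * \<bar>J s\<bar>" and tu: "t \<le> u" and K: "0 \<le> K"
  shows "g summable_on {t<..u}" "\<bar>infsum g {t<..u}\<bar> \<le> K * (V u - V t)"
  by (rule infsum_abs_bound[where w="\<lambda>s. K * \<bar>J s\<bar>"];
      use g sum_jumps_le[OF _ _ tu] K in \<open>auto simp flip: sum_distrib_left intro: mult_left_mono\<close>)+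

lemma jump_dominated_less:
  fixes g :: "real \<Rightarrow> real"
  assumes g: "\<And>s. s \<in> {t<..<u} \<Longrightarrow> \<bar>g s\<bar> \<le> K * \<bar>J s\<bar>" and tu: "t < u" and K: "0 \<le> K"
  shows "g summable_on {t<..<u}" "\<bar>infsum g {t<..<u}\<bar> \<le> K * (V u - \<bar>J u\<bar> - V t)"
  by (rule infsum_abs_bound[where w="\<lambda>s. K * \<bar>J s\<bar>"];
      use g sum_jumps_less[OF _ _ tu] K in \<open>auto simp flip: sum_distrib_left intro: mult_left_mono\<close>)+

lemma infsum_split:
  fixes g :: "real \<Rightarrow> real"
  assumes "g summable_on {t<..v}" "t \<le> u" "u \<le> v"
  shows "infsum g {t<..v} = infsum g {t<..u} + infsum g {u<..v}"
proof -
  have eq: "{t<..v} = {t<..u} \<union> {u<..v}" using assms by auto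
  show ?thesis unfolding eq
    by (rule infsum_Un_disjoint) (use assms in \<open>auto intro: summable_on_subset_banach\<close>)
qed

lemma infsum_split_last:
  fixes g :: "real \<Rightarrow> real"
  assumes "g summable_on {t<..<u}" "t < u"
  shows "infsum g {t<..u} = infsum g {t<..<u} + g u"
proof -
  have eq: "{t<..u} = insert u {t<..<u}" using assms by auto
  show ?thesis unfolding eq using assms by (subst infsum_insert) auto
qed

lemma Fc_diff:
  assumes "t \<le> u" shows "Fc u - Fc t = F u - F t - (\<Sum>\<^sub>\<infinity>s\<in>{t<..u}. J s)"
proof -
  have S: "J summable_on {x<..y}" if "x \<le> y" for x y using jump_dominated(1)[of x y J 1] that by auto
  \<comment> \<open>\<open>F\<close> has no jumps up to \<open>a\<close>, so the sums may start at
    \<open>min a t\<close>; this also covers \<open>t < a\<close>.\<close>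
  have *: "(\<Sum>\<^sub>\<infinity>s\<in>{a<..x}. J s) = (\<Sum>\<^sub>\<infinity>s\<in>{min a t<..x}. J s)" for x
    by (rule infsum_cong_neutral) (use jump_outside in auto)
  have "(\<Sum>\<^sub>\<infinity>s\<in>{min a t<..u}. J s) = (\<Sum>\<^sub>\<infinity>s\<in>{min a t<..t}. J s) + (\<Sum>\<^sub>\<infinity>s\<in>{t<..u}. J s)"
    using assms by (intro infsum_split S) auto
  then show ?thesis unfolding cont_part_def by (simp add: *)
qed

lemma Fc_incr: assumes "t \<le> u" shows "\<bar>Fc u - Fc t\<bar> \<le> 2 * V u - 2 * V t"
  using Fc_diff[OF assms] incr_le_V[OF assms] jump_dominated(2)[of t u J 1] assms by auto

lemma Fc_finite_variation: "finite_variation_on UNIV Fc"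
proof -
  obtain M where M: "\<And>t. V t \<le> M" using V_bounded by blast
  have "0 \<le> 2 * V u \<and> 2 * V u \<le> 2 * M" for u using M[of u] V_nonneg[of u] by linarith
  with Fc_incr show ?thesis
    by (rule finite_variation_dominated[where Z="\<lambda>t. 2 * V t" and M="2 * M"])
qed

sublocale Fc: finite_variation "cont_part a F"
  by (rule finite_variation.intro[OF Fc_finite_variation])

lemma Vc_incr: "t \<le> u \<Longrightarrow> Fc.V u - Fc.V t \<le> 2 * (V u - V t)"
  using Fc.V_incr_dominated[of "\<lambda>t. 2 * V t", OF Fc_incr, of t u] by simp

lemma Fc_right: "(Fc \<longlongrightarrow> Fc s) (at_right s)"
proof (rule LIM_zero_cancel, rule Lim_null_comparison)
  show "\<forall>\<^sub>F t in at_right s. norm (Fc t - Fc s) \<le> 2 * V t - 2 * V s"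
    using Fc_incr by (auto simp: eventually_at_filter)
  show "((\<lambda>t. 2 * V t - 2 * V s) \<longlongrightarrow> 0) (at_right s)" using V_right[of s] by (auto intro!: tendsto_eq_intros)
qed

text \<open>The jump of \<open>F\<close> at \<open>s\<close> cancels against the last term of the
  series. What remains are the jumps strictly between \<open>t\<close> and \<open>s\<close>, and
  these are paid for by \<open>V s - |J s| - V t\<close>, which tends to 0.\<close>

lemma Fc_left: "(Fc \<longlongrightarrow> Fc s) (at_left s)"
proof (rule LIM_zero_cancel, rule Lim_null_comparison)
  have "\<forall>\<^sub>F t in at_left s. t < s" by (auto simp: eventually_at_filter)
  then show "\<forall>\<^sub>F t in at_left s. norm (Fc t - Fc s) \<le> \<bar>F s - J s - F t\<bar> + (V s - \<bar>J s\<bar> - V t)"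
  proof eventually_elim
    case (elim t)
    have "Fc s - Fc t = F s - J s - F t - (\<Sum>\<^sub>\<infinity>s\<in>{t<..<s}. J s)"
      using Fc_diff[of t s] elim jump_dominated_less(1)[of t s J 1] by (simp add: infsum_split_last)
    then show ?case using jump_dominated_less(2)[of t s J 1] elim by auto
  qed
  show "((\<lambda>t. \<bar>F s - J s - F t\<bar> + (V s - \<bar>J s\<bar> - V t)) \<longlongrightarrow> 0) (at_left s)"
    using V_left[of s] left_lim[of s] by (auto intro!: tendsto_eq_intros)
qed

lemma Vc_left: "(Fc.V \<longlongrightarrow> Fc.V s) (at_left s)"
  using Fc.V_left_limit[OF Fc_left, of s] by simp

lemma Vc_right: "(Fc.V \<longlongrightarrow> Fc.V s) (at_right s)"
  by (rule Fc.V_right_limit[OF Fc_right])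

text \<open>The integral is a difference of integrals over two nondecreasing functions. The error is
  \<open>e\<close> times the increment of \<open>Fc.V\<close> for the first, and at most
  \<open>2 * e\<close> times it for the second, since \<open>Fc.V - Fc\<close> grows at most twice
  as fast as \<open>Fc.V\<close>.\<close>

lemma stieltjes_bound:
  fixes g :: "real \<Rightarrow> real"
  assumes g: "g \<in> borel_measurable borel" and tu: "t \<le> u"
    and b: "\<And>s. s \<in> {t<..u} \<Longrightarrow> \<bar>g s - c\<bar> \<le> e"
  shows "stieltjes_integrable Fc {t<..u} g"
    and "\<bar>stieltjes_integral Fc {t<..u} g - c * (Fc u - Fc t)\<bar> \<le> 3 * e * (Fc.V u - Fc.V t)"
proof -
  let ?W = "\<lambda>t. Fc.V t - Fc t"
  have W: "?W x \<le> ?W y" if "x \<le> y" for x y using Fc.incr_le_V[OF that] by auto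
  have cont: "continuous (at_right x) Fc.V" "continuous (at_right x) ?W" for x
    using Vc_right[of x] Fc_right[of x] by (auto simp: continuous_within intro!: tendsto_intros)
  note 1 = interval_measure_integral_bound[OF Fc.V_mono cont(1) g tu b]
  note 2 = interval_measure_integral_bound[OF W cont(2) g tu b]
  show "stieltjes_integrable Fc {t<..u} g" unfolding stieltjes_integrable_def using 1(1) 2(1) by simp
  have W2: "?W u - ?W t \<le> 2 * (Fc.V u - Fc.V t)" using Fc.incr_le_V[OF tu] by auto
  show "\<bar>stieltjes_integral Fc {t<..u} g - c * (Fc u - Fc t)\<bar> \<le> 3 * e * (Fc.V u - Fc.V t)"
  \<comment> \<open>For \<open>t = u\<close> the interval is empty and the bound on \<open>g\<close>
    says nothing about the sign of \<open>e\<close>.\<close>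
  proof (cases "t = u")
    case True then show ?thesis by (simp add: stieltjes_integral_def set_lebesgue_integral_def)
  next
    case False
    then have "e \<ge> 0" using b[of u] tu by force
    let ?I1 = "LINT s:{t<..u}|interval_measure Fc.V. g s" and ?I2 = "LINT s:{t<..u}|interval_measure ?W. g s"
    have "stieltjes_integral Fc {t<..u} g - c * (Fc u - Fc t) =
       (?I1 - c * (Fc.V u - Fc.V t)) - (?I2 - c * (?W u - ?W t))"
      by (simp add: stieltjes_integral_def algebra_simps)
    then have "\<bar>stieltjes_integral Fc {t<..u} g - c * (Fc u - Fc t)\<bar> \<le>
       e * (Fc.V u - Fc.V t) + e * (?W u - ?W t)" using 1(2) 2(2) by linarith
    also have "\<dots> \<le> e * (Fc.V u - Fc.V t) + e * (2 * (Fc.V u - Fc.V t))"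
      using W2 \<open>e \<ge> 0\<close> by (intro add_left_mono mult_left_mono)
    finally show ?thesis by (simp add: algebra_simps)
  qed
qed

lemma stieltjes_split:
  fixes g :: "real \<Rightarrow> real"
  assumes "stieltjes_integrable Fc {t<..v} g" "t \<le> u" "u \<le> v"
  shows "stieltjes_integral Fc {t<..v} g = stieltjes_integral Fc {t<..u} g + stieltjes_integral Fc {u<..v} g"
proof -
  have eq: "{t<..v} = {t<..u} \<union> {u<..v}" using assms by auto
  have *: "(LINT s:{t<..v}|M. g s) = (LINT s:{t<..u}|M. g s) + (LINT s:{u<..v}|M. g s)"
    if "set_integrable M {t<..v} g" and [simp, measurable_cong]: "sets M = sets borel" for M
    unfolding eq
    by (rule set_integral_Un) (use that assms in \<open>auto intro: set_integrable_subset simp: eq[symmetric]\<close>)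
  show ?thesis using assms(1) unfolding stieltjes_integral_def stieltjes_integrable_def
    by (simp add: *)
qed

end

lemma strip_continuous:
  fixes f :: "real \<times> real \<Rightarrow> real"
  assumes C: "0 \<le> C" and lip: "\<And>s t x z. s \<in> {a..b} \<Longrightarrow> t \<in> {a..b} \<Longrightarrow> \<bar>f (s, x) - f (t, z)\<bar> \<le> C * (\<bar>s - t\<bar> + \<bar>x - z\<bar>)"
  shows "continuous_on ({a..b} \<times> UNIV) f"
proof (rule continuous_onI)
  fix p :: "real \<times> real" and e :: real assume p: "p \<in> {a..b} \<times> UNIV" and e: "e > 0"
  show "\<exists>d>0. \<forall>q\<in>{a..b} \<times> UNIV. dist q p < d \<longrightarrow> dist (f q) (f p) \<le> e"
  proof (intro exI[of _ "e / (2 * C + 1)"] conjI ballI impI)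
    fix q :: "real \<times> real" assume q: "q \<in> {a..b} \<times> UNIV" and d: "dist q p < e / (2 * C + 1)"
    have "\<bar>fst q - fst p\<bar> \<le> dist q p" "\<bar>snd q - snd p\<bar> \<le> dist q p"
      using dist_fst_le[of q p] dist_snd_le[of q p] by (auto simp: dist_real_def)
    then have "C * (\<bar>fst q - fst p\<bar> + \<bar>snd q - snd p\<bar>) \<le> C * (2 * (e / (2 * C + 1)))"
      using d C by (intro mult_left_mono) auto
    also have "\<dots> \<le> e" using C e by (simp add: field_simps)
    finally show "dist (f q) (f p) \<le> e"
      using lip[of "fst q" "fst p" "snd q" "snd p"] p q by (auto simp: dist_real_def)
  qed (use C e in auto)
qed

section \<open>From second-order increments to the limit equation\<close>

context bv_path
begin

text \<open>By bisection it is enough to bound the increments of \<open>R\<close> by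
  \<open>e\<close> times those of \<open>V\<close> near each point \<open>s\<close>. To the right of
  \<open>s\<close> both \<open>u - s\<close> and \<open>V u - V s\<close> are small, so the
  quadratic bound does it. To the left, \<open>V\<close> may jump at \<open>s\<close> and the
  quadratic bound fails to be small across \<open>s\<close>; it is used strictly before
  \<open>s\<close>, and left-continuity of \<open>R\<close> carries the result to
  \<open>s\<close>.\<close>

lemma sewing_zero:
  fixes R :: "real \<Rightarrow> real"
  assumes quad: "\<And>t u. a \<le> t \<Longrightarrow> t \<le> u \<Longrightarrow> u < b \<Longrightarrow>
      \<bar>R u - R t\<bar> \<le> K * ((u - t) + (V u - V t)) * (V u - V t)"
    and left: "\<And>s. a < s \<Longrightarrow> s \<le> b \<Longrightarrow> (R \<longlongrightarrow> R s) (at_left s)"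
    and K: "0 < K" and t: "t \<in> {a..b}"
  shows "R t = R a"
proof -
  have small: "\<bar>R t - R a\<bar> \<le> e * (V t - V a)" if e: "e > 0" for e
  proof -
    define P where "P x u \<longleftrightarrow> (a \<le> x \<longrightarrow> u \<le> b \<longrightarrow> \<bar>R u - R x\<bar> \<le> e * (V u - V x))" for x u
    have "P a t"
    proof (rule Bolzano)
      show "a \<le> t" using t by simp
      fix x y z assume "P x y" "P y z" "x \<le> y" "y \<le> z"
      then show "P x z" unfolding P_def right_diff_distrib by linarith
    next
      fix s assume s: "a \<le> s" "s \<le> t"
      define k where "k = e / (2 * K)"
      have k: "k > 0" using e K by (simp add: k_def)
      have close: "\<bar>R u - R x\<bar> \<le> e * (V u - V x)"
        if "a \<le> x" "x \<le> u" "u < b" "u - x \<le> k" "V u - V x \<le> k" for x u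
      proof -
        have "\<bar>R u - R x\<bar> \<le> K * ((u - x) + (V u - V x)) * (V u - V x)" using quad that by auto
        also have "\<dots> \<le> (K * (k + k)) * (V u - V x)"
          using that V_mono[of x u] K by (intro mult_right_mono mult_left_mono) auto
        also have "K * (k + k) = e" using K by (simp add: k_def field_simps)
        finally show ?thesis .
      qed
      have "\<forall>\<^sub>F u in at_right s. dist (V u) (V s) < k" using V_right k by (rule tendstoD)
      then obtain r1 where r1: "r1 > s" "\<And>u. s < u \<Longrightarrow> u < r1 \<Longrightarrow> V u - V s < k"
        unfolding eventually_at_right_field dist_real_def by (fastforce simp: abs_less_iff)
      have "\<forall>\<^sub>F x in at_left s. dist (V x) (V s - \<bar>J s\<bar>) < k" using V_left k by (rule tendstoD)
      then obtain r0 where r0: "r0 < s" "\<And>x. r0 < x \<Longrightarrow> x < s \<Longrightarrow> V s - \<bar>J s\<bar> - V x < k"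
        unfolding eventually_at_left_field dist_real_def by (fastforce simp: abs_less_iff)
      define d where "d = min k (min (r1 - s) (s - r0))"
      have d: "d > 0" using k r1 r0 by (auto simp: d_def)
      have right: "\<bar>R u - R s\<bar> \<le> e * (V u - V s)" if "s \<le> u" "u - s < d" "u < b" for u
      proof (cases "u = s")
        case False
        then show ?thesis using that r1(2)[of u] s by (intro close) (auto simp: d_def)
      qed simp
      \<comment> \<open>The quadratic estimate stops short of \<open>b\<close>, so
        \<open>u = b\<close> is reached by a limit from the left.\<close>
      have right': "\<bar>R u - R s\<bar> \<le> e * (V u - V s)" if "s \<le> u" "u - s < d" "u \<le> b" for u
      proof (cases "u = b")
        case True
        show ?thesis
        proof (cases "s = b")
          case False
          then have sb: "s < b" using that True by simp
          have "((\<lambda>x. \<bar>R x - R s\<bar>) \<longlongrightarrow> \<bar>R b - R s\<bar>) (at_left b)"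
            using sb s by (intro tendsto_intros left) auto
          moreover have "\<forall>\<^sub>F x in at_left b. \<bar>R x - R s\<bar> \<le> e * (V b - V s)"
            using eventually_at_left_real[OF sb]
          proof eventually_elim
            case (elim x)
            have "\<bar>R x - R s\<bar> \<le> e * (V x - V s)" using elim that True by (intro right) auto
            also have "\<dots> \<le> e * (V b - V s)" using e V_mono[of x b] elim by (intro mult_left_mono) auto
            finally show ?case .
          qed
          ultimately show ?thesis unfolding True by (rule tendsto_upperbound) simp
        qed (use True in simp)
      qed (use that right in auto)
      \<comment> \<open>Between \<open>x\<close> and a point \<open>z < s\<close> the variation does
        not contain the jump at \<open>s\<close>, so \<open>close\<close> applies; then
        \<open>z\<close> tends to \<open>s\<close>.\<close>
      have lft: "\<bar>R s - R x\<bar> \<le> e * (V s - V x)" if "a \<le> x" "x \<le> s" "s - x < d" for x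
      proof (cases "x = s")
        case False
        then have xs: "x < s" using that by simp
        have "((\<lambda>z. \<bar>R z - R x\<bar>) \<longlongrightarrow> \<bar>R s - R x\<bar>) (at_left s)"
          using xs s t that by (intro tendsto_intros left) auto
        moreover have "\<forall>\<^sub>F z in at_left s. \<bar>R z - R x\<bar> \<le> e * (V s - V x)"
          using eventually_at_left_real[OF xs]
        proof eventually_elim
          case (elim z)
          have "V z \<le> V s - \<bar>J s\<bar>" using jump_le_V[of z s] elim by auto
          then have "\<bar>R z - R x\<bar> \<le> e * (V z - V x)"
            using elim that xs r0(2)[of x] s t by (intro close) (auto simp: d_def)
          also have "\<dots> \<le> e * (V s - V x)" using e V_mono[of z s] elim by (intro mult_left_mono) auto
          finally show ?case .
        qed
        ultimately show ?thesis by (rule tendsto_upperbound) simp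
      qed simp
      show "\<exists>d>0. \<forall>x u. x \<le> s \<and> s \<le> u \<and> u - x < d \<longrightarrow> P x u"
      proof (intro exI[of _ d] conjI d allI impI)
        fix x u assume xu: "x \<le> s \<and> s \<le> u \<and> u - x < d"
        show "P x u" unfolding P_def
        proof (intro impI)
          assume "a \<le> x" "u \<le> b"
          then have "\<bar>R u - R s\<bar> \<le> e * (V u - V s)" "\<bar>R s - R x\<bar> \<le> e * (V s - V x)"
            using xu by (auto intro!: right' lft)
          then show "\<bar>R u - R x\<bar> \<le> e * (V u - V x)" unfolding right_diff_distrib by linarith
        qed
      qed
    qed
    then show ?thesis using t by (auto simp: P_def)
  qed
  have D: "V t - V a \<ge> 0" using V_mono t by auto
  have "\<bar>R t - R a\<bar> \<le> 0"
  proof (rule field_le_epsilon)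
    fix e :: real assume e: "e > 0"
    have "\<bar>R t - R a\<bar> \<le> e / (V t - V a + 1) * (V t - V a)" using e D by (intro small) auto
    also have "\<dots> \<le> e" using e D by (simp add: field_simps)
    finally show "\<bar>R t - R a\<bar> \<le> 0 + e" by simp
  qed
  then show ?thesis by simp
qed

text \<open>Freezing \<open>f\<close> at the left end point, the right-hand side \<open>N\<close> of
  the equation has the same first-order part \<open>f (t, y t) * (F u - F t)\<close> as
  \<open>y\<close>, with an error of second order. By \<open>left\<close> the two have the same left
  jumps, so \<open>R = y - N\<close> is left-continuous and \<open>sewing_zero\<close> makes it
  constant. The estimates are asked for before \<open>b\<close> only; the jump at \<open>b\<close>
  may be arbitrary.\<close>

lemma limit_equation:
  fixes y jt :: "real \<Rightarrow> real" and f :: "real \<times> real \<Rightarrow> real"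
  assumes C: "0 \<le> C" and B: "0 \<le> B" and K: "0 \<le> K"
    and lip: "\<And>s t x z. s \<in> {a..b} \<Longrightarrow> t \<in> {a..b} \<Longrightarrow> \<bar>f (s, x) - f (t, z)\<bar> \<le> C * (\<bar>s - t\<bar> + \<bar>x - z\<bar>)"
    and ym: "y \<in> borel_measurable borel"
    and y_incr: "\<And>t u. a \<le> t \<Longrightarrow> t \<le> u \<Longrightarrow> u < b \<Longrightarrow> \<bar>y u - y t\<bar> \<le> B * (V u - V t)"
    and fB: "\<And>t. t \<in> {a..b} \<Longrightarrow> \<bar>f (t, y t)\<bar> \<le> B"
    and quad: "\<And>t u. a \<le> t \<Longrightarrow> t \<le> u \<Longrightarrow> u < b \<Longrightarrow>
      \<bar>y u - y t - f (t, y t) * (F u - F t)\<bar> \<le> K * ((u - t) + (V u - V t)) * (V u - V t)"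
    and left: "\<And>s. a < s \<Longrightarrow> s \<le> b \<Longrightarrow> (y \<longlongrightarrow> y s - jt s) (at_left s)"
  shows "stieltjes_integrable Fc {a<..b} (\<lambda>s. f (s, y s))"
    and "jt summable_on {a<..b}"
    and "t \<in> {a..b} \<Longrightarrow> y t = y a + stieltjes_integral Fc {a<..t} (\<lambda>s. f (s, y s)) + (\<Sum>\<^sub>\<infinity>s\<in>{a<..t}. jt s)"
proof -
  \<comment> \<open>Clamping the time makes the integrand Borel measurable on the whole line without
    changing it on \<open>{a..b}\<close>.\<close>
  define g where "g s = f (max a (min b s), y s)" for s
  have "continuous_on UNIV (\<lambda>p. f (max a (min b (fst p)), snd p))"
    using ab by (intro continuous_on_compose2[OF strip_continuous[OF C lip]] continuous_intros) auto
  then have gm: "g \<in> borel_measurable borel"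
    unfolding g_def using ym
    by (intro borel_measurable_continuous_Pair[where H="\<lambda>x z. f (max a (min b x), z)"]) (auto simp: split_beta')
  have gf: "g s = f (s, y s)" if "s \<in> {a..b}" for s using that by (auto simp: g_def min_def max_def)
  have SI_eq: "stieltjes_integrable Fc {x<..z} (\<lambda>s. f (s, y s)) \<longleftrightarrow> stieltjes_integrable Fc {x<..z} g"
    "stieltjes_integral Fc {x<..z} (\<lambda>s. f (s, y s)) = stieltjes_integral Fc {x<..z} g"
    if "a \<le> x" "z \<le> b" for x z
  proof -
    have *: "(\<lambda>s. indicator {x<..z} s *\<^sub>R f (s, y s)) = (\<lambda>s. indicator {x<..z} s *\<^sub>R g s)"
      using that gf by (auto split: split_indicator)
    show "stieltjes_integrable Fc {x<..z} (\<lambda>s. f (s, y s)) \<longleftrightarrow> stieltjes_integrable Fc {x<..z} g"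
      "stieltjes_integral Fc {x<..z} (\<lambda>s. f (s, y s)) = stieltjes_integral Fc {x<..z} g"
      unfolding stieltjes_integrable_def stieltjes_integral_def set_integrable_def set_lebesgue_integral_def * by auto
  qed
  have gB: "\<bar>g s\<bar> \<le> B" if "s \<in> {a..b}" for s using fB[OF that] gf[OF that] by simp
  have SI_B: "stieltjes_integrable Fc {x<..z} g"
     "\<bar>stieltjes_integral Fc {x<..z} g\<bar> \<le> 3 * B * (Fc.V z - Fc.V x)" if "a \<le> x" "x \<le> z" "z \<le> b" for x z
    using stieltjes_bound[OF gm that(2), of 0 B] gB that by auto
  show "stieltjes_integrable Fc {a<..b} (\<lambda>s. f (s, y s))" using SI_eq(1)[of a b] SI_B(1)[of a b] ab by simp
  have jtB: "\<bar>jt s\<bar> \<le> B * \<bar>J s\<bar>" if "a < s" "s < b" for s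
  proof -
    have 1: "((\<lambda>t. \<bar>y s - y t\<bar>) \<longlongrightarrow> \<bar>y s - (y s - jt s)\<bar>) (at_left s)"
      using that by (intro tendsto_intros left) auto
    have 2: "((\<lambda>t. B * (V s - V t)) \<longlongrightarrow> B * (V s - (V s - \<bar>J s\<bar>))) (at_left s)"
      by (intro tendsto_intros V_left)
    have "\<bar>y s - (y s - jt s)\<bar> \<le> B * (V s - (V s - \<bar>J s\<bar>))"
      by (rule tendsto_le[OF _ 2 1 eventually_mono[OF eventually_at_left_real[OF that(1)]]])
        (use y_incr that in auto)
    then show ?thesis by simp
  qed
  \<comment> \<open>The jump at \<open>b\<close> is not bounded by \<open>B * |J b|\<close>, but a
    single term does not affect summability.\<close>
  have "jt summable_on {a<..<b}"
    using jump_dominated_less(1)[of a b jt B] jtB ab B by auto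
  moreover have "{a<..b} = insert b {a<..<b}" using ab by auto
  ultimately show jts: "jt summable_on {a<..b}" by (simp add: summable_on_insert_iff)
  have jts': "jt summable_on {x<..z}" "jt summable_on {x<..<z}" if "a \<le> x" "z \<le> b" for x z
    using that by (auto intro!: summable_on_subset_banach[OF jts])
  define N where "N t = stieltjes_integral Fc {a<..t} g + (\<Sum>\<^sub>\<infinity>s\<in>{a<..t}. jt s)" for t
  have N_diff: "N u - N t = stieltjes_integral Fc {t<..u} g + (\<Sum>\<^sub>\<infinity>s\<in>{t<..u}. jt s)"
    if "a \<le> t" "t \<le> u" "u \<le> b" for t u
    using stieltjes_split[of a u g t] infsum_split[of jt a u t] SI_B(1)[of a u] jts'(1)[of a u] that
    unfolding N_def by auto
  define M where "M = K + C * (1 + B)"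
  have M: "M \<ge> 0" "C * (1 + B) \<le> M" using C B K by (auto simp: M_def)
  define q where "q t u = (u - t) + (V u - V t)" for t u
  have q0: "0 \<le> q t u" if "t \<le> u" for t u using that V_mono[OF that] by (simp add: q_def)
  have f_osc: "\<bar>f (s, y s) - f (t, y t)\<bar> \<le> C * (1 + B) * q t u" if "a \<le> t" "t \<le> s" "s \<le> u" "u < b" for s t u
  proof -
    have "\<bar>f (s, y s) - f (t, y t)\<bar> \<le> C * (\<bar>s - t\<bar> + \<bar>y s - y t\<bar>)" using that by (intro lip) auto
    also have "\<dots> \<le> C * ((u - t) + B * (V u - V t))"
    proof (intro mult_left_mono add_mono)
      have "\<bar>y s - y t\<bar> \<le> B * (V s - V t)" using that by (intro y_incr) auto
      also have "\<dots> \<le> B * (V u - V t)" using B V_mono[OF that(3)] by (intro mult_left_mono) auto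
      finally show "\<bar>y s - y t\<bar> \<le> B * (V u - V t)" .
    qed (use that C in auto)
    also have "\<dots> \<le> C * ((1 + B) * q t u)"
    proof (rule mult_left_mono)
      have "0 \<le> B * (u - t)" using that B by simp
      then show "(u - t) + B * (V u - V t) \<le> (1 + B) * q t u"
        using V_mono[of t u] that by (simp add: q_def ring_distribs)
    qed (rule C)
    finally show ?thesis by (simp add: mult.assoc)
  qed
  have jt_osc: "\<bar>jt r - f (t, y t) * J r\<bar> \<le> M * q t u * \<bar>J r\<bar>" if r: "a \<le> t" "t < r" "r \<le> u" "u < b" for r t u
  proof -
    \<comment> \<open>In the quadratic estimate from \<open>x\<close> to \<open>r\<close> let
      \<open>x\<close> tend to \<open>r\<close> from the left: the increment of \<open>y\<close>
      becomes \<open>jt r\<close>, that of \<open>V\<close> becomes \<open>|J r|\<close>, and the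
      time difference vanishes. One factor \<open>|J r|\<close> is then absorbed by
      \<open>q t u\<close>.\<close>
    have 1: "((\<lambda>x. \<bar>y r - y x - f (t, y t) * (F r - F x)\<bar>) \<longlongrightarrow>
        \<bar>y r - (y r - jt r) - f (t, y t) * (F r - (F r - J r))\<bar>) (at_left r)"
      using r by (intro tendsto_intros left left_lim) auto
    have 2: "((\<lambda>x. K * ((r - x) + (V r - V x)) * (V r - V x) + C * (1 + B) * q t u * (V r - V x)) \<longlongrightarrow>
        K * ((r - r) + (V r - (V r - \<bar>J r\<bar>))) * (V r - (V r - \<bar>J r\<bar>)) + C * (1 + B) * q t u * (V r - (V r - \<bar>J r\<bar>))) (at_left r)"
      by (intro tendsto_intros V_left)
    have "\<bar>y r - (y r - jt r) - f (t, y t) * (F r - (F r - J r))\<bar> \<le>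
       K * ((r - r) + (V r - (V r - \<bar>J r\<bar>))) * (V r - (V r - \<bar>J r\<bar>)) + C * (1 + B) * q t u * (V r - (V r - \<bar>J r\<bar>))"
    proof (rule tendsto_le[OF _ 2 1 eventually_mono[OF eventually_at_left_real[OF r(2)]]])
      fix x assume x: "x \<in> {t<..<r}"
      have "\<bar>y r - y x - f (t, y t) * (F r - F x)\<bar> \<le> \<bar>y r - y x - f (x, y x) * (F r - F x)\<bar> + \<bar>(f (x, y x) - f (t, y t)) * (F r - F x)\<bar>"
        by (simp add: algebra_simps)
      also have "\<dots> \<le> K * ((r - x) + (V r - V x)) * (V r - V x) + C * (1 + B) * q t u * (V r - V x)"
        unfolding abs_mult using x r C B incr_le_V[of x r] f_osc[of t x u] q0[of t u]
        by (intro add_mono quad mult_mono) auto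
      finally show "\<bar>y r - y x - f (t, y t) * (F r - F x)\<bar> \<le> K * ((r - x) + (V r - V x)) * (V r - V x) + C * (1 + B) * q t u * (V r - V x)" .
    qed simp
    then have "\<bar>jt r - f (t, y t) * J r\<bar> \<le> K * \<bar>J r\<bar> * \<bar>J r\<bar> + C * (1 + B) * q t u * \<bar>J r\<bar>" by simp
    also have "\<dots> \<le> K * q t u * \<bar>J r\<bar> + C * (1 + B) * q t u * \<bar>J r\<bar>"
      using jump_le_V[of t r] V_mono[of r u] r K by (intro add_mono mult_right_mono mult_left_mono order_refl) (auto simp: q_def)
    finally show ?thesis by (simp add: M_def algebra_simps)
  qed
  define R where "R t = y t - N t" for t
  \<comment> \<open>The 8 collects \<open>M\<close> from \<open>y\<close>, \<open>3 * 2 * M\<close>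
    from the integral (the 2 is from \<open>Vc_incr\<close>) and \<open>M\<close> from the jumps;
    the added 1 makes the constant positive.\<close>
  have Rquad: "\<bar>R u - R t\<bar> \<le> (8 * M + 1) * ((u - t) + (V u - V t)) * (V u - V t)"
    if tu: "a \<le> t" "t \<le> u" "u < b" for t u
  proof -
    let ?c = "f (t, y t)" and ?D = "V u - V t"
    have D: "?D \<ge> 0" using V_mono tu by auto
    have s1: "\<bar>stieltjes_integral Fc {t<..u} g - ?c * (Fc u - Fc t)\<bar> \<le> 3 * (M * q t u) * (Fc.V u - Fc.V t)"
    proof (rule stieltjes_bound(2)[OF gm tu(2)])
      fix s assume "s \<in> {t<..u}"
      then show "\<bar>g s - ?c\<bar> \<le> M * q t u"
        using f_osc[of t s u] tu gf[of s] mult_right_mono[OF M(2) q0[OF tu(2)]] by auto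
    qed
    have "3 * (M * q t u) * (Fc.V u - Fc.V t) \<le> 3 * (M * q t u) * (2 * ?D)"
      using M q0[OF tu(2)] Vc_incr[OF tu(2)] by (intro mult_left_mono) auto
    note s1 = order_trans[OF s1 this]
    have Js: "J summable_on {t<..u}" using jump_dominated(1)[of t u J 1] tu by auto
    have "(\<Sum>\<^sub>\<infinity>s\<in>{t<..u}. jt s) - ?c * (\<Sum>\<^sub>\<infinity>s\<in>{t<..u}. J s) = (\<Sum>\<^sub>\<infinity>s\<in>{t<..u}. jt s - ?c * J s)"
      using infsum_add[OF jts'(1)[of t u] summable_on_cmult_right[OF Js, of "- ?c"]]
        infsum_cmult_right[OF Js, of "- ?c"] tu by simp
    moreover have "\<bar>\<dots>\<bar> \<le> M * q t u * ?D"
      by (rule jump_dominated(2)) (use jt_osc tu M q0[OF tu(2)] in auto)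
    ultimately have s2: "\<bar>(\<Sum>\<^sub>\<infinity>s\<in>{t<..u}. jt s) - ?c * (\<Sum>\<^sub>\<infinity>s\<in>{t<..u}. J s)\<bar> \<le> M * q t u * ?D" by simp
    have s3: "\<bar>y u - y t - ?c * (F u - F t)\<bar> \<le> M * q t u * ?D"
    proof -
      have "K * q t u * ?D \<le> M * q t u * ?D" using q0[OF tu(2)] D C B by (intro mult_right_mono) (auto simp: M_def)
      then show ?thesis using quad[OF tu] by (simp add: q_def)
    qed
    have "R u - R t = (y u - y t - ?c * (F u - F t)) - (stieltjes_integral Fc {t<..u} g - ?c * (Fc u - Fc t))
       - ((\<Sum>\<^sub>\<infinity>s\<in>{t<..u}. jt s) - ?c * (\<Sum>\<^sub>\<infinity>s\<in>{t<..u}. J s))"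
    proof -
      have "?c * (F u - F t) = ?c * (Fc u - Fc t) + ?c * (\<Sum>\<^sub>\<infinity>s\<in>{t<..u}. J s)"
        using Fc_diff[of t u] tu by (simp flip: distrib_left)
      then show ?thesis using N_diff[of t u] tu by (simp add: R_def)
    qed
    then have "\<bar>R u - R t\<bar> \<le> M * q t u * ?D + 3 * (M * q t u) * (2 * ?D) + M * q t u * ?D"
      using s1 s2 s3 by linarith
    also have "\<dots> = 8 * M * q t u * ?D" by simp
    also have "\<dots> \<le> (8 * M + 1) * q t u * ?D" using q0[OF tu(2)] D by (intro mult_right_mono) auto
    finally show ?thesis by (simp add: q_def)
  qed
  have Rleft: "(R \<longlongrightarrow> R s) (at_left s)" if s: "a < s" "s \<le> b" for s
  proof -
    have "((\<lambda>t. N s - N t - jt s) \<longlongrightarrow> 0) (at_left s)"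
    proof (rule Lim_null_comparison)
      show "\<forall>\<^sub>F t in at_left s. norm (N s - N t - jt s) \<le> 3 * B * (Fc.V s - Fc.V t) + B * (V s - \<bar>J s\<bar> - V t)"
        using eventually_at_left_real[OF s(1)]
      proof eventually_elim
        case (elim t)
        have "N s - N t - jt s = stieltjes_integral Fc {t<..s} g + (\<Sum>\<^sub>\<infinity>r\<in>{t<..<s}. jt r)"
          using N_diff[of t s] infsum_split_last[of jt t s] jts'(2)[of t s] elim s by auto
        moreover have "\<bar>\<Sum>\<^sub>\<infinity>r\<in>{t<..<s}. jt r\<bar> \<le> B * (V s - \<bar>J s\<bar> - V t)"
          by (rule jump_dominated_less(2)) (use jtB elim s B in auto)
        ultimately show ?case using SI_B(2)[of t s] elim s by auto
      qed
      show "((\<lambda>t. 3 * B * (Fc.V s - Fc.V t) + B * (V s - \<bar>J s\<bar> - V t)) \<longlongrightarrow> 0) (at_left s)"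
        by (auto intro!: tendsto_eq_intros V_left Vc_left)
    qed
    then have "((\<lambda>t. y t - N s + (N s - N t - jt s) + jt s) \<longlongrightarrow> (y s - jt s) - N s + 0 + jt s) (at_left s)"
      using s by (intro tendsto_intros left) auto
    then show ?thesis by (simp add: R_def[abs_def])
  qed
  assume t: "t \<in> {a..b}"
  have "R t = R a" by (rule sewing_zero[OF Rquad Rleft _ t]) (use M in auto)
  moreover have "N a = 0" by (simp add: N_def stieltjes_integral_def set_lebesgue_integral_def)
  ultimately show "y t = y a + stieltjes_integral Fc {a<..t} (\<lambda>s. f (s, y s)) + (\<Sum>\<^sub>\<infinity>s\<in>{a<..t}. jt s)"
    using SI_eq(2)[of a t] t by (simp add: R_def N_def)
qed

end

section \<open>Gap functions and the retarded equation\<close>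

text \<open>Class G in terms of order: a left-continuous closure operator on the unit interval. In
  this form it can be verified for a function obtained by a limit, where no intervals are given;
  \<open>class_G\<close> recovers the intervals.\<close>

locale gap_function =
  fixes \<sigma> :: "real \<Rightarrow> real"
  assumes mono_\<sigma>: "0 \<le> u \<Longrightarrow> u \<le> v \<Longrightarrow> v \<le> 1 \<Longrightarrow> \<sigma> u \<le> \<sigma> v"
    and left_\<sigma>: "0 < u \<Longrightarrow> u \<le> 1 \<Longrightarrow> (\<sigma> \<longlongrightarrow> \<sigma> u) (at_left u)"
    and \<sigma>_0: "\<sigma> 0 = 0"
    and \<sigma>_ge: "0 \<le> u \<Longrightarrow> u \<le> 1 \<Longrightarrow> u \<le> \<sigma> u"
    and \<sigma>_le: "0 \<le> u \<Longrightarrow> u \<le> 1 \<Longrightarrow> \<sigma> u \<le> 1"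
    and \<sigma>_idem: "0 \<le> u \<Longrightarrow> u \<le> 1 \<Longrightarrow> \<sigma> (\<sigma> u) = \<sigma> u"
begin

lemma \<sigma>_1: "\<sigma> 1 = 1"
  using \<sigma>_ge[of 1] \<sigma>_le[of 1] by simp

lemma \<sigma>_nonneg: "0 \<le> u \<Longrightarrow> u \<le> 1 \<Longrightarrow> 0 \<le> \<sigma> u"
  using \<sigma>_ge[of u] by linarith

text \<open>\<open>\<pi>\<close> rounds down to a fixed point of \<open>\<sigma>\<close>, as \<open>\<sigma>\<close> rounds up.\<close>

definition \<pi> :: "real \<Rightarrow> real" where
  "\<pi> v = Sup {u \<in> {0..1}. \<sigma> u \<le> max v 0}"

lemma \<pi>_bdd: "bdd_above {u \<in> {0..1}. \<sigma> u \<le> max v 0}"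
  by (rule bdd_aboveI[of _ 1]) auto

lemma \<pi>_zero_mem: "0 \<in> {u \<in> {0..1}. \<sigma> u \<le> max v 0}"
  by (simp add: \<sigma>_0)

lemma \<pi>_range: "0 \<le> \<pi> v" "\<pi> v \<le> 1"
proof -
  show "0 \<le> \<pi> v" unfolding \<pi>_def by (rule cSup_upper[OF \<pi>_zero_mem \<pi>_bdd])
  show "\<pi> v \<le> 1" unfolding \<pi>_def by (rule cSup_least) (use \<pi>_zero_mem[of v] in \<open>blast, auto\<close>)
qed

text \<open>Rounding down and rounding up are adjoint. Left-continuity gives the strict inequality:
  if \<open>v < \<sigma> u\<close>, then already \<open>v < \<sigma> t\<close> for some
  \<open>t < u\<close>, and \<open>t\<close> bounds the supremum defining
  \<open>\<pi> v\<close>.\<close>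

lemma \<pi>_less_iff:
  assumes "0 \<le> u" "u \<le> 1" "0 \<le> v"
  shows "\<pi> v < u \<longleftrightarrow> v < \<sigma> u"
proof
  assume "\<pi> v < u"
  moreover have "u \<le> \<pi> v" if "\<sigma> u \<le> v"
    unfolding \<pi>_def using that assms by (intro cSup_upper \<pi>_bdd) auto
  ultimately show "v < \<sigma> u" by (meson not_le)
next
  assume v: "v < \<sigma> u"
  then have u0: "0 < u" using \<sigma>_0 assms by (cases "u = 0") auto
  have "\<forall>\<^sub>F t in at_left u. v < \<sigma> t"
    using order_tendstoD(1)[OF left_\<sigma> v] u0 assms by blast
  moreover have "\<forall>\<^sub>F t in at_left u. t \<in> {0<..<u}" using u0 by (rule eventually_at_left_real)
  ultimately have "\<forall>\<^sub>F t in at_left u. v < \<sigma> t \<and> t \<in> {0<..<u}" by (rule eventually_conj)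
  then obtain t where t: "v < \<sigma> t" "0 < t" "t < u"
    using eventually_happens'[of "at_left u"] by auto
  have "\<pi> v \<le> t" unfolding \<pi>_def
  proof (rule cSup_least)
    fix x assume x: "x \<in> {u \<in> {0..1}. \<sigma> u \<le> max v 0}"
    show "x \<le> t"
    proof (rule ccontr)
      assume "\<not> x \<le> t"
      then have "\<sigma> t \<le> \<sigma> x" using x t by (intro mono_\<sigma>) auto
      then show False using x t assms by auto
    qed
  qed (use \<pi>_zero_mem in blast)
  then show "\<pi> v < u" using t by simp
qed

lemma \<pi>_mono: "v \<le> v' \<Longrightarrow> \<pi> v \<le> \<pi> v'"
  unfolding \<pi>_def by (rule cSup_subset_mono[OF _ \<pi>_bdd]) (use \<pi>_zero_mem[of v] in \<open>blast, auto\<close>)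

lemma \<pi>_measurable [measurable]: "\<pi> \<in> borel_measurable borel"
  by (rule borel_measurable_mono) (auto simp: mono_def \<pi>_mono)

lemma \<pi>_le: assumes "0 \<le> v" shows "\<pi> v \<le> v"
proof (rule ccontr)
  assume "\<not> \<pi> v \<le> v"
  then have v: "v < \<pi> v" by simp
  then have "v < 1" using \<pi>_range(2)[of v] by simp
  have "\<pi> v \<le> \<sigma> (\<pi> v)" using \<pi>_range by (intro \<sigma>_ge)
  then show False using v \<pi>_less_iff[of "\<pi> v" v] \<pi>_range[of v] assms by simp
qed

lemma \<sigma>_\<pi>: assumes "0 \<le> v" shows "\<sigma> (\<pi> v) = \<pi> v"
proof (rule antisym)
  have 1: "\<sigma> (\<pi> v) \<le> v" using \<pi>_less_iff[of "\<pi> v" v] \<pi>_range[of v] assms by auto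
  have 2: "0 \<le> \<sigma> (\<pi> v)" "\<sigma> (\<pi> v) \<le> 1" using \<sigma>_nonneg \<sigma>_le \<pi>_range by auto
  then show "\<sigma> (\<pi> v) \<le> \<pi> v"
    using \<pi>_less_iff[of "\<sigma> (\<pi> v)" v] \<sigma>_idem[of "\<pi> v"] \<pi>_range[of v] 1 assms by (simp add: not_less[symmetric])
  show "\<pi> v \<le> \<sigma> (\<pi> v)" using \<pi>_range by (intro \<sigma>_ge)
qed

text \<open>A value \<open>d\<close> is a fixed point and the largest element of its fibre, which
  therefore fills the interval from its infimum \<open>lo d\<close> to \<open>d\<close>. A point
  \<open>u\<close> outside all intervals with \<open>\<sigma> u \<noteq> u\<close> would be the
  infimum of its own fibre; then \<open>\<sigma> t \<le> u\<close> for all \<open>t < u\<close>, and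
  left-continuity gives \<open>\<sigma> u \<le> u\<close>.\<close>

lemma class_G: "class_G \<sigma>"
proof -
  define lo where "lo d = Inf {u \<in> {0..1}. \<sigma> u = d}" for d
  define P where "P = {(lo d, d) | d. d \<in> \<sigma> ` {0..1} \<and> lo d < d}"
  have bdd: "bdd_below {u \<in> {0..1}. \<sigma> u = d}" for d by (rule bdd_belowI[of _ 0]) auto
  have ne: "d \<in> {u \<in> {0..1}. \<sigma> u = d}" if "d \<in> \<sigma> ` {0..1}" for d
    using that \<sigma>_idem \<sigma>_nonneg \<sigma>_le by auto
  have lo: "0 \<le> lo d" "lo d \<le> d" if "d \<in> \<sigma> ` {0..1}" for d
  proof -
    show "0 \<le> lo d" unfolding lo_def by (rule cInf_greatest) (use ne[OF that] in auto)
    show "lo d \<le> d" unfolding lo_def by (rule cInf_lower[OF ne[OF that] bdd])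
  qed
  have d1: "d \<le> 1" if "d \<in> \<sigma> ` {0..1}" for d using that \<sigma>_le by auto
  have on: "\<sigma> u = d" if d: "d \<in> \<sigma> ` {0..1}" and u: "lo d < u" "u \<le> d" for u d
  proof -
    have ne': "{u \<in> {0..1}. \<sigma> u = d} \<noteq> {}" using ne[OF d] by blast
    obtain x where x: "x \<in> {u \<in> {0..1}. \<sigma> u = d}" "x < u"
      using u cInf_less_iff[OF ne' bdd] unfolding lo_def by auto
    have "\<sigma> x \<le> \<sigma> u" using x u d1[OF d] by (intro mono_\<sigma>) auto
    moreover have "\<sigma> u \<le> \<sigma> d" using x u d1[OF d] by (intro mono_\<sigma>) auto
    ultimately show ?thesis using x ne[OF d] by auto
  qed
  have off: "\<sigma> u = u" if u: "u \<in> {0..1}" "\<And>d. d \<in> \<sigma> ` {0..1} \<Longrightarrow> \<not> (lo d < u \<and> u \<le> d)" for u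
  proof (rule ccontr)
    assume neq: "\<sigma> u \<noteq> u"
    define d where "d = \<sigma> u"
    have d: "d \<in> \<sigma> ` {0..1}" "u < d" "d \<le> 1" using u \<sigma>_ge[of u] \<sigma>_le[of u] neq by (auto simp: d_def)
    have "lo d \<le> u" unfolding lo_def using u by (intro cInf_lower bdd) (auto simp: d_def)
    moreover have "\<not> lo d < u" using u(2)[OF d(1)] d by auto
    ultimately have lou: "lo d = u" by simp
    have u0: "0 < u" using u neq \<sigma>_0 by (cases "u = 0") auto
    have "\<sigma> t \<le> u" if t: "0 < t" "t < u" for t
    proof (rule ccontr)
      assume "\<not> \<sigma> t \<le> u"
      then have st: "u < \<sigma> t" by simp
      have "\<sigma> t \<le> \<sigma> u" using t u by (intro mono_\<sigma>) auto
      then have "\<sigma> (\<sigma> t) = d" using on[OF d(1), of "\<sigma> t"] st lou by (simp add: d_def)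
      then have "\<sigma> t = d" using \<sigma>_idem[of t] t u by simp
      then have "lo d \<le> t" unfolding lo_def using t u by (intro cInf_lower bdd) auto
      then show False using t lou by simp
    qed
    then have "\<forall>\<^sub>F t in at_left u. \<sigma> t \<le> u"
      using eventually_at_left_real[OF u0] by (auto elim!: eventually_mono)
    then have "\<sigma> u \<le> u" using left_\<sigma>[OF u0] u by (intro tendsto_upperbound[where F="at_left u"]) auto
    then show False using d by (simp add: d_def)
  qed
  show ?thesis unfolding class_G_def
  proof (intro exI[of _ P] conjI)
    show "\<forall>(c, d)\<in>P. 0 \<le> c \<and> c < d \<and> d \<le> 1"
    proof clarify
      fix c d assume "(c, d) \<in> P"
      then have "d \<in> \<sigma> ` {0..1}" "lo d < d" "c = lo d" unfolding P_def by auto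
      then show "0 \<le> c \<and> c < d \<and> d \<le> 1" using lo(1)[of d] d1[of d] by simp
    qed
    show "disjoint_family_on (\<lambda>(c, d). {c<..d}) P"
    proof -
      have "d = d'" if "d \<in> \<sigma> ` {0..1}" "d' \<in> \<sigma> ` {0..1}" "lo d < x" "x \<le> d" "lo d' < x" "x \<le> d'" for d d' x
        using on[OF that(1,3,4)] on[OF that(2,5,6)] by simp
      note same = this
      show ?thesis unfolding disjoint_family_on_def
      proof (intro ballI impI)
        fix p p' assume p: "p \<in> P" "p' \<in> P" "p \<noteq> p'"
        obtain d d' where d: "p = (lo d, d)" "p' = (lo d', d')" "d \<in> \<sigma> ` {0..1}" "d' \<in> \<sigma> ` {0..1}"
          using p unfolding P_def by blast
        have "x \<notin> {lo d'<..d'}" if "x \<in> {lo d<..d}" for x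
          using same[OF d(3,4), of x] that p(3) d(1,2) by auto
        then show "(\<lambda>(c, d). {c<..d}) p \<inter> (\<lambda>(c, d). {c<..d}) p' = {}"
          unfolding d(1,2) by blast
      qed
    qed
    show "\<forall>(c, d)\<in>P. \<forall>u\<in>{c<..d}. \<sigma> u = d"
    proof (intro ballI, clarify)
      fix c d u assume "(c, d) \<in> P" "u \<in> {c<..d}"
      then have "d \<in> \<sigma> ` {0..1}" "lo d < u" "u \<le> d" unfolding P_def by auto
      then show "\<sigma> u = d" by (rule on)
    qed
    show "\<forall>u\<in>{0..1} - (\<Union>(c, d)\<in>P. {c<..d}). \<sigma> u = u"
    proof
      fix u assume u: "u \<in> {0..1} - (\<Union>(c, d)\<in>P. {c<..d})"
      show "\<sigma> u = u"
      proof (rule off)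
        fix d assume "d \<in> \<sigma> ` {0..1}"
        then have "(lo d, d) \<in> P" if "lo d < d" using that unfolding P_def by blast
        then show "\<not> (lo d < u \<and> u \<le> d)" using u by fastforce
      qed (use u in simp)
    qed
  qed
qed

text \<open>The quantile construction: by adjointness the preimage of \<open>{0..<u}\<close> under
  \<pi> is \<open>{0..<\<sigma> u}\<close>, whose Lebesgue measure is \<open>\<sigma> u\<close>. It
  turns integrals over \<mu> into Lebesgue integrals of functions composed with \<pi>.\<close>

definition \<mu> :: "real measure" where
  "\<mu> = distr (restrict_space lborel {0..<1}) (restrict_space borel {0..1}) \<pi>"

lemma \<pi>_meas2 [measurable]: "\<pi> \<in> measurable (restrict_space lborel {0..<1}) (restrict_space borel {0..1})"
  by (rule measurable_restrict_space2) (use \<pi>_range in \<open>auto intro!: measurable_restrict_space1\<close>)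

lemma \<mu>_simps [simp]: "space \<mu> = {0..1}" "sets \<mu> = sets (restrict_space borel {0..1})"
  by (auto simp: \<mu>_def space_restrict_space)

lemma \<mu>_generated: "generated_by \<sigma> \<mu>"
proof -
  have P: "prob_space \<mu>" unfolding \<mu>_def
  proof (rule prob_space.prob_space_distr[OF _ \<pi>_meas2])
    show "prob_space (restrict_space lborel {0..<1::real})"
      by (rule prob_spaceI) (simp add: emeasure_restrict_space space_restrict_space)
  qed
  moreover have "measure \<mu> {0..<u} = \<sigma> u" if u: "u \<in> {0..1}" for u
  proof -
    have "{0..<u} \<in> sets (restrict_space borel {0..1})" using u by (auto simp: sets_restrict_space_iff)
    then have "measure \<mu> {0..<u} = measure (restrict_space lborel {0..<1}) (\<pi> -` {0..<u} \<inter> {0..<1})"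
      unfolding \<mu>_def by (subst measure_distr[OF \<pi>_meas2]) (auto simp: space_restrict_space)
    also have "\<pi> -` {0..<u} \<inter> {0..<1} = {0..<\<sigma> u}"
      using u \<pi>_less_iff[of u] \<pi>_range \<sigma>_le[of u] by auto
    also have "measure (restrict_space lborel {0..<1}) {0..<\<sigma> u} = \<sigma> u"
      using u \<sigma>_le[of u] \<sigma>_nonneg[of u] by (subst measure_restrict_space) auto
    finally show ?thesis .
  qed
  ultimately show ?thesis unfolding generated_by_def prob_on_unit_def by auto
qed

end

section \<open>Integrals over subintervals and existence for the retarded equation\<close>

lemma set_integral_bounded:
  fixes g :: "real \<Rightarrow> real"
  assumes "g \<in> borel_measurable borel" "S \<in> sets borel" "emeasure lborel S < \<infinity>"
    and b: "\<And>v. v \<in> S \<Longrightarrow> \<bar>g v\<bar> \<le> M"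
  shows "set_integrable lborel S g" "\<bar>LINT v:S|lborel. g v\<bar> \<le> M * measure lborel S"
proof -
  have const: "set_integrable lborel S (\<lambda>_. k)" for k :: real
    unfolding set_integrable_def using assms by (auto intro!: integrable_mult_left integrable_real_indicator)
  have sm: "set_borel_measurable lborel S g"
    using assms unfolding set_borel_measurable_def by auto
  show int: "set_integrable lborel S g"
    by (rule set_integrable_bound[OF const[of M] sm]) (use b in \<open>fastforce intro!: AE_I2\<close>)
  have "\<bar>LINT v:S|lborel. g v\<bar> \<le> (LINT v:S|lborel. \<bar>g v\<bar>)"
    using set_integral_norm_bound[OF int] by simp
  also have "\<dots> \<le> (LINT v:S|lborel. M)"
    by (rule set_integral_mono) (use const int b in \<open>auto intro: set_integrable_abs\<close>)
  also have "\<dots> = M * measure lborel S" using assms by (simp add: set_lebesgue_integral_def)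
  finally show "\<bar>LINT v:S|lborel. g v\<bar> \<le> M * measure lborel S" .
qed

lemma set_integral_split_Ico:
  fixes g :: "real \<Rightarrow> real"
  assumes g: "g \<in> borel_measurable borel" "\<And>v. \<bar>g v\<bar> \<le> M" and st: "r \<le> s" "s \<le> t"
  shows "(LINT v:{r..<t}|lborel. g v) = (LINT v:{r..<s}|lborel. g v) + (LINT v:{s..<t}|lborel. g v)"
proof -
  have eq: "{r..<t} = {r..<s} \<union> {s..<t}" using st by auto
  show ?thesis unfolding eq
    by (rule set_integral_Un) (use st in \<open>auto intro!: set_integral_bounded(1)[OF g(1), where M=M] g(2)\<close>)
qed

lemma continuous_on_integral_clamp:
  fixes g :: "real \<Rightarrow> real"
  assumes g: "g \<in> borel_measurable borel" "\<And>v. \<bar>g v\<bar> \<le> M"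
  shows "continuous_on UNIV (\<lambda>w. LINT v:{0..<max 0 (min 1 w)}|lborel. g v)"
proof -
  let ?c = "\<lambda>w::real. max 0 (min 1 w)"
  let ?I = "\<lambda>w. LINT v:{0..<w}|lborel. g v"
  have M: "M \<ge> 0" using g(2)[of 0] by linarith
  have 1: "\<bar>?I t - ?I s\<bar> \<le> M * (t - s)" if "0 \<le> s" "s \<le> t" for s t
    using set_integral_split_Ico[OF g, of 0 s t] set_integral_bounded(2)[OF g(1), of "{s..<t}" M] g(2) that by auto
  have 2: "\<bar>?I t - ?I s\<bar> \<le> M * \<bar>t - s\<bar>" if "0 \<le> s" "0 \<le> t" for s t
    using 1[of s t] 1[of t s] that by (cases "s \<le> t") auto
  have "\<bar>?I (?c t) - ?I (?c s)\<bar> \<le> M * \<bar>t - s\<bar>" for s t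
  proof -
    have "\<bar>?I (?c t) - ?I (?c s)\<bar> \<le> M * \<bar>?c t - ?c s\<bar>" by (rule 2) auto
    also have "\<dots> \<le> M * \<bar>t - s\<bar>" using M by (intro mult_left_mono) auto
    finally show ?thesis .
  qed
  then have "M-lipschitz_on UNIV (\<lambda>w. ?I (?c w))"
    using M by (intro lipschitz_onI) (auto simp: dist_real_def)
  then show ?thesis by (rule lipschitz_on_continuous_on)
qed

lemma integral_exp_le:
  fixes \<kappa> w :: real
  assumes "0 < \<kappa>" "0 \<le> w"
  shows "set_integrable lborel {0..<w} (\<lambda>v. exp (\<kappa> * v))"
    and "(LINT v:{0..<w}|lborel. exp (\<kappa> * v)) \<le> exp (\<kappa> * w) / \<kappa>"
proof -
  have "has_bochner_integral lborel (\<lambda>v. exp (\<kappa> * v) * indicator {0..w} v) (exp (\<kappa> * w) / \<kappa> - exp (\<kappa> * 0) / \<kappa>)"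
  proof (rule has_bochner_integral_FTC_Icc_real[OF assms(2)])
    show "DERIV (\<lambda>v. exp (\<kappa> * v) / \<kappa>) x :> exp (\<kappa> * x)" for x
      using assms by (auto intro!: derivative_eq_intros)
  qed (auto intro!: continuous_intros)
  then have I: "set_integrable lborel {0..w} (\<lambda>v. exp (\<kappa> * v))"
    "(LINT v:{0..w}|lborel. exp (\<kappa> * v)) = exp (\<kappa> * w) / \<kappa> - 1 / \<kappa>"
    by (auto simp: set_integrable_def set_lebesgue_integral_def has_bochner_integral_iff mult.commute)
  show I2: "set_integrable lborel {0..<w} (\<lambda>v. exp (\<kappa> * v))"
    by (rule set_integrable_subset[OF I(1)]) auto
  have "(LINT v:{0..<w}|lborel. exp (\<kappa> * v)) \<le> (LINT v:{0..w}|lborel. exp (\<kappa> * v))"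
    using I2 I(1) unfolding set_lebesgue_integral_def set_integrable_def
    by (intro integral_mono) (auto split: split_indicator)
  then show "(LINT v:{0..<w}|lborel. exp (\<kappa> * v)) \<le> exp (\<kappa> * w) / \<kappa>"
    unfolding I(2) using assms by (smt (verit) divide_nonneg_pos)
qed

context gap_function
begin

text \<open>Banach's fixed point theorem in the norm weighted by \<open>exp (- \<kappa> w)\<close>: the equation is
  retarded because \<open>\<pi> v \<le> v\<close>.\<close>

lemma retarded_solution:
  fixes z :: "real \<Rightarrow> real"
  assumes lip: "\<And>p q. \<bar>z p - z q\<bar> \<le> \<Lambda> * \<bar>p - q\<bar>" and L: "0 \<le> \<Lambda>"
  obtains \<psi> where "continuous_on UNIV \<psi>" "\<And>w. w \<in> {0..1} \<Longrightarrow> \<psi> w = x + (LINT v:{0..<w}|lborel. z (\<psi> (\<pi> v)))"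
proof -
  \<comment> \<open>This weight gives the contraction factor
    \<open>\<Lambda> / \<kappa> \<le> 1 / 2\<close>; the added 1 keeps it positive when
    \<open>\<Lambda> = 0\<close>.\<close>
  define \<kappa> where "\<kappa> = 2 * \<Lambda> + 1"
  have lam: "\<kappa> > 0" using L by (simp add: \<kappa>_def)
  let ?c = "\<lambda>w::real. max 0 (min 1 w)"
  have zc: "continuous_on UNIV z"
    using L by (intro lipschitz_on_continuous_on[of \<Lambda>] lipschitz_onI) (auto simp: dist_real_def lip)
  have zm [measurable]: "z \<in> borel_measurable borel" by (rule borel_measurable_continuous_onI[OF zc])
  \<comment> \<open>The unknown \<phi> is the solution divided by its weight
    \<open>exp (\<kappa> * w)\<close>, so that the plain supremum norm of \<phi> is the weighted
    norm of the solution.\<close>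
  define g where "g \<phi> v = z (exp (\<kappa> * \<pi> v) * apply_bcontfun \<phi> (\<pi> v))" for \<phi> :: "real \<Rightarrow>\<^sub>C real" and v
  have [measurable]: "apply_bcontfun \<phi> \<in> borel_measurable borel" for \<phi> :: "real \<Rightarrow>\<^sub>C real"
    by (intro borel_measurable_continuous_onI continuous_on_apply_bcontfun)
  have gm: "g \<phi> \<in> borel_measurable borel" for \<phi> unfolding g_def[abs_def] by measurable
  have gb: "\<exists>M. \<forall>v. \<bar>g \<phi> v\<bar> \<le> M" for \<phi>
  proof (intro exI allI)
    fix v
    have "\<bar>g \<phi> v\<bar> \<le> \<bar>z 0\<bar> + \<Lambda> * \<bar>exp (\<kappa> * \<pi> v) * apply_bcontfun \<phi> (\<pi> v)\<bar>"
      using lip[of "exp (\<kappa> * \<pi> v) * apply_bcontfun \<phi> (\<pi> v)" 0, unfolded diff_0_right] unfolding g_def by linarith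
    also have "\<dots> \<le> \<bar>z 0\<bar> + \<Lambda> * (exp \<kappa> * norm \<phi>)"
      unfolding abs_mult using L lam \<pi>_range[of v] norm_bounded[of \<phi> "\<pi> v"]
      by (intro add_left_mono mult_left_mono mult_mono) auto
    finally show "\<bar>g \<phi> v\<bar> \<le> \<bar>z 0\<bar> + \<Lambda> * (exp \<kappa> * norm \<phi>)" .
  qed
  define S where "S \<phi> w = exp (- \<kappa> * ?c w) * (x + (LINT v:{0..<?c w}|lborel. g \<phi> v))" for \<phi> w
  have Sb: "S \<phi> \<in> bcontfun" for \<phi>
  proof -
    obtain M where M: "\<And>v. \<bar>g \<phi> v\<bar> \<le> M" using gb by blast
    have "continuous_on UNIV (S \<phi>)" unfolding S_def
      by (intro continuous_intros continuous_on_integral_clamp[OF gm M])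
    moreover have "norm (S \<phi> w) \<le> \<bar>x\<bar> + M" for w
    proof -
      have M0: "M \<ge> 0" using M[of 0] by linarith
      have "\<bar>LINT v:{0..<?c w}|lborel. g \<phi> v\<bar> \<le> M * (?c w)"
        using set_integral_bounded(2)[OF gm, of "{0..<?c w}" \<phi> M] M by simp
      also have "\<dots> \<le> M * 1" using M0 by (intro mult_left_mono) auto
      finally have 1: "\<bar>x + (LINT v:{0..<?c w}|lborel. g \<phi> v)\<bar> \<le> \<bar>x\<bar> + M" by linarith
      have "norm (S \<phi> w) \<le> 1 * (\<bar>x\<bar> + M)"
        unfolding S_def real_norm_def abs_mult using lam 1 M0 by (intro mult_mono) auto
      then show ?thesis by simp
    qed
    ultimately show ?thesis by (intro bcontfun_normI)
  qed
  define T where "T \<phi> = Bcontfun (S \<phi>)" for \<phi>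
  have T: "apply_bcontfun (T \<phi>) w = S \<phi> w" for \<phi> w unfolding T_def using Sb by (simp add: Bcontfun_inverse)
  have contr: "dist (T \<phi>1) (T \<phi>2) \<le> (1/2) * dist \<phi>1 \<phi>2" for \<phi>1 \<phi>2
  proof (rule dist_bound)
    fix w
    let ?d = "dist \<phi>1 \<phi>2"
    obtain M1 where M1: "\<And>v. \<bar>g \<phi>1 v\<bar> \<le> M1" using gb by blast
    obtain M2 where M2: "\<And>v. \<bar>g \<phi>2 v\<bar> \<le> M2" using gb by blast
    have i: "set_integrable lborel {0..<?c w} (g \<phi>1)" "set_integrable lborel {0..<?c w} (g \<phi>2)"
      using set_integral_bounded(1)[OF gm, of "{0..<?c w}"] M1 M2 by auto
    have cw: "0 \<le> ?c w" by simp
    have "\<bar>(LINT v:{0..<?c w}|lborel. g \<phi>1 v) - (LINT v:{0..<?c w}|lborel. g \<phi>2 v)\<bar>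
        = \<bar>LINT v:{0..<?c w}|lborel. g \<phi>1 v - g \<phi>2 v\<bar>" using set_integral_diff(2)[OF i] by simp
    also have "\<dots> \<le> (LINT v:{0..<?c w}|lborel. \<bar>g \<phi>1 v - g \<phi>2 v\<bar>)"
      using set_integral_norm_bound[OF set_integral_diff(1)[OF i]] by simp
    also have "\<dots> \<le> (LINT v:{0..<?c w}|lborel. \<Lambda> * ?d * exp (\<kappa> * v))"
    proof (rule set_integral_mono)
      show "set_integrable lborel {0..<?c w} (\<lambda>v. \<bar>g \<phi>1 v - g \<phi>2 v\<bar>)"
        by (rule set_integrable_abs[OF set_integral_diff(1)[OF i]])
      show "set_integrable lborel {0..<?c w} (\<lambda>v. \<Lambda> * ?d * exp (\<kappa> * v))"
        by (rule set_integrable_mult_right) (rule integral_exp_le(1)[OF lam cw])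
      fix v assume v: "v \<in> {0..<?c w}"
      have "\<bar>g \<phi>1 v - g \<phi>2 v\<bar> \<le> \<Lambda> * \<bar>exp (\<kappa> * \<pi> v) * (apply_bcontfun \<phi>1 (\<pi> v) - apply_bcontfun \<phi>2 (\<pi> v))\<bar>"
        unfolding g_def right_diff_distrib by (rule lip)
      also have "\<dots> \<le> \<Lambda> * (exp (\<kappa> * v) * ?d)"
        unfolding abs_mult using L lam \<pi>_le[of v] v dist_bounded[of \<phi>1 "\<pi> v" \<phi>2]
        by (intro mult_left_mono mult_mono) (auto simp: dist_real_def)
      finally show "\<bar>g \<phi>1 v - g \<phi>2 v\<bar> \<le> \<Lambda> * ?d * exp (\<kappa> * v)" by (simp add: mult_ac)
    qed
    also have "\<dots> = \<Lambda> * ?d * (LINT v:{0..<?c w}|lborel. exp (\<kappa> * v))" by (rule set_integral_mult_right)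
    also have "\<dots> \<le> \<Lambda> * ?d * (exp (\<kappa> * ?c w) / \<kappa>)"
      using L by (intro mult_left_mono integral_exp_le(2)[OF lam cw]) auto
    finally have 1: "\<bar>(LINT v:{0..<?c w}|lborel. g \<phi>1 v) - (LINT v:{0..<?c w}|lborel. g \<phi>2 v)\<bar> \<le> \<Lambda> * ?d * (exp (\<kappa> * ?c w) / \<kappa>)" .
    have "dist (T \<phi>1 w) (T \<phi>2 w) = exp (- \<kappa> * ?c w) * \<bar>(LINT v:{0..<?c w}|lborel. g \<phi>1 v) - (LINT v:{0..<?c w}|lborel. g \<phi>2 v)\<bar>"
      unfolding T S_def dist_real_def by (simp flip: right_diff_distrib add: abs_mult)
    also have "\<dots> \<le> exp (- \<kappa> * ?c w) * (\<Lambda> * ?d * (exp (\<kappa> * ?c w) / \<kappa>))"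
      using 1 by (intro mult_left_mono) auto
    also have "\<dots> = (\<Lambda> / \<kappa>) * ?d" by (simp add: exp_minus field_simps)
    also have "\<dots> \<le> (1/2) * ?d" using L by (intro mult_right_mono) (auto simp: \<kappa>_def field_simps)
    finally show "dist (T \<phi>1 w) (T \<phi>2 w) \<le> (1/2) * ?d" .
  qed
  have "\<exists>!\<phi>. T \<phi> = \<phi>" by (rule banach_fix_type[of "1/2"]) (use contr in auto)
  then obtain \<phi> where \<phi>: "T \<phi> = \<phi>" by blast
  define \<psi> where "\<psi> w = exp (\<kappa> * ?c w) * apply_bcontfun \<phi> w" for w
  have g\<psi>: "g \<phi> v = z (\<psi> (\<pi> v))" for v
    using \<pi>_range[of v] by (simp add: g_def \<psi>_def)
  show ?thesis
  proof (rule that[of \<psi>])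
    show "continuous_on UNIV \<psi>" unfolding \<psi>_def by (intro continuous_intros continuous_on_apply_bcontfun)
    fix w :: real assume w: "w \<in> {0..1}"
    have "\<psi> w = exp (\<kappa> * w) * S \<phi> w" using w T[of \<phi> w] \<phi> by (simp add: \<psi>_def)
    also have "\<dots> = x + (LINT v:{0..<w}|lborel. g \<phi> v)"
      using w by (simp add: S_def exp_minus)
    finally show "\<psi> w = x + (LINT v:{0..<w}|lborel. z (\<psi> (\<pi> v)))" unfolding g\<psi> .
  qed
qed

end

section \<open>Uniqueness for the jump equation and its reduction to the retarded equation\<close>

lemma phi_zero:
  assumes "prob_on_unit \<mu>" shows "phi \<mu> (\<lambda>_. 0) x 1 = x"
proof -
  have "phi_equation \<mu> (\<lambda>_. 0) x \<phi> \<longleftrightarrow> (\<forall>u\<in>{0..1}. \<phi> u = x)" for \<phi>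
    by (simp add: phi_equation_def set_integrable_def set_lebesgue_integral_def)
  then show ?thesis unfolding phi_def
    by (intro the_equality) (auto intro!: exI[of _ "\<lambda>_. x"])
qed

text \<open>The difference of two solutions vanishes on a maximal interval \<open>{0..r}\<close>; beyond \<open>r\<close> the
  measure of \<open>{r<..<u}\<close> is small, even when \<open>\<mu>\<close> has an atom at \<open>r\<close>.\<close>

lemma phi_equation_unique:
  assumes \<mu>: "prob_on_unit \<mu>" and lip: "\<And>p q. \<bar>z p - z q\<bar> \<le> \<Lambda> * \<bar>p - q\<bar>" and L: "0 \<le> \<Lambda>"
    and 1: "phi_equation \<mu> z x \<phi>1" and 2: "phi_equation \<mu> z x \<phi>2"
  shows "\<phi>1 1 = \<phi>2 1"
proof -
  interpret prob_space \<mu> using \<mu> by (simp add: prob_on_unit_def)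
  have sets: "sets \<mu> = sets (restrict_space borel {0..1})" using \<mu> by (simp add: prob_on_unit_def)
  have S: "A \<in> sets \<mu>" if "A \<in> sets borel" "A \<subseteq> {0..1}" for A :: "real set"
    unfolding sets using that by (subst sets_restrict_space_iff) auto
  define q where "q v = \<bar>z (\<phi>1 v) - z (\<phi>2 v)\<bar>" for v
  have i: "set_integrable \<mu> {0..<1} (\<lambda>v. z (\<phi>1 v))" "set_integrable \<mu> {0..<1} (\<lambda>v. z (\<phi>2 v))"
    using 1 2 by (auto simp: phi_equation_def)
  have iq: "set_integrable \<mu> {0..<1} q"
    unfolding q_def by (rule set_integrable_abs[OF set_integral_diff(1)[OF i]])
  have iqs: "set_integrable \<mu> A q" if "A \<in> sets borel" "A \<subseteq> {0..<1}" for A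
    by (rule set_integrable_subset[OF iq S]) (use that in auto)
  define Q where "Q u = (LINT v:{0..<u}|\<mu>. q v)" for u
  have d: "\<bar>\<phi>1 u - \<phi>2 u\<bar> \<le> Q u" if u: "u \<in> {0..1}" for u
  proof -
    have i': "set_integrable \<mu> {0..<u} (\<lambda>v. z (\<phi>1 v))" "set_integrable \<mu> {0..<u} (\<lambda>v. z (\<phi>2 v))"
      by (rule set_integrable_subset[OF i(1) S]; use u in auto)
         (rule set_integrable_subset[OF i(2) S]; use u in auto)
    have "\<phi>1 u - \<phi>2 u = (LINT v:{0..<u}|\<mu>. z (\<phi>1 v) - z (\<phi>2 v))"
      using 1 2 u set_integral_diff(2)[OF i'] by (auto simp: phi_equation_def)
    then show ?thesis
      using set_integral_norm_bound[OF set_integral_diff(1)[OF i']] by (simp add: Q_def q_def)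
  qed
  have q_le: "q v \<le> \<Lambda> * Q v" if "v \<in> {0..1}" for v
  proof -
    have "q v \<le> \<Lambda> * \<bar>\<phi>1 v - \<phi>2 v\<bar>" unfolding q_def by (rule lip)
    also have "\<dots> \<le> \<Lambda> * Q v" using d[OF that] L by (intro mult_left_mono)
    finally show ?thesis .
  qed
  have Q_split: "Q u = Q t + (LINT v:{t..<u}|\<mu>. q v)" if "0 \<le> t" "t \<le> u" "u \<le> 1" for t u
  proof -
    have eq: "{0..<u} = {0..<t} \<union> {t..<u}" using that by auto
    show ?thesis unfolding Q_def eq
      by (rule set_integral_Un) (use that in \<open>auto intro!: iqs\<close>)
  qed
  have q0: "q v \<ge> 0" for v by (simp add: q_def)
  have Q_mono: "Q t \<le> Q u" if "0 \<le> t" "t \<le> u" "u \<le> 1" for t u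
    unfolding Q_split[OF that] using q0 by (auto simp: set_lebesgue_integral_def intro!: Bochner_Integration.integral_nonneg)
  have Q0: "Q 0 = 0" by (simp add: Q_def set_lebesgue_integral_def)
  have Q_nonneg: "0 \<le> Q u" if "u \<in> {0..1}" for u using Q_mono[of 0 u] Q0 that by simp
  define r where "r = Sup {u \<in> {0..1}. Q u = 0}"
  have bdd: "bdd_above {u \<in> {0..1}. Q u = 0}" by (rule bdd_aboveI[of _ 1]) auto
  have mem: "0 \<in> {u \<in> {0..1}. Q u = 0}" using Q0 by simp
  have r: "0 \<le> r" "r \<le> 1"
  proof -
    show "0 \<le> r" unfolding r_def by (rule cSup_upper[OF mem bdd])
    show "r \<le> 1" unfolding r_def by (rule cSup_least) (use mem in \<open>blast, auto\<close>)
  qed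
  have below: "q v = 0" if "0 \<le> v" "v < r" for v
  proof -
    have "\<exists>u\<in>{u \<in> {0..1}. Q u = 0}. v < u"
      using that less_cSup_iff[OF _ bdd, of v] mem unfolding r_def by blast
    then obtain u where "u \<le> 1" "Q u = 0" "v < u" by auto
    then have "Q v \<le> 0" using Q_mono[of v u] that by simp
    then have "\<Lambda> * Q v \<le> 0" using L by (simp add: mult_nonneg_nonpos)
    then show ?thesis using q_le[of v] q0[of v] that r by simp
  qed
  have Qr: "Q r = 0"
  proof -
    have *: "(\<lambda>v. indicator {0..<r} v *\<^sub>R q v) = (\<lambda>v. 0)" using below by (auto split: split_indicator)
    show ?thesis unfolding Q_def set_lebesgue_integral_def * by simp
  qed
  \<comment> \<open>\<open>Q r\<close> integrates over \<open>{0..<r}\<close> only, yet it bounds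
    the difference of the solutions at \<open>r\<close> itself. Hence the integrand vanishes at
    \<open>r\<close> and an atom there is harmless.\<close>
  have qr: "q r = 0" using q_le[of r] q0[of r] Qr r by simp
  have "r = 1"
  proof (rule ccontr)
    assume "r \<noteq> 1"
    then have r1: "r < 1" using r by simp
    have lim: "(\<lambda>n. measure \<mu> {r<..<r + (1 - r) / real (Suc n)}) \<longlonglongrightarrow> measure \<mu> (\<Inter>n. {r<..<r + (1 - r) / real (Suc n)})"
    proof (rule finite_Lim_measure_decseq)
      have *: "(1 - r) / real (Suc n) \<le> 1 - r" for n using r1 divide_left_mono[of 1 "real (Suc n)" "1 - r"] by simp
      show "range (\<lambda>n. {r<..<r + (1 - r) / real (Suc n)}) \<subseteq> sets \<mu>"
      proof safe
        fix n show "{r<..<r + (1 - r) / real (Suc n)} \<in> sets \<mu>" using *[of n] r by (intro S) auto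
      qed
      show "decseq (\<lambda>n. {r<..<r + (1 - r) / real (Suc n)})"
      proof (rule decseq_SucI)
        fix n
        have "(1 - r) / real (Suc (Suc n)) \<le> (1 - r) / real (Suc n)" using r1 by (intro divide_left_mono) auto
        then show "{r<..<r + (1 - r) / real (Suc (Suc n))} \<subseteq> {r<..<r + (1 - r) / real (Suc n)}" by auto
      qed
    qed
    have "(\<Inter>n. {r<..<r + (1 - r) / real (Suc n)}) = {}"
    proof (rule ccontr)
      assume "(\<Inter>n. {r<..<r + (1 - r) / real (Suc n)}) \<noteq> {}"
      then obtain v where "v \<in> (\<Inter>n. {r<..<r + (1 - r) / real (Suc n)})" by blast
      then have v: "r < v \<and> v < r + (1 - r) / real (Suc n)" for n by simp
      have "(\<lambda>n. r + (1 - r) / real (Suc n)) \<longlonglongrightarrow> r + 0"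
        by (intro tendsto_intros LIMSEQ_Suc[OF lim_const_over_n])
      then have "v \<le> r + 0" by (rule LIMSEQ_le_const) (use v in \<open>auto intro: less_imp_le\<close>)
      then show False using v[of 0] by simp
    qed
    then have "(\<lambda>n. measure \<mu> {r<..<r + (1 - r) / real (Suc n)}) \<longlonglongrightarrow> 0" using lim by simp
    \<comment> \<open>With this threshold \<open>Q u\<close> is at most
      \<open>\<Lambda> / (2 * \<Lambda> + 1)\<close> times itself, a factor below 1, and so
      vanishes.\<close>
    then have "\<forall>\<^sub>F n in sequentially. measure \<mu> {r<..<r + (1 - r) / real (Suc n)} < 1 / (2 * \<Lambda> + 1)"
      using L by (intro order_tendstoD(2)) auto
    then obtain n where n: "measure \<mu> {r<..<r + (1 - r) / real (Suc n)} < 1 / (2 * \<Lambda> + 1)"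
      by (auto simp: eventually_sequentially)
    define u where "u = r + (1 - r) / real (Suc n)"
    have ru: "r < u" "u \<le> 1" using r1 divide_left_mono[of 1 "real (Suc n)" "1 - r"] by (auto simp: u_def)
    have const: "set_integrable \<mu> {r<..<u} (\<lambda>_. k)" for k :: real
      unfolding set_integrable_def using ru r by (intro integrable_scaleR_left integrable_real_indicator S) (auto simp: emeasure_eq_measure)
    have "Q u = (LINT v:{r..<u}|\<mu>. q v)" using Q_split[of r u] Qr r ru by simp
    also have "\<dots> = (LINT v:{r<..<u}|\<mu>. q v)"
    proof -
      have "(\<lambda>v. indicator {r..<u} v *\<^sub>R q v) = (\<lambda>v. indicator {r<..<u} v *\<^sub>R q v)"
        using qr by (auto split: split_indicator simp: le_less)
      then show ?thesis by (simp add: set_lebesgue_integral_def)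
    qed
    also have "\<dots> \<le> (LINT v:{r<..<u}|\<mu>. \<Lambda> * Q u)"
    proof (rule set_integral_mono[OF iqs const])
      fix v assume v: "v \<in> {r<..<u}"
      have "q v \<le> \<Lambda> * Q v" using v r ru by (intro q_le) auto
      also have "\<dots> \<le> \<Lambda> * Q u" using v r ru L by (intro mult_left_mono Q_mono) auto
      finally show "q v \<le> \<Lambda> * Q u" .
    qed (use r ru in auto)
    also have "\<dots> = \<Lambda> * Q u * measure \<mu> {r<..<u}"
      using S[of "{r<..<u}"] ru r by (simp add: set_lebesgue_integral_def mult.commute subset_eq)
    also have "\<dots> \<le> \<Lambda> * Q u * (1 / (2 * \<Lambda> + 1))"
      using n Q_nonneg[of u] L ru r unfolding u_def[symmetric] by (intro mult_left_mono) auto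
    finally have "Q u * (2 * \<Lambda> + 1) \<le> \<Lambda> * Q u" using L by (simp add: field_simps)
    then have "Q u * (\<Lambda> + 1) \<le> 0" by (simp add: algebra_simps)
    then have "Q u = 0" using Q_nonneg[of u] ru r L by (simp add: mult_le_0_iff)
    then have "u \<le> r" unfolding r_def using ru r by (intro cSup_upper bdd) auto
    then show False using ru by simp
  qed
  then show ?thesis using d[of 1] Qr by simp
qed

context gap_function
begin

text \<open>The function \<psi> composed with \<sigma> solves the jump equation: \<pi> carries
  Lebesgue measure to \<mu>, the interval \<open>{0..<u}\<close> pulls back to
  \<open>{0..<\<sigma> u}\<close>, and \<sigma> fixes the values of \<pi>, where the composition
  therefore agrees with \<psi>. Uniqueness at 1 then evaluates the definite description.\<close>

lemma phi_eq_retarded: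
  assumes lip: "\<And>p q. \<bar>z p - z q\<bar> \<le> \<Lambda> * \<bar>p - q\<bar>" and L: "0 \<le> \<Lambda>"
    and cont: "continuous_on UNIV \<psi>"
    and eq: "\<And>w. w \<in> {0..1} \<Longrightarrow> \<psi> w = x + (LINT v:{0..<w}|lborel. z (\<psi> (\<pi> v)))"
  shows "phi \<mu> z x 1 = \<psi> 1"
proof -
  define \<phi> where "\<phi> u = \<psi> (\<sigma> (max 0 (min 1 u)))" for u
  have P: "prob_on_unit \<mu>" using \<mu>_generated by (simp add: generated_by_def)
  have zc: "continuous_on UNIV z"
    using L by (intro lipschitz_on_continuous_on[of \<Lambda>] lipschitz_onI) (auto simp: dist_real_def lip)
  have zm [measurable]: "z \<in> borel_measurable borel" by (rule borel_measurable_continuous_onI[OF zc])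
  have pm [measurable]: "\<psi> \<in> borel_measurable borel" by (rule borel_measurable_continuous_onI[OF cont])
  have sm [measurable]: "(\<lambda>u. \<sigma> (max 0 (min 1 u))) \<in> borel_measurable borel"
    by (rule borel_measurable_mono) (auto simp: mono_def intro!: mono_\<sigma>)
  have phm [measurable]: "\<phi> \<in> borel_measurable borel" unfolding \<phi>_def[abs_def] by measurable
  have ph\<pi>: "\<phi> (\<pi> v) = \<psi> (\<pi> v)" if "0 \<le> v" for v
    using \<pi>_range[of v] \<sigma>_\<pi>[OF that] by (simp add: \<phi>_def)
  have ind: "(\<lambda>v. indicator {0..<u} v *\<^sub>R z (\<phi> v)) \<in> borel_measurable (restrict_space borel {0..1})" for u
    by (rule measurable_restrict_space1) measurable
  have "compact (z ` \<psi> ` {0..1})"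
    by (intro compact_continuous_image continuous_on_subset[OF zc] continuous_on_subset[OF cont]) auto
  then obtain M where "\<forall>y\<in>z ` \<psi> ` {0..1}. norm y \<le> M"
    using compact_imp_bounded bounded_iff by blast
  then have M: "\<bar>z (\<psi> v)\<bar> \<le> M" if "v \<in> {0..1}" for v using that by simp
  have bound: "\<bar>z (\<psi> (\<pi> v))\<bar> \<le> M" for v using \<pi>_range[of v] by (intro M) auto
  have key: "set_integrable \<mu> {0..<u} (\<lambda>v. z (\<phi> v)) \<and> (LINT v:{0..<u}|\<mu>. z (\<phi> v)) = (LINT v:{0..<\<sigma> u}|lborel. z (\<psi> (\<pi> v)))"
    if u: "u \<in> {0..1}" for u
  proof -
    have eq': "indicator {0..<1} v *\<^sub>R (indicator {0..<u} (\<pi> v) *\<^sub>R z (\<phi> (\<pi> v))) = indicator {0..<\<sigma> u} v *\<^sub>R z (\<psi> (\<pi> v))" for v :: real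
      using \<pi>_less_iff[of u v] \<pi>_range[of v] u \<sigma>_le[of u] ph\<pi>[of v]
      by (cases "0 \<le> v") (auto split: split_indicator)
    have "integrable \<mu> (\<lambda>v. indicator {0..<u} v *\<^sub>R z (\<phi> v)) \<longleftrightarrow>
       integrable lborel (\<lambda>v. indicator {0..<1} v *\<^sub>R (indicator {0..<u} (\<pi> v) *\<^sub>R z (\<phi> (\<pi> v))))"
      unfolding \<mu>_def by (subst integrable_distr_eq[OF \<pi>_meas2 ind]) (simp add: integrable_restrict_space)
    also have "\<dots>" unfolding eq' using u \<sigma>_nonneg[of u] set_integral_bounded(1)[of "\<lambda>v. z (\<psi> (\<pi> v))" "{0..<\<sigma> u}" M] bound
      by (simp add: set_integrable_def)
    finally have 1: "set_integrable \<mu> {0..<u} (\<lambda>v. z (\<phi> v))" by (simp add: set_integrable_def)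
    have "(LINT v:{0..<u}|\<mu>. z (\<phi> v)) = (\<integral>v. indicator {0..<1} v *\<^sub>R (indicator {0..<u} (\<pi> v) *\<^sub>R z (\<phi> (\<pi> v))) \<partial>lborel)"
      unfolding \<mu>_def set_lebesgue_integral_def
      by (subst integral_distr[OF \<pi>_meas2 ind]) (simp add: integral_restrict_space)
    then show ?thesis using 1 unfolding eq' set_lebesgue_integral_def by simp
  qed
  have sol: "phi_equation \<mu> z x \<phi>" unfolding phi_equation_def
  proof (intro conjI ballI)
    show "set_integrable \<mu> {0..<1} (\<lambda>v. z (\<phi> v))" using key[of 1] by simp
    fix u :: real assume u: "u \<in> {0..1}"
    then have "\<phi> u = \<psi> (\<sigma> u)" by (simp add: \<phi>_def)
    then show "\<phi> u = x + (LINT v:{0..<u}|\<mu>. z (\<phi> v))"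
      using key[OF u] eq[of "\<sigma> u"] \<sigma>_le[of u] \<sigma>_nonneg[of u] u by simp
  qed
  have "\<phi> 1 = \<psi> 1" by (simp add: \<phi>_def \<sigma>_1)
  moreover have "phi \<mu> z x 1 = \<phi> 1" unfolding phi_def
  proof (rule the_equality)
    show "\<exists>\<phi>'. phi_equation \<mu> z x \<phi>' \<and> \<phi> 1 = \<phi>' 1" using sol by blast
    show "y = \<phi> 1" if "\<exists>\<phi>'. phi_equation \<mu> z x \<phi>' \<and> y = \<phi>' 1" for y
      using that phi_equation_unique[OF P lip L sol] by metis
  qed
  ultimately show ?thesis by simp
qed

end

section \<open>Euler schemes on a partition against the retarded solution\<close>

lemma sum_indicator_Ico:
  fixes u :: "nat \<Rightarrow> real"
  assumes "p \<le> q" "\<And>k. p \<le> k \<Longrightarrow> k < q \<Longrightarrow> u k \<le> u (Suc k)"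
  shows "(\<Sum>k=p..<q. indicator {u k..<u (Suc k)} v :: ennreal) = indicator {u p..<u q} v" "u p \<le> u q"
proof -
  have "(\<Sum>k=p..<q. indicator {u k..<u (Suc k)} v :: ennreal) = indicator {u p..<u q} v \<and> u p \<le> u q"
    using assms
  proof (induction q rule: dec_induct)
    case (step n)
    have un: "u n \<le> u (Suc n)" "u p \<le> u n" using step by auto
    then have "{u p..<u (Suc n)} = {u p..<u n} \<union> {u n..<u (Suc n)}" "u p \<le> u (Suc n)" by auto
    moreover have "{u p..<u n} \<inter> {u n..<u (Suc n)} = {}" by auto
    ultimately show ?case using step by (auto simp: indicator_add[symmetric] split: split_indicator)
  qed simp
  then show "(\<Sum>k=p..<q. indicator {u k..<u (Suc k)} v :: ennreal) = indicator {u p..<u q} v" "u p \<le> u q" by auto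
qed

context gap_function
begin

text \<open>The area between the graphs of two increasing functions is the area between the graphs of
  their generalised inverses.\<close>

lemma area_between:
  fixes s :: "real \<Rightarrow> real" and u :: "nat \<Rightarrow> real"
  assumes pq: "p \<le> q" "u p = 0" "u q = 1" and mono: "\<And>k. p \<le> k \<Longrightarrow> k < q \<Longrightarrow> u k \<le> u (Suc k)"
    and s [measurable]: "s \<in> borel_measurable borel" and s01: "\<And>t. t \<in> {0<..<1} \<Longrightarrow> s t \<in> {0..1}"
    and H: "\<And>k v t. p \<le> k \<Longrightarrow> k < q \<Longrightarrow> u k \<le> v \<Longrightarrow> v < u (Suc k) \<Longrightarrow> 0 < t \<Longrightarrow> t < 1 \<Longrightarrow> v < s t \<longleftrightarrow> u k < t"
  shows "(\<Sum>k=p..<q. LINT v:{u k..<u (Suc k)}|lborel. \<bar>u k - \<pi> v\<bar>) \<le> (LINT t:{0<..<1}|lborel. \<bar>s t - \<sigma> t\<bar>)"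
proof -
  define \<sigma>' where "\<sigma>' t = \<sigma> (max 0 (min 1 t))" for t
  have [measurable]: "\<sigma>' \<in> borel_measurable borel" unfolding \<sigma>'_def
    by (rule borel_measurable_mono) (auto simp: mono_def intro!: mono_\<sigma>)
  have u01: "0 \<le> u k" "u k \<le> 1" if "p \<le> k" "k \<le> q" for k
    using sum_indicator_Ico(2)[of p k u] sum_indicator_Ico(2)[of k q u] that mono pq by auto
  define D where "D v t = (if (v < s t) = (v < \<sigma>' t) then 0 else 1 :: ennreal)" for v t
  have [measurable]: "(\<lambda>(v, t). D v t) \<in> borel_measurable (borel \<Otimes>\<^sub>M borel)"
    unfolding D_def by measurable
  have inner: "ennreal \<bar>u k - \<pi> v\<bar> = (\<integral>\<^sup>+t. indicator {0<..<1} t * D v t \<partial>lborel)"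
    if k: "p \<le> k" "k < q" "u k \<le> v" "v < u (Suc k)" for k v
  proof -
    have v: "0 \<le> v" "v < 1" using u01[of k] u01[of "Suc k"] k by auto
    define lo hi where "lo = min (u k) (\<pi> v)" and "hi = max (u k) (\<pi> v)"
    have lh: "lo \<le> hi" "0 \<le> lo" "hi \<le> 1" using u01[of k] \<pi>_range[of v] k by (auto simp: lo_def hi_def)
    have "(indicator {0<..<1} t * D v t :: ennreal) = indicator {lo<..hi} t" if "t \<noteq> 1" for t
    proof (cases "0 < t \<and> t < 1")
      case True
      have "v < s t \<longleftrightarrow> u k < t" using H k True by blast
      moreover have "v < \<sigma>' t \<longleftrightarrow> \<pi> v < t" using True v \<pi>_less_iff[of t v] by (simp add: \<sigma>'_def min_def max_def)
      ultimately show ?thesis using True by (auto simp: D_def lo_def hi_def split: split_indicator)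
    next
      case False
      then show ?thesis using that lh by (auto split: split_indicator)
    qed
    then have "(\<integral>\<^sup>+t. indicator {0<..<1} t * D v t \<partial>lborel) = (\<integral>\<^sup>+t. indicator {lo<..hi} t \<partial>lborel)"
      by (intro nn_integral_cong_AE eventually_mono[OF AE_lborel_singleton[of 1]]) auto
    also have "\<dots> = ennreal (hi - lo)" using lh by simp
    also have "hi - lo = \<bar>u k - \<pi> v\<bar>" by (auto simp: hi_def lo_def)
    finally show ?thesis by simp
  qed
  have bnd: "\<bar>\<bar>u k - \<pi> v\<bar>\<bar> \<le> 1" if "p \<le> k" "k < q" for k v
    using u01[of k] \<pi>_range[of v] that by auto
  have "ennreal (\<Sum>k=p..<q. LINT v:{u k..<u (Suc k)}|lborel. \<bar>u k - \<pi> v\<bar>)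
      = (\<Sum>k=p..<q. \<integral>\<^sup>+v. indicator {u k..<u (Suc k)} v * ennreal \<bar>u k - \<pi> v\<bar> \<partial>lborel)"
  proof (subst sum_ennreal[symmetric])
    show "(\<Sum>k=p..<q. ennreal (LINT v:{u k..<u (Suc k)}|lborel. \<bar>u k - \<pi> v\<bar>))
      = (\<Sum>k=p..<q. \<integral>\<^sup>+v. indicator {u k..<u (Suc k)} v * ennreal \<bar>u k - \<pi> v\<bar> \<partial>lborel)"
    proof (rule sum.cong[OF refl])
      fix k assume k: "k \<in> {p..<q}"
      have "set_integrable lborel {u k..<u (Suc k)} (\<lambda>v. \<bar>u k - \<pi> v\<bar>)"
        by (rule set_integral_bounded(1)[where M=1]) (use k bnd mono[of k] in auto)
      then have "ennreal (LINT v:{u k..<u (Suc k)}|lborel. \<bar>u k - \<pi> v\<bar>) =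
          (\<integral>\<^sup>+v. ennreal (indicator {u k..<u (Suc k)} v *\<^sub>R \<bar>u k - \<pi> v\<bar>) \<partial>lborel)"
        unfolding set_lebesgue_integral_def set_integrable_def by (intro nn_integral_eq_integral[symmetric]) auto
      also have "\<dots> = (\<integral>\<^sup>+v. indicator {u k..<u (Suc k)} v * ennreal \<bar>u k - \<pi> v\<bar> \<partial>lborel)"
        by (intro nn_integral_cong) (auto split: split_indicator)
      finally show "ennreal (LINT v:{u k..<u (Suc k)}|lborel. \<bar>u k - \<pi> v\<bar>) = (\<integral>\<^sup>+v. indicator {u k..<u (Suc k)} v * ennreal \<bar>u k - \<pi> v\<bar> \<partial>lborel)" .
    qed
  qed (auto simp: set_lebesgue_integral_def intro!: Bochner_Integration.integral_nonneg)
  also have "\<dots> = (\<Sum>k=p..<q. \<integral>\<^sup>+v. indicator {u k..<u (Suc k)} v * (\<integral>\<^sup>+t. indicator {0<..<1} t * D v t \<partial>lborel) \<partial>lborel)"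
    by (intro sum.cong nn_integral_cong refl) (auto split: split_indicator simp: inner)
  also have "\<dots> = (\<integral>\<^sup>+v. (\<Sum>k=p..<q. indicator {u k..<u (Suc k)} v * (\<integral>\<^sup>+t. indicator {0<..<1} t * D v t \<partial>lborel)) \<partial>lborel)"
    by (rule nn_integral_sum[symmetric]) measurable
  also have "\<dots> = (\<integral>\<^sup>+v. indicator {0..<1} v * (\<integral>\<^sup>+t. indicator {0<..<1} t * D v t \<partial>lborel) \<partial>lborel)"
    unfolding sum_distrib_right[symmetric] using sum_indicator_Ico(1)[where p=p and q=q and u=u, OF pq(1) mono] pq by simp
  also have "\<dots> = (\<integral>\<^sup>+v. \<integral>\<^sup>+t. indicator {0..<1} v * (indicator {0<..<1} t * D v t) \<partial>lborel \<partial>lborel)"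
    by (intro nn_integral_cong nn_integral_cmult[symmetric]) measurable
  also have "\<dots> = (\<integral>\<^sup>+t. \<integral>\<^sup>+v. indicator {0..<1} v * (indicator {0<..<1} t * D v t) \<partial>lborel \<partial>lborel)"
    by (rule lborel_pair.Fubini') measurable
  also have "\<dots> = (\<integral>\<^sup>+t. ennreal (indicator {0<..<1} t *\<^sub>R \<bar>s t - \<sigma>' t\<bar>) \<partial>lborel)"
  proof (rule nn_integral_cong)
    fix t :: real
    show "(\<integral>\<^sup>+v. indicator {0..<1} v * (indicator {0<..<1} t * D v t) \<partial>lborel) = ennreal (indicator {0<..<1} t *\<^sub>R \<bar>s t - \<sigma>' t\<bar>)"
    proof (cases "t \<in> {0<..<1}")
      case True
      have r: "0 \<le> s t" "s t \<le> 1" "0 \<le> \<sigma>' t" "\<sigma>' t \<le> 1"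
        using s01[OF True] \<sigma>_le[of t] \<sigma>_nonneg[of t] True by (auto simp: \<sigma>'_def)
      have "(\<integral>\<^sup>+v. indicator {0..<1} v * (indicator {0<..<1} t * D v t) \<partial>lborel)
         = (\<integral>\<^sup>+v. indicator {min (s t) (\<sigma>' t)..<max (s t) (\<sigma>' t)} v \<partial>lborel)"
        using True r by (intro nn_integral_cong) (auto simp: D_def split: split_indicator)
      also have "\<dots> = ennreal \<bar>s t - \<sigma>' t\<bar>" by (auto simp: min_def max_def)
      finally show ?thesis using True by simp
    qed simp
  qed
  also have "\<dots> = ennreal (LINT t:{0<..<1}|lborel. \<bar>s t - \<sigma>' t\<bar>)"
  proof -
    have "set_integrable lborel {0<..<1} (\<lambda>t. \<bar>s t - \<sigma>' t\<bar>)"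
    proof (rule set_integral_bounded(1)[where M=1])
      fix t :: real assume t: "t \<in> {0<..<1}"
      show "\<bar>\<bar>s t - \<sigma>' t\<bar>\<bar> \<le> 1" using s01[OF t] \<sigma>_le[of t] \<sigma>_nonneg[of t] t by (auto simp: \<sigma>'_def)
    qed auto
    then show ?thesis unfolding set_integrable_def set_lebesgue_integral_def
      by (intro nn_integral_eq_integral) auto
  qed
  finally have "(\<Sum>k=p..<q. LINT v:{u k..<u (Suc k)}|lborel. \<bar>u k - \<pi> v\<bar>) \<le> (LINT t:{0<..<1}|lborel. \<bar>s t - \<sigma>' t\<bar>)"
    by (subst (asm) ennreal_inj) (auto simp: set_lebesgue_integral_def intro!: Bochner_Integration.integral_nonneg sum_nonneg)
  also have "(LINT t:{0<..<1}|lborel. \<bar>s t - \<sigma>' t\<bar>) = (LINT t:{0<..<1}|lborel. \<bar>s t - \<sigma> t\<bar>)"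
    by (rule set_lebesgue_integral_cong) (auto simp: \<sigma>'_def)
  finally show ?thesis .
qed

text \<open>A discrete Gronwall argument. On the cell from \<open>u k\<close> the retarded solution
  makes an Euler step up to \<open>\<Lambda> * M\<close> times the integral of
  \<open>|u k - \<pi> v|\<close>, because \<psi> is Lipschitz with constant \<open>M\<close>; by
  \<open>area_between\<close> these defects add up to the distance of the two rounding functions.
  Hypothesis \<open>H\<close> says that \<open>s\<close> rounds up to the partition, without naming
  an inverse of \<open>u\<close>.\<close>

lemma euler_compare:
  fixes s z w e :: "_ \<Rightarrow> real" and u :: "nat \<Rightarrow> real"
  assumes pq: "p \<le> q" "u p = 0" "u q = 1" and mono: "\<And>k. p \<le> k \<Longrightarrow> k < q \<Longrightarrow> u k \<le> u (Suc k)"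
    and s [measurable]: "s \<in> borel_measurable borel" and s01: "\<And>t. t \<in> {0<..<1} \<Longrightarrow> s t \<in> {0..1}"
    and H: "\<And>k v t. p \<le> k \<Longrightarrow> k < q \<Longrightarrow> u k \<le> v \<Longrightarrow> v < u (Suc k) \<Longrightarrow> 0 < t \<Longrightarrow> t < 1 \<Longrightarrow> v < s t \<longleftrightarrow> u k < t"
    and step: "\<And>k. p \<le> k \<Longrightarrow> k < q \<Longrightarrow> \<bar>w (Suc k) - w k - z (w k) * (u (Suc k) - u k)\<bar> \<le> e k"
    and lip: "\<And>p q. \<bar>z p - z q\<bar> \<le> \<Lambda> * \<bar>p - q\<bar>" and L: "0 \<le> \<Lambda>"
    and cont: "continuous_on UNIV \<psi>"
    and eq: "\<And>w. w \<in> {0..1} \<Longrightarrow> \<psi> w = x + (LINT v:{0..<w}|lborel. z (\<psi> (\<pi> v)))"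
    and M: "\<And>v. v \<in> {0..1} \<Longrightarrow> \<bar>z (\<psi> v)\<bar> \<le> M"
  shows "\<bar>w q - \<psi> 1\<bar> \<le> exp \<Lambda> * (\<bar>w p - x\<bar> + (\<Sum>k=p..<q. e k) + \<Lambda> * M * (LINT t:{0<..<1}|lborel. \<bar>s t - \<sigma> t\<bar>))"
proof -
  define E where "E k = (LINT v:{u k..<u (Suc k)}|lborel. \<bar>u k - \<pi> v\<bar>)" for k
  have u01: "0 \<le> u k" "u k \<le> 1" if "p \<le> k" "k \<le> q" for k
    using sum_indicator_Ico(2)[of p k u] sum_indicator_Ico(2)[of k q u] that mono pq by auto
  have M0: "M \<ge> 0" using M[of 0] by simp
  have zc: "continuous_on UNIV z"
    using L by (intro lipschitz_on_continuous_on[of \<Lambda>] lipschitz_onI) (auto simp: dist_real_def lip)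
  have zm [measurable]: "z \<in> borel_measurable borel" by (rule borel_measurable_continuous_onI[OF zc])
  have pm [measurable]: "\<psi> \<in> borel_measurable borel" by (rule borel_measurable_continuous_onI[OF cont])
  define g where "g v = z (\<psi> (\<pi> v))" for v
  have gm [measurable]: "g \<in> borel_measurable borel" unfolding g_def[abs_def] by measurable
  have gM: "\<bar>g v\<bar> \<le> M" for v unfolding g_def using \<pi>_range[of v] by (intro M) auto
  have psi_diff: "\<psi> t - \<psi> r = (LINT v:{r..<t}|lborel. g v)" if "0 \<le> r" "r \<le> t" "t \<le> 1" for r t
    using eq[of t] eq[of r] set_integral_split_Ico[OF gm gM, of 0 r t] that by (simp add: g_def)
  have psi_lip: "\<bar>\<psi> t - \<psi> r\<bar> \<le> M * \<bar>t - r\<bar>" if "t \<in> {0..1}" "r \<in> {0..1}" for r t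
  proof -
    have *: "\<bar>\<psi> t - \<psi> r\<bar> \<le> M * (t - r)" if "0 \<le> r" "r \<le> t" "t \<le> 1" for r t
      using psi_diff[OF that] set_integral_bounded(2)[OF gm, of "{r..<t}" M] gM that by auto
    show ?thesis using *[of r t] *[of t r] that by (cases "r \<le> t") auto
  qed
  have incr: "\<bar>\<psi> (u (Suc k)) - \<psi> (u k) - z (\<psi> (u k)) * (u (Suc k) - u k)\<bar> \<le> \<Lambda> * M * E k" if k: "p \<le> k" "k < q" for k
  proof -
    have uk: "0 \<le> u k" "u k \<le> u (Suc k)" "u (Suc k) \<le> 1" using u01[of k] u01[of "Suc k"] mono k by auto
    let ?I = "{u k..<u (Suc k)}"
    have ig: "set_integrable lborel ?I g" by (rule set_integral_bounded(1)[OF gm _ _ gM]) (use uk in auto)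
    have ic: "set_integrable lborel ?I (\<lambda>_. z (\<psi> (u k)))"
      by (rule set_integral_bounded(1)[where M="\<bar>z (\<psi> (u k))\<bar>"]) (use uk in auto)
    have ie: "set_integrable lborel ?I (\<lambda>v. \<bar>u k - \<pi> v\<bar>)"
    proof (rule set_integral_bounded(1)[where M=1])
      show "\<bar>\<bar>u k - \<pi> v\<bar>\<bar> \<le> 1" for v using uk \<pi>_range[of v] by auto
    qed (use uk in auto)
    have "\<psi> (u (Suc k)) - \<psi> (u k) - z (\<psi> (u k)) * (u (Suc k) - u k) = (LINT v:?I|lborel. g v - z (\<psi> (u k)))"
      unfolding psi_diff[OF uk] set_integral_diff(2)[OF ig ic] using uk by (simp add: set_lebesgue_integral_def)
    also have "\<bar>\<dots>\<bar> \<le> (LINT v:?I|lborel. \<bar>g v - z (\<psi> (u k))\<bar>)"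
      using set_integral_norm_bound[OF set_integral_diff(1)[OF ig ic]] by simp
    also have "\<dots> \<le> (LINT v:?I|lborel. \<Lambda> * M * \<bar>u k - \<pi> v\<bar>)"
    proof (rule set_integral_mono)
      show "set_integrable lborel ?I (\<lambda>v. \<bar>g v - z (\<psi> (u k))\<bar>)"
        by (rule set_integrable_abs[OF set_integral_diff(1)[OF ig ic]])
      show "set_integrable lborel ?I (\<lambda>v. \<Lambda> * M * \<bar>u k - \<pi> v\<bar>)" by (rule set_integrable_mult_right) (rule ie)
      fix v
      have "\<bar>g v - z (\<psi> (u k))\<bar> \<le> \<Lambda> * \<bar>\<psi> (\<pi> v) - \<psi> (u k)\<bar>" unfolding g_def by (rule lip)
      also have "\<dots> \<le> \<Lambda> * (M * \<bar>\<pi> v - u k\<bar>)" using L \<pi>_range[of v] uk by (intro mult_left_mono psi_lip) auto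
      finally show "\<bar>g v - z (\<psi> (u k))\<bar> \<le> \<Lambda> * M * \<bar>u k - \<pi> v\<bar>" by (simp add: abs_minus_commute mult.assoc)
    qed
    also have "\<dots> = \<Lambda> * M * E k" unfolding E_def by (rule set_integral_mult_right)
    finally show ?thesis .
  qed
  have E0: "E k \<ge> 0" for k unfolding E_def set_lebesgue_integral_def by (intro Bochner_Integration.integral_nonneg) auto
  \<comment> \<open>\<open>A\<close> sums initial and local errors without growth; all growth sits
    in the factor \<open>exp (\<Lambda> * u k)\<close>.\<close>
  define A where "A k = \<bar>w p - x\<bar> + (\<Sum>j=p..<k. e j + \<Lambda> * M * E j)" for k
  have "\<bar>w k - \<psi> (u k)\<bar> \<le> exp (\<Lambda> * u k) * A k" if "p \<le> k" "k \<le> q" for k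
    using that
  proof (induction k rule: dec_induct)
    case base
    then show ?case using pq eq[of 0] by (simp add: A_def set_lebesgue_integral_def)
  next
    case (step k)
    let ?d = "u (Suc k) - u k" and ?D = "\<bar>w k - \<psi> (u k)\<bar>"
    have kk: "p \<le> k" "k < q" using step by auto
    have d: "?d \<ge> 0" using mono kk by auto
    have e0: "e k \<ge> 0" using assms(8)[OF kk] by linarith
    have "\<bar>z (w k) - z (\<psi> (u k))\<bar> * ?d \<le> \<Lambda> * ?D * ?d" using lip d by (intro mult_right_mono) auto
    moreover have "w (Suc k) - \<psi> (u (Suc k)) = (w (Suc k) - w k - z (w k) * ?d) + (w k - \<psi> (u k))
       + (z (w k) - z (\<psi> (u k))) * ?d - (\<psi> (u (Suc k)) - \<psi> (u k) - z (\<psi> (u k)) * ?d)" by (simp add: algebra_simps)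
    moreover have "\<bar>(z (w k) - z (\<psi> (u k))) * ?d\<bar> = \<bar>z (w k) - z (\<psi> (u k))\<bar> * ?d" using d by (simp add: abs_mult)
    ultimately have "\<bar>w (Suc k) - \<psi> (u (Suc k))\<bar> \<le> e k + ?D + \<Lambda> * ?D * ?d + \<Lambda> * M * E k"
      using assms(8)[OF kk] incr[OF kk] by linarith
    also have "\<dots> = (1 + \<Lambda> * ?d) * ?D + (e k + \<Lambda> * M * E k)" by (simp add: algebra_simps)
    also have "\<dots> \<le> exp (\<Lambda> * ?d) * (exp (\<Lambda> * u k) * A k) + exp (\<Lambda> * u (Suc k)) * (e k + \<Lambda> * M * E k)"
    proof (rule add_mono)
      show "(1 + \<Lambda> * ?d) * ?D \<le> exp (\<Lambda> * ?d) * (exp (\<Lambda> * u k) * A k)"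
        using step kk by (intro mult_mono exp_ge_add_one_self) auto
      have "1 \<le> exp (\<Lambda> * u (Suc k))" using L u01[of "Suc k"] kk by simp
      moreover have "0 \<le> e k + \<Lambda> * M * E k" using e0 L M0 E0 by simp
      ultimately show "e k + \<Lambda> * M * E k \<le> exp (\<Lambda> * u (Suc k)) * (e k + \<Lambda> * M * E k)"
        using mult_right_mono by fastforce
    qed
    also have "exp (\<Lambda> * ?d) * (exp (\<Lambda> * u k) * A k) = exp (\<Lambda> * u (Suc k)) * A k"
      by (simp add: mult.assoc[symmetric] exp_add[symmetric] algebra_simps)
    also have "\<dots> + exp (\<Lambda> * u (Suc k)) * (e k + \<Lambda> * M * E k) = exp (\<Lambda> * u (Suc k)) * A (Suc k)"
      using kk by (simp add: A_def algebra_simps)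
    finally show ?case .
  qed
  from this[of q] have "\<bar>w q - \<psi> 1\<bar> \<le> exp \<Lambda> * A q" using pq by simp
  also have "A q = \<bar>w p - x\<bar> + (\<Sum>k=p..<q. e k) + \<Lambda> * M * (\<Sum>k=p..<q. E k)"
    by (simp add: A_def sum.distrib sum_distrib_left)
  also have "exp \<Lambda> * \<dots> \<le> exp \<Lambda> * (\<bar>w p - x\<bar> + (\<Sum>k=p..<q. e k) + \<Lambda> * M * (LINT t:{0<..<1}|lborel. \<bar>s t - \<sigma> t\<bar>))"
    unfolding E_def using L M0 by (intro mult_left_mono add_left_mono area_between[OF pq mono s s01 H]) auto
  finally show ?thesis .
qed

end

section \<open>The difference scheme\<close>

lemma mollifierD:
  assumes "mollifier K \<rho>"
  shows "continuous_on UNIV \<rho>" "\<And>s. 0 \<le> \<rho> s" "\<And>s. s \<notin> K \<Longrightarrow> \<rho> s = 0"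
    "set_integrable lborel K \<rho>" "(LINT s:K|lborel. \<rho> s) = 1"
proof -
  have "C_k 0 \<rho>" using assms by (simp add: mollifier_def C_infinity_def del: C_k.simps)
  then show "continuous_on UNIV \<rho>" by simp
  show "0 \<le> \<rho> s" for s using assms by (simp add: mollifier_def)
  show "\<rho> s = 0" if "s \<notin> K" for s
    using assms that closure_subset[of "{s. \<rho> s \<noteq> 0}"] unfolding mollifier_def by blast
  show 1: "(LINT s:K|lborel. \<rho> s) = 1" using assms by (simp add: mollifier_def)
  \<comment> \<open>A function that is not integrable has integral 0 by default, so the value 1
    forces integrability.\<close>
  show "set_integrable lborel K \<rho>"
    using 1 not_integrable_integral_eq unfolding set_integrable_def set_lebesgue_integral_def by fastforce
qed

lemma mollifier_average:
  fixes \<rho> \<phi> :: "'a::euclidean_space \<Rightarrow> real"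
  assumes m: "mollifier K \<rho>" and meas: "(\<lambda>p. indicator K p *\<^sub>R \<phi> p) \<in> borel_measurable borel"
    and K: "K \<in> sets borel" and b: "\<And>p. p \<in> K \<Longrightarrow> lo \<le> \<phi> p \<and> \<phi> p \<le> hi"
  shows "set_integrable lborel K (\<lambda>p. \<phi> p * \<rho> p)"
    "lo \<le> (LINT p:K|lborel. \<phi> p * \<rho> p)" "(LINT p:K|lborel. \<phi> p * \<rho> p) \<le> hi"
proof -
  note md = mollifierD[OF m]
  have [measurable]: "\<rho> \<in> borel_measurable borel" by (rule borel_measurable_continuous_onI[OF md(1)])
  have int: "set_integrable lborel K (\<lambda>p. c * \<rho> p)" for c by (rule set_integrable_mult_right) (rule md(4))
  have cint: "(LINT p:K|lborel. c * \<rho> p) = c" for c by (simp add: md(5))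
  show i: "set_integrable lborel K (\<lambda>p. \<phi> p * \<rho> p)"
  proof (rule set_integrable_bound[OF int[of "max \<bar>lo\<bar> \<bar>hi\<bar>"]])
    have "(\<lambda>p. (indicator K p *\<^sub>R \<phi> p) * \<rho> p) \<in> borel_measurable borel" using meas by measurable
    then show "set_borel_measurable lborel K (\<lambda>p. \<phi> p * \<rho> p)" by (simp add: set_borel_measurable_def mult.assoc)
    show "AE p in lborel. p \<in> K \<longrightarrow> norm (\<phi> p * \<rho> p) \<le> norm (max \<bar>lo\<bar> \<bar>hi\<bar> * \<rho> p)"
    proof (intro AE_I2 impI)
      fix p assume "p \<in> K"
      then have "\<bar>\<phi> p\<bar> \<le> max \<bar>lo\<bar> \<bar>hi\<bar>" using b[of p] by auto
      then show "norm (\<phi> p * \<rho> p) \<le> norm (max \<bar>lo\<bar> \<bar>hi\<bar> * \<rho> p)"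
        using md(2)[of p] by (auto simp: abs_mult intro: mult_right_mono)
    qed
  qed
  show "lo \<le> (LINT p:K|lborel. \<phi> p * \<rho> p)"
    by (subst cint[of lo, symmetric], rule set_integral_mono[OF int i]) (use b md(2) in \<open>auto intro: mult_right_mono\<close>)
  show "(LINT p:K|lborel. \<phi> p * \<rho> p) \<le> hi"
    by (subst cint[of hi, symmetric], rule set_integral_mono[OF i int]) (use b md(2) in \<open>auto intro: mult_right_mono\<close>)
qed

text \<open>\<open>Z\<close> and \<open>Z - \<phi>\<close> are nondecreasing, hence Borel, and
  \<phi> is their difference.\<close>

lemma measurable_dominated:
  fixes \<phi> Z :: "real \<Rightarrow> real"
  assumes "\<And>u v. u \<le> v \<Longrightarrow> \<bar>\<phi> v - \<phi> u\<bar> \<le> Z v - Z u"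
  shows "\<phi> \<in> borel_measurable borel" "Z \<in> borel_measurable borel"
proof -
  have 1: "Z u \<le> Z v" "Z u - \<phi> u \<le> Z v - \<phi> v" if "u \<le> v" for u v using assms[OF that] by linarith+
  show Z: "Z \<in> borel_measurable borel" by (rule borel_measurable_mono) (auto simp: mono_def 1)
  have "(\<lambda>u. Z u - \<phi> u) \<in> borel_measurable borel" by (rule borel_measurable_mono) (auto simp: mono_def 1)
  then have "(\<lambda>u. Z u - (Z u - \<phi> u)) \<in> borel_measurable borel" using Z by measurable
  then show "\<phi> \<in> borel_measurable borel" by simp
qed

section \<open>Mollified paths and the functions \<open>F_n\<close>\<close>

locale mollify1 =
  fixes n :: nat and r :: "real \<Rightarrow> real"
  assumes n1: "1 \<le> n" and moll: "mollifier {0..1 / real n} r"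
begin

definition mol :: "(real \<Rightarrow> real) \<Rightarrow> real \<Rightarrow> real" where
  "mol \<phi> t = (LINT s:{0..1 / real n}|lborel. \<phi> (t + s) * r s)"

lemma mol_bounds:
  assumes "\<phi> \<in> borel_measurable borel" and b: "\<And>v. t \<le> v \<Longrightarrow> v \<le> t + 1 / real n \<Longrightarrow> lo \<le> \<phi> v \<and> \<phi> v \<le> hi"
  shows "set_integrable lborel {0..1 / real n} (\<lambda>s. \<phi> (t + s) * r s)" "lo \<le> mol \<phi> t" "mol \<phi> t \<le> hi"
proof -
  have meas: "(\<lambda>s. indicator {0..1 / real n} s *\<^sub>R \<phi> (t + s)) \<in> borel_measurable borel"
    using assms(1) by measurable
  have bb: "lo \<le> \<phi> (t + s) \<and> \<phi> (t + s) \<le> hi" if "s \<in> {0..1 / real n}" for s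
    using that by (intro b) auto
  note * = mollifier_average[OF moll meas _ bb]
  show "set_integrable lborel {0..1 / real n} (\<lambda>s. \<phi> (t + s) * r s)" "lo \<le> mol \<phi> t" "mol \<phi> t \<le> hi"
    unfolding mol_def by (rule *; simp)+
qed

lemma mol_diff:
  assumes "\<phi> \<in> borel_measurable borel" "\<psi> \<in> borel_measurable borel"
    and "\<And>v. t \<le> v \<Longrightarrow> v \<le> t + 1 / real n \<Longrightarrow> \<bar>\<phi> v\<bar> \<le> A" "\<And>v. t \<le> v \<Longrightarrow> v \<le> t + 1 / real n \<Longrightarrow> \<bar>\<psi> v\<bar> \<le> B"
  shows "mol (\<lambda>v. \<phi> v - \<psi> v) t = mol \<phi> t - mol \<psi> t"
proof -
  have i: "set_integrable lborel {0..1 / real n} (\<lambda>s. \<phi> (t + s) * r s)"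
    by (rule mol_bounds(1)[OF assms(1), where lo="-A" and hi=A]) (use assms(3) in \<open>simp add: abs_le_iff minus_le_iff\<close>)
  have j: "set_integrable lborel {0..1 / real n} (\<lambda>s. \<psi> (t + s) * r s)"
    by (rule mol_bounds(1)[OF assms(2), where lo="-B" and hi=B]) (use assms(4) in \<open>simp add: abs_le_iff minus_le_iff\<close>)
  show ?thesis unfolding mol_def left_diff_distrib by (rule set_integral_diff(2)[OF i j])
qed

lemma mol_incr:
  fixes \<phi> Z :: "real \<Rightarrow> real"
  assumes d: "\<And>u v. u \<le> v \<Longrightarrow> \<bar>\<phi> v - \<phi> u\<bar> \<le> Z v - Z u" and t: "t \<le> t'"
  shows "\<bar>mol \<phi> t' - mol \<phi> t\<bar> \<le> mol Z t' - mol Z t" "Z t \<le> mol Z t" "mol Z t \<le> Z (t + 1 / real n)"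
    "u \<le> t \<Longrightarrow> \<bar>mol \<phi> t - \<phi> u\<bar> \<le> Z (t + 1 / real n) - Z u"
proof -
  have m [measurable]: "\<phi> \<in> borel_measurable borel" "Z \<in> borel_measurable borel"
    by (rule measurable_dominated[of \<phi> Z]; rule d; assumption)+
  have Zm: "Z u \<le> Z v" if "u \<le> v" for u v using d[OF that] by linarith
  show "Z t \<le> mol Z t" "mol Z t \<le> Z (t + 1 / real n)"
    by (rule mol_bounds(2,3)[OF m(2), where lo="Z t" and hi="Z (t + 1 / real n)"]; auto intro: Zm)+
  have Zi: "set_integrable lborel {0..1 / real n} (\<lambda>s. Z (t + s) * r s)" for t
    by (rule mol_bounds(1)[OF m(2), where lo="Z t" and hi="Z (t + 1 / real n)"]) (auto intro: Zm)
  have \<phi>b: "\<phi> u - (Z (t + 1 / real n) - Z u) \<le> \<phi> v \<and> \<phi> v \<le> \<phi> u + (Z (t + 1 / real n) - Z u)"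
    if "u \<le> t" "t \<le> v" "v \<le> t + 1 / real n" for u t v
    using d[of u v] Zm[of v "t + 1 / real n"] that by auto
  have \<phi>i: "set_integrable lborel {0..1 / real n} (\<lambda>s. \<phi> (t + s) * r s)" for t
    by (rule mol_bounds(1)[OF m(1) \<phi>b[of t t]]) auto
  note md = mollifierD[OF moll]
  show "\<bar>mol \<phi> t' - mol \<phi> t\<bar> \<le> mol Z t' - mol Z t"
  proof -
    have "mol \<phi> t' - mol \<phi> t = (LINT s:{0..1 / real n}|lborel. \<phi> (t' + s) * r s - \<phi> (t + s) * r s)"
      unfolding mol_def by (rule set_integral_diff(2)[OF \<phi>i \<phi>i, symmetric])
    also have "\<bar>\<dots>\<bar> \<le> (LINT s:{0..1 / real n}|lborel. \<bar>\<phi> (t' + s) * r s - \<phi> (t + s) * r s\<bar>)"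
      using set_integral_norm_bound[OF set_integral_diff(1)[OF \<phi>i \<phi>i]] by simp
    also have "\<dots> \<le> (LINT s:{0..1 / real n}|lborel. Z (t' + s) * r s - Z (t + s) * r s)"
    proof (rule set_integral_mono[OF set_integrable_abs[OF set_integral_diff(1)[OF \<phi>i \<phi>i]] set_integral_diff(1)[OF Zi Zi]])
      fix s
      have "\<bar>\<phi> (t' + s) - \<phi> (t + s)\<bar> * r s \<le> (Z (t' + s) - Z (t + s)) * r s"
        using t md(2)[of s] d[of "t + s" "t' + s"] by (intro mult_right_mono) auto
      then show "\<bar>\<phi> (t' + s) * r s - \<phi> (t + s) * r s\<bar> \<le> Z (t' + s) * r s - Z (t + s) * r s"
        using md(2)[of s] by (simp add: left_diff_distrib[symmetric] abs_mult)
    qed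
    also have "\<dots> = mol Z t' - mol Z t" unfolding mol_def by (rule set_integral_diff(2)[OF Zi Zi])
    finally show ?thesis .
  qed
  assume u: "u \<le> t"
  show "\<bar>mol \<phi> t - \<phi> u\<bar> \<le> Z (t + 1 / real n) - Z u"
    using mol_bounds(2,3)[where t=t, OF m(1) \<phi>b[OF u]] by force
qed

text \<open>This is \<open>F_n\<close> on the real line (see \<open>F_fun_eq\<close>), written as a
  mollified unit step so that the mollified jump of \<open>L\<close> at \<open>s\<close> is a
  multiple of \<open>tail (s - t)\<close>.\<close>

definition tail :: "real \<Rightarrow> real" where
  "tail x = mol (indicator {x..}) 0"

lemma r_measurable [measurable]: "r \<in> borel_measurable borel"
  by (rule borel_measurable_continuous_onI[OF mollifierD(1)[OF moll]])

lemma tail_shift: "mol (indicator {s..}) t = tail (s - t)"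
  unfolding tail_def mol_def by (rule set_lebesgue_integral_cong) (auto split: split_indicator)

lemma tail_bounds: "0 \<le> tail x" "tail x \<le> 1"
  unfolding tail_def by (rule mol_bounds(2,3)[where lo=0 and hi=1]; auto split: split_indicator)+

lemma tail_1: assumes "x \<le> 0" shows "tail x = 1"
proof (rule antisym)
  show "1 \<le> tail x" unfolding tail_def by (rule mol_bounds(2)[where hi=1]) (use assms in auto)
qed (rule tail_bounds)

lemma tail_0: assumes "1 / real n < x" shows "tail x = 0"
proof (rule antisym)
  show "tail x \<le> 0" unfolding tail_def by (rule mol_bounds(3)[where lo=0]) (use assms in auto)
qed (rule tail_bounds)

lemma tail_integrable: "set_integrable lborel {0..1 / real n} (\<lambda>s. indicator {x..} (0 + s) * r s)"
  by (rule mol_bounds(1)[where lo=0 and hi=1]) (auto split: split_indicator)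

lemma tail_antimono: assumes "x \<le> y" shows "tail y \<le> tail x"
  unfolding tail_def mol_def
proof (rule set_integral_mono[OF tail_integrable tail_integrable])
  fix s show "indicator {y..} (0 + s) * r s \<le> indicator {x..} (0 + s) * r s"
    using mollifierD(2)[OF moll, of s] assms by (auto split: split_indicator)
qed

lemma tail_lipschitz: obtains M where "\<And>x y. \<bar>tail x - tail y\<bar> \<le> M * \<bar>x - y\<bar>"
proof -
  have "compact (r ` {0..1 / real n})"
    by (intro compact_continuous_image continuous_on_subset[OF mollifierD(1)[OF moll]]) auto
  then obtain M where "\<forall>y\<in>r ` {0..1 / real n}. norm y \<le> M"
    using compact_imp_bounded bounded_iff by blast
  then have M: "r s \<le> M" if "s \<in> {0..1 / real n}" for s using that by force
  have M0: "0 \<le> M" using M[of 0] mollifierD(2)[OF moll, of 0] by simp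
  have 1: "tail x - tail y \<le> M * (y - x)" if xy: "x \<le> y" for x y
  proof -
    let ?d = "\<lambda>s. indicator {x..} (0 + s) * r s - indicator {y..} (0 + s) * r s"
    have "tail x - tail y = (LINT s:{0..1 / real n}|lborel. ?d s)"
      unfolding tail_def mol_def by (rule set_integral_diff(2)[OF tail_integrable tail_integrable, symmetric])
    also have "\<dots> \<le> (LINT s:{x..<y}|lborel. M)"
      unfolding set_lebesgue_integral_def
    proof (rule integral_mono)
      show "integrable lborel (\<lambda>s. indicator {0..1 / real n} s *\<^sub>R ?d s)"
        using set_integral_diff(1)[OF tail_integrable[of x] tail_integrable[of y]] by (simp add: set_integrable_def)
      show "integrable lborel (\<lambda>s. indicator {x..<y} s *\<^sub>R M)" using xy by simp
      fix s show "indicator {0..1 / real n} s *\<^sub>R ?d s \<le> indicator {x..<y} s *\<^sub>R M"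
        using M[of s] M0 xy by (auto split: split_indicator)
    qed
    also have "\<dots> = M * (y - x)" using xy by (simp add: set_lebesgue_integral_def)
    finally show ?thesis .
  qed
  show ?thesis
  proof (rule that)
    fix x y show "\<bar>tail x - tail y\<bar> \<le> M * \<bar>x - y\<bar>"
      using 1[of x y] 1[of y x] tail_antimono[of x y] tail_antimono[of y x] by (cases "x \<le> y") auto
  qed
qed

lemma tail_continuous: "continuous_on UNIV tail"
proof -
  obtain M where M: "\<And>x y. \<bar>tail x - tail y\<bar> \<le> M * \<bar>x - y\<bar>" by (rule tail_lipschitz) blast
  have "0 \<le> M" using M[of 0 1] by simp
  then have "M-lipschitz_on UNIV tail" using M by (intro lipschitz_onI) (auto simp: dist_real_def)
  then show ?thesis by (rule lipschitz_on_continuous_on)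
qed

lemma F_fun_eq: "(LBINT s=ereal x..ereal (1 / real n). r s) = tail x"
proof -
  have t: "tail x = (\<integral>s. indicator {0..1 / real n} s *\<^sub>R (indicator {x..} s * r s) \<partial>lborel)"
    by (simp add: tail_def mol_def set_lebesgue_integral_def)
  have out: "r s = 0" if "s < 0 \<or> s > 1 / real n" for s using mollifierD(3)[OF moll, of s] that by auto
  show ?thesis
  proof (cases "x \<le> 1 / real n")
    case True
    then have "(LBINT s=ereal x..ereal (1 / real n). r s) = (\<integral>s. indicator {x<..<1 / real n} s *\<^sub>R r s \<partial>lborel)"
      by (simp add: interval_lebesgue_integral_def set_lebesgue_integral_def einterval_eq)
    also have "\<dots> = tail x" unfolding t
    proof (rule integral_cong_AE)
      have "AE s in lborel. s \<noteq> x" "AE s in lborel. s \<noteq> 1 / real n" by (rule AE_lborel_singleton)+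
      then show "AE s in lborel. indicator {x<..<1 / real n} s *\<^sub>R r s = indicator {0..1 / real n} s *\<^sub>R (indicator {x..} s * r s)"
        by eventually_elim (use out in \<open>force split: split_indicator\<close>)
    qed auto
    finally show ?thesis .
  next
    case False
    \<comment> \<open>Beyond \<open>1 / n\<close> the oriented integral runs backwards over a set
      where the mollifier vanishes.\<close>
    have z: "(\<lambda>s. indicator {1 / real n<..<x} s *\<^sub>R r s) = (\<lambda>_. 0)" using out by (auto split: split_indicator)
    have "(LBINT s=ereal x..ereal (1 / real n). r s) = 0"
      using False z by (simp add: interval_lebesgue_integral_def set_lebesgue_integral_def einterval_eq)
    then show ?thesis using tail_0 False by simp
  qed
qed

end

section \<open>The data of the scheme and the mollified coefficient\<close>

locale scheme_data =
  fixes a b :: real and L :: "real \<Rightarrow> real" and h :: "nat \<Rightarrow> real"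
    and \<rho> :: "nat \<Rightarrow> real \<Rightarrow> real" and \<rho>2 :: "nat \<Rightarrow> real \<times> real \<Rightarrow> real" and X0 :: "nat \<Rightarrow> real \<Rightarrow> real"
  assumes ab': "a < b"
    and L_right: "\<And>t. t \<in> {a..<b} \<Longrightarrow> continuous (at_right t) L"
    and L_fv: "finite_variation_on {a..b} L"
    and h_pos: "\<And>n. n \<ge> 1 \<Longrightarrow> h n > 0"
    and h_lim: "h \<longlonglongrightarrow> 0"
    and \<rho>_moll: "\<And>n. n \<ge> 1 \<Longrightarrow> mollifier {0..1 / real n} (\<rho> n)"
    and \<rho>2_moll: "\<And>n. n \<ge> 1 \<Longrightarrow> mollifier ({0..1 / real n} \<times> {0..1 / real n}) (\<rho>2 n)"
    and X0_smooth: "\<And>n. n \<ge> 1 \<Longrightarrow> \<exists>g. C_infinity g \<and> (\<forall>t\<in>{a..<a + h n}. X0 n t = g t)"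

sublocale scheme_data \<subseteq> bv_path "extend a b L" a b
proof
  let ?F = "extend a b L"
  show "a < b" by (rule ab')
  show "finite_variation_on UNIV ?F"
  proof -
    have "variation_sums UNIV ?F \<subseteq> variation_sums {a..b} L"
    proof
      fix x assume "x \<in> variation_sums UNIV ?F"
      then obtain n and p :: "nat \<Rightarrow> real" where x: "x = (\<Sum>i<n. \<bar>?F (p (Suc i)) - ?F (p i)\<bar>)" and p: "mono p"
        unfolding variation_sums_def by blast
      \<comment> \<open>Projecting a chain onto \<open>{a..b}\<close> keeps it nondecreasing and
        leaves the values of the extension unchanged.\<close>
      define q where "q i = max a (min b (p i))" for i
      have "mono q" unfolding mono_def q_def
      proof (intro allI impI)
        fix i j :: nat assume "i \<le> j"
        then have "p i \<le> p j" using p by (auto simp: mono_def)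
        then show "max a (min b (p i)) \<le> max a (min b (p j))" by auto
      qed
      moreover have "range q \<subseteq> {a..b}" using ab' by (auto simp: q_def)
      moreover have "?F (p i) = L (q i)" for i using ab' by (auto simp: q_def extend_def max_def min_def)
      ultimately show "x \<in> variation_sums {a..b} L" unfolding x variation_sums_def by auto
    qed
    then show ?thesis using L_fv unfolding finite_variation_on_def by (rule bdd_above_mono[rotated])
  qed
  show "?F t = ?F a" if "t \<le> a" for t using that ab' by (auto simp: extend_def)
  show "?F t = ?F b" if "t \<ge> b" for t using that ab' by (auto simp: extend_def)
  show "(?F \<longlongrightarrow> ?F s) (at_right s)" for s
  proof -
    consider "s < a" | "a \<le> s" "s < b" | "b \<le> s" by linarith
    then show ?thesis
    proof cases
      case 1
      have "\<forall>\<^sub>F t in at_right s. ?F t = ?F s"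
        using eventually_at_right_real[OF 1] by eventually_elim (use 1 ab' in \<open>auto simp: extend_def\<close>)
      then show ?thesis by (rule tendsto_eventually)
    next
      case 2
      have "(L \<longlongrightarrow> L s) (at_right s)" using L_right[of s] 2 by (simp add: continuous_within)
      moreover have "\<forall>\<^sub>F t in at_right s. L t = ?F t"
        using eventually_at_right_real[OF 2(2)] by eventually_elim (use 2 in \<open>auto simp: extend_def\<close>)
      ultimately show ?thesis using 2 by (auto simp: extend_def elim: Lim_transform_eventually)
    next
      case 3
      have "\<forall>\<^sub>F t in at_right s. t \<in> {s<..<s+1}" by (rule eventually_at_right_real) simp
      then have "\<forall>\<^sub>F t in at_right s. ?F t = ?F s"
        by eventually_elim (use 3 ab' in \<open>auto simp: extend_def\<close>)
      then show ?thesis by (rule tendsto_eventually)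
    qed
  qed
qed

locale coefficient = scheme_data +
  fixes f :: "real \<times> real \<Rightarrow> real" and C K :: real
  assumes C0: "0 \<le> C" and K0: "0 \<le> K"
    and lip: "\<And>s t x z. s \<in> {a..b} \<Longrightarrow> t \<in> {a..b} \<Longrightarrow> \<bar>f (s, x) - f (t, z)\<bar> \<le> C * (\<bar>s - t\<bar> + \<bar>x - z\<bar>)"
    and growth: "\<And>t x. t \<in> {a..b} \<Longrightarrow> \<bar>f (t, x)\<bar> \<le> K * (1 + \<bar>x\<bar>)"
begin

lemma f_window_measurable:
  assumes "n \<ge> 1" "t \<ge> a"
  shows "(\<lambda>p. indicator ({0..1 / real n} \<times> {0..1 / real n}) p *\<^sub>R f (min (t + fst p) b, x + snd p)) \<in> borel_measurable borel"
proof (rule borel_measurable_continuous_on_indicator)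
  show "continuous_on ({0..1 / real n} \<times> {0..1 / real n}) (\<lambda>p. f (min (t + fst p) b, x + snd p))"
    using assms ab'
    by (intro continuous_on_compose2[OF strip_continuous[OF C0 lip]] continuous_intros) auto
qed (simp add: borel_closed closed_Times)

lemma window_sets: "({0..1 / real n} \<times> {0..1 / real n}) \<in> sets (borel :: (real \<times> real) measure)"
  by (simp add: borel_closed closed_Times)

lemma mollify_f_close:
  assumes n: "n \<ge> 1" and t: "t \<ge> a"
  shows "\<bar>mollify_f b \<rho>2 f n t x - f (min t b, x)\<bar> \<le> 2 * C / real n"
proof -
  have 1: "f (min t b, x) - 2 * C / real n \<le> f (min (t + fst p) b, x + snd p) \<and>
     f (min (t + fst p) b, x + snd p) \<le> f (min t b, x) + 2 * C / real n"
    if p: "p \<in> {0..1 / real n} \<times> {0..1 / real n}" for p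
  proof -
    have "\<bar>f (min (t + fst p) b, x + snd p) - f (min t b, x)\<bar> \<le> C * (\<bar>min (t + fst p) b - min t b\<bar> + \<bar>x + snd p - x\<bar>)"
      using p t ab' by (intro lip) auto
    also have "\<dots> \<le> C * (1 / real n + 1 / real n)" using p C0 by (intro mult_left_mono add_mono) auto
    also have "\<dots> = 2 * C / real n" by simp
    finally show ?thesis by linarith
  qed
  show ?thesis
    using mollifier_average(2,3)[OF \<rho>2_moll[OF n] f_window_measurable[OF n t, of x] window_sets 1]
    unfolding mollify_f_def by linarith
qed

text \<open>Averaging moves \<open>x\<close> by at most \<open>1 / n\<close>, and
  \<open>1 / n \<le> 1\<close> turns \<open>1 + |x|\<close> into \<open>2 + |x|\<close>.\<close>

lemma mollify_f_growth:
  assumes n: "n \<ge> 1" and t: "t \<ge> a"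
  shows "\<bar>mollify_f b \<rho>2 f n t x\<bar> \<le> K * (2 + \<bar>x\<bar>)"
proof -
  have 1: "- (K * (2 + \<bar>x\<bar>)) \<le> f (min (t + fst p) b, x + snd p) \<and> f (min (t + fst p) b, x + snd p) \<le> K * (2 + \<bar>x\<bar>)"
    if p: "p \<in> {0..1 / real n} \<times> {0..1 / real n}" for p
  proof -
    have n1: "1 / real n \<le> 1" using n by simp
    have "\<bar>f (min (t + fst p) b, x + snd p)\<bar> \<le> K * (1 + \<bar>x + snd p\<bar>)"
      using p t ab' by (intro growth) auto
    also have "\<dots> \<le> K * (2 + \<bar>x\<bar>)" using p K0 n1 by (intro mult_left_mono) (auto simp: abs_le_iff)
    finally show ?thesis by linarith
  qed
  show ?thesis
    using mollifier_average(2,3)[OF \<rho>2_moll[OF n] f_window_measurable[OF n t, of x] window_sets 1]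
    unfolding mollify_f_def by linarith
qed

end

section \<open>The scheme along a grid of fixed phase\<close>

locale grid = coefficient +
  fixes n :: nat and \<omega> :: real and x :: "real \<Rightarrow> real"
  assumes n1: "n \<ge> 1" and \<omega>: "0 \<le> \<omega>" "\<omega> < 1"
    and sol: "scheme_solution a b L h \<rho> \<rho>2 X0 f n x"

sublocale grid \<subseteq> mollify1 n "\<rho> n"
  by (unfold_locales) (use n1 \<rho>_moll in auto)

definition grid_point :: "real \<Rightarrow> real \<Rightarrow> real \<Rightarrow> nat \<Rightarrow> real" where
  "grid_point a h \<omega> k = a + h * (\<omega> + real k)"

text \<open>Rounding up puts the grid point, and with it the averaging window, to the right of
  \<open>t\<close>, the side on which \<open>L\<close> and \<open>V\<close> are continuous.\<close>

definition grid_index :: "real \<Rightarrow> real \<Rightarrow> real \<Rightarrow> real \<Rightarrow> nat" where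
  "grid_index a h \<omega> t = nat \<lceil>(t - a) / h - \<omega>\<rceil>"

lemma grid_index_bounds:
  assumes "h > 0" "a \<le> t" "0 \<le> \<omega>" "\<omega> < 1"
  shows "t \<le> grid_point a h \<omega> (grid_index a h \<omega> t)" "grid_point a h \<omega> (grid_index a h \<omega> t) < t + h"
proof -
  let ?x = "(t - a) / h - \<omega>"
  have "0 \<le> (t - a) / h" using assms by simp
  then have "-1 < ?x" using assms by linarith
  then have "0 \<le> \<lceil>?x\<rceil>" by linarith
  then have k: "real (grid_index a h \<omega> t) = of_int \<lceil>?x\<rceil>" by (simp add: grid_index_def)
  have t: "a + h * (\<omega> + ?x) = t" using assms by (simp add: field_simps)
  have "h * (\<omega> + ?x) \<le> h * (\<omega> + of_int \<lceil>?x\<rceil>)" using assms by (intro mult_left_mono add_left_mono le_of_int_ceiling) simp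
  then show "t \<le> grid_point a h \<omega> (grid_index a h \<omega> t)" using t by (simp add: grid_point_def k)
  have "h * (\<omega> + of_int \<lceil>?x\<rceil>) < h * (\<omega> + ?x + 1)" using assms by (intro mult_strict_left_mono) linarith+
  then show "grid_point a h \<omega> (grid_index a h \<omega> t) < t + h" using t by (simp add: grid_point_def k algebra_simps)
qed

lemma grid_index_mono: "h > 0 \<Longrightarrow> s \<le> t \<Longrightarrow> grid_index a h \<omega> s \<le> grid_index a h \<omega> t"
  unfolding grid_index_def by (intro nat_mono ceiling_mono diff_right_mono divide_right_mono) auto

context grid
begin

abbreviation "tk \<equiv> grid_point a (h n) \<omega>"
abbreviation "w \<equiv> \<lambda>k. x (tk k)"
abbreviation "fn \<equiv> mollify_f b \<rho>2 f n"
abbreviation "Lmol \<equiv> mollify_L a b \<rho> L n"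
abbreviation "F \<equiv> extend a b L"

lemma hn: "h n > 0" by (rule h_pos[OF n1])

lemma tk_ge: "a \<le> tk k" using hn \<omega> by (simp add: grid_point_def)

lemma tk_Suc: "tk (Suc k) = tk k + h n" by (simp add: grid_point_def algebra_simps)

lemma tk_mono: "i \<le> j \<Longrightarrow> tk i \<le> tk j" using hn by (simp add: grid_point_def)

lemma w_0: "w 0 = X0 n (a + h n * \<omega>)"
proof -
  have "a + h n * \<omega> \<in> {a..<a + h n}" using hn \<omega> by simp
  then show ?thesis using sol by (simp add: scheme_solution_def grid_point_def)
qed

lemma w_Suc: "w (Suc k) - w k = fn (tk k) (w k) * (Lmol (tk (Suc k)) - Lmol (tk k))"
  using sol tk_ge[of k] unfolding tk_Suc scheme_solution_def by blast

lemma Lmol_eq: "Lmol t = mol F t" by (simp add: mollify_L_def mol_def)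

lemma molV:
  "t \<le> t' \<Longrightarrow> \<bar>Lmol t' - Lmol t\<bar> \<le> mol V t' - mol V t" "V t \<le> mol V t" "mol V t \<le> V (t + 1 / real n)"
  "u \<le> t \<Longrightarrow> \<bar>Lmol t - F u\<bar> \<le> V (t + 1 / real n) - V u"
  unfolding Lmol_eq
  by (rule mol_incr[of F V]; (rule incr_le_V)?; (assumption | rule order_refl))+

lemma sum_mol:
  "i \<le> j \<Longrightarrow> (\<Sum>k=i..<j. mol Z (tk (Suc k)) - mol Z (tk k)) = mol Z (tk j) - mol Z (tk i)"
  using sum_Suc_diff'[of i j "\<lambda>k. mol Z (tk k)"] by simp

text \<open>Each step deviates from \<open>c\<close> times the increment of the mollified path by at
  most \<open>e\<close> times the increment of the mollified \<open>V\<close>; these increments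
  telescope. The case \<open>c = 0\<close> bounds the oscillation of the scheme, a frozen
  coefficient \<open>c\<close> gives the second-order estimate.\<close>

lemma w_linear:
  assumes ij: "i \<le> j" and e: "0 \<le> e" and c: "\<And>k. i \<le> k \<Longrightarrow> k < j \<Longrightarrow> \<bar>fn (tk k) (w k) - c\<bar> \<le> e"
  shows "\<bar>w j - w i - c * (Lmol (tk j) - Lmol (tk i))\<bar> \<le> e * (V (tk j + 1 / real n) - V (tk i))"
proof -
  have "w j - w i - c * (Lmol (tk j) - Lmol (tk i)) = (\<Sum>k=i..<j. (w (Suc k) - w k) - c * (Lmol (tk (Suc k)) - Lmol (tk k)))"
    using sum_Suc_diff'[OF ij, of w] sum_Suc_diff'[OF ij, of "\<lambda>k. Lmol (tk k)"]
    by (simp add: sum_subtractf sum_distrib_left[symmetric])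
  then have "\<bar>w j - w i - c * (Lmol (tk j) - Lmol (tk i))\<bar> \<le> (\<Sum>k=i..<j. \<bar>(w (Suc k) - w k) - c * (Lmol (tk (Suc k)) - Lmol (tk k))\<bar>)"
    by (simp only: sum_abs)
  also have "\<dots> \<le> (\<Sum>k=i..<j. e * (mol V (tk (Suc k)) - mol V (tk k)))"
  proof (rule sum_mono)
    fix k assume k: "k \<in> {i..<j}"
    have "\<bar>(w (Suc k) - w k) - c * (Lmol (tk (Suc k)) - Lmol (tk k))\<bar> = \<bar>fn (tk k) (w k) - c\<bar> * \<bar>Lmol (tk (Suc k)) - Lmol (tk k)\<bar>"
      by (simp only: w_Suc left_diff_distrib[symmetric] abs_mult)
    also have "\<dots> \<le> e * (mol V (tk (Suc k)) - mol V (tk k))"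
      using c k e molV(1)[OF tk_mono[of k "Suc k"]] by (intro mult_mono) auto
    finally show "\<bar>(w (Suc k) - w k) - c * (Lmol (tk (Suc k)) - Lmol (tk k))\<bar> \<le> e * (mol V (tk (Suc k)) - mol V (tk k))" .
  qed
  also have "\<dots> = e * (mol V (tk j) - mol V (tk i))" using sum_mol[OF ij, of V] by (simp add: sum_distrib_left[symmetric])
  also have "\<dots> \<le> e * (V (tk j + 1 / real n) - V (tk i))"
    using molV(3)[of "tk j"] molV(2)[of "tk i"] e
    by (intro mult_left_mono) auto
  finally show ?thesis .
qed

lemma w_osc:
  assumes "i \<le> j" "0 \<le> B" "\<And>k. i \<le> k \<Longrightarrow> k < j \<Longrightarrow> \<bar>fn (tk k) (w k)\<bar> \<le> B"
  shows "\<bar>w j - w i\<bar> \<le> B * (V (tk j + 1 / real n) - V (tk i))"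
  using w_linear[of i j B 0] assms by simp

text \<open>Discrete Gronwall for \<open>2 + |w k|\<close>, the quantity in which the growth bound
  is linear. The exponents telescope to the mollified variation, so the bound depends neither on
  \<open>n\<close> nor on the phase except through \<open>w 0\<close>.\<close>

lemma w_bound:
  assumes M: "\<And>t. V t \<le> M" shows "2 + \<bar>w k\<bar> \<le> (2 + \<bar>w 0\<bar>) * exp (K * M)"
proof -
  have "2 + \<bar>w k\<bar> \<le> (2 + \<bar>w 0\<bar>) * exp (K * (mol V (tk k) - mol V (tk 0)))"
  proof (induction k)
    case (Suc k)
    let ?d = "mol V (tk (Suc k)) - mol V (tk k)"
    have "\<bar>fn (tk k) (w k)\<bar> * \<bar>Lmol (tk (Suc k)) - Lmol (tk k)\<bar> \<le> (K * (2 + \<bar>w k\<bar>)) * ?d"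
      using molV(1)[OF tk_mono[of k "Suc k"]] mollify_f_growth[OF n1 tk_ge] K0
      by (intro mult_mono) auto
    then have "2 + \<bar>w (Suc k)\<bar> \<le> (2 + \<bar>w k\<bar>) * (1 + K * ?d)"
    proof -
      assume 1: "\<bar>fn (tk k) (w k)\<bar> * \<bar>Lmol (tk (Suc k)) - Lmol (tk k)\<bar> \<le> (K * (2 + \<bar>w k\<bar>)) * ?d"
      have "\<bar>w (Suc k) - w k\<bar> \<le> (K * (2 + \<bar>w k\<bar>)) * ?d" using 1 by (simp only: w_Suc abs_mult)
      moreover have "(2 + \<bar>w k\<bar>) * (1 + K * ?d) = 2 + \<bar>w k\<bar> + (K * (2 + \<bar>w k\<bar>)) * ?d" by (simp add: algebra_simps)
      ultimately show ?thesis by linarith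
    qed
    also have "\<dots> \<le> ((2 + \<bar>w 0\<bar>) * exp (K * (mol V (tk k) - mol V (tk 0)))) * exp (K * ?d)"
      using K0 molV(1)[OF tk_mono[of k "Suc k"]] by (intro mult_mono Suc exp_ge_add_one_self) auto
    finally show ?case by (simp add: mult.assoc exp_add[symmetric] algebra_simps)
  qed simp
  also have "\<dots> \<le> (2 + \<bar>w 0\<bar>) * exp (K * M)"
  proof -
    have "mol V (tk k) \<le> M" using molV(3)[of "tk k"] M[of "tk k + 1 / real n"] by linarith
    moreover have "0 \<le> mol V (tk 0)" using molV(2)[of "tk 0"] V_nonneg[of "tk 0"] by linarith
    ultimately show ?thesis using K0 by (intro mult_left_mono) (auto intro!: mult_left_mono)
  qed
  finally show ?thesis .
qed

definition Zs :: "real \<Rightarrow> real \<Rightarrow> real" where "Zs s t = V t - \<bar>J s\<bar> * indicator {s..} t"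

text \<open>Subtracting the jump at \<open>s\<close> lowers the variation near \<open>s\<close> by exactly \<open>\<bar>J s\<bar>\<close>.\<close>

lemma Zs_dominates:
  assumes "u \<le> v"
  shows "\<bar>(F v - J s * indicator {s..} v) - (F u - J s * indicator {s..} u)\<bar> \<le> Zs s v - Zs s u"
proof (cases "u < s \<and> s \<le> v")
  case False
  then show ?thesis using incr_le_V[OF assms] assms by (auto simp: Zs_def split: split_indicator)
next
  case True
  have 1: "((\<lambda>t. \<bar>F t - F u\<bar>) \<longlongrightarrow> \<bar>F s - J s - F u\<bar>) (at_left s)" by (intro tendsto_intros left_lim)
  have 2: "((\<lambda>t. V t - V u) \<longlongrightarrow> V s - \<bar>J s\<bar> - V u) (at_left s)" by (intro tendsto_intros V_left)
  have "\<bar>F s - J s - F u\<bar> \<le> V s - \<bar>J s\<bar> - V u"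
  proof (rule tendsto_le[OF _ 2 1])
    show "\<forall>\<^sub>F t in at_left s. \<bar>F t - F u\<bar> \<le> V t - V u"
      using True by (intro eventually_mono[OF eventually_at_left_real[of u s]] incr_le_V) auto
  qed simp
  moreover have "\<bar>F v - F s\<bar> \<le> V v - V s" using True by (intro incr_le_V) auto
  ultimately show ?thesis using True by (auto simp: Zs_def split: split_indicator)
qed

lemma molZ:
  "t \<le> t' \<Longrightarrow> \<bar>mol (\<lambda>v. F v - J s * indicator {s..} v) t' - mol (\<lambda>v. F v - J s * indicator {s..} v) t\<bar>
     \<le> mol (Zs s) t' - mol (Zs s) t"
  "Zs s t \<le> mol (Zs s) t" "mol (Zs s) t \<le> Zs s (t + 1 / real n)"
  by (rule mol_incr[of "\<lambda>v. F v - J s * indicator {s..} v" "Zs s"]; (rule Zs_dominates)?; (assumption | rule order_refl))+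

text \<open>Mollification is linear, and a unit step at \<open>s\<close> mollifies to
  \<open>tail (s - t)\<close>, the fraction of the jump already completed at time \<open>t\<close>.
  This is how the numbers \<open>F_n (s - t_k)\<close> enter the scheme.\<close>

lemma Lmol_jump_split: "Lmol t = mol (\<lambda>v. F v - J s * indicator {s..} v) t + J s * tail (s - t)"
proof -
  have FM: "F \<in> borel_measurable borel" using measurable_dominated(1)[of F V] incr_le_V by blast
  obtain M where M: "\<And>t. V t \<le> M" using V_bounded by blast
  have Fb: "\<bar>F v\<bar> \<le> \<bar>F 0\<bar> + 2 * M" for v
    using incr_le_V[of v 0] incr_le_V[of 0 v] M[of v] M[of 0] V_nonneg[of v] V_nonneg[of 0] by (cases "v \<le> 0") auto
  have "mol (\<lambda>v. F v - J s * indicator {s..} v) t = mol F t - mol (\<lambda>v. J s * indicator {s..} v) t"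
    by (rule mol_diff[OF FM, where A="\<bar>F 0\<bar> + 2 * M" and B="\<bar>J s\<bar>"]) (use Fb in \<open>auto split: split_indicator\<close>)
  moreover have "mol (\<lambda>v. J s * indicator {s..} v) t = J s * tail (s - t)"
    unfolding tail_shift[symmetric] by (simp add: mol_def mult.assoc)
  ultimately show ?thesis by (simp add: Lmol_eq)
qed

abbreviation "uk s \<equiv> \<lambda>k. tail (s - tk k)"

lemma uk_mono: "i \<le> j \<Longrightarrow> uk s i \<le> uk s j"
  using tk_mono[of i j] by (intro tail_antimono) auto

text \<open>The first term is the contribution of \<open>L\<close> without its jump at
  \<open>s\<close>. The second is the price of replacing the mollified coefficient at
  \<open>t_k\<close> by \<open>f (s, .)\<close>: while the jump is in progress \<open>t_k\<close> is
  within \<open>h + 1 / n\<close> of \<open>s\<close>, and mollifying \<open>f\<close> costs another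
  \<open>2 / n\<close>.\<close>

definition jump_error :: "real \<Rightarrow> real \<Rightarrow> nat \<Rightarrow> real" where
  "jump_error B s k = B * (mol (Zs s) (tk (Suc k)) - mol (Zs s) (tk k)) +
     \<bar>J s\<bar> * C * (h n + 3 / real n) * (uk s (Suc k) - uk s k)"

lemma w_jump_step:
  assumes s: "a < s" "s \<le> b" and B: "\<bar>fn (tk k) (w k)\<bar> \<le> B"
  shows "\<bar>w (Suc k) - w k - J s * f (s, w k) * (uk s (Suc k) - uk s k)\<bar> \<le> jump_error B s k"
proof -
  let ?d = "uk s (Suc k) - uk s k" and ?m = "\<lambda>t. mol (\<lambda>v. F v - J s * indicator {s..} v) t"
  have d0: "?d \<ge> 0" using uk_mono[of k "Suc k"] by simp
  have "w (Suc k) - w k - J s * f (s, w k) * ?d = fn (tk k) (w k) * (?m (tk (Suc k)) - ?m (tk k))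
     + J s * (fn (tk k) (w k) - f (s, w k)) * ?d"
    unfolding w_Suc Lmol_jump_split[of _ s] by (simp add: algebra_simps)
  moreover have "\<bar>fn (tk k) (w k) * (?m (tk (Suc k)) - ?m (tk k))\<bar> \<le> B * (mol (Zs s) (tk (Suc k)) - mol (Zs s) (tk k))"
    unfolding abs_mult using B molZ(1)[OF tk_mono[of k "Suc k"]] by (intro mult_mono) auto
  moreover have "\<bar>J s * (fn (tk k) (w k) - f (s, w k)) * ?d\<bar> \<le> \<bar>J s\<bar> * C * (h n + 3 / real n) * ?d"
  proof (cases "?d = 0")
    case False
    \<comment> \<open>If the completed fraction changes in this step, then at its end the window has
      reached \<open>s\<close>, and at its start the jump was not yet complete.\<close>
    have 1: "s - tk (Suc k) \<le> 1 / real n"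
    proof (rule ccontr)
      assume "\<not> ?thesis"
      then have "uk s (Suc k) = 0" by (intro tail_0) auto
      then show False using False d0 tail_bounds(1)[of "s - tk k"] by auto
    qed
    have 2: "tk k \<le> s"
    proof (rule ccontr)
      assume "\<not> ?thesis"
      then have "uk s k = 1" by (intro tail_1) auto
      then show False using False d0 tail_bounds(2)[of "s - tk (Suc k)"] by auto
    qed
    have "\<bar>f (min (tk k) b, w k) - f (s, w k)\<bar> \<le> C * (\<bar>tk k - s\<bar> + \<bar>w k - w k\<bar>)"
      using 2 s tk_ge[of k] lip[of "min (tk k) b" s "w k" "w k"] by auto
    also have "\<dots> \<le> C * (h n + 1 / real n)" using 1 2 C0 unfolding tk_Suc by (intro mult_left_mono) auto
    finally have "\<bar>fn (tk k) (w k) - f (s, w k)\<bar> \<le> C * (h n + 1 / real n) + 2 * C / real n"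
      using mollify_f_close[OF n1 tk_ge[of k], of "w k"] by linarith
    also have "\<dots> = C * (h n + 3 / real n)" by (simp add: field_simps)
    finally have "\<bar>J s\<bar> * \<bar>fn (tk k) (w k) - f (s, w k)\<bar> * ?d \<le> \<bar>J s\<bar> * (C * (h n + 3 / real n)) * ?d"
      using d0 by (intro mult_right_mono mult_left_mono) auto
    then show ?thesis using d0 by (simp add: abs_mult mult.assoc)
  qed simp
  ultimately show ?thesis unfolding jump_error_def by linarith
qed

lemma sum_jump_error:
  assumes ij: "i \<le> j" and B: "0 \<le> B"
  shows "(\<Sum>k=i..<j. jump_error B s k) \<le> B * (Zs s (tk j + 1 / real n) - Zs s (tk i)) + \<bar>J s\<bar> * C * (h n + 3 / real n)"
proof -
  have "(\<Sum>k=i..<j. jump_error B s k) = B * (mol (Zs s) (tk j) - mol (Zs s) (tk i)) + \<bar>J s\<bar> * C * (h n + 3 / real n) * (uk s j - uk s i)"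
    unfolding jump_error_def sum.distrib sum_distrib_left[symmetric]
    using sum_mol[OF ij] sum_Suc_diff'[OF ij, of "uk s"] by simp
  also have "\<dots> \<le> B * (Zs s (tk j + 1 / real n) - Zs s (tk i)) + \<bar>J s\<bar> * C * (h n + 3 / real n) * 1"
  proof (intro add_mono mult_left_mono B)
    show "mol (Zs s) (tk j) - mol (Zs s) (tk i) \<le> Zs s (tk j + 1 / real n) - Zs s (tk i)"
      using molZ(3)[of s "tk j"] molZ(2)[of s "tk i"] by linarith
    show "uk s j - uk s i \<le> 1" using tail_bounds(2)[of "s - tk j"] tail_bounds(1)[of "s - tk i"] by linarith
    show "0 \<le> \<bar>J s\<bar> * C * (h n + 3 / real n)" using C0 hn by simp
  qed
  finally show ?thesis by simp
qed

end

section \<open>The limit along a fixed phase of the grid\<close>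

lemma grid_index_le_iff:
  assumes "h > 0" shows "grid_index a h \<omega> t \<le> k \<longleftrightarrow> t \<le> grid_point a h \<omega> k"
proof -
  have "grid_index a h \<omega> t \<le> k \<longleftrightarrow> (t - a) / h - \<omega> \<le> real k"
    by (simp add: grid_index_def nat_le_iff ceiling_le_iff)
  also have "\<dots> \<longleftrightarrow> t \<le> grid_point a h \<omega> k"
    using assms by (simp add: grid_point_def field_simps)
  finally show ?thesis .
qed

context mollify1
begin

text \<open>On \<open>{0<..<1}\<close>, \<open>tinv\<close> is the function \<open>F_inv\<close>; elsewhere it only has to be monotone.\<close>

definition tinv :: "real \<Rightarrow> real" where
  "tinv u = (if u \<le> 0 then 1 / real n else if 1 \<le> u then 0 else Sup {x. u \<le> tail x})"

lemma tinv_set: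
  assumes "0 < u" "u < 1"
  shows "0 \<in> {x. u \<le> tail x}" "bdd_above {x. u \<le> tail x}" "closed {x. u \<le> tail x}"
proof -
  show "0 \<in> {x. u \<le> tail x}" using tail_1[of 0] assms by simp
  show "bdd_above {x. u \<le> tail x}"
  proof (rule bdd_aboveI[of _ "1 / real n"])
    fix x assume "x \<in> {x. u \<le> tail x}"
    then show "x \<le> 1 / real n" using tail_0[of x] assms by (cases "1 / real n < x") auto
  qed
  show "closed {x. u \<le> tail x}"
    by (intro closed_Collect_le continuous_intros tail_continuous)
qed

text \<open>The level set \<open>{x. u \<le> tail x}\<close> is nonempty, bounded above and,
  \<open>tail\<close> being continuous, closed; hence it contains its supremum, and by monotonicity
  everything below.\<close>

lemma le_tail_iff:
  assumes "0 < u" "u < 1" shows "u \<le> tail x \<longleftrightarrow> x \<le> tinv u"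
proof -
  have t: "tinv u = Sup {x. u \<le> tail x}" using assms by (simp add: tinv_def)
  have mem: "u \<le> tail (tinv u)"
    using closed_contains_Sup[OF _ tinv_set(2,3)[OF assms]] tinv_set(1)[OF assms] unfolding t by auto
  show ?thesis
  proof
    assume "u \<le> tail x" then show "x \<le> tinv u" unfolding t by (intro cSup_upper tinv_set(2)[OF assms]) auto
  next
    assume "x \<le> tinv u" then show "u \<le> tail x" using mem tail_antimono[of x "tinv u"] by linarith
  qed
qed

lemma tinv_bounds: "0 \<le> tinv u" "tinv u \<le> 1 / real n"
proof -
  have "0 \<le> tinv u \<and> tinv u \<le> 1 / real n"
  proof (cases "0 < u \<and> u < 1")
    case True
    then have "0 \<le> tinv u" using le_tail_iff[of u 0] tail_1[of 0] by simp
    moreover have "tinv u \<le> 1 / real n"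
      using True le_tail_iff[of u "tinv u"] tail_0[of "tinv u"] by (cases "1 / real n < tinv u") auto
    ultimately show ?thesis by simp
  qed (auto simp: tinv_def)
  then show "0 \<le> tinv u" "tinv u \<le> 1 / real n" by auto
qed

lemma tinv_antimono: assumes "u \<le> v" shows "tinv v \<le> tinv u"
proof (cases "0 < u \<and> v < 1")
  case True
  then show ?thesis using assms le_tail_iff[of v "tinv v"] le_tail_iff[of u "tinv v"] by auto
next
  case False
  then show ?thesis using assms tinv_bounds[of u] tinv_bounds[of v] by (auto simp: tinv_def)
qed

lemma tinv_measurable [measurable]: "tinv \<in> borel_measurable borel"
proof -
  have "(\<lambda>u. - tinv u) \<in> borel_measurable borel"
    by (rule borel_measurable_mono) (auto simp: mono_def tinv_antimono)
  then have "(\<lambda>u. - (- tinv u)) \<in> borel_measurable borel" by (rule borel_measurable_uminus)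
  then show ?thesis by simp
qed

lemma tail_tinv: assumes "0 < u" "u < 1" shows "tail (tinv u) = u"
proof (rule antisym)
  show "u \<le> tail (tinv u)" using le_tail_iff[OF assms] by simp
  show "tail (tinv u) \<le> u"
  proof (rule ccontr)
    assume "\<not> tail (tinv u) \<le> u"
    moreover have "(tail \<longlongrightarrow> tail (tinv u)) (at_right (tinv u))"
      using tail_continuous by (auto simp: continuous_on_def intro: tendsto_within_subset)
    ultimately have "\<forall>\<^sub>F x in at_right (tinv u). u < tail x" by (intro order_tendstoD(1)) auto
    moreover have "\<forall>\<^sub>F x in at_right (tinv u). tinv u < x" by (auto simp: eventually_at_filter)
    ultimately have "\<forall>\<^sub>F x in at_right (tinv u). False"
      by eventually_elim (use le_tail_iff[OF assms] in \<open>metis less_imp_le not_le\<close>)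
    then show False by simp
  qed
qed

text \<open>For the grid with phase \<open>\<omega>\<close>, \<open>round_up\<close> sends \<open>u\<close> to the first value not below \<open>u\<close> that
  the fraction of the jump at \<open>s\<close> completed so far takes on the grid.\<close>

definition round_up :: "real \<Rightarrow> real \<Rightarrow> real \<Rightarrow> real \<Rightarrow> real \<Rightarrow> real" where
  "round_up a h s \<omega> u = tail (s - grid_point a h \<omega> (grid_index a h \<omega> (s - tinv u)))"

lemma round_up_mono: "h > 0 \<Longrightarrow> u \<le> v \<Longrightarrow> round_up a h s \<omega> u \<le> round_up a h s \<omega> v"
  unfolding round_up_def
  by (intro tail_antimono diff_left_mono) (auto simp: grid_point_def intro!: grid_index_mono tinv_antimono)

lemma round_up_bounds: "0 \<le> round_up a h s \<omega> u" "round_up a h s \<omega> u \<le> 1"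
  unfolding round_up_def by (rule tail_bounds)+

lemma round_up_measurable: "h > 0 \<Longrightarrow> round_up a h s \<omega> \<in> borel_measurable borel"
  by (rule borel_measurable_mono) (auto simp: mono_def round_up_mono)

text \<open>Chaining two adjunctions, the one of \<open>tinv\<close> with \<open>tail\<close> and
  the one of \<open>grid_index\<close> with the grid points, \<open>u \<le> tail (s - t_k)\<close>
  holds iff the index used by \<open>round_up\<close> is at most \<open>k\<close>. As
  \<open>v\<close> lies in a single cell, monotonicity decides the comparison. This supplies
  hypothesis \<open>H\<close> of \<open>euler_compare\<close>.\<close>

lemma round_up_galois:
  assumes h: "h > 0" and u: "0 < u" "u < 1"
    and v: "tail (s - grid_point a h \<omega> k) \<le> v" "v < tail (s - grid_point a h \<omega> (Suc k))"
  shows "v < round_up a h s \<omega> u \<longleftrightarrow> tail (s - grid_point a h \<omega> k) < u"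
proof -
  let ?m = "grid_index a h \<omega> (s - tinv u)"
  have gm: "grid_point a h \<omega> i \<le> grid_point a h \<omega> j" if "i \<le> j" for i j using h that by (simp add: grid_point_def)
  have "u \<le> tail (s - grid_point a h \<omega> k) \<longleftrightarrow> ?m \<le> k"
    using le_tail_iff[OF u] grid_index_le_iff[OF h, of a \<omega> "s - tinv u" k] by (auto simp: algebra_simps)
  moreover have "round_up a h s \<omega> u \<le> v" if "?m \<le> k"
    using gm[OF that] tail_antimono[of "s - grid_point a h \<omega> k" "s - grid_point a h \<omega> ?m"] v unfolding round_up_def by auto
  moreover have "v < round_up a h s \<omega> u" if "\<not> ?m \<le> k"
    using gm[of "Suc k" ?m] that tail_antimono[of "s - grid_point a h \<omega> ?m" "s - grid_point a h \<omega> (Suc k)"] v unfolding round_up_def by auto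
  ultimately show ?thesis by (meson not_le)
qed

end

section \<open>The limit along one phase and one subsequence\<close>

locale phase_limit = coefficient +
  fixes \<omega> :: real and r :: "nat \<Rightarrow> nat" and X :: "nat \<Rightarrow> real \<Rightarrow> real" and x :: "real \<Rightarrow> real" and x0 :: real
  assumes \<omega>: "0 \<le> \<omega>" "\<omega> < 1" and r: "strict_mono r" "\<And>j. 1 \<le> r j"
    and sol: "\<And>n. n \<ge> 1 \<Longrightarrow> scheme_solution a b L h \<rho> \<rho>2 X0 f n (X n)"
    and X0_lim: "(\<lambda>j. X0 (r j) (a + h (r j) * \<omega>)) \<longlonglongrightarrow> x0"
    and X_lim: "AE t in lborel. t \<in> {a..<b} \<longrightarrow>
      (\<lambda>j. X (r j) (grid_point a (h (r j)) \<omega> (grid_index a (h (r j)) \<omega> t))) \<longlonglongrightarrow> x t"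
begin

abbreviation "F \<equiv> extend a b L"
abbreviation "gp j \<equiv> grid_point a (h (r j)) \<omega>"
abbreviation "gi j \<equiv> grid_index a (h (r j)) \<omega>"
abbreviation "Y j t \<equiv> X (r j) (gp j (gi j t))"
text \<open>Overshoot of the grid point plus width of the averaging window: how far beyond
  \<open>t\<close> the scheme can look.\<close>

definition "mesh j = h (r j) + 1 / real (r j)"

lemma grid: "grid a b L h \<rho> \<rho>2 X0 f C K (r j) \<omega> (X (r j))"
  using coefficient_axioms \<omega> r(2) sol by (intro grid.intro grid_axioms.intro) auto

lemma hr: "h (r j) > 0" by (rule h_pos[OF r(2)])

lemma mesh_pos: "0 < mesh j" "h (r j) < mesh j" "1 / real (r j) < mesh j"
proof -
  have "0 < 1 / real (r j)" using r(2)[of j] by simp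
  then show "0 < mesh j" "h (r j) < mesh j" "1 / real (r j) < mesh j"
    using hr[of j] unfolding mesh_def by linarith+
qed

lemma mesh_lim: "mesh \<longlonglongrightarrow> 0"
proof -
  have "(\<lambda>j. h (r j) + 1 / real (r j)) \<longlonglongrightarrow> 0 + 0"
    using LIMSEQ_subseq_LIMSEQ[OF h_lim r(1)] LIMSEQ_subseq_LIMSEQ[OF lim_inverse_n' r(1)]
    by (intro tendsto_add) (auto simp: o_def)
  then show ?thesis by (simp add: mesh_def[abs_def])
qed

lemma gp_bounds: assumes "a \<le> t" shows "t \<le> gp j (gi j t)" "gp j (gi j t) < t + h (r j)"
  using grid_index_bounds[OF hr assms \<omega>] by auto

lemma gi_mono: "s \<le> t \<Longrightarrow> gi j s \<le> gi j t" by (rule grid_index_mono[OF hr])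

lemma gp_mono: "i \<le> k \<Longrightarrow> gp j i \<le> gp j k" using hr[of j] by (simp add: grid_point_def)

lemma V_mesh: "(\<lambda>j. V (t + mesh j)) \<longlonglongrightarrow> V t"
proof (rule filterlim_compose[OF V_right])
  have "(\<lambda>j. t + mesh j) \<longlonglongrightarrow> t" using tendsto_add[OF tendsto_const mesh_lim, of t] by simp
  then show "filterlim (\<lambda>j. t + mesh j) (at_right t) sequentially"
    using mesh_pos(1) by (auto simp: filterlim_at intro!: always_eventually less_imp_neq[THEN not_sym])
qed

lemma uniform_bound:
  obtains B where "0 \<le> B" "\<And>j k. \<bar>X (r j) (gp j k)\<bar> \<le> B" "\<And>j k. \<bar>mollify_f b \<rho>2 f (r j) (gp j k) (X (r j) (gp j k))\<bar> \<le> B"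
proof -
  obtain M where M: "\<And>t. V t \<le> M" using V_bounded by blast
  obtain M0 where M0: "\<And>j. \<bar>X0 (r j) (a + h (r j) * \<omega>)\<bar> \<le> M0"
    using Bseq_def[of "\<lambda>j. X0 (r j) (a + h (r j) * \<omega>)"] convergent_imp_Bseq[OF convergentI[OF X0_lim]] by auto
  define R where "R = (2 + M0) * exp (K * M)"
  have wR: "2 + \<bar>X (r j) (gp j k)\<bar> \<le> R" for j k
  proof -
    have "2 + \<bar>X (r j) (gp j k)\<bar> \<le> (2 + \<bar>X (r j) (gp j 0)\<bar>) * exp (K * M)"
      using grid.w_bound[OF grid M] .
    also have "\<dots> \<le> R" unfolding R_def using M0[of j] grid.w_0[OF grid] by (intro mult_right_mono) auto
    finally show ?thesis .
  qed
  have R2: "2 \<le> R" using wR[of 0 0] by linarith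
  show ?thesis
  proof (rule that[of "R + K * R"])
    show "0 \<le> R + K * R" using R2 K0 by simp
    show "\<bar>X (r j) (gp j k)\<bar> \<le> R + K * R" for j k using wR[of j k] R2 K0 mult_nonneg_nonneg[of K R] by linarith
    show "\<bar>mollify_f b \<rho>2 f (r j) (gp j k) (X (r j) (gp j k))\<bar> \<le> R + K * R" for j k
    proof -
      have "\<bar>mollify_f b \<rho>2 f (r j) (gp j k) (X (r j) (gp j k))\<bar> \<le> K * (2 + \<bar>X (r j) (gp j k)\<bar>)"
        by (rule mollify_f_growth[OF r(2) grid.tk_ge[OF grid]])
      also have "\<dots> \<le> K * R" using wR K0 by (intro mult_left_mono) auto
      finally show ?thesis using R2 by linarith
    qed
  qed
qed

lemma Y_incr:
  assumes B: "0 \<le> B" "\<And>j k. \<bar>mollify_f b \<rho>2 f (r j) (gp j k) (X (r j) (gp j k))\<bar> \<le> B"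
    and tu: "a \<le> t" "t \<le> u"
  shows "\<bar>Y j u - Y j t\<bar> \<le> B * (V (u + mesh j) - V t)"
proof -
  have "\<bar>Y j u - Y j t\<bar> \<le> B * (V (gp j (gi j u) + 1 / real (r j)) - V (gp j (gi j t)))"
    using grid.w_osc[OF grid gi_mono[OF tu(2)] B(1) B(2)] .
  also have "\<dots> \<le> B * (V (u + mesh j) - V t)"
    using gp_bounds[of u j] gp_bounds[of t j] tu B
    by (intro mult_left_mono diff_mono V_mono) (auto simp: mesh_def)
  finally show ?thesis .
qed

text \<open>Convergence is given almost everywhere only. To the right of \<open>t\<close> there are
  points \<open>t'\<close> of convergence with \<open>V\<close> close to \<open>V t\<close>, and
  \<open>Y_incr\<close> bounds \<open>|Y j t' - Y j t|\<close> uniformly for large \<open>j\<close>;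
  so the sequence at \<open>t\<close> is Cauchy. The bound \<open>c\<close> leaves room for the mesh
  beyond \<open>t'\<close>.\<close>

lemma Y_convergent:
  assumes t: "a \<le> t" "t < b" shows "convergent (\<lambda>j. Y j t)"
proof -
  obtain B where B: "0 \<le> B" "\<And>j k. \<bar>mollify_f b \<rho>2 f (r j) (gp j k) (X (r j) (gp j k))\<bar> \<le> B"
    by (rule uniform_bound) blast
  have "Cauchy (\<lambda>j. Y j t)"
  proof (rule metric_CauchyI)
    fix e :: real assume e: "0 < e"
    define e' where "e' = e / (4 * (B + 1))"
    have e': "0 < e'" using e B by (simp add: e'_def)
    have "\<forall>\<^sub>F u in at_right t. dist (V u) (V t) < e'" using V_right e' by (rule tendstoD)
    then obtain t2 where t2: "t2 > t" "\<And>u. t < u \<Longrightarrow> u < t2 \<Longrightarrow> V u - V t < e'"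
      unfolding eventually_at_right_field dist_real_def by (fastforce simp: abs_less_iff)
    define c where "c = min b ((t + t2) / 2)"
    have c: "t < c" "c \<le> b" "c < t2" using t t2(1) by (auto simp: c_def min_def field_simps)
    have "\<exists>t'\<in>{t<..<c}. (\<lambda>j. Y j t') \<longlonglongrightarrow> x t'"
    proof (rule ccontr)
      assume no: "\<not> ?thesis"
      have "AE t' in lborel. t' \<notin> {t<..<c}"
        using X_lim by eventually_elim (use no t c in auto)
      then have "emeasure lborel {t<..<c} = 0"
        by (subst (asm) AE_iff_measurable[of "{t<..<c}"]) auto
      then show False using c by simp
    qed
    then obtain t' where t': "t < t'" "t' < c" "(\<lambda>j. Y j t') \<longlonglongrightarrow> x t'" by auto
    have "Cauchy (\<lambda>j. Y j t')" using t'(3) by (rule LIMSEQ_imp_Cauchy)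
    then obtain N1 where N1: "\<And>i j. N1 \<le> i \<Longrightarrow> N1 \<le> j \<Longrightarrow> dist (Y i t') (Y j t') < e / 2"
      using metric_CauchyD[of "\<lambda>j. Y j t'" "e/2"] e by auto
    have "\<forall>\<^sub>F j in sequentially. mesh j < c - t'" using order_tendstoD(2)[OF mesh_lim, of "c - t'"] t' by simp
    then obtain N2 where N2: "\<And>j. N2 \<le> j \<Longrightarrow> mesh j < c - t'" unfolding eventually_sequentially by auto
    have close: "\<bar>Y j t' - Y j t\<bar> < e / 4" if "N2 \<le> j" for j
    proof -
      have "\<bar>Y j t' - Y j t\<bar> \<le> B * (V (t' + mesh j) - V t)" by (rule Y_incr[OF B]) (use t t' in auto)
      also have "\<dots> \<le> B * e'"
        using B t2(2)[of "t' + mesh j"] N2[OF that] mesh_pos[of j] t' c by (intro mult_left_mono) auto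
      also have "\<dots> < e / 4" using e B by (simp add: e'_def field_simps)
      finally show ?thesis .
    qed
    show "\<exists>M. \<forall>m\<ge>M. \<forall>n\<ge>M. dist (Y m t) (Y n t) < e"
    proof (intro exI[of _ "max N1 N2"] allI impI)
      fix i j assume "max N1 N2 \<le> i" "max N1 N2 \<le> j"
      then have "\<bar>Y i t' - Y i t\<bar> < e / 4" "\<bar>Y j t' - Y j t\<bar> < e / 4" "\<bar>Y i t' - Y j t'\<bar> < e / 2"
        using close[of i] close[of j] N1[of i j] unfolding dist_real_def by auto
      then show "dist (Y i t) (Y j t) < e" unfolding dist_real_def by linarith
    qed
  qed
  then show ?thesis by (simp add: Cauchy_convergent_iff)
qed

definition y0 :: "real \<Rightarrow> real" where "y0 t = lim (\<lambda>j. Y j t)"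

lemma Y_lim: "a \<le> t \<Longrightarrow> t < b \<Longrightarrow> (\<lambda>j. Y j t) \<longlonglongrightarrow> y0 t"
  unfolding y0_def using Y_convergent convergent_LIMSEQ_iff by blast

lemma y0_a: "y0 a = x0"
proof -
  have "gi j a = 0" for j using \<omega> by (simp add: grid_index_def)
  then have "Y j a = X0 (r j) (a + h (r j) * \<omega>)" for j using grid.w_0[OF grid, of j] by simp
  then have "(\<lambda>j. Y j a) \<longlonglongrightarrow> x0" using X0_lim by simp
  then show ?thesis using Y_lim[of a] ab' LIMSEQ_unique by blast
qed

lemma y0_ae: "AE t in lborel. t \<in> {a..<b} \<longrightarrow> x t = y0 t"
  using X_lim
proof eventually_elim
  case (elim t)
  then show ?case using Y_lim[of t] LIMSEQ_unique by auto
qed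

lemma y0_incr:
  assumes B: "0 \<le> B" "\<And>j k. \<bar>mollify_f b \<rho>2 f (r j) (gp j k) (X (r j) (gp j k))\<bar> \<le> B"
    and tu: "a \<le> t" "t \<le> u" "u < b"
  shows "\<bar>y0 u - y0 t\<bar> \<le> B * (V u - V t)"
proof (rule LIMSEQ_le)
  show "(\<lambda>j. \<bar>Y j u - Y j t\<bar>) \<longlonglongrightarrow> \<bar>y0 u - y0 t\<bar>" using tu by (intro tendsto_intros Y_lim) auto
  show "(\<lambda>j. B * (V (u + mesh j) - V t)) \<longlonglongrightarrow> B * (V u - V t)" by (intro tendsto_intros V_mesh)
  show "\<exists>N. \<forall>j\<ge>N. \<bar>Y j u - Y j t\<bar> \<le> B * (V (u + mesh j) - V t)" using Y_incr[OF B tu(1,2)] by blast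
qed

text \<open>Between \<open>t\<close> and \<open>u\<close> the coefficient differs from
  \<open>f (t, y0 t)\<close> by at most \<open>E j\<close>, composed of the mollification error, the
  time lag, the oscillation \<open>B\<close> times the variation, and the distance of
  \<open>Y j t\<close> from its limit. The first and last vanish as \<open>j\<close> grows, and
  \<open>w_linear\<close> multiplies the rest by the variation once more.\<close>

lemma y0_quad:
  assumes B: "0 \<le> B" "\<And>j k. \<bar>mollify_f b \<rho>2 f (r j) (gp j k) (X (r j) (gp j k))\<bar> \<le> B"
    and tu: "a \<le> t" "t \<le> u" "u < b"
  shows "\<bar>y0 u - y0 t - f (t, y0 t) * (F u - F t)\<bar> \<le> C * (1 + B) * ((u - t) + (V u - V t)) * (V u - V t)"
proof -
  let ?c = "f (t, y0 t)"
  define E where "E j = 2 * C / real (r j) + C * ((u + h (r j) - t) + (B * (V (u + mesh j) - V t) + \<bar>Y j t - y0 t\<bar>))" for j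
  let ?Lm = "\<lambda>j. mollify_L a b \<rho> L (r j)"
  have est: "\<bar>Y j u - Y j t - ?c * (?Lm j (gp j (gi j u)) - ?Lm j (gp j (gi j t)))\<bar> \<le> E j * (V (u + mesh j) - V t)" for j
  proof -
    interpret G: grid a b L h \<rho> \<rho>2 X0 f C K "r j" \<omega> "X (r j)" by (rule grid)
    have Vm: "V t \<le> V (u + mesh j)" using tu mesh_pos[of j] by (intro V_mono) auto
    have E0: "0 \<le> E j" using C0 hr[of j] tu B Vm by (auto simp: E_def intro!: add_nonneg_nonneg mult_nonneg_nonneg)
    have "\<bar>Y j u - Y j t - ?c * (?Lm j (gp j (gi j u)) - ?Lm j (gp j (gi j t)))\<bar>
       \<le> E j * (V (gp j (gi j u) + 1 / real (r j)) - V (gp j (gi j t)))"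
    proof (rule G.w_linear[OF gi_mono[OF tu(2)] E0])
      fix k assume k: "gi j t \<le> k" "k < gi j u"
      have gk: "t \<le> gp j k" "gp j k < u + h (r j)"
        using gp_mono[OF k(1), of j] gp_mono[of k "gi j u" j] k gp_bounds[of t j] gp_bounds[of u j] tu by auto
      have "\<bar>X (r j) (gp j k) - Y j t\<bar> \<le> B * (V (gp j k + 1 / real (r j)) - V (gp j (gi j t)))"
        by (rule G.w_osc[OF k(1) B])
      also have "\<dots> \<le> B * (V (u + mesh j) - V t)"
        using gk gp_bounds[of t j] tu B by (intro mult_left_mono diff_mono V_mono) (auto simp: mesh_def)
      finally have 1: "\<bar>X (r j) (gp j k) - y0 t\<bar> \<le> B * (V (u + mesh j) - V t) + \<bar>Y j t - y0 t\<bar>" by linarith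
      have "\<bar>f (min (gp j k) b, X (r j) (gp j k)) - ?c\<bar> \<le> C * (\<bar>min (gp j k) b - t\<bar> + \<bar>X (r j) (gp j k) - y0 t\<bar>)"
        using gk tu by (intro lip) auto
      also have "\<dots> \<le> C * ((u + h (r j) - t) + (B * (V (u + mesh j) - V t) + \<bar>Y j t - y0 t\<bar>))"
        using 1 gk tu C0 by (intro mult_left_mono add_mono) auto
      finally show "\<bar>mollify_f b \<rho>2 f (r j) (gp j k) (X (r j) (gp j k)) - ?c\<bar> \<le> E j"
        using mollify_f_close[OF r(2) G.tk_ge[of k], of j "X (r j) (gp j k)"] unfolding E_def by linarith
    qed
    also have "\<dots> \<le> E j * (V (u + mesh j) - V t)"
      using E0 gp_bounds[of u j] gp_bounds[of t j] tu by (intro mult_left_mono diff_mono V_mono) (auto simp: mesh_def)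
    finally show ?thesis .
  qed
  have Lm: "(\<lambda>j. ?Lm j (gp j (gi j v))) \<longlonglongrightarrow> F v" if v: "a \<le> v" for v
  proof (rule LIM_zero_cancel, rule Lim_null_comparison)
    show "\<forall>\<^sub>F j in sequentially. norm (?Lm j (gp j (gi j v)) - F v) \<le> V (v + mesh j) - V v"
    proof (intro always_eventually allI)
      fix j
      have "\<bar>?Lm j (gp j (gi j v)) - F v\<bar> \<le> V (gp j (gi j v) + 1 / real (r j)) - V v"
        by (rule grid.molV(4)[OF grid gp_bounds(1)[OF v]])
      also have "\<dots> \<le> V (v + mesh j) - V v"
        using gp_bounds[OF v, of j] by (intro diff_right_mono V_mono) (auto simp: mesh_def)
      finally show "norm (?Lm j (gp j (gi j v)) - F v) \<le> V (v + mesh j) - V v" by simp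
    qed
    show "(\<lambda>j. V (v + mesh j) - V v) \<longlonglongrightarrow> 0" using tendsto_diff[OF V_mesh tendsto_const, of v "V v"] by simp
  qed
  have Elim: "E \<longlonglongrightarrow> C * 2 * 0 + C * ((u + 0 - t) + (B * (V u - V t) + \<bar>y0 t - y0 t\<bar>))"
  proof -
    have 1: "(\<lambda>j. 1 / real (r j)) \<longlonglongrightarrow> 0" using LIMSEQ_subseq_LIMSEQ[OF lim_inverse_n' r(1)] by (simp add: o_def)
    have 2: "(\<lambda>j. h (r j)) \<longlonglongrightarrow> 0" using LIMSEQ_subseq_LIMSEQ[OF h_lim r(1)] by (simp add: o_def)
    have "(\<lambda>j. C * 2 * (1 / real (r j)) + C * ((u + h (r j) - t) + (B * (V (u + mesh j) - V t) + \<bar>Y j t - y0 t\<bar>)))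
      \<longlonglongrightarrow> C * 2 * 0 + C * ((u + 0 - t) + (B * (V u - V t) + \<bar>y0 t - y0 t\<bar>))"
      using tu by (intro tendsto_intros 1 2 V_mesh Y_lim) auto
    then show ?thesis by (simp add: E_def[abs_def] mult.commute)
  qed
  have "\<bar>y0 u - y0 t - ?c * (F u - F t)\<bar> \<le> (C * 2 * 0 + C * ((u + 0 - t) + (B * (V u - V t) + \<bar>y0 t - y0 t\<bar>))) * (V u - V t)"
  proof (rule LIMSEQ_le)
    show "(\<lambda>j. \<bar>Y j u - Y j t - ?c * (?Lm j (gp j (gi j u)) - ?Lm j (gp j (gi j t)))\<bar>) \<longlonglongrightarrow> \<bar>y0 u - y0 t - ?c * (F u - F t)\<bar>"
      using tu by (intro tendsto_intros Y_lim Lm) auto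
    show "(\<lambda>j. E j * (V (u + mesh j) - V t)) \<longlonglongrightarrow> (C * 2 * 0 + C * ((u + 0 - t) + (B * (V u - V t) + \<bar>y0 t - y0 t\<bar>))) * (V u - V t)"
      by (intro tendsto_intros Elim V_mesh)
    show "\<exists>N. \<forall>j\<ge>N. \<bar>Y j u - Y j t - ?c * (?Lm j (gp j (gi j u)) - ?Lm j (gp j (gi j t)))\<bar> \<le> E j * (V (u + mesh j) - V t)"
      using est by blast
  qed
  also have "\<dots> \<le> (C * ((1 + B) * ((u - t) + (V u - V t)))) * (V u - V t)"
  proof (rule mult_right_mono)
    have D: "V u - V t \<ge> 0" using V_mono tu by auto
    have "0 \<le> B * (u - t)" using B tu by simp
    then have "(u - t) + B * (V u - V t) \<le> (1 + B) * ((u - t) + (V u - V t))" using D by (simp add: ring_distribs)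
    then show "C * 2 * 0 + C * ((u + 0 - t) + (B * (V u - V t) + \<bar>y0 t - y0 t\<bar>)) \<le> C * ((1 + B) * ((u - t) + (V u - V t)))"
      using C0 by (simp add: mult_left_mono)
    show "0 \<le> V u - V t" by (rule D)
  qed
  finally show ?thesis by (simp add: mult.assoc)
qed

text \<open>\<open>y0\<close> is meaningful on \<open>{a..<b}\<close> only. Extended by constants it
  has finite variation on the line, which yields measurability and left limits, also at
  \<open>b\<close>; the value 0 at \<open>b\<close> is a placeholder.\<close>

definition bend :: "real \<Rightarrow> real" where
  "bend t = (if t < a then y0 a else if t < b then y0 t else 0)"

lemma bend_dominated:
  obtains Z where "\<And>u v. u \<le> v \<Longrightarrow> \<bar>bend v - bend u\<bar> \<le> Z v - Z u" "\<exists>M. \<forall>u. 0 \<le> Z u \<and> Z u \<le> M"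
proof -
  obtain B where B: "0 \<le> B" "\<And>j k. \<bar>X (r j) (gp j k)\<bar> \<le> B" "\<And>j k. \<bar>mollify_f b \<rho>2 f (r j) (gp j k) (X (r j) (gp j k))\<bar> \<le> B"
    by (rule uniform_bound) blast
  have yB: "\<bar>y0 t\<bar> \<le> B" if "a \<le> t" "t < b" for t
    by (rule tendsto_upperbound[OF tendsto_rabs[OF Y_lim[OF that]]]) (use B(2) in auto)
  \<comment> \<open>The step of height \<open>B\<close> at \<open>b\<close> pays for the drop to 0
    there.\<close>
  define Z where "Z t = B * V t + B * indicator {b..} t" for t
  obtain M where M: "\<And>t. V t \<le> M" using V_bounded by blast
  show ?thesis
  proof (rule that[of Z])
    have inc: "\<bar>y0 v - y0 u\<bar> \<le> B * (V v - V u)" if "a \<le> u" "u \<le> v" "v < b" for u v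
      using y0_incr[OF B(1,3) that] .
    have inc0: "B * (V v - V u) \<ge> 0" if "u \<le> v" for u v using B(1) V_mono[OF that] by simp
    fix u v :: real assume uv: "u \<le> v"
    consider "v < b" | "b \<le> u" | "u < b" "b \<le> v" by linarith
    then show "\<bar>bend v - bend u\<bar> \<le> Z v - Z u"
    proof cases
      case 1
      have "\<bar>bend v - bend u\<bar> \<le> B * (V v - V u)"
      proof (cases "v < a")
        case True then show ?thesis using uv inc0[OF uv] by (simp add: bend_def)
      next
        case False
        show ?thesis
        proof (cases "u < a")
          case True
          have "\<bar>y0 v - y0 a\<bar> \<le> B * (V v - V a)" using False 1 by (intro inc) auto
          also have "\<dots> \<le> B * (V v - V u)" using B(1) True V_mono[of u a] by (intro mult_left_mono) auto
          finally show ?thesis using True False 1 by (simp add: bend_def)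
        qed (use False 1 uv inc[of u v] in \<open>simp add: bend_def\<close>)
      qed
      then show ?thesis using 1 uv by (simp add: Z_def right_diff_distrib)
    next
      case 2
      then show ?thesis using inc0[OF uv] ab' uv by (simp add: Z_def bend_def right_diff_distrib)
    next
      case 3
      have "\<bar>bend u\<bar> \<le> B" using yB[of u] yB[of a] ab' 3 by (auto simp: bend_def)
      then show ?thesis using 3 inc0[OF uv] ab' by (simp add: Z_def right_diff_distrib) (simp add: bend_def)
    qed
  next
    show "\<exists>M. \<forall>u. 0 \<le> Z u \<and> Z u \<le> M"
    proof (intro exI[of _ "B * M + B"] allI conjI)
      fix u show "0 \<le> Z u" using B(1) V_nonneg[of u] by (simp add: Z_def)
      show "Z u \<le> B * M + B" unfolding Z_def
        using B(1) M[of u] by (intro add_mono mult_left_mono) (auto split: split_indicator)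
    qed
  qed
qed

lemma bend_measurable: "bend \<in> borel_measurable borel"
proof -
  obtain Z where "\<And>u v. u \<le> v \<Longrightarrow> \<bar>bend v - bend u\<bar> \<le> Z v - Z u" by (rule bend_dominated) blast
  then show ?thesis by (rule measurable_dominated(1))
qed

lemma bend_left: "(bend \<longlongrightarrow> Lim (at_left s) bend) (at_left s)"
proof -
  obtain Z M where Z: "\<And>u v. u \<le> v \<Longrightarrow> \<bar>bend v - bend u\<bar> \<le> Z v - Z u" "\<forall>u. 0 \<le> Z u \<and> Z u \<le> M"
    by (rule bend_dominated) blast
  have "finite_variation bend"
    by (rule finite_variation.intro, rule finite_variation_dominated[of bend Z M]) (use Z in blast)+
  then obtain l where "(bend \<longlongrightarrow> l) (at_left s)" using finite_variation.left_limit_exists by blast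
  then show ?thesis by (metis tendsto_Lim trivial_limit_at_left_real)
qed

lemma at_left_cong:
  fixes g1 g2 :: "real \<Rightarrow> real"
  assumes "c < s" "\<And>t. c < t \<Longrightarrow> t < s \<Longrightarrow> g1 t = g2 t"
  shows "(g1 \<longlongrightarrow> l) (at_left s) \<longleftrightarrow> (g2 \<longlongrightarrow> l) (at_left s)"
  by (rule tendsto_cong) (use eventually_at_left_real[OF assms(1)] assms(2) in \<open>auto elim!: eventually_mono\<close>)

text \<open>Across the jump at \<open>s\<close> the scheme is an Euler scheme for the retarded equation.\<close>

lemma jump_limit:
  assumes G: "gap_function \<sigma>" and s: "a < s" "s < b"
    and conv: "(\<lambda>j. LINT u:{0<..<1}|lborel. \<bar>mollify1.round_up (r j) (\<rho> (r j)) a (h (r j)) s \<omega> u - \<sigma> u\<bar>) \<longlonglongrightarrow> 0"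
  shows "phi (gap_function.\<mu> \<sigma>) (\<lambda>v. J s * f (s, v)) (Lim (at_left s) bend) 1 = y0 s"
proof -
  interpret gap_function \<sigma> by (rule G)
  obtain B where B: "0 \<le> B" "\<And>j k. \<bar>X (r j) (gp j k)\<bar> \<le> B" "\<And>j k. \<bar>mollify_f b \<rho>2 f (r j) (gp j k) (X (r j) (gp j k))\<bar> \<le> B"
    by (rule uniform_bound) blast
  define l where "l = Lim (at_left s) bend"
  define z where "z v = J s * f (s, v)" for v
  define \<Lambda> where "\<Lambda> = \<bar>J s\<bar> * C"
  have L0: "0 \<le> \<Lambda>" using C0 by (simp add: \<Lambda>_def)
  have zl: "\<bar>z p - z q\<bar> \<le> \<Lambda> * \<bar>p - q\<bar>" for p q
  proof -
    have "\<bar>f (s, p) - f (s, q)\<bar> \<le> C * \<bar>p - q\<bar>" using lip[of s s p q] s by simp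
    then have "\<bar>J s\<bar> * \<bar>f (s, p) - f (s, q)\<bar> \<le> \<bar>J s\<bar> * (C * \<bar>p - q\<bar>)" by (rule mult_left_mono) simp
    then show ?thesis by (simp add: z_def \<Lambda>_def abs_mult[symmetric] right_diff_distrib mult.assoc)
  qed
  obtain \<psi> where \<psi>: "continuous_on UNIV \<psi>" "\<And>w. w \<in> {0..1} \<Longrightarrow> \<psi> w = l + (LINT v:{0..<w}|lborel. z (\<psi> (\<pi> v)))"
    using retarded_solution[OF zl L0, of l] by blast
  have zc: "continuous_on UNIV z"
    using L0 by (intro lipschitz_on_continuous_on[of \<Lambda>] lipschitz_onI) (auto simp: dist_real_def zl)
  have "compact (z ` \<psi> ` {0..1})"
    by (intro compact_continuous_image continuous_on_subset[OF zc] continuous_on_subset[OF \<psi>(1)]) auto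
  then obtain M where "\<forall>y\<in>z ` \<psi> ` {0..1}. norm y \<le> M"
    using compact_imp_bounded bounded_iff by blast
  then have M: "\<bar>z (\<psi> v)\<bar> \<le> M" if "v \<in> {0..1}" for v using that by simp
  define D where "D j = (LINT u:{0<..<1}|lborel. \<bar>mollify1.round_up (r j) (\<rho> (r j)) a (h (r j)) s \<omega> u - \<sigma> u\<bar>)" for j
  have bl: "(bend \<longlongrightarrow> l) (at_left s)" unfolding l_def by (rule bend_left)
  \<comment> \<open>Start the Euler scheme at the grid point after a fixed \<open>t < s\<close>. For
    large \<open>j\<close> the completed fraction is 0 there and 1 at the grid point after
    \<open>s\<close>. The bound keeps the initial error and the variation between \<open>t\<close>
    and \<open>s\<close> apart from the jump; both vanish when \<open>t\<close> afterwards tends to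
    \<open>s\<close>.\<close>
  have est: "\<bar>y0 s - \<psi> 1\<bar> \<le> exp \<Lambda> * (\<bar>y0 t - l\<bar> + B * (V s - \<bar>J s\<bar> - V t))" if t: "a < t" "t < s" for t
  proof (rule LIMSEQ_le)
    let ?R = "\<lambda>j. exp \<Lambda> * (\<bar>Y j t - l\<bar> + (B * (V (s + mesh j) - \<bar>J s\<bar> - V t) + \<bar>J s\<bar> * C * (3 * mesh j)) + \<Lambda> * M * D j)"
    show "(\<lambda>j. \<bar>Y j s - \<psi> 1\<bar>) \<longlonglongrightarrow> \<bar>y0 s - \<psi> 1\<bar>" using s by (intro tendsto_intros Y_lim) auto
    have "?R \<longlonglongrightarrow> exp \<Lambda> * (\<bar>y0 t - l\<bar> + (B * (V s - \<bar>J s\<bar> - V t) + \<bar>J s\<bar> * C * (3 * 0)) + \<Lambda> * M * 0)"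
      using conv s t unfolding D_def[symmetric] by (intro tendsto_intros Y_lim V_mesh mesh_lim) auto
    then show "?R \<longlonglongrightarrow> exp \<Lambda> * (\<bar>y0 t - l\<bar> + B * (V s - \<bar>J s\<bar> - V t))" by simp
    have "\<forall>\<^sub>F j in sequentially. mesh j < s - t" using order_tendstoD(2)[OF mesh_lim, of "s - t"] t by simp
    then obtain N where N: "\<And>j. N \<le> j \<Longrightarrow> mesh j < s - t" unfolding eventually_sequentially by auto
    show "\<exists>N. \<forall>j\<ge>N. \<bar>Y j s - \<psi> 1\<bar> \<le> ?R j"
    proof (intro exI[of _ N] allI impI)
      fix j assume j: "N \<le> j"
      interpret G: grid a b L h \<rho> \<rho>2 X0 f C K "r j" \<omega> "X (r j)" by (rule grid)
      have gt: "gp j (gi j t) < t + h (r j)" "t \<le> gp j (gi j t)" "s \<le> gp j (gi j s)" "gp j (gi j s) < s + h (r j)"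
        using gp_bounds[of t j] gp_bounds[of s j] s t by auto
      have "\<bar>Y j s - \<psi> 1\<bar> \<le> exp \<Lambda> * (\<bar>Y j t - l\<bar> + (\<Sum>k=gi j t..<gi j s. G.jump_error B s k)
         + \<Lambda> * M * (LINT u:{0<..<1}|lborel. \<bar>G.round_up a (h (r j)) s \<omega> u - \<sigma> u\<bar>))"
      proof (rule euler_compare[where u="\<lambda>k. G.tail (s - gp j k)" and z=z and w="\<lambda>k. X (r j) (gp j k)", OF _ _ _ _ _ _ _ _ zl L0 \<psi> M])
        show "gi j t \<le> gi j s" using t by (intro gi_mono) auto
        show "G.tail (s - gp j (gi j t)) = 0"
          using gt N[OF j] by (intro G.tail_0) (auto simp: mesh_def)
        show "G.tail (s - gp j (gi j s)) = 1" using gt by (intro G.tail_1) auto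
        show "G.tail (s - gp j k) \<le> G.tail (s - gp j (Suc k))" for k by (rule G.uk_mono) simp
        show "G.round_up a (h (r j)) s \<omega> \<in> borel_measurable borel" by (rule G.round_up_measurable[OF hr])
        show "G.round_up a (h (r j)) s \<omega> u \<in> {0..1}" for u using G.round_up_bounds by simp
        show "v < G.round_up a (h (r j)) s \<omega> u \<longleftrightarrow> G.tail (s - gp j k) < u"
          if "G.tail (s - gp j k) \<le> v" "v < G.tail (s - gp j (Suc k))" "0 < u" "u < 1" for k v u
          by (rule G.round_up_galois[OF hr that(3,4,1,2)])
        show "\<bar>X (r j) (gp j (Suc k)) - X (r j) (gp j k) - z (X (r j) (gp j k)) * (G.tail (s - gp j (Suc k)) - G.tail (s - gp j k))\<bar> \<le> G.jump_error B s k" for k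
          unfolding z_def using s by (intro G.w_jump_step B(3)) auto
      qed auto
      also have "\<dots> \<le> ?R j"
      proof -
        have "(\<Sum>k=gi j t..<gi j s. G.jump_error B s k) \<le> B * (G.Zs s (gp j (gi j s) + 1 / real (r j)) - G.Zs s (gp j (gi j t))) + \<bar>J s\<bar> * C * (h (r j) + 3 / real (r j))"
          using t by (intro G.sum_jump_error gi_mono B(1)) auto
        also have "\<dots> \<le> B * (V (s + mesh j) - \<bar>J s\<bar> - V t) + \<bar>J s\<bar> * C * (3 * mesh j)"
        proof (intro add_mono mult_left_mono B(1))
          have 0: "0 \<le> 1 / real (r j)" by simp
          have 1: "G.Zs s (gp j (gi j s) + 1 / real (r j)) = V (gp j (gi j s) + 1 / real (r j)) - \<bar>J s\<bar>"
          proof -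
            have "s \<le> gp j (gi j s) + 1 / real (r j)" using gt(3) 0 by linarith
            then show ?thesis by (simp add: G.Zs_def)
          qed
          have 2: "V (gp j (gi j s) + 1 / real (r j)) \<le> V (s + mesh j)"
            using gt by (intro V_mono) (auto simp: mesh_def)
          have 3: "gp j (gi j t) < s" using gt N[OF j] mesh_pos[of j] by linarith
          have 4: "V t \<le> G.Zs s (gp j (gi j t))" using V_mono[OF gt(2)] 3 by (simp add: G.Zs_def)
          show "G.Zs s (gp j (gi j s) + 1 / real (r j)) - G.Zs s (gp j (gi j t)) \<le> V (s + mesh j) - \<bar>J s\<bar> - V t"
            using 1 2 4 by linarith
          show "h (r j) + 3 / real (r j) \<le> 3 * mesh j" using hr[of j] by (simp add: mesh_def)
        qed (use C0 in auto)
        finally show ?thesis unfolding D_def by (intro mult_left_mono add_right_mono add_left_mono) auto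
      qed
      finally show "\<bar>Y j s - \<psi> 1\<bar> \<le> ?R j" .
    qed
  qed
  have "\<bar>y0 s - \<psi> 1\<bar> \<le> exp \<Lambda> * (\<bar>l - l\<bar> + B * (V s - \<bar>J s\<bar> - (V s - \<bar>J s\<bar>)))"
  proof (rule tendsto_le[OF _ _ tendsto_const])
    show "((\<lambda>t. exp \<Lambda> * (\<bar>bend t - l\<bar> + B * (V s - \<bar>J s\<bar> - V t))) \<longlongrightarrow> exp \<Lambda> * (\<bar>l - l\<bar> + B * (V s - \<bar>J s\<bar> - (V s - \<bar>J s\<bar>)))) (at_left s)"
      by (intro tendsto_intros bl V_left)
    show "\<forall>\<^sub>F t in at_left s. \<bar>y0 s - \<psi> 1\<bar> \<le> exp \<Lambda> * (\<bar>bend t - l\<bar> + B * (V s - \<bar>J s\<bar> - V t))"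
      using eventually_at_left_real[OF s(1)] by eventually_elim (use est s in \<open>auto simp: bend_def\<close>)
  qed simp
  then have "y0 s = \<psi> 1" by simp
  moreover have "phi \<mu> z l 1 = \<psi> 1" by (rule phi_eq_retarded[OF zl L0 \<psi>])
  ultimately show ?thesis by (simp add: z_def[abs_def] l_def)
qed

text \<open>At \<open>s < b\<close> without a jump, \<open>y\<close> is left-continuous by its
  increment bound and the prescribed jump is 0 because the coefficient vanishes; at the other
  interior points the jump is the assumption. At \<open>b\<close> nothing is known from the scheme,
  and the value is chosen as the left limit plus the prescribed jump.\<close>

lemma solution:
  assumes jumps: "\<And>s. a < s \<Longrightarrow> s < b \<Longrightarrow> J s \<noteq> 0 \<Longrightarrow> phi \<mu> (\<lambda>v. J s * f (s, v)) (Lim (at_left s) bend) 1 = y0 s"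
    and \<mu>: "prob_on_unit \<mu>"
  shows "limit_solution a b L \<mu> f x0 (bend(b := phi \<mu> (\<lambda>v. J b * f (b, v)) (Lim (at_left b) bend) 1))"
proof -
  obtain B where B: "0 \<le> B" "\<And>j k. \<bar>X (r j) (gp j k)\<bar> \<le> B" "\<And>j k. \<bar>mollify_f b \<rho>2 f (r j) (gp j k) (X (r j) (gp j k))\<bar> \<le> B"
    by (rule uniform_bound) blast
  define y where "y = bend(b := phi \<mu> (\<lambda>v. J b * f (b, v)) (Lim (at_left b) bend) 1)"
  have y_eq: "y t = y0 t" if "a \<le> t" "t < b" for t using that by (simp add: y_def bend_def)
  have yB: "\<bar>y0 t\<bar> \<le> B" if "a \<le> t" "t < b" for t
    by (rule tendsto_upperbound[OF tendsto_rabs[OF Y_lim[OF that]]]) (use B(2) in auto)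
  have y_left: "(y \<longlongrightarrow> l) (at_left s) \<longleftrightarrow> (bend \<longlongrightarrow> l) (at_left s)" if "s \<le> b" for s l
    by (rule at_left_cong[of "s - 1"]) (use that in \<open>auto simp: y_def\<close>)
  have y_left': "(y \<longlongrightarrow> Lim (at_left s) bend) (at_left s)" if "s \<le> b" for s
    using y_left[OF that] bend_left by blast
  have Lim_y: "Lim (at_left s) y = Lim (at_left s) bend" if "s \<le> b" for s
    using y_left'[OF that] by (intro tendsto_Lim) auto
  define jt where "jt = jump_term \<mu> F f y"
  have jt: "jt s = phi \<mu> (\<lambda>v. J s * f (s, v)) (Lim (at_left s) bend) 1 - Lim (at_left s) bend" if "s \<le> b" for s
    using Lim_y[OF that] by (simp add: jt_def jump_term_def)
  \<comment> \<open>The chosen value at \<open>b\<close> need not obey the uniform bound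
    \<open>B\<close>, so \<open>f (b, y b)\<close> enters separately.\<close>
  define B' where "B' = Max {B, K * (1 + B), \<bar>f (b, y b)\<bar>}"
  have B': "0 \<le> B'" "B \<le> B'" "K * (1 + B) \<le> B'" "\<bar>f (b, y b)\<bar> \<le> B'" using B(1) by (auto simp: B'_def)
  have incr: "\<bar>y u - y t\<bar> \<le> B' * (V u - V t)" if "a \<le> t" "t \<le> u" "u < b" for t u
  proof -
    have "\<bar>y u - y t\<bar> \<le> B * (V u - V t)" using y0_incr[OF B(1,3) that] that y_eq by simp
    also have "\<dots> \<le> B' * (V u - V t)" using B'(2) V_mono[OF that(2)] by (intro mult_right_mono) auto
    finally show ?thesis .
  qed
  have left: "(y \<longlongrightarrow> y s - jt s) (at_left s)" if s: "a < s" "s \<le> b" for s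
  proof -
    have "y s - jt s = Lim (at_left s) bend"
    proof (cases "s < b")
      case False
      then show ?thesis using jt[of s] s by (simp add: y_def)
    next
      case True
      have ys: "y s = y0 s" using y_eq s True by simp
      show ?thesis
      proof (cases "J s = 0")
        case False
        then show ?thesis using jumps[of s] jt[of s] s True ys by simp
      next
        case Js: True
        have "((\<lambda>t. y s - (y s - y t)) \<longlongrightarrow> y s - 0) (at_left s)"
        proof (intro tendsto_diff tendsto_const)
          show "((\<lambda>t. y s - y t) \<longlongrightarrow> 0) (at_left s)"
          proof (rule Lim_null_comparison)
            show "\<forall>\<^sub>F t in at_left s. norm (y s - y t) \<le> B' * (V s - V t)"
              using eventually_at_left_real[OF s(1)] by eventually_elim (use incr s True in auto)
            show "((\<lambda>t. B' * (V s - V t)) \<longlongrightarrow> 0) (at_left s)" using V_left[of s] Js by (auto intro!: tendsto_eq_intros)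
          qed
        qed
        then have "(y \<longlongrightarrow> y s) (at_left s)" by simp
        then have "Lim (at_left s) bend = y s" using y_left' s by (metis tendsto_unique trivial_limit_at_left_real)
        moreover have "jt s = 0" using jt[of s] s Js phi_zero[OF \<mu>] by simp
        ultimately show ?thesis by simp
      qed
    qed
    then show ?thesis using y_left'[OF s(2)] by simp
  qed
  have fB: "\<bar>f (t, y t)\<bar> \<le> B'" if t: "t \<in> {a..b}" for t
  proof (cases "t = b")
    case False
    then have "\<bar>y t\<bar> \<le> B" using t y_eq yB by simp
    then have "1 + \<bar>y t\<bar> \<le> 1 + B" by simp
    then have "K * (1 + \<bar>y t\<bar>) \<le> K * (1 + B)" using K0 by (rule mult_left_mono)
    then show ?thesis using growth[OF t, of "y t"] B'(3) by linarith
  qed (use B' in simp)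
  have quad: "\<bar>y u - y t - f (t, y t) * (F u - F t)\<bar> \<le> C * (1 + B) * ((u - t) + (V u - V t)) * (V u - V t)"
    if "a \<le> t" "t \<le> u" "u < b" for t u
    using y0_quad[OF B(1,3) that] that y_eq by simp
  have ym: "y \<in> borel_measurable borel" unfolding y_def fun_upd_def using bend_measurable by measurable
  have CB: "0 \<le> C * (1 + B)" using C0 B by simp
  note eq = limit_equation[OF C0 B'(1) CB lip ym incr fB quad left]
  have ya: "y a = x0" using y_eq[of a] y0_a ab' by simp
  show ?thesis unfolding limit_solution_def Let_def y_def[symmetric] jt_def[symmetric]
  proof (intro conjI ballI)
    fix s assume "s \<in> {a<..b}" then show "\<exists>l. (y \<longlongrightarrow> l) (at_left s)" using left by auto
  next
    fix t assume "t \<in> {a..b}"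
    then show "y t = x0 + stieltjes_integral Fc {a<..t} (\<lambda>s. f (s, y s)) + (\<Sum>\<^sub>\<infinity>s\<in>{a<..t}. jt s)"
      using eq(3)[of t] ya by simp
  qed (use eq(1,2) in auto)
qed

lemma solution_ae: "AE t in lborel. t \<in> {a..b} \<longrightarrow> x t = (bend(b := c)) t"
proof -
  have "AE t in lborel. t \<noteq> b" by (rule AE_lborel_singleton)
  then show ?thesis using y0_ae by eventually_elim (auto simp: bend_def)
qed

end

section \<open>Averaging over the phase of the grid\<close>

text \<open>Continuity of translations in L1, in terms of nonnegative integrals so that no
  integrability has to be carried along, and for sequences of shifts, to be used with
  \<open>h n * \<delta>\<close>.\<close>

definition translation_continuous :: "(real \<Rightarrow> real) \<Rightarrow> bool" where
  "translation_continuous f \<longleftrightarrow>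
     (\<forall>\<eta>. \<eta> \<longlonglongrightarrow> 0 \<longrightarrow> (\<lambda>k::nat. \<integral>\<^sup>+t. ennreal \<bar>f (t + \<eta> k) - f t\<bar> \<partial>lborel) \<longlonglongrightarrow> 0)"

lemma nn_integral_translate:
  fixes g :: "real \<Rightarrow> ennreal"
  assumes "g \<in> borel_measurable borel" shows "(\<integral>\<^sup>+t. g (t + c) \<partial>lborel) = (\<integral>\<^sup>+t. g t \<partial>lborel)"
  using nn_integral_real_affine[of g 1 c] assms by (simp add: add.commute)

lemma ennreal_tendsto_0_le:
  fixes g :: "nat \<Rightarrow> ennreal"
  assumes "\<And>e::real. e > 0 \<Longrightarrow> \<forall>\<^sub>F n in sequentially. g n \<le> ennreal e"
  shows "g \<longlonglongrightarrow> 0"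
proof (rule order_tendstoI)
  fix a :: ennreal assume "0 < a"
  then obtain e where e: "0 < ennreal e" "ennreal e < a"
    using dense[of 0 a] by (metis ennreal_cases less_top_ennreal not_less_iff_gr_or_eq top_greatest order_less_le_trans)
  then have "e > 0" by (simp add: ennreal_less_zero_iff)
  from assms[OF this] show "\<forall>\<^sub>F n in sequentially. g n < a"
    by eventually_elim (use e in \<open>auto intro: le_less_trans\<close>)
qed simp

lemma translation_continuous_approx:
  assumes f: "f \<in> borel_measurable borel"
    and ap: "\<And>e::real. e > 0 \<Longrightarrow> \<exists>g. g \<in> borel_measurable borel \<and> translation_continuous g \<and> (\<integral>\<^sup>+t. ennreal \<bar>f t - g t\<bar> \<partial>lborel) \<le> ennreal e"
  shows "translation_continuous f"
  unfolding translation_continuous_def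
proof (intro allI impI ennreal_tendsto_0_le)
  fix \<eta> :: "nat \<Rightarrow> real" and e :: real assume \<eta>: "\<eta> \<longlonglongrightarrow> 0" and e: "e > 0"
  obtain g where g: "g \<in> borel_measurable borel" "translation_continuous g" "(\<integral>\<^sup>+t. ennreal \<bar>f t - g t\<bar> \<partial>lborel) \<le> ennreal (e / 3)"
    using ap[of "e / 3"] e by auto
  have "(\<lambda>k. \<integral>\<^sup>+t. ennreal \<bar>g (t + \<eta> k) - g t\<bar> \<partial>lborel) \<longlonglongrightarrow> 0" using g(2) \<eta> by (auto simp: translation_continuous_def)
  then have "\<forall>\<^sub>F k in sequentially. (\<integral>\<^sup>+t. ennreal \<bar>g (t + \<eta> k) - g t\<bar> \<partial>lborel) < ennreal (e / 3)"
    using e by (intro order_tendstoD(2)) auto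
  then show "\<forall>\<^sub>F k in sequentially. (\<integral>\<^sup>+t. ennreal \<bar>f (t + \<eta> k) - f t\<bar> \<partial>lborel) \<le> ennreal e"
  proof eventually_elim
    case (elim k)
    note [measurable] = f g(1)
    have "(\<integral>\<^sup>+t. ennreal \<bar>f (t + \<eta> k) - f t\<bar> \<partial>lborel) \<le>
      (\<integral>\<^sup>+t. ennreal \<bar>f (t + \<eta> k) - g (t + \<eta> k)\<bar> + (ennreal \<bar>g (t + \<eta> k) - g t\<bar> + ennreal \<bar>f t - g t\<bar>) \<partial>lborel)"
      by (intro nn_integral_mono) (auto simp flip: ennreal_plus intro!: ennreal_leI)
    also have "\<dots> = (\<integral>\<^sup>+t. ennreal \<bar>f (t + \<eta> k) - g (t + \<eta> k)\<bar> \<partial>lborel) +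
        ((\<integral>\<^sup>+t. ennreal \<bar>g (t + \<eta> k) - g t\<bar> \<partial>lborel) + (\<integral>\<^sup>+t. ennreal \<bar>f t - g t\<bar> \<partial>lborel))"
      by (subst nn_integral_add, measurable, subst nn_integral_add, measurable)
    also have "(\<integral>\<^sup>+t. ennreal \<bar>f (t + \<eta> k) - g (t + \<eta> k)\<bar> \<partial>lborel) = (\<integral>\<^sup>+t. ennreal \<bar>f t - g t\<bar> \<partial>lborel)"
      by (rule nn_integral_translate) measurable
    also have "\<dots> + ((\<integral>\<^sup>+t. ennreal \<bar>g (t + \<eta> k) - g t\<bar> \<partial>lborel) + \<dots>) \<le> ennreal (e / 3) + (ennreal (e / 3) + ennreal (e / 3))"
      using g(3) elim by (intro add_mono) auto
    also have "\<dots> = ennreal e" using e by (simp flip: ennreal_plus)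
    finally show ?case .
  qed
qed

text \<open>A point of \<open>U\<close> stays in \<open>U\<close> under small shifts, so the part of
  \<open>U\<close> that a shift moves out has measure tending to 0 by dominated convergence. The
  part moved in is the same thing for the opposite shift.\<close>

lemma translation_continuous_open:
  assumes U: "open U" "emeasure lborel U < \<infinity>" shows "translation_continuous (indicator U)"
proof -
  have [measurable]: "U \<in> sets borel" using U by simp
  have half: "(\<lambda>k. \<integral>\<^sup>+t. indicator U t * indicator (- U) (t + \<eta> k) \<partial>lborel) \<longlonglongrightarrow> 0" if \<eta>: "\<eta> \<longlonglongrightarrow> 0" for \<eta> :: "nat \<Rightarrow> real"
  proof -
    have "(\<lambda>k. \<integral>\<^sup>+t. indicator U t * indicator (- U) (t + \<eta> k) \<partial>lborel) \<longlonglongrightarrow> (\<integral>\<^sup>+t. 0 \<partial>(lborel :: real measure))"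
    proof (rule nn_integral_dominated_convergence[where w="indicator U"])
      show "(\<integral>\<^sup>+t. indicator U t \<partial>lborel) < \<infinity>" using U by simp
      show "AE t in lborel. (\<lambda>k. indicator U t * indicator (- U) (t + \<eta> k) :: ennreal) \<longlonglongrightarrow> 0"
      proof (intro AE_I2)
        fix t
        show "(\<lambda>k. indicator U t * indicator (- U) (t + \<eta> k) :: ennreal) \<longlonglongrightarrow> 0"
        proof (cases "t \<in> U")
          case True
          have "(\<lambda>k. t + \<eta> k) \<longlonglongrightarrow> t" using tendsto_add[OF tendsto_const \<eta>, of t] by simp
          then have "\<forall>\<^sub>F k in sequentially. t + \<eta> k \<in> U" using U(1) True by (rule topological_tendstoD)
          then have "\<forall>\<^sub>F k in sequentially. (indicator U t * indicator (- U) (t + \<eta> k) :: ennreal) = 0"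
            by eventually_elim simp
          then show ?thesis by (rule tendsto_eventually)
        qed simp
      qed
    qed (auto split: split_indicator)
    then show ?thesis by simp
  qed
  show ?thesis unfolding translation_continuous_def
  proof (intro allI impI)
    fix \<eta> :: "nat \<Rightarrow> real" assume \<eta>: "\<eta> \<longlonglongrightarrow> 0"
    have eq: "(\<integral>\<^sup>+t. ennreal \<bar>indicator U (t + \<eta> k) - indicator U t\<bar> \<partial>lborel) =
      (\<integral>\<^sup>+t. indicator U t * indicator (- U) (t + \<eta> k) \<partial>lborel) + (\<integral>\<^sup>+t. indicator U t * indicator (- U) (t + (- \<eta> k)) \<partial>lborel)" for k
    proof -
      have "(\<integral>\<^sup>+t. ennreal \<bar>indicator U (t + \<eta> k) - indicator U t\<bar> \<partial>lborel) =
        (\<integral>\<^sup>+t. indicator U t * indicator (- U) (t + \<eta> k) + indicator U (t + \<eta> k) * indicator (- U) t \<partial>lborel)"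
        by (intro nn_integral_cong) (auto split: split_indicator)
      also have "\<dots> = (\<integral>\<^sup>+t. indicator U t * indicator (- U) (t + \<eta> k) \<partial>lborel) + (\<integral>\<^sup>+t. indicator U (t + \<eta> k) * indicator (- U) t \<partial>lborel)"
        by (rule nn_integral_add) measurable
      also have "(\<integral>\<^sup>+t. indicator U (t + \<eta> k) * indicator (- U) t \<partial>lborel) = (\<integral>\<^sup>+t. indicator U t * indicator (- U) (t + (- \<eta> k)) \<partial>lborel)"
        using nn_integral_translate[of "\<lambda>t. indicator U t * indicator (- U) (t + (- \<eta> k))" "\<eta> k"] by simp
      finally show ?thesis .
    qed
    have "(\<lambda>k. - \<eta> k) \<longlonglongrightarrow> 0" using tendsto_minus[OF \<eta>] by simp
    from tendsto_add[OF half[OF \<eta>] half[OF this]]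
    show "(\<lambda>k. \<integral>\<^sup>+t. ennreal \<bar>indicator U (t + \<eta> k) - indicator U t\<bar> \<partial>lborel) \<longlonglongrightarrow> 0" unfolding eq by simp
  qed
qed

lemma translation_continuous_scale:
  assumes g: "g \<in> borel_measurable borel" "translation_continuous g"
  shows "translation_continuous (\<lambda>t. g t * c)"
  unfolding translation_continuous_def
proof (intro allI impI)
  fix \<eta> :: "nat \<Rightarrow> real" assume \<eta>: "\<eta> \<longlonglongrightarrow> 0"
  note [measurable] = g(1)
  have "(\<lambda>k. ennreal \<bar>c\<bar> * (\<integral>\<^sup>+t. ennreal \<bar>g (t + \<eta> k) - g t\<bar> \<partial>lborel)) \<longlonglongrightarrow> ennreal \<bar>c\<bar> * 0"
    using g(2) \<eta> by (intro tendsto_mult_ennreal) (auto simp: translation_continuous_def)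
  moreover have "ennreal \<bar>c\<bar> * (\<integral>\<^sup>+t. ennreal \<bar>g (t + \<eta> k) - g t\<bar> \<partial>lborel) = (\<integral>\<^sup>+t. ennreal \<bar>g (t + \<eta> k) * c - g t * c\<bar> \<partial>lborel)" for k
    by (subst nn_integral_cmult[symmetric]) (auto simp: ennreal_mult'[symmetric] abs_mult[symmetric] algebra_simps)
  ultimately show "(\<lambda>k. \<integral>\<^sup>+t. ennreal \<bar>g (t + \<eta> k) * c - g t * c\<bar> \<partial>lborel) \<longlonglongrightarrow> 0" by simp
qed

lemma translation_continuous_add:
  assumes [measurable]: "f \<in> borel_measurable borel" "g \<in> borel_measurable borel"
    and "translation_continuous f" "translation_continuous g"
  shows "translation_continuous (\<lambda>t. f t + g t)"
  unfolding translation_continuous_def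
proof (intro allI impI)
  fix \<eta> :: "nat \<Rightarrow> real" assume \<eta>: "\<eta> \<longlonglongrightarrow> 0"
  have "(\<lambda>k. (\<integral>\<^sup>+t. ennreal \<bar>f (t + \<eta> k) - f t\<bar> \<partial>lborel) + (\<integral>\<^sup>+t. ennreal \<bar>g (t + \<eta> k) - g t\<bar> \<partial>lborel)) \<longlonglongrightarrow> 0 + 0"
    using assms \<eta> by (intro tendsto_add) (auto simp: translation_continuous_def)
  then have 1: "(\<lambda>k. (\<integral>\<^sup>+t. ennreal \<bar>f (t + \<eta> k) - f t\<bar> \<partial>lborel) + (\<integral>\<^sup>+t. ennreal \<bar>g (t + \<eta> k) - g t\<bar> \<partial>lborel)) \<longlonglongrightarrow> 0" by simp
  show "(\<lambda>k. \<integral>\<^sup>+t. ennreal \<bar>f (t + \<eta> k) + g (t + \<eta> k) - (f t + g t)\<bar> \<partial>lborel) \<longlonglongrightarrow> 0"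
  proof (rule tendsto_sandwich[OF _ _ tendsto_const 1])
    show "\<forall>\<^sub>F k in sequentially. (\<integral>\<^sup>+t. ennreal \<bar>f (t + \<eta> k) + g (t + \<eta> k) - (f t + g t)\<bar> \<partial>lborel)
      \<le> (\<integral>\<^sup>+t. ennreal \<bar>f (t + \<eta> k) - f t\<bar> \<partial>lborel) + (\<integral>\<^sup>+t. ennreal \<bar>g (t + \<eta> k) - g t\<bar> \<partial>lborel)"
      by (intro always_eventually allI, subst nn_integral_add[symmetric])
         (auto simp flip: ennreal_plus intro!: nn_integral_mono ennreal_leI)
  qed auto
qed

text \<open>Density: sets of finite measure are approximated by open sets through outer regularity,
  then come multiples, sums and dominated limits.\<close>

lemma translation_continuous_integrable:
  fixes f :: "real \<Rightarrow> real"
  assumes "integrable lborel f" shows "translation_continuous f"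
  using assms
proof (induction rule: integrable_induct)
  case (base A c)
  have [measurable]: "A \<in> sets borel" using base by simp
  have "translation_continuous (indicator A)"
  proof (rule translation_continuous_approx)
    fix e :: real assume e: "e > 0"
    obtain U where U: "open U" "A \<subseteq> U" "emeasure lborel (U - A) < ennreal e"
      using outer_regular_lborel[of A e] base(1) e by auto
    have [measurable]: "U \<in> sets borel" using U by simp
    have "emeasure lborel U \<le> emeasure lborel A + emeasure lborel (U - A)"
      using U emeasure_subadditive[of A lborel "U - A"] by (simp add: Un_absorb1)
    also have "\<dots> < \<infinity>" using base(2) U(3) by (simp add: less_top[symmetric] ennreal_add_eq_top) (metis ennreal_less_top less_trans order_less_irrefl top.not_eq_extremum)
    finally have "translation_continuous (indicator U)" using U by (intro translation_continuous_open)
    moreover have "(\<integral>\<^sup>+t. ennreal \<bar>indicator A t - indicator U t\<bar> \<partial>lborel) = (\<integral>\<^sup>+t. indicator (U - A) t \<partial>lborel)"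
      using U(2) by (intro nn_integral_cong) (auto split: split_indicator)
    ultimately show "\<exists>g. g \<in> borel_measurable borel \<and> translation_continuous g \<and> (\<integral>\<^sup>+t. ennreal \<bar>indicator A t - g t\<bar> \<partial>lborel) \<le> ennreal e"
      using U(3) by (intro exI[of _ "indicator U"]) auto
  qed simp
  from translation_continuous_scale[OF _ this, of c] show ?case by simp
next
  case (add f g)
  then show ?case by (intro translation_continuous_add) auto
next
  case (lim f s)
  have [measurable]: "f \<in> borel_measurable borel" "\<And>i. s i \<in> borel_measurable borel"
    using lim by (auto dest: borel_measurable_integrable)
  have "(\<lambda>i. \<integral>\<^sup>+t. ennreal \<bar>f t - s i t\<bar> \<partial>lborel) \<longlonglongrightarrow> (\<integral>\<^sup>+t. 0 \<partial>(lborel :: real measure))"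
  proof (rule nn_integral_dominated_convergence[where w="\<lambda>t. ennreal (3 * \<bar>f t\<bar>)"])
    show "(\<integral>\<^sup>+t. ennreal (3 * \<bar>f t\<bar>) \<partial>lborel) < \<infinity>"
    proof -
      have "(\<integral>\<^sup>+t. ennreal (norm (3 * \<bar>f t\<bar>)) \<partial>lborel) < \<infinity>"
        using integrable_mult_right[OF integrable_abs[OF lim(4)], of 3] unfolding integrable_iff_bounded by blast
      moreover have "norm (3 * \<bar>f t\<bar>) = 3 * \<bar>f t\<bar>" for t by simp
      ultimately show ?thesis by (simp only:)
    qed
    show "AE t in lborel. ennreal \<bar>f t - s i t\<bar> \<le> ennreal (3 * \<bar>f t\<bar>)" for i
    proof (intro AE_I2 ennreal_leI)
      fix t
      have "\<bar>s i t\<bar> \<le> 2 * \<bar>f t\<bar>" using lim(3)[of t i] by simp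
      then show "\<bar>f t - s i t\<bar> \<le> 3 * \<bar>f t\<bar>" by linarith
    qed
    show "AE t in lborel. (\<lambda>i. ennreal \<bar>f t - s i t\<bar>) \<longlonglongrightarrow> 0"
    proof (intro AE_I2)
      fix t
      have "(\<lambda>i. \<bar>f t - s i t\<bar>) \<longlonglongrightarrow> \<bar>f t - f t\<bar>" using lim(2)[of t] by (intro tendsto_intros) auto
      then show "(\<lambda>i. ennreal \<bar>f t - s i t\<bar>) \<longlonglongrightarrow> 0" using tendsto_ennrealI by fastforce
    qed
  qed auto
  then have L: "(\<lambda>i. \<integral>\<^sup>+t. ennreal \<bar>f t - s i t\<bar> \<partial>lborel) \<longlonglongrightarrow> 0" by simp
  show ?case
  proof (rule translation_continuous_approx)
    fix e :: real assume "e > 0"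
    then have "\<forall>\<^sub>F i in sequentially. (\<integral>\<^sup>+t. ennreal \<bar>f t - s i t\<bar> \<partial>lborel) < ennreal e"
      using order_tendstoD(2)[OF L, of "ennreal e"] by simp
    then obtain i where "(\<integral>\<^sup>+t. ennreal \<bar>f t - s i t\<bar> \<partial>lborel) < ennreal e" by (auto simp: eventually_sequentially)
    then show "\<exists>g. g \<in> borel_measurable borel \<and> translation_continuous g \<and> (\<integral>\<^sup>+t. ennreal \<bar>f t - g t\<bar> \<partial>lborel) \<le> ennreal e"
      using lim(5)[of i] by (intro exI[of _ "s i"]) auto
  qed simp
qed

section \<open>A uniformly distributed phase and the resulting uniform overshoot\<close>

lemma frac_measurable [measurable]: "(frac :: real \<Rightarrow> real) \<in> borel_measurable borel"
  unfolding frac_def[abs_def] by measurable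

text \<open>Rotating the circle preserves Lebesgue measure: cut \<open>{0..<1}\<close> at
  \<open>1 - frac c\<close> and translate the two pieces.\<close>

lemma nn_integral_frac_shift:
  fixes G :: "real \<Rightarrow> ennreal"
  assumes [measurable]: "G \<in> borel_measurable borel"
  shows "(\<integral>\<^sup>+\<omega>. indicator {0..<1} \<omega> * G (frac (\<omega> + c)) \<partial>lborel) = (\<integral>\<^sup>+\<omega>. indicator {0..<1} \<omega> * G \<omega> \<partial>lborel)"
proof -
  define d where "d = frac c"
  have d: "0 \<le> d" "d < 1" by (simp_all add: d_def frac_lt_1)
  have fr: "frac (\<omega> + c) = (if \<omega> < 1 - d then \<omega> + d else \<omega> + d - 1)" if "\<omega> \<in> {0..<1}" for \<omega>
  proof -
    have "frac (\<omega> + c) = frac (\<omega> + d)"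
    proof -
      have e: "\<omega> + c = (\<omega> + d) + of_int \<lfloor>c\<rfloor>" by (simp add: d_def frac_def)
      have "\<lfloor>\<omega> + c\<rfloor> = \<lfloor>\<omega> + d\<rfloor> + \<lfloor>c\<rfloor>" unfolding e by (rule floor_add_int[symmetric])
      then have "real_of_int \<lfloor>\<omega> + c\<rfloor> = real_of_int \<lfloor>\<omega> + d\<rfloor> + real_of_int \<lfloor>c\<rfloor>" by (simp only: of_int_add)
      then show ?thesis using e unfolding frac_def by linarith
    qed
    also have "\<dots> = (if \<omega> < 1 - d then \<omega> + d else \<omega> + d - 1)"
      using that d by (subst frac_unique_iff) (auto simp: Ints_def intro: exI[of _ 0] exI[of _ 1])
    finally show ?thesis .
  qed
  have "(\<integral>\<^sup>+\<omega>. indicator {0..<1} \<omega> * G (frac (\<omega> + c)) \<partial>lborel) =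
    (\<integral>\<^sup>+\<omega>. indicator {d..<1} (\<omega> + d) * G (\<omega> + d) + indicator {0..<d} (\<omega> + (d - 1)) * G (\<omega> + (d - 1)) \<partial>lborel)"
    using d by (intro nn_integral_cong) (auto simp: fr add_diff_eq split: split_indicator)
  also have "\<dots> = (\<integral>\<^sup>+\<omega>. indicator {d..<1} (\<omega> + d) * G (\<omega> + d) \<partial>lborel) + (\<integral>\<^sup>+\<omega>. indicator {0..<d} (\<omega> + (d - 1)) * G (\<omega> + (d - 1)) \<partial>lborel)"
    by (rule nn_integral_add) measurable
  also have "\<dots> = (\<integral>\<^sup>+\<omega>. indicator {d..<1} \<omega> * G \<omega> \<partial>lborel) + (\<integral>\<^sup>+\<omega>. indicator {0..<d} \<omega> * G \<omega> \<partial>lborel)"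
    using nn_integral_translate[of "\<lambda>\<omega>. indicator {d..<1} \<omega> * G \<omega>" d]
      nn_integral_translate[of "\<lambda>\<omega>. indicator {0..<d} \<omega> * G \<omega>" "d - 1"] by simp
  also have "\<dots> = (\<integral>\<^sup>+\<omega>. indicator {d..<1} \<omega> * G \<omega> + indicator {0..<d} \<omega> * G \<omega> \<partial>lborel)"
    by (rule nn_integral_add[symmetric]) measurable
  also have "\<dots> = (\<integral>\<^sup>+\<omega>. indicator {0..<1} \<omega> * G \<omega> \<partial>lborel)"
    using d by (intro nn_integral_cong) (auto split: split_indicator)
  finally show ?thesis .
qed

text \<open>The overshoot of the grid point beyond \<open>t\<close>, in units of \<open>h\<close>,
  is the phase rotated by an amount depending on \<open>t\<close>. For a uniform phase it is thus
  uniform, whatever \<open>t\<close> is.\<close>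

lemma grid_point_index_frac:
  assumes "h > 0" "a \<le> t" "0 \<le> \<omega>" "\<omega> < 1"
  shows "grid_point a h \<omega> (grid_index a h \<omega> t) = t + h * frac (\<omega> + - ((t - a) / h))"
proof -
  let ?x = "(t - a) / h - \<omega>"
  have "0 \<le> (t - a) / h" using assms by simp
  then have "-1 < ?x" using assms by linarith
  then have "0 \<le> \<lceil>?x\<rceil>" by linarith
  then have k: "real (grid_index a h \<omega> t) = of_int \<lceil>?x\<rceil>" by (simp add: grid_index_def)
  have "frac (\<omega> + - ((t - a) / h)) = of_int \<lceil>?x\<rceil> - ?x" by (simp add: frac_def ceiling_def)
  then have "\<omega> + of_int \<lceil>?x\<rceil> = frac (\<omega> + - ((t - a) / h)) + (t - a) / h" by linarith
  then show ?thesis unfolding grid_point_def k using assms by (simp add: distrib_left)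
qed

lemma nn_integral_grid:
  fixes G :: "real \<Rightarrow> ennreal"
  assumes [measurable]: "G \<in> borel_measurable borel" and "h > 0" "a \<le> t"
  shows "(\<integral>\<^sup>+\<omega>. indicator {0..<1} \<omega> * G (grid_point a h \<omega> (grid_index a h \<omega> t)) \<partial>lborel)
    = (\<integral>\<^sup>+\<omega>. indicator {0..<1} \<omega> * G (t + h * \<omega>) \<partial>lborel)"
proof -
  have "(\<integral>\<^sup>+\<omega>. indicator {0..<1} \<omega> * G (grid_point a h \<omega> (grid_index a h \<omega> t)) \<partial>lborel)
     = (\<integral>\<^sup>+\<omega>. indicator {0..<1} \<omega> * G (t + h * frac (\<omega> + - ((t - a) / h))) \<partial>lborel)"
    by (intro nn_integral_cong) (auto simp: grid_point_index_frac[OF assms(2,3)] split: split_indicator)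
  also have "\<dots> = (\<integral>\<^sup>+\<omega>. indicator {0..<1} \<omega> * G (t + h * \<omega>) \<partial>lborel)"
    by (rule nn_integral_frac_shift) measurable
  finally show ?thesis .
qed

lemma grid_point_measurable [measurable]:
  "(\<lambda>(\<omega>, t). grid_point a h \<omega> (grid_index a h \<omega> t)) \<in> borel_measurable (borel \<Otimes>\<^sub>M borel)"
  "(\<lambda>t. grid_point a h \<omega> (grid_index a h \<omega> t)) \<in> borel_measurable borel"
  unfolding grid_point_def grid_index_def by measurable

text \<open>By Fubini and the uniform overshoot, the phase average of evaluation on the grid is an
  average over shifts \<open>h n * \<delta>\<close>. For each shift the error is the L1 distance of
  \<open>u n\<close> and \<open>v\<close> plus the translation error of \<open>v\<close>; the latter
  is dominated by twice the norm of \<open>v\<close>.\<close>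

lemma grid_L1:
  fixes u :: "nat \<Rightarrow> real \<Rightarrow> real" and v :: "real \<Rightarrow> real"
  assumes u [measurable]: "\<And>n. u n \<in> borel_measurable borel" and v: "integrable lborel v"
    and conv: "(\<lambda>n. \<integral>\<^sup>+t. ennreal \<bar>u n t - v t\<bar> \<partial>lborel) \<longlonglongrightarrow> 0"
    and h: "\<And>n. n \<ge> 1 \<Longrightarrow> h n > 0" "h \<longlonglongrightarrow> 0"
  shows "(\<lambda>n. \<integral>\<^sup>+\<omega>. indicator {0..<1} \<omega> * (\<integral>\<^sup>+t. indicator {a..} t *
    ennreal \<bar>u n (grid_point a (h n) \<omega> (grid_index a (h n) \<omega> t)) - v t\<bar> \<partial>lborel) \<partial>lborel) \<longlonglongrightarrow> 0"
proof -
  have [measurable]: "v \<in> borel_measurable borel" using v by auto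
  let ?I = "\<lambda>n \<delta>. \<integral>\<^sup>+t. ennreal \<bar>u n (t + h n * \<delta>) - v t\<bar> \<partial>lborel"
  let ?E = "\<lambda>n. \<integral>\<^sup>+t. ennreal \<bar>u n t - v t\<bar> \<partial>lborel"
  let ?T = "\<lambda>n \<delta>. \<integral>\<^sup>+t. ennreal \<bar>v (t + h n * \<delta>) - v t\<bar> \<partial>lborel"
  have I: "?I n \<delta> \<le> ?E n + ?T n \<delta>" for n \<delta>
  proof -
    have "?I n \<delta> \<le> (\<integral>\<^sup>+t. ennreal \<bar>u n (t + h n * \<delta>) - v (t + h n * \<delta>)\<bar> + ennreal \<bar>v (t + h n * \<delta>) - v t\<bar> \<partial>lborel)"
      by (intro nn_integral_mono) (auto simp flip: ennreal_plus intro!: ennreal_leI)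
    also have "\<dots> = (\<integral>\<^sup>+t. ennreal \<bar>u n (t + h n * \<delta>) - v (t + h n * \<delta>)\<bar> \<partial>lborel) + ?T n \<delta>"
      by (rule nn_integral_add) measurable
    also have "(\<integral>\<^sup>+t. ennreal \<bar>u n (t + h n * \<delta>) - v (t + h n * \<delta>)\<bar> \<partial>lborel) = ?E n"
      by (rule nn_integral_translate) measurable
    finally show ?thesis .
  qed
  have "(\<integral>\<^sup>+\<omega>. indicator {0..<1} \<omega> * (\<integral>\<^sup>+t. indicator {a..} t *
    ennreal \<bar>u n (grid_point a (h n) \<omega> (grid_index a (h n) \<omega> t)) - v t\<bar> \<partial>lborel) \<partial>lborel)
    \<le> ?E n + (\<integral>\<^sup>+\<delta>. indicator {0..<1} \<delta> * ?T n \<delta> \<partial>lborel)" if n: "n \<ge> 1" for n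
  proof -
    have "(\<integral>\<^sup>+\<omega>. indicator {0..<1} \<omega> * (\<integral>\<^sup>+t. indicator {a..} t *
      ennreal \<bar>u n (grid_point a (h n) \<omega> (grid_index a (h n) \<omega> t)) - v t\<bar> \<partial>lborel) \<partial>lborel)
      = (\<integral>\<^sup>+\<omega>. \<integral>\<^sup>+t. indicator {0..<1} \<omega> * (indicator {a..} t *
      ennreal \<bar>u n (grid_point a (h n) \<omega> (grid_index a (h n) \<omega> t)) - v t\<bar>) \<partial>lborel \<partial>lborel)"
      by (intro nn_integral_cong nn_integral_cmult[symmetric]) measurable
    also have "\<dots> = (\<integral>\<^sup>+t. \<integral>\<^sup>+\<omega>. indicator {0..<1} \<omega> * (indicator {a..} t *
      ennreal \<bar>u n (grid_point a (h n) \<omega> (grid_index a (h n) \<omega> t)) - v t\<bar>) \<partial>lborel \<partial>lborel)"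
      by (rule lborel_pair.Fubini') measurable
    also have "\<dots> = (\<integral>\<^sup>+t. \<integral>\<^sup>+\<delta>. indicator {0..<1} \<delta> * (indicator {a..} t * ennreal \<bar>u n (t + h n * \<delta>) - v t\<bar>) \<partial>lborel \<partial>lborel)"
    proof (rule nn_integral_cong)
      fix t
      show "(\<integral>\<^sup>+\<omega>. indicator {0..<1} \<omega> * (indicator {a..} t *
         ennreal \<bar>u n (grid_point a (h n) \<omega> (grid_index a (h n) \<omega> t)) - v t\<bar>) \<partial>lborel)
       = (\<integral>\<^sup>+\<delta>. indicator {0..<1} \<delta> * (indicator {a..} t * ennreal \<bar>u n (t + h n * \<delta>) - v t\<bar>) \<partial>lborel)"
        using nn_integral_grid[of "\<lambda>s. ennreal \<bar>u n s - v t\<bar>" "h n" a t] h(1)[OF n]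
        by (cases "a \<le> t") (auto simp: mult.assoc)
    qed
    also have "\<dots> = (\<integral>\<^sup>+\<delta>. \<integral>\<^sup>+t. indicator {0..<1} \<delta> * (indicator {a..} t * ennreal \<bar>u n (t + h n * \<delta>) - v t\<bar>) \<partial>lborel \<partial>lborel)"
      by (rule lborel_pair.Fubini') measurable
    also have "\<dots> \<le> (\<integral>\<^sup>+\<delta>. indicator {0..<1} \<delta> * ?E n + indicator {0..<1} \<delta> * ?T n \<delta> \<partial>lborel)"
    proof (rule nn_integral_mono)
      fix \<delta>
      have "(\<integral>\<^sup>+t. indicator {0..<1} \<delta> * (indicator {a..} t * ennreal \<bar>u n (t + h n * \<delta>) - v t\<bar>) \<partial>lborel)
         \<le> (\<integral>\<^sup>+t. indicator {0..<1} \<delta> * ennreal \<bar>u n (t + h n * \<delta>) - v t\<bar> \<partial>lborel)"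
        by (intro nn_integral_mono) (auto split: split_indicator)
      also have "\<dots> = indicator {0..<1} \<delta> * ?I n \<delta>" by (rule nn_integral_cmult) measurable
      also have "\<dots> \<le> indicator {0..<1} \<delta> * (?E n + ?T n \<delta>)" by (intro mult_left_mono I) auto
      finally show "(\<integral>\<^sup>+t. indicator {0..<1} \<delta> * (indicator {a..} t * ennreal \<bar>u n (t + h n * \<delta>) - v t\<bar>) \<partial>lborel)
         \<le> indicator {0..<1} \<delta> * ?E n + indicator {0..<1} \<delta> * ?T n \<delta>" by (simp add: distrib_left)
    qed
    also have "\<dots> = (\<integral>\<^sup>+\<delta>. indicator {0..<1::real} \<delta> * ?E n \<partial>lborel) + (\<integral>\<^sup>+\<delta>. indicator {0..<1} \<delta> * ?T n \<delta> \<partial>lborel)"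
      by (rule nn_integral_add) measurable
    also have "(\<integral>\<^sup>+\<delta>. indicator {0..<1::real} \<delta> * ?E n \<partial>lborel) = ?E n"
      by (subst nn_integral_multc) auto
    finally show ?thesis .
  qed
  then have bnd: "\<forall>\<^sub>F n in sequentially. (\<integral>\<^sup>+\<omega>. indicator {0..<1} \<omega> * (\<integral>\<^sup>+t. indicator {a..} t *
    ennreal \<bar>u n (grid_point a (h n) \<omega> (grid_index a (h n) \<omega> t)) - v t\<bar> \<partial>lborel) \<partial>lborel)
    \<le> ?E n + (\<integral>\<^sup>+\<delta>. indicator {0..<1} \<delta> * ?T n \<delta> \<partial>lborel)"
    by (auto simp: eventually_sequentially)
  have fin: "(\<integral>\<^sup>+t. ennreal \<bar>v t\<bar> \<partial>lborel) < \<infinity>" using v by (simp add: integrable_iff_bounded)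
  have T2: "?T n \<delta> \<le> 2 * (\<integral>\<^sup>+t. ennreal \<bar>v t\<bar> \<partial>lborel)" for n \<delta>
  proof -
    have "?T n \<delta> \<le> (\<integral>\<^sup>+t. ennreal \<bar>v (t + h n * \<delta>)\<bar> + ennreal \<bar>v t\<bar> \<partial>lborel)"
      by (intro nn_integral_mono) (auto simp flip: ennreal_plus intro!: ennreal_leI)
    also have "\<dots> = (\<integral>\<^sup>+t. ennreal \<bar>v (t + h n * \<delta>)\<bar> \<partial>lborel) + (\<integral>\<^sup>+t. ennreal \<bar>v t\<bar> \<partial>lborel)"
      by (rule nn_integral_add) measurable
    also have "(\<integral>\<^sup>+t. ennreal \<bar>v (t + h n * \<delta>)\<bar> \<partial>lborel) = (\<integral>\<^sup>+t. ennreal \<bar>v t\<bar> \<partial>lborel)"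
      by (rule nn_integral_translate) measurable
    finally show ?thesis by (simp add: mult_2)
  qed
  have "(\<lambda>n. \<integral>\<^sup>+\<delta>. indicator {0..<1} \<delta> * ?T n \<delta> \<partial>lborel) \<longlonglongrightarrow> (\<integral>\<^sup>+\<delta>. 0 \<partial>(lborel :: real measure))"
  proof (rule nn_integral_dominated_convergence[where w="\<lambda>\<delta>. indicator {0..<1} \<delta> * (2 * (\<integral>\<^sup>+t. ennreal \<bar>v t\<bar> \<partial>lborel))"])
    show "(\<integral>\<^sup>+\<delta>. indicator {0..<1::real} \<delta> * (2 * (\<integral>\<^sup>+t. ennreal \<bar>v t\<bar> \<partial>lborel)) \<partial>lborel) < \<infinity>"
      using fin by (subst nn_integral_multc) (auto simp: ennreal_mult_less_top)
    show "AE \<delta> in lborel. (\<lambda>n. indicator {0..<1} \<delta> * ?T n \<delta>) \<longlonglongrightarrow> 0"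
    proof (intro AE_I2)
      fix \<delta> :: real
      have "(\<lambda>n. h n * \<delta>) \<longlonglongrightarrow> 0" using tendsto_mult_right[OF h(2), of \<delta>] by simp
      then have "(\<lambda>n. ?T n \<delta>) \<longlonglongrightarrow> 0"
        using translation_continuous_integrable[OF v] unfolding translation_continuous_def by blast
      then show "(\<lambda>n. indicator {0..<1} \<delta> * ?T n \<delta>) \<longlonglongrightarrow> 0" by (cases "\<delta> \<in> {0..<1}") auto
    qed
  qed (use T2 in \<open>auto split: split_indicator\<close>)
  then have "(\<lambda>n. ?E n + (\<integral>\<^sup>+\<delta>. indicator {0..<1} \<delta> * ?T n \<delta> \<partial>lborel)) \<longlonglongrightarrow> 0 + 0"
    by (intro tendsto_add conv) simp
  then have lim: "(\<lambda>n. ?E n + (\<integral>\<^sup>+\<delta>. indicator {0..<1} \<delta> * ?T n \<delta> \<partial>lborel)) \<longlonglongrightarrow> 0" by simp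
  show ?thesis by (rule tendsto_sandwich[OF _ bnd tendsto_const lim]) auto
qed

section \<open>Almost everywhere convergence along fast subsequences and the choice of a
  phase\<close>

lemma AE_tendsto_0_of_fast:
  fixes g :: "nat \<Rightarrow> 'a \<Rightarrow> ennreal"
  assumes [measurable]: "\<And>j. g j \<in> borel_measurable M" and fast: "\<And>j. (\<integral>\<^sup>+x. g j x \<partial>M) \<le> ennreal ((1/2) ^ j)"
  shows "AE x in M. (\<lambda>j. g j x) \<longlonglongrightarrow> 0"
proof -
  have "(\<integral>\<^sup>+x. (\<Sum>j. g j x) \<partial>M) = (\<Sum>j. \<integral>\<^sup>+x. g j x \<partial>M)" by (rule nn_integral_suminf) measurable
  also have "\<dots> \<le> (\<Sum>j. ennreal ((1/2) ^ j))" by (intro suminf_le fast) auto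
  also have "\<dots> = ennreal (\<Sum>j. (1/2) ^ j)" by (intro suminf_ennreal2) auto
  finally have "(\<integral>\<^sup>+x. (\<Sum>j. g j x) \<partial>M) \<noteq> \<infinity>" by (auto simp: top_unique)
  then have "AE x in M. (\<Sum>j. g j x) \<noteq> \<infinity>" by (intro nn_integral_PInf_AE) measurable
  then show ?thesis
  proof eventually_elim
    case (elim x)
    have fin: "g j x < \<top>" for j
      using elim sum_le_suminf[of "\<lambda>j. g j x" "{j}"] by (auto simp: less_top top_unique)
    then have eq: "g j x = ennreal (enn2real (g j x))" for j by simp
    have "(\<Sum>j. ennreal (enn2real (g j x))) \<noteq> \<top>" using elim eq by simp
    then have "summable (\<lambda>j. enn2real (g j x))" by (intro summable_suminf_not_top) auto
    then have "(\<lambda>j. enn2real (g j x)) \<longlonglongrightarrow> 0" by (rule summable_LIMSEQ_zero)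
    then have "(\<lambda>j. ennreal (enn2real (g j x))) \<longlonglongrightarrow> ennreal 0" by (rule tendsto_ennrealI)
    then show ?case using eq by simp
  qed
qed

lemma fast_subsequence:
  fixes d :: "nat \<Rightarrow> ennreal"
  assumes "d \<longlonglongrightarrow> 0"
  shows "\<exists>r. strict_mono r \<and> (\<forall>j. N \<le> r j \<and> d (r j) \<le> ennreal ((1/2) ^ j))"
proof -
  have "\<forall>j. \<exists>m. \<forall>n\<ge>m. d n \<le> ennreal ((1/2) ^ j)"
  proof
    fix j
    have "\<forall>\<^sub>F n in sequentially. d n < ennreal ((1/2) ^ j)" using assms by (rule order_tendstoD(2)) simp
    then show "\<exists>m. \<forall>n\<ge>m. d n \<le> ennreal ((1/2) ^ j)" unfolding eventually_sequentially by (meson less_imp_le)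
  qed
  then obtain m where m: "\<And>j n. m j \<le> n \<Longrightarrow> d n \<le> ennreal ((1/2) ^ j)" by metis
  define r where "r = rec_nat (max N (m 0)) (\<lambda>j k. max (Suc k) (m (Suc j)))"
  have r: "r 0 = max N (m 0)" "r (Suc j) = max (Suc (r j)) (m (Suc j))" for j by (simp_all add: r_def)
  have sm: "strict_mono r" by (rule strict_monoI_Suc) (simp add: r)
  have "N \<le> r j" for j by (induction j) (auto simp: r)
  moreover have "d (r j) \<le> ennreal ((1/2) ^ j)" for j by (rule m) (cases j; simp add: r)
  ultimately show ?thesis using sm by blast
qed

lemma AE_lborel_obtain:
  fixes c d :: real
  assumes "AE w in lborel. w \<in> {c..<d} \<longrightarrow> P w" "c < d"
  obtains w where "w \<in> {c..<d}" "P w"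
proof -
  have "\<exists>w\<in>{c..<d}. P w"
  proof (rule ccontr)
    assume no: "\<not> ?thesis"
    have "AE w in lborel. w \<notin> {c..<d}" using assms(1) by eventually_elim (use no in auto)
    then have "emeasure lborel {c..<d} = 0" by (subst (asm) AE_iff_measurable[of "{c..<d}"]) auto
    then show False using assms by simp
  qed
  then show ?thesis using that by blast
qed

text \<open>Integrability of \<open>X n\<close> is granted for large \<open>n\<close> and on
  \<open>T\<close> only. Replacing it by 0 for the other indices and outside \<open>T\<close> meets
  the measurability conditions of Fubini's theorem for all indices.\<close>

lemma L1_converges_ennreal:
  assumes "L1_converges T X x" and T [measurable]: "T \<in> sets borel"
  obtains u v N where "\<And>n::nat. u n \<in> borel_measurable borel" "integrable lborel v"
    "(\<lambda>n. \<integral>\<^sup>+t. ennreal \<bar>u n t - v t\<bar> \<partial>lborel) \<longlonglongrightarrow> 0"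
    "\<And>t. v t = indicator T t * x t" "\<And>n t. N \<le> n \<Longrightarrow> u n t = indicator T t * X n t"
    "\<And>n. N \<le> n \<Longrightarrow> set_integrable lborel T (X n)"
proof -
  obtain N where N: "\<And>n. N \<le> n \<Longrightarrow> set_integrable lborel T (X n)"
    using assms unfolding L1_converges_def eventually_sequentially by blast
  define u where "u n = (if N \<le> n then (\<lambda>t. indicator T t * X n t) else (\<lambda>_. 0))" for n
  define v where "v t = indicator T t * x t" for t
  have ui: "integrable lborel (\<lambda>t. indicator T t * X n t)" if "N \<le> n" for n using N[OF that] by (simp add: set_integrable_def)
  have vi: "integrable lborel v" using assms unfolding L1_converges_def v_def[abs_def] by (simp add: set_integrable_def)
  have lim: "(\<lambda>n. LINT t:T|lborel. \<bar>X n t - x t\<bar>) \<longlonglongrightarrow> 0" using assms by (simp add: L1_converges_def)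
  show ?thesis
  proof (rule that[of u v N])
    show "u n \<in> borel_measurable borel" for n using ui[of n] by (auto simp: u_def dest: borel_measurable_integrable)
    show "(\<lambda>n. \<integral>\<^sup>+t. ennreal \<bar>u n t - v t\<bar> \<partial>lborel) \<longlonglongrightarrow> 0"
    proof -
      have eq: "(\<integral>\<^sup>+t. ennreal \<bar>u n t - v t\<bar> \<partial>lborel) = ennreal (LINT t:T|lborel. \<bar>X n t - x t\<bar>)" if n: "N \<le> n" for n
      proof -
        have "integrable lborel (\<lambda>t. \<bar>u n t - v t\<bar>)" using ui[OF n] vi n by (simp add: u_def)
        then have "(\<integral>\<^sup>+t. ennreal \<bar>u n t - v t\<bar> \<partial>lborel) = ennreal (\<integral>t. \<bar>u n t - v t\<bar> \<partial>lborel)"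
          by (rule nn_integral_eq_integral) auto
        also have "(\<integral>t. \<bar>u n t - v t\<bar> \<partial>lborel) = (LINT t:T|lborel. \<bar>X n t - x t\<bar>)"
          unfolding set_lebesgue_integral_def
          by (rule Bochner_Integration.integral_cong) (auto simp: u_def v_def n split: split_indicator)
        finally show ?thesis .
      qed
      have "(\<lambda>n. ennreal (LINT t:T|lborel. \<bar>X n t - x t\<bar>)) \<longlonglongrightarrow> ennreal 0" by (rule tendsto_ennrealI[OF lim])
      moreover have "\<forall>\<^sub>F n in sequentially. ennreal (LINT t:T|lborel. \<bar>X n t - x t\<bar>) = (\<integral>\<^sup>+t. ennreal \<bar>u n t - v t\<bar> \<partial>lborel)"
        using eq unfolding eventually_sequentially by (intro exI[of _ N]) simp
      ultimately show ?thesis by (auto elim: Lim_transform_eventually)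
    qed
  qed (use vi N in \<open>auto simp: u_def v_def\<close>)
qed

context scheme_data
begin

lemma mollify1: "1 \<le> n \<Longrightarrow> mollify1 n (\<rho> n)"
  using \<rho>_moll by unfold_locales auto

lemma X0_phase_measurable:
  assumes n: "1 \<le> n"
  shows "(\<lambda>\<omega>. indicator {0..<1} \<omega> * ennreal \<bar>X0 n (a + h n * \<omega>) - c\<bar>) \<in> borel_measurable borel"
proof -
  obtain g where g: "C_infinity g" "\<And>t. t \<in> {a..<a + h n} \<Longrightarrow> X0 n t = g t" using X0_smooth[OF n] by blast
  have "C_k 0 g" using g(1) by (simp add: C_infinity_def del: C_k.simps)
  then have [measurable]: "g \<in> borel_measurable borel" by (simp add: borel_measurable_continuous_onI)
  have "(indicator {0..<1} \<omega> * ennreal \<bar>X0 n (a + h n * \<omega>) - c\<bar>) = (indicator {0..<1} \<omega> * ennreal \<bar>g (a + h n * \<omega>) - c\<bar>)" for \<omega>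
    using g(2)[of "a + h n * \<omega>"] h_pos[OF n] by (auto split: split_indicator)
  moreover have "(\<lambda>\<omega>. indicator {0..<1} \<omega> * ennreal \<bar>g (a + h n * \<omega>) - c\<bar>) \<in> borel_measurable borel" by measurable
  ultimately show ?thesis by simp
qed

text \<open>The distance of \<open>F_n (F_n^{-1} u - \<delta> h_n)\<close> from
  \<open>\<sigma> u\<close>, averaged over \<open>u\<close> and \<delta>. It does not involve the
  location of a jump, so one quantity controls the rounding functions at all of them.\<close>

definition phase_error :: "(real \<Rightarrow> real) \<Rightarrow> nat \<Rightarrow> ennreal" where
  "phase_error \<sigma> n = (\<integral>\<^sup>+u. indicator {0<..<1} u * (\<integral>\<^sup>+\<delta>. indicator {0..<1} \<delta> *
     ennreal \<bar>mollify1.tail n (\<rho> n) (mollify1.tinv n (\<rho> n) u - h n * \<delta>) - \<sigma> u\<bar> \<partial>lborel) \<partial>lborel)"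

lemma round_up_joint_measurable:
  assumes n: "1 \<le> n"
  shows "(\<lambda>(\<omega>, u). mollify1.round_up n (\<rho> n) a (h n) s \<omega> u) \<in> borel_measurable (borel \<Otimes>\<^sub>M borel)"
proof -
  interpret M: mollify1 n "\<rho> n" by (rule mollify1[OF n])
  have [measurable]: "M.tail \<in> borel_measurable borel" by (rule borel_measurable_continuous_onI[OF M.tail_continuous])
  have "(\<lambda>p. (\<lambda>(\<omega>, t). grid_point a (h n) \<omega> (grid_index a (h n) \<omega> t)) (fst p, s - M.tinv (snd p))) \<in> borel_measurable (borel \<Otimes>\<^sub>M borel)"
    by measurable
  then have [measurable]: "(\<lambda>p. grid_point a (h n) (fst p) (grid_index a (h n) (fst p) (s - M.tinv (snd p)))) \<in> borel_measurable (borel \<Otimes>\<^sub>M borel)"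
    by simp
  show ?thesis unfolding M.round_up_def split_beta' by measurable
qed

text \<open>For fixed \<open>u\<close> the rounding function is \<open>tail\<close> at
  \<open>tinv u\<close> minus the overshoot of the grid point after \<open>s - tinv u\<close>, which
  is uniform in the phase. The bound on \<open>1 / n\<close> keeps \<open>s - tinv u\<close> to the
  right of \<open>a\<close>.\<close>

lemma round_up_average:
  assumes n: "1 \<le> n" and s: "1 / real n \<le> s - a" and [measurable]: "\<sigma> \<in> borel_measurable borel"
  shows "(\<integral>\<^sup>+\<omega>. indicator {0..<1} \<omega> * (\<integral>\<^sup>+u. indicator {0<..<1} u *
      ennreal \<bar>mollify1.round_up n (\<rho> n) a (h n) s \<omega> u - \<sigma> u\<bar> \<partial>lborel) \<partial>lborel) = phase_error \<sigma> n"
proof -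
  interpret M: mollify1 n "\<rho> n" by (rule mollify1[OF n])
  have tm [measurable]: "M.tail \<in> borel_measurable borel" by (rule borel_measurable_continuous_onI[OF M.tail_continuous])
  note rm [measurable] = round_up_joint_measurable[OF n, of s]
  have [measurable]: "(\<lambda>u. M.round_up a (h n) s \<omega> u) \<in> borel_measurable borel" for \<omega>
    by (rule M.round_up_measurable[OF h_pos[OF n]])
  have "(\<integral>\<^sup>+\<omega>. indicator {0..<1} \<omega> * (\<integral>\<^sup>+u. indicator {0<..<1} u * ennreal \<bar>M.round_up a (h n) s \<omega> u - \<sigma> u\<bar> \<partial>lborel) \<partial>lborel)
    = (\<integral>\<^sup>+\<omega>. \<integral>\<^sup>+u. indicator {0..<1} \<omega> * (indicator {0<..<1} u * ennreal \<bar>M.round_up a (h n) s \<omega> u - \<sigma> u\<bar>) \<partial>lborel \<partial>lborel)"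
    by (intro nn_integral_cong nn_integral_cmult[symmetric]) measurable
  also have "\<dots> = (\<integral>\<^sup>+u. \<integral>\<^sup>+\<omega>. indicator {0..<1} \<omega> * (indicator {0<..<1} u * ennreal \<bar>M.round_up a (h n) s \<omega> u - \<sigma> u\<bar>) \<partial>lborel \<partial>lborel)"
    by (rule lborel_pair.Fubini') measurable
  also have "\<dots> = phase_error \<sigma> n" unfolding phase_error_def
  proof (rule nn_integral_cong)
    fix u :: real
    have "a \<le> s - M.tinv u" using M.tinv_bounds(2)[of u] s by linarith
    from nn_integral_grid[OF _ h_pos[OF n] this, of "\<lambda>p. ennreal \<bar>M.tail (s - p) - \<sigma> u\<bar>"]
    have eq: "(\<integral>\<^sup>+\<omega>. indicator {0..<1} \<omega> * ennreal \<bar>M.round_up a (h n) s \<omega> u - \<sigma> u\<bar> \<partial>lborel) =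
      (\<integral>\<^sup>+\<delta>. indicator {0..<1} \<delta> * ennreal \<bar>M.tail (M.tinv u - h n * \<delta>) - \<sigma> u\<bar> \<partial>lborel)"
      unfolding M.round_up_def by (simp add: diff_diff_eq2 add.commute)
    have "(\<integral>\<^sup>+\<omega>. indicator {0..<1} \<omega> * (indicator {0<..<1} u * ennreal \<bar>M.round_up a (h n) s \<omega> u - \<sigma> u\<bar>) \<partial>lborel)
      = (\<integral>\<^sup>+\<omega>. indicator {0<..<1} u * (indicator {0..<1} \<omega> * ennreal \<bar>M.round_up a (h n) s \<omega> u - \<sigma> u\<bar>) \<partial>lborel)"
      by (simp add: mult.left_commute)
    also have "\<dots> = indicator {0<..<1} u * (\<integral>\<^sup>+\<omega>. indicator {0..<1} \<omega> * ennreal \<bar>M.round_up a (h n) s \<omega> u - \<sigma> u\<bar> \<partial>lborel)"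
    proof (rule nn_integral_cmult)
      have "(\<lambda>\<omega>. (\<lambda>(\<omega>, u). M.round_up a (h n) s \<omega> u) (\<omega>, u)) \<in> borel_measurable borel" by measurable
      then have [measurable]: "(\<lambda>\<omega>. M.round_up a (h n) s \<omega> u) \<in> borel_measurable borel" by simp
      show "(\<lambda>\<omega>. indicator {0..<1} \<omega> * ennreal \<bar>M.round_up a (h n) s \<omega> u - \<sigma> u\<bar>) \<in> borel_measurable lborel" by measurable
    qed
    finally show "(\<integral>\<^sup>+\<omega>. indicator {0..<1} \<omega> * (indicator {0<..<1} u * ennreal \<bar>M.round_up a (h n) s \<omega> u - \<sigma> u\<bar>) \<partial>lborel)
      = indicator {0<..<1} u * (\<integral>\<^sup>+\<delta>. indicator {0..<1} \<delta> * ennreal \<bar>M.tail (M.tinv u - h n * \<delta>) - \<sigma> u\<bar> \<partial>lborel)"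
      unfolding eq .
  qed
  finally show ?thesis .
qed

text \<open>L1 convergence along one phase gives convergence almost everywhere along a fast
  subsequence. For \<open>t < b\<close> the grid point after \<open>t\<close> is finally at most
  \<open>b\<close>, where the truncated functions agree with the scheme.\<close>

lemma phase_subsequence_ae:
  fixes u :: "nat \<Rightarrow> real \<Rightarrow> real"
  assumes u [measurable]: "\<And>n. u n \<in> borel_measurable borel" and [measurable]: "v \<in> borel_measurable borel"
    and v_eq: "\<And>t. v t = indicator {a..b} t * x t" and u_eq: "\<And>n t. N \<le> n \<Longrightarrow> u n t = indicator {a..b} t * X n t"
    and r: "strict_mono r" and r1: "\<And>j. 1 \<le> r j" "\<And>j. N \<le> r j" and \<omega>1: "\<omega> \<in> {0..<1}"
    and A_lim: "(\<lambda>j. \<integral>\<^sup>+t. indicator {a..} t * ennreal \<bar>u (r j) (grid_point a (h (r j)) \<omega> (grid_index a (h (r j)) \<omega> t)) - v t\<bar> \<partial>lborel) \<longlonglongrightarrow> 0"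
  obtains r2 where "strict_mono r2" "AE t in lborel. t \<in> {a..<b} \<longrightarrow>
    (\<lambda>j. X (r (r2 j)) (grid_point a (h (r (r2 j))) \<omega> (grid_index a (h (r (r2 j))) \<omega> t))) \<longlonglongrightarrow> x t"
proof -
  define A where "A n = (\<integral>\<^sup>+t. indicator {a..} t * ennreal \<bar>u n (grid_point a (h n) \<omega> (grid_index a (h n) \<omega> t)) - v t\<bar> \<partial>lborel)" for n
  have Ar: "(\<lambda>j. A (r j)) \<longlonglongrightarrow> 0" unfolding A_def by (rule A_lim)
  from fast_subsequence[OF Ar, of 0]
  obtain r2 where r2: "strict_mono r2" and r2A: "\<forall>j. 0 \<le> r2 j \<and> A (r (r2 j)) \<le> ennreal ((1/2) ^ j)"
    by (elim exE conjE)
  have "AE t in lborel. (\<lambda>j. indicator {a..} t * ennreal \<bar>u (r (r2 j)) (grid_point a (h (r (r2 j))) \<omega> (grid_index a (h (r (r2 j))) \<omega> t)) - v t\<bar>) \<longlonglongrightarrow> 0"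
  proof (rule AE_tendsto_0_of_fast)
    fix j
    show "(\<integral>\<^sup>+t. indicator {a..} t * ennreal \<bar>u (r (r2 j)) (grid_point a (h (r (r2 j))) \<omega> (grid_index a (h (r (r2 j))) \<omega> t)) - v t\<bar> \<partial>lborel) \<le> ennreal ((1/2) ^ j)"
      using r2A[rule_format, of j] unfolding A_def by (rule conjunct2)
  qed measurable
  then have "AE t in lborel. t \<in> {a..<b} \<longrightarrow> (\<lambda>j. X (r (r2 j)) (grid_point a (h (r (r2 j))) \<omega> (grid_index a (h (r (r2 j))) \<omega> t))) \<longlonglongrightarrow> x t"
  proof (eventually_elim, intro impI)
    fix t assume l: "(\<lambda>j. indicator {a..} t * ennreal \<bar>u (r (r2 j)) (grid_point a (h (r (r2 j))) \<omega> (grid_index a (h (r (r2 j))) \<omega> t)) - v t\<bar>) \<longlonglongrightarrow> 0"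
      and t: "t \<in> {a..<b}"
    let ?g = "\<lambda>j. grid_point a (h (r (r2 j))) \<omega> (grid_index a (h (r (r2 j))) \<omega> t)"
    have hr: "(\<lambda>j. h (r (r2 j))) \<longlonglongrightarrow> 0"
      using LIMSEQ_subseq_LIMSEQ[OF h_lim strict_mono_o[OF r r2]] by (simp add: o_def)
    have "\<forall>\<^sub>F j in sequentially. h (r (r2 j)) < b - t" using order_tendstoD(2)[OF hr, of "b - t"] t by simp
    then have ev: "\<forall>\<^sub>F j in sequentially. u (r (r2 j)) (?g j) = X (r (r2 j)) (?g j)"
    proof eventually_elim
      case (elim j)
      have "t \<le> ?g j" "?g j < t + h (r (r2 j))" using grid_index_bounds[OF h_pos[OF r1(1)[of "r2 j"]], of a t \<omega>] t \<omega>1 by auto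
      then have "?g j \<in> {a..b}" using elim t by auto
      then show ?case by (simp add: u_eq[OF r1(2)])
    qed
    have "(\<lambda>j. ennreal \<bar>u (r (r2 j)) (?g j) - x t\<bar>) \<longlonglongrightarrow> ennreal 0" using l t by (simp add: v_eq)
    then have "(\<lambda>j. \<bar>u (r (r2 j)) (?g j) - x t\<bar>) \<longlonglongrightarrow> 0" by (subst (asm) tendsto_ennreal_iff) auto
    then have "(\<lambda>j. u (r (r2 j)) (?g j) - x t) \<longlonglongrightarrow> 0" by (rule tendsto_rabs_zero_cancel)
    then have "(\<lambda>j. u (r (r2 j)) (?g j)) \<longlonglongrightarrow> x t" by (rule LIM_zero_cancel)
    then show "(\<lambda>j. X (r (r2 j)) (?g j)) \<longlonglongrightarrow> x t" using ev by (rule Lim_transform_eventually)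
  qed
  with r2 show ?thesis by (rule that)
qed

lemma jumps_countable: "countable {s. a < s \<and> s < b \<and> J s \<noteq> 0}"
proof -
  have "J summable_on {a<..b}" using jump_dominated(1)[of a b J 1] ab' by auto
  then have "countable {s \<in> {a<..b}. J s \<noteq> 0}" by (rule summable_countable_real)
  then show ?thesis by (rule countable_subset[rotated]) auto
qed

end

context coefficient
begin

text \<open>The errors of grid evaluation, of the initial values and of rounding all have phase
  averages tending to 0, so along one fast subsequence of their sum each tends to 0 for almost every
  phase. There are countably many jumps, hence one phase serves all of them at once.\<close>

lemma phase_selection:
  assumes L1: "L1_converges {a..b} X x"
    and sol: "\<And>n. n \<ge> 1 \<Longrightarrow> scheme_solution a b L h \<rho> \<rho>2 X0 f n (X n)"
    and X0c: "(\<lambda>n. \<integral>\<^sup>+\<omega>. indicator {0..<1} \<omega> * ennreal \<bar>X0 n (a + h n * \<omega>) - x0\<bar> \<partial>lborel) \<longlonglongrightarrow> 0"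
    and \<sigma>m [measurable]: "\<sigma> \<in> borel_measurable borel" and \<sigma>01: "\<And>u. u \<in> {0<..<1} \<Longrightarrow> \<sigma> u \<in> {0..1}"
    and err: "\<exists>s. a < s \<and> s < b \<and> J s \<noteq> 0 \<Longrightarrow> phase_error \<sigma> \<longlonglongrightarrow> 0"
  obtains \<omega> r where "phase_limit a b L h \<rho> \<rho>2 X0 f C K \<omega> r X x x0"
    "\<And>s. a < s \<Longrightarrow> s < b \<Longrightarrow> J s \<noteq> 0 \<Longrightarrow>
      (\<lambda>j. LINT u:{0<..<1}|lborel. \<bar>mollify1.round_up (r j) (\<rho> (r j)) a (h (r j)) s \<omega> u - \<sigma> u\<bar>) \<longlonglongrightarrow> 0"
proof -
  obtain u v N where u [measurable]: "\<And>n::nat. u n \<in> borel_measurable borel" and v: "integrable lborel v"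
    and conv: "(\<lambda>n. \<integral>\<^sup>+t. ennreal \<bar>u n t - v t\<bar> \<partial>lborel) \<longlonglongrightarrow> 0"
    and v_eq: "\<And>t. v t = indicator {a..b} t * x t" and u_eq: "\<And>n t. N \<le> n \<Longrightarrow> u n t = indicator {a..b} t * X n t"
    by (rule L1_converges_ennreal[OF L1]) auto
  have vm [measurable]: "v \<in> borel_measurable borel" using v by auto
  define A where "A n \<omega> = (\<integral>\<^sup>+t. indicator {a..} t * ennreal \<bar>u n (grid_point a (h n) \<omega> (grid_index a (h n) \<omega> t)) - v t\<bar> \<partial>lborel)" for n \<omega>
  define D where "D s n \<omega> = (\<integral>\<^sup>+u. indicator {0<..<1} u * ennreal \<bar>mollify1.round_up n (\<rho> n) a (h n) s \<omega> u - \<sigma> u\<bar> \<partial>lborel)" for s n \<omega>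
  \<comment> \<open>The rounding error is controlled only when there is an interior jump; otherwise
    0 takes its place in the sum.\<close>
  define pe where "pe n = (if \<exists>s. a < s \<and> s < b \<and> J s \<noteq> 0 then phase_error \<sigma> n else 0)" for n
  have Alim: "(\<lambda>n. \<integral>\<^sup>+\<omega>. indicator {0..<1} \<omega> * A n \<omega> \<partial>lborel) \<longlonglongrightarrow> 0"
    unfolding A_def by (rule grid_L1[OF u v conv h_pos h_lim])
  have "pe \<longlonglongrightarrow> 0"
  proof (cases "\<exists>s. a < s \<and> s < b \<and> J s \<noteq> 0")
    case True
    have "pe = phase_error \<sigma>"
    proof
      show "pe n = phase_error \<sigma> n" for n unfolding pe_def using True by (rule if_P)
    qed
    then show ?thesis using err[OF True] by simp
  next
    case False
    then have "pe = (\<lambda>_. 0)" by (simp only: pe_def[abs_def] if_False)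
    then show ?thesis by simp
  qed
  then have "(\<lambda>n. (\<integral>\<^sup>+\<omega>. indicator {0..<1} \<omega> * A n \<omega> \<partial>lborel) +
    ((\<integral>\<^sup>+\<omega>. indicator {0..<1} \<omega> * ennreal \<bar>X0 n (a + h n * \<omega>) - x0\<bar> \<partial>lborel) + pe n)) \<longlonglongrightarrow> 0 + (0 + 0)"
    by (intro tendsto_add Alim X0c)
  then have tot: "(\<lambda>n. (\<integral>\<^sup>+\<omega>. indicator {0..<1} \<omega> * A n \<omega> \<partial>lborel) +
    ((\<integral>\<^sup>+\<omega>. indicator {0..<1} \<omega> * ennreal \<bar>X0 n (a + h n * \<omega>) - x0\<bar> \<partial>lborel) + pe n)) \<longlonglongrightarrow> 0" by simp
  from fast_subsequence[OF tot, of "max 1 N"] obtain r where r: "strict_mono r"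
    and rj: "\<forall>j. max 1 N \<le> r j \<and> (\<integral>\<^sup>+\<omega>. indicator {0..<1} \<omega> * A (r j) \<omega> \<partial>lborel) +
    ((\<integral>\<^sup>+\<omega>. indicator {0..<1} \<omega> * ennreal \<bar>X0 (r j) (a + h (r j) * \<omega>) - x0\<bar> \<partial>lborel) + pe (r j)) \<le> ennreal ((1/2) ^ j)"
    by (elim exE conjE)
  note fast = rj[rule_format, THEN conjunct2]
  have r1: "1 \<le> r j" "N \<le> r j" for j using rj[rule_format, of j, THEN conjunct1] by auto
  have Am [measurable]: "A n \<in> borel_measurable borel" for n unfolding A_def[abs_def] by measurable
  have ae1: "AE \<omega> in lborel. (\<lambda>j. indicator {0..<1} \<omega> * A (r j) \<omega>) \<longlonglongrightarrow> 0"
  proof (rule AE_tendsto_0_of_fast)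
    show "(\<integral>\<^sup>+\<omega>. indicator {0..<1} \<omega> * A (r j) \<omega> \<partial>lborel) \<le> ennreal ((1/2) ^ j)" for j
      by (rule order_trans[OF _ fast[of j]]) (simp add: add_increasing2)
  qed measurable
  have ae2: "AE \<omega> in lborel. (\<lambda>j. indicator {0..<1} \<omega> * ennreal \<bar>X0 (r j) (a + h (r j) * \<omega>) - x0\<bar>) \<longlonglongrightarrow> 0"
  proof (rule AE_tendsto_0_of_fast)
    show "(\<integral>\<^sup>+\<omega>. indicator {0..<1} \<omega> * ennreal \<bar>X0 (r j) (a + h (r j) * \<omega>) - x0\<bar> \<partial>lborel) \<le> ennreal ((1/2) ^ j)" for j
      by (rule order_trans[OF _ fast[of j]]) (simp add: add_increasing add_increasing2)
    show "(\<lambda>\<omega>. indicator {0..<1} \<omega> * ennreal \<bar>X0 (r j) (a + h (r j) * \<omega>) - x0\<bar>) \<in> borel_measurable lborel" for j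
      using X0_phase_measurable[OF r1(1)] by simp
  qed
  have ae3: "AE \<omega> in lborel. (\<lambda>j. indicator {0..<1} \<omega> * D s (r j) \<omega>) \<longlonglongrightarrow> 0" if s: "s \<in> {s. a < s \<and> s < b \<and> J s \<noteq> 0}" for s
  proof -
    \<comment> \<open>\<open>round_up_average\<close> requires \<open>1 / n \<le> s - a\<close>;
      setting the finitely many other terms to 0 does not change the limit.\<close>
    define D' where "D' j \<omega> = (if 1 / real (r j) \<le> s - a then indicator {0..<1} \<omega> * D s (r j) \<omega> else 0)" for j \<omega>
    have "AE \<omega> in lborel. (\<lambda>j. D' j \<omega>) \<longlonglongrightarrow> 0"
    proof (rule AE_tendsto_0_of_fast)
      fix j
      note [measurable] = round_up_joint_measurable[OF r1(1)[of j], of s]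
      have "D s (r j) \<in> borel_measurable borel" unfolding D_def[abs_def] by measurable
      then show "D' j \<in> borel_measurable lborel" unfolding D'_def[abs_def] by measurable
      show "(\<integral>\<^sup>+\<omega>. D' j \<omega> \<partial>lborel) \<le> ennreal ((1/2) ^ j)"
      proof (cases "1 / real (r j) \<le> s - a")
        case True
        have "pe (r j) = phase_error \<sigma> (r j)" using s by (auto simp: pe_def)
        moreover have "(\<integral>\<^sup>+\<omega>. D' j \<omega> \<partial>lborel) = phase_error \<sigma> (r j)"
          using round_up_average[OF r1(1) True \<sigma>m] True by (simp add: D'_def D_def)
        moreover have "pe (r j) \<le> ennreal ((1/2) ^ j)"
          by (rule order_trans[OF _ fast[of j]]) (simp add: add_increasing)
        ultimately show ?thesis by simp
      qed (simp add: D'_def)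
    qed
    moreover have "\<forall>\<^sub>F j in sequentially. 1 / real (r j) \<le> s - a"
    proof -
      have "(\<lambda>j. 1 / real (r j)) \<longlonglongrightarrow> 0" using LIMSEQ_subseq_LIMSEQ[OF lim_inverse_n' r] by (simp add: o_def)
      then have "\<forall>\<^sub>F j in sequentially. 1 / real (r j) < s - a" using s by (intro order_tendstoD(2)) auto
      then show ?thesis by eventually_elim simp
    qed
    ultimately show ?thesis
    proof (elim eventually_mono)
      fix \<omega> assume ev: "\<forall>\<^sub>F j in sequentially. 1 / real (r j) \<le> s - a" and l: "(\<lambda>j. D' j \<omega>) \<longlonglongrightarrow> 0"
      have "\<forall>\<^sub>F j in sequentially. D' j \<omega> = indicator {0..<1} \<omega> * D s (r j) \<omega>" using ev by eventually_elim (simp add: D'_def)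
      with l show "(\<lambda>j. indicator {0..<1} \<omega> * D s (r j) \<omega>) \<longlonglongrightarrow> 0" by (rule Lim_transform_eventually)
    qed
  qed
  have ae3': "AE \<omega> in lborel. \<forall>s\<in>{s. a < s \<and> s < b \<and> J s \<noteq> 0}. (\<lambda>j. indicator {0..<1} \<omega> * D s (r j) \<omega>) \<longlonglongrightarrow> 0"
    using ae3 by (subst AE_ball_countable[OF jumps_countable]) blast
  have "AE \<omega> in lborel. \<omega> \<in> {0..<1} \<longrightarrow> (\<lambda>j. A (r j) \<omega>) \<longlonglongrightarrow> 0 \<and> (\<lambda>j. ennreal \<bar>X0 (r j) (a + h (r j) * \<omega>) - x0\<bar>) \<longlonglongrightarrow> 0 \<and>
      (\<forall>s\<in>{s. a < s \<and> s < b \<and> J s \<noteq> 0}. (\<lambda>j. D s (r j) \<omega>) \<longlonglongrightarrow> 0)"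
    using ae1 ae2 ae3' by eventually_elim auto
  then obtain \<omega> where \<omega>: "\<omega> \<in> {0..<1}" "(\<lambda>j. A (r j) \<omega>) \<longlonglongrightarrow> 0" "(\<lambda>j. ennreal \<bar>X0 (r j) (a + h (r j) * \<omega>) - x0\<bar>) \<longlonglongrightarrow> 0"
      "\<And>s. a < s \<Longrightarrow> s < b \<Longrightarrow> J s \<noteq> 0 \<Longrightarrow> (\<lambda>j. D s (r j) \<omega>) \<longlonglongrightarrow> 0"
    by (rule AE_lborel_obtain) auto
  obtain r2 where r2: "strict_mono r2" and ae: "AE t in lborel. t \<in> {a..<b} \<longrightarrow>
    (\<lambda>j. X (r (r2 j)) (grid_point a (h (r (r2 j))) \<omega> (grid_index a (h (r (r2 j))) \<omega> t))) \<longlonglongrightarrow> x t"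
    by (rule phase_subsequence_ae[where u=u and v=v and x=x and N=N and X=X and r=r and \<omega>=\<omega>,
          OF u vm v_eq u_eq r r1 \<omega>(1) \<omega>(2)[unfolded A_def]])
  have X0l: "(\<lambda>j. X0 (r (r2 j)) (a + h (r (r2 j)) * \<omega>)) \<longlonglongrightarrow> x0"
  proof -
    have "(\<lambda>j. ennreal \<bar>X0 (r j) (a + h (r j) * \<omega>) - x0\<bar>) \<longlonglongrightarrow> ennreal 0" using \<omega>(3) by simp
    then have "(\<lambda>j. \<bar>X0 (r j) (a + h (r j) * \<omega>) - x0\<bar>) \<longlonglongrightarrow> 0" by (subst (asm) tendsto_ennreal_iff) auto
    then have "(\<lambda>j. X0 (r j) (a + h (r j) * \<omega>)) \<longlonglongrightarrow> x0" by (rule LIM_zero_cancel[OF tendsto_rabs_zero_cancel])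
    from LIMSEQ_subseq_LIMSEQ[OF this r2] show ?thesis by (simp add: o_def)
  qed
  show ?thesis
  proof (rule that[of \<omega> "\<lambda>j. r (r2 j)"])
    show "phase_limit a b L h \<rho> \<rho>2 X0 f C K \<omega> (\<lambda>j. r (r2 j)) X x x0"
      using \<omega>(1) strict_mono_o[OF r r2] r1 sol X0l ae
      by unfold_locales (auto simp: o_def)
    fix s assume s: "a < s" "s < b" "J s \<noteq> 0"
    have eq: "D s (r j) \<omega> = ennreal (LINT u:{0<..<1}|lborel. \<bar>mollify1.round_up (r j) (\<rho> (r j)) a (h (r j)) s \<omega> u - \<sigma> u\<bar>)" for j
    proof -
      interpret M: mollify1 "r j" "\<rho> (r j)" by (rule mollify1[OF r1(1)])
      have [measurable]: "M.round_up a (h (r j)) s \<omega> \<in> borel_measurable borel" by (rule M.round_up_measurable[OF h_pos[OF r1(1)]])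
      have "set_integrable lborel {0<..<1} (\<lambda>u. \<bar>M.round_up a (h (r j)) s \<omega> u - \<sigma> u\<bar>)"
      proof (rule set_integral_bounded(1)[where M=1])
        fix u :: real assume u: "u \<in> {0<..<1}"
        show "\<bar>\<bar>M.round_up a (h (r j)) s \<omega> u - \<sigma> u\<bar>\<bar> \<le> 1"
          using \<sigma>01[OF u] M.round_up_bounds[of a "h (r j)" s \<omega> u] by auto
      qed auto
      then have "(\<integral>\<^sup>+u. ennreal (indicator {0<..<1} u *\<^sub>R \<bar>M.round_up a (h (r j)) s \<omega> u - \<sigma> u\<bar>) \<partial>lborel) =
         ennreal (LINT u:{0<..<1}|lborel. \<bar>M.round_up a (h (r j)) s \<omega> u - \<sigma> u\<bar>)"
        unfolding set_integrable_def set_lebesgue_integral_def by (intro nn_integral_eq_integral) auto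
      then show ?thesis unfolding D_def by (simp add: ennreal_mult' ennreal_indicator)
    qed
    have "(\<lambda>j. ennreal (LINT u:{0<..<1}|lborel. \<bar>mollify1.round_up (r j) (\<rho> (r j)) a (h (r j)) s \<omega> u - \<sigma> u\<bar>)) \<longlonglongrightarrow> ennreal 0"
      using \<omega>(4)[OF s] unfolding eq by simp
    then have "(\<lambda>j. LINT u:{0<..<1}|lborel. \<bar>mollify1.round_up (r j) (\<rho> (r j)) a (h (r j)) s \<omega> u - \<sigma> u\<bar>) \<longlonglongrightarrow> 0"
      by (subst (asm) tendsto_ennreal_iff) (auto simp: set_lebesgue_integral_def intro!: Bochner_Integration.integral_nonneg)
    from LIMSEQ_subseq_LIMSEQ[OF this r2]
    show "(\<lambda>j. LINT u:{0<..<1}|lborel. \<bar>mollify1.round_up (r (r2 j)) (\<rho> (r (r2 j))) a (h (r (r2 j))) s \<omega> u - \<sigma> u\<bar>) \<longlonglongrightarrow> 0"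
      by (simp add: o_def)
  qed
qed

end

section \<open>Convergence of the partitions at a jump\<close>

context scheme_data
begin

abbreviation "Gp n \<omega> t \<equiv> grid_point a (h n) \<omega> (grid_index a (h n) \<omega> t)"

text \<open>If the scheme is periodic beyond \<open>c0\<close>, its limit does not depend on the phase, hence is
  constant there.\<close>

lemma phase_constant:
  assumes L1: "L1_converges {a..b} X x" and c0: "a \<le> c0" "c0 < b"
    and H: "\<And>n \<omega> t. N0 \<le> n \<Longrightarrow> 0 \<le> \<omega> \<Longrightarrow> \<omega> < 1 \<Longrightarrow> c0 \<le> t \<Longrightarrow> t + h n \<le> b \<Longrightarrow> X n (Gp n \<omega> t) = X n (Gp n \<omega> c0)"
  shows "\<exists>c. (AE t in lborel. t \<in> {c0..<b} \<longrightarrow> x t = c) \<and>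
    (\<lambda>n. \<integral>\<^sup>+\<omega>. indicator {0..<1} \<omega> * ennreal \<bar>X n (Gp n \<omega> c0) - c\<bar> \<partial>lborel) \<longlonglongrightarrow> 0 \<and>
    (\<forall>\<^sub>F n in sequentially. (\<lambda>\<omega>. indicator {0..<1} \<omega> * ennreal \<bar>X n (Gp n \<omega> c0) - c\<bar>) \<in> borel_measurable borel)"
proof -
  obtain u v N where u [measurable]: "\<And>n::nat. u n \<in> borel_measurable borel" and v: "integrable lborel v"
    and conv: "(\<lambda>n. \<integral>\<^sup>+t. ennreal \<bar>u n t - v t\<bar> \<partial>lborel) \<longlonglongrightarrow> 0"
    and v_eq: "\<And>t. v t = indicator {a..b} t * x t" and u_eq: "\<And>n t. N \<le> n \<Longrightarrow> u n t = indicator {a..b} t * X n t"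
    by (rule L1_converges_ennreal[OF L1]) auto
  have vm [measurable]: "v \<in> borel_measurable borel" using v by auto
  define A where "A n \<omega> = (\<integral>\<^sup>+t. indicator {a..} t * ennreal \<bar>u n (Gp n \<omega> t) - v t\<bar> \<partial>lborel)" for n \<omega>
  have Am [measurable]: "A n \<in> borel_measurable borel" for n unfolding A_def[abs_def] by measurable
  have Alim: "(\<lambda>n. \<integral>\<^sup>+\<omega>. indicator {0..<1} \<omega> * A n \<omega> \<partial>lborel) \<longlonglongrightarrow> 0"
    unfolding A_def by (rule grid_L1[OF u v conv h_pos h_lim])
  have G: "t \<le> Gp n \<omega> t" "Gp n \<omega> t < t + h n" if "1 \<le> n" "a \<le> t" "0 \<le> \<omega>" "\<omega> < 1" for n t \<omega>
    using grid_index_bounds[OF h_pos[OF that(1)] that(2-4)] by auto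
  from fast_subsequence[OF Alim, of "max 1 (max N N0)"] obtain r where r: "strict_mono r"
    and rj: "\<forall>j. max 1 (max N N0) \<le> r j \<and> (\<integral>\<^sup>+\<omega>. indicator {0..<1} \<omega> * A (r j) \<omega> \<partial>lborel) \<le> ennreal ((1/2) ^ j)"
    by (elim exE conjE)
  have r1: "1 \<le> r j" "N \<le> r j" "N0 \<le> r j" for j using rj[rule_format, of j] by auto
  have "AE \<omega> in lborel. (\<lambda>j. indicator {0..<1} \<omega> * A (r j) \<omega>) \<longlonglongrightarrow> 0"
    by (rule AE_tendsto_0_of_fast, measurable) (rule rj[rule_format, THEN conjunct2])
  then have "AE \<omega> in lborel. \<omega> \<in> {0..<1} \<longrightarrow> (\<lambda>j. A (r j) \<omega>) \<longlonglongrightarrow> 0" by eventually_elim auto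
  then obtain \<omega> where \<omega>: "\<omega> \<in> {0..<1}" "(\<lambda>j. A (r j) \<omega>) \<longlonglongrightarrow> 0" by (rule AE_lborel_obtain) auto
  obtain r2 where r2: "strict_mono r2" and ae: "AE t in lborel. t \<in> {a..<b} \<longrightarrow> (\<lambda>j. X (r (r2 j)) (Gp (r (r2 j)) \<omega> t)) \<longlonglongrightarrow> x t"
    by (rule phase_subsequence_ae[where u=u and v=v and x=x and N=N and X=X and r=r and \<omega>=\<omega>,
          OF u vm v_eq u_eq r r1(1,2) \<omega>(1) \<omega>(2)[unfolded A_def]])
  let ?W = "\<lambda>j. X (r (r2 j)) (Gp (r (r2 j)) \<omega> c0)"
  have hr: "(\<lambda>j. h (r (r2 j))) \<longlonglongrightarrow> 0"
    using LIMSEQ_subseq_LIMSEQ[OF h_lim strict_mono_o[OF r r2]] by (simp add: o_def)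
  have aeW: "AE t in lborel. t \<in> {c0..<b} \<longrightarrow> ?W \<longlonglongrightarrow> x t"
    using ae
  proof (eventually_elim, intro impI)
    fix t assume l: "t \<in> {a..<b} \<longrightarrow> (\<lambda>j. X (r (r2 j)) (Gp (r (r2 j)) \<omega> t)) \<longlonglongrightarrow> x t" and t: "t \<in> {c0..<b}"
    have "\<forall>\<^sub>F j in sequentially. h (r (r2 j)) < b - t" using order_tendstoD(2)[OF hr, of "b - t"] t by simp
    then have "\<forall>\<^sub>F j in sequentially. X (r (r2 j)) (Gp (r (r2 j)) \<omega> t) = ?W j"
    proof eventually_elim
      case (elim j)
      show ?case by (rule H[OF r1(3)]) (use elim t \<omega>(1) in auto)
    qed
    moreover have "(\<lambda>j. X (r (r2 j)) (Gp (r (r2 j)) \<omega> t)) \<longlonglongrightarrow> x t" using l t c0 by auto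
    ultimately show "?W \<longlonglongrightarrow> x t" by (rule Lim_transform_eventually[rotated])
  qed
  obtain t0 where t0: "t0 \<in> {c0..<b}" "?W \<longlonglongrightarrow> x t0" by (rule AE_lborel_obtain[OF aeW c0(2)])
  define c where "c = x t0"
  have xc: "AE t in lborel. t \<in> {c0..<b} \<longrightarrow> x t = c"
    using aeW by eventually_elim (use t0 LIMSEQ_unique in \<open>auto simp: c_def\<close>)
  \<comment> \<open>Up to \<open>c1\<close> a full step of length \<open>h n\<close> still fits
    before \<open>b\<close> for large \<open>n\<close>.\<close>
  define c1 where "c1 = (c0 + b) / 2"
  have c1: "c0 < c1" "c1 < b" using c0 by (auto simp: c1_def)
  have "\<forall>\<^sub>F n in sequentially. h n < b - c1" using order_tendstoD(2)[OF h_lim, of "b - c1"] c1 by simp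
  moreover have "\<forall>\<^sub>F n in sequentially. max 1 (max N N0) \<le> n" by (rule eventually_ge_at_top)
  ultimately have big: "\<forall>\<^sub>F n in sequentially. h n < b - c1 \<and> max 1 (max N N0) \<le> n" by (rule eventually_conj)
  have W_eq: "indicator {0..<1} \<omega> * ennreal \<bar>X n (Gp n \<omega> c0) - c\<bar> = indicator {0..<1} \<omega> * ennreal \<bar>u n (Gp n \<omega> c0) - c\<bar>"
    if n: "h n < b - c1 \<and> max 1 (max N N0) \<le> n" for n \<omega>
    using G[of n c0 \<omega>] n c0 c1 u_eq[of n "Gp n \<omega> c0"] by (cases "\<omega> \<in> {0..<1}") auto
  have meas: "(\<lambda>\<omega>. indicator {0..<1} \<omega> * ennreal \<bar>X n (Gp n \<omega> c0) - c\<bar>) \<in> borel_measurable borel"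
    if n: "h n < b - c1 \<and> max 1 (max N N0) \<le> n" for n
  proof -
    have "(\<lambda>\<omega>. (\<lambda>(\<omega>, t). Gp n \<omega> t) (\<omega>, c0)) \<in> borel_measurable borel" by measurable
    then have [measurable]: "(\<lambda>\<omega>. Gp n \<omega> c0) \<in> borel_measurable borel" by simp
    show ?thesis unfolding W_eq[OF n] by measurable
  qed
  \<comment> \<open>On \<open>{c0..<c1}\<close> both the scheme along the phase and the limit are
    constant in \<open>t\<close>, so the L1 error over that interval is its length times the
    deviation of the phase.\<close>
  have bound: "(\<integral>\<^sup>+\<omega>. indicator {0..<1} \<omega> * ennreal \<bar>X n (Gp n \<omega> c0) - c\<bar> \<partial>lborel)
     \<le> ennreal (1 / (c1 - c0)) * (\<integral>\<^sup>+\<omega>. indicator {0..<1} \<omega> * A n \<omega> \<partial>lborel)"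
    if n: "h n < b - c1 \<and> max 1 (max N N0) \<le> n" for n
  proof -
    have "(\<integral>\<^sup>+\<omega>. indicator {0..<1} \<omega> * ennreal \<bar>X n (Gp n \<omega> c0) - c\<bar> \<partial>lborel)
      \<le> (\<integral>\<^sup>+\<omega>. ennreal (1 / (c1 - c0)) * (indicator {0..<1} \<omega> * A n \<omega>) \<partial>lborel)"
    proof (rule nn_integral_mono)
      fix \<omega> :: real
      show "indicator {0..<1} \<omega> * ennreal \<bar>X n (Gp n \<omega> c0) - c\<bar> \<le> ennreal (1 / (c1 - c0)) * (indicator {0..<1} \<omega> * A n \<omega>)"
      proof (cases "\<omega> \<in> {0..<1}")
        case True
        let ?w = "ennreal \<bar>X n (Gp n \<omega> c0) - c\<bar>"
        have "ennreal (c1 - c0) * ?w = (\<integral>\<^sup>+t. indicator {c0..<c1} t * ?w \<partial>lborel)"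
          using c1 by (subst nn_integral_multc) auto
        also have "\<dots> \<le> A n \<omega>" unfolding A_def
        proof (rule nn_integral_mono_AE)
          show "AE t in lborel. indicator {c0..<c1} t * ?w \<le> indicator {a..} t * ennreal \<bar>u n (Gp n \<omega> t) - v t\<bar>"
            using xc
          proof eventually_elim
            case (elim t)
            show ?case
            proof (cases "t \<in> {c0..<c1}")
              case t: True
              have "X n (Gp n \<omega> t) = X n (Gp n \<omega> c0)" using n t True by (intro H) auto
              moreover have "Gp n \<omega> t \<in> {a..b}" using G[of n t \<omega>] n t True c0 by auto
              ultimately show ?thesis using elim t c0 c1 n u_eq[of n "Gp n \<omega> t"] v_eq[of t] by auto
            qed simp
          qed
        qed
        finally have "ennreal (1 / (c1 - c0)) * (ennreal (c1 - c0) * ?w) \<le> ennreal (1 / (c1 - c0)) * A n \<omega>"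
          by (intro mult_left_mono) auto
        moreover have "ennreal (1 / (c1 - c0)) * (ennreal (c1 - c0) * ?w) = ?w"
          using c1 by (simp add: mult.assoc[symmetric] ennreal_mult'[symmetric])
        ultimately show ?thesis using True by simp
      qed simp
    qed
    also have "\<dots> = ennreal (1 / (c1 - c0)) * (\<integral>\<^sup>+\<omega>. indicator {0..<1} \<omega> * A n \<omega> \<partial>lborel)"
      by (rule nn_integral_cmult) measurable
    finally show ?thesis .
  qed
  have "(\<lambda>n. ennreal (1 / (c1 - c0)) * (\<integral>\<^sup>+\<omega>. indicator {0..<1} \<omega> * A n \<omega> \<partial>lborel)) \<longlonglongrightarrow> ennreal (1 / (c1 - c0)) * 0"
    by (intro tendsto_mult_ennreal Alim tendsto_const) auto
  then have lim0: "(\<lambda>n. ennreal (1 / (c1 - c0)) * (\<integral>\<^sup>+\<omega>. indicator {0..<1} \<omega> * A n \<omega> \<partial>lborel)) \<longlonglongrightarrow> 0" by simp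
  have "(\<lambda>n. \<integral>\<^sup>+\<omega>. indicator {0..<1} \<omega> * ennreal \<bar>X n (Gp n \<omega> c0) - c\<bar> \<partial>lborel) \<longlonglongrightarrow> 0"
    by (rule tendsto_sandwich[OF _ _ tendsto_const lim0]) (use big bound in \<open>auto elim!: eventually_mono\<close>)
  moreover have "\<forall>\<^sub>F n in sequentially. (\<lambda>\<omega>. indicator {0..<1} \<omega> * ennreal \<bar>X n (Gp n \<omega> c0) - c\<bar>) \<in> borel_measurable borel"
    using big by eventually_elim (rule meas)
  ultimately show ?thesis using xc by blast
qed

text \<open>For the coefficient 0 the scheme extends its initial function periodically, so its limit
  is constant from \<open>a\<close> on by \<open>phase_constant\<close>. That constant is
  \<open>x0\<close>, in the phase average as well as in the form with \<open>tau\<close>.\<close>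

lemma initial_limit:
  assumes sol: "\<And>n. n \<ge> 1 \<Longrightarrow> scheme_solution a b L h \<rho> \<rho>2 X0 (\<lambda>_. 0) n (X n)"
    and L1: "L1_converges {a..b} X x"
  shows "\<exists>x0. (\<lambda>n. \<integral>\<^sup>+\<omega>. indicator {0..<1} \<omega> * ennreal \<bar>X0 n (a + h n * \<omega>) - x0\<bar> \<partial>lborel) \<longlonglongrightarrow> 0 \<and>
     (\<lambda>n. LINT t:{a..b}|lborel. \<bar>X0 n (tau a (h n) t) - x0\<bar>) \<longlonglongrightarrow> 0"
proof -
  have coeff: "coefficient a b L h \<rho> \<rho>2 X0 (\<lambda>_. 0) 0 0" by unfold_locales auto
  have step: "X n (t + h n) = X n t" if "1 \<le> n" "a \<le> t" for n t
  proof -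
    have "mollify_f b \<rho>2 (\<lambda>_. 0) n t (X n t) = 0" by (simp add: mollify_f_def set_lebesgue_integral_def)
    moreover have "X n (t + h n) - X n t = mollify_f b \<rho>2 (\<lambda>_. 0) n t (X n t) * (mollify_L a b \<rho> L n (t + h n) - mollify_L a b \<rho> L n t)"
      using sol[OF that(1)] that(2) unfolding scheme_solution_def by blast
    ultimately show ?thesis by simp
  qed
  have per: "X n (t + real m * h n) = X0 n t" if n: "1 \<le> n" and t: "a \<le> t" "t < a + h n" for n t m
  proof (induction m)
    case 0
    then show ?case using sol[OF n] t by (simp add: scheme_solution_def)
  next
    case (Suc m)
    have "a \<le> t + real m * h n" using t h_pos[OF n] by (simp add: add_increasing2)
    then show ?case using step[OF n, of "t + real m * h n"] Suc by (simp add: algebra_simps)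
  qed
  have W: "X n (Gp n \<omega> t) = X0 n (a + h n * \<omega>)" if "1 \<le> n" "0 \<le> \<omega>" "\<omega> < 1" for n \<omega> t
    using per[of n "a + h n * \<omega>" "grid_index a (h n) \<omega> t"] h_pos[of n] that by (simp add: grid_point_def algebra_simps)
  have "X n (Gp n \<omega> t) = X n (Gp n \<omega> a)" if "1 \<le> n" "0 \<le> \<omega>" "\<omega> < 1" for n \<omega> t
    by (simp only: W[OF that])
  from phase_constant[OF L1 order_refl ab', of 1, OF this]
  obtain c where c: "AE t in lborel. t \<in> {a..<b} \<longrightarrow> x t = c"
    "(\<lambda>n. \<integral>\<^sup>+\<omega>. indicator {0..<1} \<omega> * ennreal \<bar>X n (Gp n \<omega> a) - c\<bar> \<partial>lborel) \<longlonglongrightarrow> 0" by blast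
  have "\<forall>\<^sub>F n in sequentially. (\<integral>\<^sup>+\<omega>. indicator {0..<1} \<omega> * ennreal \<bar>X n (Gp n \<omega> a) - c\<bar> \<partial>lborel)
     = (\<integral>\<^sup>+\<omega>. indicator {0..<1} \<omega> * ennreal \<bar>X0 n (a + h n * \<omega>) - c\<bar> \<partial>lborel)"
    using eventually_ge_at_top[of 1]
  proof eventually_elim
    case (elim n)
    show ?case by (intro nn_integral_cong) (use W[OF elim] in \<open>auto split: split_indicator\<close>)
  qed
  then have 1: "(\<lambda>n. \<integral>\<^sup>+\<omega>. indicator {0..<1} \<omega> * ennreal \<bar>X0 n (a + h n * \<omega>) - c\<bar> \<partial>lborel) \<longlonglongrightarrow> 0"
    using c(2) by (rule Lim_transform_eventually[rotated])
  have tau: "X n t = X0 n (tau a (h n) t)" if n: "1 \<le> n" and t: "a \<le> t" for n t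
  proof -
    let ?m = "nat \<lfloor>(t - a) / h n\<rfloor>"
    have hn: "h n > 0" by (rule h_pos[OF n])
    have "0 \<le> (t - a) / h n" using t hn by simp
    then have m: "real ?m = of_int \<lfloor>(t - a) / h n\<rfloor>" by simp
    have "real ?m \<le> (t - a) / h n" "(t - a) / h n < real ?m + 1" unfolding m by linarith+
    then have "real ?m * h n \<le> t - a" "t - a < (real ?m + 1) * h n" using hn by (simp_all add: field_simps)
    then have "a \<le> tau a (h n) t" "tau a (h n) t < a + h n" by (auto simp: tau_def algebra_simps)
    from per[OF n this, of ?m] show ?thesis by (simp add: tau_def)
  qed
  have eq: "\<forall>\<^sub>F n in sequentially. (LINT t:{a..b}|lborel. \<bar>X n t - x t\<bar>) = (LINT t:{a..b}|lborel. \<bar>X0 n (tau a (h n) t) - c\<bar>)"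
  proof -
    have "\<forall>\<^sub>F n in sequentially. set_integrable lborel {a..b} (X n) \<and> 1 \<le> n"
      using L1 eventually_ge_at_top[of 1] unfolding L1_converges_def by (intro eventually_conj) auto
    then show ?thesis
    proof eventually_elim
      case (elim n)
      have ae: "AE t in lborel. t \<noteq> b" by (rule AE_lborel_singleton)
      have m1: "(\<lambda>t. indicator {a..b} t *\<^sub>R \<bar>X n t - x t\<bar>) \<in> borel_measurable lborel"
        using borel_measurable_integrable[OF set_integrable_abs[OF set_integral_diff(1)[of lborel "{a..b}" "X n" x], unfolded set_integrable_def]] elim L1
        unfolding L1_converges_def set_integrable_def by auto
      have "set_integrable lborel {a..b} (\<lambda>_. c)"
        by (rule set_integral_bounded(1)[where M="\<bar>c\<bar>"]) (use ab' in auto)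
      then have m2: "(\<lambda>t. indicator {a..b} t *\<^sub>R \<bar>X n t - c\<bar>) \<in> borel_measurable lborel"
        using borel_measurable_integrable[OF set_integrable_abs[OF set_integral_diff(1)[of lborel "{a..b}" "X n" "\<lambda>_. c"], unfolded set_integrable_def]] elim
        unfolding set_integrable_def by auto
      have "(LINT t:{a..b}|lborel. \<bar>X n t - x t\<bar>) = (LINT t:{a..b}|lborel. \<bar>X n t - c\<bar>)"
        unfolding set_lebesgue_integral_def
      proof (rule integral_cong_AE[OF m1 m2])
        show "AE t in lborel. indicator {a..b} t *\<^sub>R \<bar>X n t - x t\<bar> = indicator {a..b} t *\<^sub>R \<bar>X n t - c\<bar>"
          using c(1) ae by eventually_elim (auto split: split_indicator)
      qed
      also have "\<dots> = (LINT t:{a..b}|lborel. \<bar>X0 n (tau a (h n) t) - c\<bar>)"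
        by (rule set_lebesgue_integral_cong) (use tau elim in auto)
      finally show ?case .
    qed
  qed
  have "(\<lambda>n. LINT t:{a..b}|lborel. \<bar>X n t - x t\<bar>) \<longlonglongrightarrow> 0" using L1 by (simp add: L1_converges_def)
  then have "(\<lambda>n. LINT t:{a..b}|lborel. \<bar>X0 n (tau a (h n) t) - c\<bar>) \<longlonglongrightarrow> 0" using eq by (rule Lim_transform_eventually)
  with 1 show ?thesis by blast
qed

end

context coefficient
begin

lemma mollify_f_range:
  assumes n: "n \<ge> 1" and t: "t \<ge> a"
    and b: "\<And>p q. 0 \<le> p \<Longrightarrow> p \<le> 1 / real n \<Longrightarrow> lo \<le> f (min (t + p) b, x + q) \<and> f (min (t + p) b, x + q) \<le> hi"
  shows "lo \<le> mollify_f b \<rho>2 f n t x" "mollify_f b \<rho>2 f n t x \<le> hi"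
proof -
  have 1: "lo \<le> f (min (t + fst p) b, x + snd p) \<and> f (min (t + fst p) b, x + snd p) \<le> hi"
    if "p \<in> {0..1 / real n} \<times> {0..1 / real n}" for p using that by (intro b) auto
  show "lo \<le> mollify_f b \<rho>2 f n t x" "mollify_f b \<rho>2 f n t x \<le> hi"
    using mollifier_average(2,3)[OF \<rho>2_moll[OF n] f_window_measurable[OF n t, of x] window_sets 1]
    unfolding mollify_f_def by auto
qed

end

context grid
begin

text \<open>The terminal value of the Euler scheme for \<open>1 + \<epsilon> g\<close> is, to first order in \<open>\<epsilon>\<close>, a Riemann sum
  of \<open>g\<close> over the partition, which reveals the partition.\<close>

lemma bump_estimate:
  assumes s: "a < s" "s \<le> b" and B: "\<And>k. \<bar>fn (tk k) (w k)\<bar> \<le> B"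
    and f: "\<And>v. J s * f (s, v) = 1 + \<epsilon> * g (v - x0)"
    and g01: "\<And>v. 0 \<le> g v \<and> g v \<le> 1" and gl: "\<And>p q. \<bar>g p - g q\<bar> \<le> G * \<bar>p - q\<bar>"
    and e: "0 \<le> \<epsilon>" and G0: "0 \<le> G"
    and ij: "i \<le> j" "uk s i = 0" "uk s j = 1" and E: "(\<Sum>k=i..<j. jump_error B s k) \<le> E"
  shows "\<bar>w j - x0 - 1 - \<epsilon> * (\<Sum>k=i..<j. g (uk s k) * (uk s (Suc k) - uk s k))\<bar>
    \<le> \<bar>w i - x0\<bar> + E + \<epsilon> * G * (\<epsilon> + E + \<bar>w i - x0\<bar>)"
proof -
  let ?d = "\<lambda>k. uk s (Suc k) - uk s k"
  let ?z = "\<lambda>k. 1 + \<epsilon> * g (w k - x0)"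
  have d0: "0 \<le> ?d k" for k using uk_mono[of k "Suc k"] by simp
  have st: "\<bar>w (Suc k) - w k - ?z k * ?d k\<bar> \<le> jump_error B s k" for k
    using w_jump_step[OF s B, of k] unfolding f by simp
  have je0: "0 \<le> jump_error B s k" for k using st[of k] by linarith
  have tel: "(\<Sum>k=i..<m. ?d k) = uk s m" if "i \<le> m" for m
    using sum_Suc_diff'[OF that, of "uk s"] ij by simp
  have part: "\<bar>w m - w i - (\<Sum>k=i..<m. ?z k * ?d k)\<bar> \<le> (\<Sum>k=i..<m. jump_error B s k)" if "i \<le> m" for m
  proof -
    have "w m - w i - (\<Sum>k=i..<m. ?z k * ?d k) = (\<Sum>k=i..<m. w (Suc k) - w k - ?z k * ?d k)"
      using sum_Suc_diff'[OF that, of w] by (simp add: sum_subtractf)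
    then have "\<bar>w m - w i - (\<Sum>k=i..<m. ?z k * ?d k)\<bar> \<le> (\<Sum>k=i..<m. \<bar>w (Suc k) - w k - ?z k * ?d k\<bar>)"
      by (simp only: sum_abs)
    also have "\<dots> \<le> (\<Sum>k=i..<m. jump_error B s k)" by (intro sum_mono st)
    finally show ?thesis .
  qed
  have zsum: "(\<Sum>k=i..<m. ?z k * ?d k) = uk s m + \<epsilon> * (\<Sum>k=i..<m. g (w k - x0) * ?d k)" if "i \<le> m" for m
    using tel[OF that] by (simp add: distrib_right sum.distrib sum_distrib_left mult.assoc)
  have gs: "0 \<le> (\<Sum>k=i..<m. g (w k - x0) * ?d k)" "(\<Sum>k=i..<m. g (w k - x0) * ?d k) \<le> 1" if "i \<le> m" for m
  proof -
    show "0 \<le> (\<Sum>k=i..<m. g (w k - x0) * ?d k)" using g01 d0 by (intro sum_nonneg mult_nonneg_nonneg) auto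
    have "(\<Sum>k=i..<m. g (w k - x0) * ?d k) \<le> (\<Sum>k=i..<m. ?d k)" using g01 d0 by (intro sum_mono mult_left_le_one_le) auto
    then show "(\<Sum>k=i..<m. g (w k - x0) * ?d k) \<le> 1" using tel[OF that] tail_bounds(2)[of "s - tk m"] by linarith
  qed
  \<comment> \<open>To leading order the coefficient is 1, so \<open>w k - x0\<close> follows the
    completed fraction \<open>uk s k\<close> up to \<open>\<epsilon>\<close> and the errors.
    Evaluating \<open>g\<close> at the latter instead costs \<open>G\<close> times this distance,
    and the outer factor \<epsilon> makes it second order.\<close>
  have near: "\<bar>w k - x0 - uk s k\<bar> \<le> \<epsilon> + E + \<bar>w i - x0\<bar>" if k: "i \<le> k" "k < j" for k
  proof -
    have "(\<Sum>m=i..<k. jump_error B s m) \<le> (\<Sum>m=i..<j. jump_error B s m)"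
      using k je0 by (intro sum_mono2) auto
    then have 1: "\<bar>w k - w i - (uk s k + \<epsilon> * (\<Sum>m=i..<k. g (w m - x0) * ?d m))\<bar> \<le> E"
      using part[OF k(1)] E zsum[OF k(1)] by linarith
    have "\<epsilon> * (\<Sum>m=i..<k. g (w m - x0) * ?d m) \<le> \<epsilon> * 1" using gs(2)[OF k(1)] e by (intro mult_left_mono)
    moreover have "0 \<le> \<epsilon> * (\<Sum>m=i..<k. g (w m - x0) * ?d m)" using gs(1)[OF k(1)] e by simp
    ultimately show ?thesis using 1 by linarith
  qed
  have "\<bar>(\<Sum>k=i..<j. g (w k - x0) * ?d k) - (\<Sum>k=i..<j. g (uk s k) * ?d k)\<bar> = \<bar>\<Sum>k=i..<j. (g (w k - x0) - g (uk s k)) * ?d k\<bar>"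
    by (simp add: sum_subtractf left_diff_distrib)
  also have "\<dots> \<le> (\<Sum>k=i..<j. \<bar>(g (w k - x0) - g (uk s k)) * ?d k\<bar>)" by (rule sum_abs)
  also have "\<dots> \<le> (\<Sum>k=i..<j. G * (\<epsilon> + E + \<bar>w i - x0\<bar>) * ?d k)"
  proof (rule sum_mono)
    fix k assume k: "k \<in> {i..<j}"
    have "\<bar>g (w k - x0) - g (uk s k)\<bar> \<le> G * \<bar>w k - x0 - uk s k\<bar>" by (rule gl)
    also have "\<dots> \<le> G * (\<epsilon> + E + \<bar>w i - x0\<bar>)" using near[of k] k G0 by (intro mult_left_mono) auto
    finally show "\<bar>(g (w k - x0) - g (uk s k)) * ?d k\<bar> \<le> G * (\<epsilon> + E + \<bar>w i - x0\<bar>) * ?d k"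
      unfolding abs_mult using d0[of k] by (simp add: mult_right_mono)
  qed
  also have "\<dots> = G * (\<epsilon> + E + \<bar>w i - x0\<bar>)" using tel[OF ij(1)] ij(3) by (simp add: sum_distrib_left[symmetric])
  finally have gd: "\<bar>(\<Sum>k=i..<j. g (w k - x0) * ?d k) - (\<Sum>k=i..<j. g (uk s k) * ?d k)\<bar> \<le> G * (\<epsilon> + E + \<bar>w i - x0\<bar>)" .
  have "\<bar>\<epsilon> * (\<Sum>k=i..<j. g (w k - x0) * ?d k) - \<epsilon> * (\<Sum>k=i..<j. g (uk s k) * ?d k)\<bar> \<le> \<epsilon> * (G * (\<epsilon> + E + \<bar>w i - x0\<bar>))"
    unfolding right_diff_distrib[symmetric] abs_mult using gd e by (simp add: mult_left_mono)
  then show ?thesis using part[OF ij(1)] zsum[OF ij(1)] E ij(3) by (simp add: mult.assoc)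
qed

text \<open>The bump lies between the indicators of \<open>{..u}\<close> and of
  \<open>{..<u'}\<close>. The lengths of the cells starting below \<open>u\<close> telescope to the
  first partition value not below \<open>u\<close>, which is \<open>round_up\<close> at
  \<open>u\<close>; similarly for \<open>u'\<close>.\<close>

lemma riemann_squeeze:
  assumes u: "0 < u" "u < u'" "u' < 1" and ij: "i \<le> j" "uk s i = 0" "uk s j = 1"
    and g01: "\<And>v. 0 \<le> g v \<and> g v \<le> 1" and g1: "\<And>v. v \<le> u \<Longrightarrow> g v = 1" and g0: "\<And>v. u' \<le> v \<Longrightarrow> g v = 0"
  shows "round_up a (h n) s \<omega> u \<le> (\<Sum>k=i..<j. g (uk s k) * (uk s (Suc k) - uk s k))"
    "(\<Sum>k=i..<j. g (uk s k) * (uk s (Suc k) - uk s k)) \<le> round_up a (h n) s \<omega> u'"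
proof -
  let ?d = "\<lambda>k. uk s (Suc k) - uk s k"
  have d0: "0 \<le> ?d k" for k using uk_mono[of k "Suc k"] by simp
  have idx: "v \<le> uk s k \<longleftrightarrow> grid_index a (h n) \<omega> (s - tinv v) \<le> k" if "0 < v" "v < 1" for v k
    using le_tail_iff[OF that] grid_index_le_iff[OF hn, of a \<omega> "s - tinv v" k] by (auto simp: algebra_simps)
  have tel: "(\<Sum>k=i..<m. ?d k) = uk s m" if "i \<le> m" for m
    using sum_Suc_diff'[OF that, of "uk s"] ij by simp
  have rng: "i \<le> grid_index a (h n) \<omega> (s - tinv v)" "grid_index a (h n) \<omega> (s - tinv v) \<le> j" if v: "0 < v" "v < 1" for v
  proof -
    show "grid_index a (h n) \<omega> (s - tinv v) \<le> j" using idx[OF v, of j] ij v by simp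
    show "i \<le> grid_index a (h n) \<omega> (s - tinv v)" using idx[OF v, of i] ij v by auto
  qed
  let ?m = "grid_index a (h n) \<omega> (s - tinv u)" and ?m' = "grid_index a (h n) \<omega> (s - tinv u')"
  have r: "round_up a (h n) s \<omega> u = (\<Sum>k=i..<?m. ?d k)" "round_up a (h n) s \<omega> u' = (\<Sum>k=i..<?m'. ?d k)"
    using tel rng u by (auto simp: round_up_def)
  have "(\<Sum>k=i..<?m. ?d k) = (\<Sum>k=i..<?m. g (uk s k) * ?d k)"
  proof (rule sum.cong[OF refl])
    fix k assume "k \<in> {i..<?m}"
    then have "uk s k < u" using idx[of u k] u by auto
    then show "?d k = g (uk s k) * ?d k" using g1 by simp
  qed
  also have "\<dots> \<le> (\<Sum>k=i..<j. g (uk s k) * ?d k)"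
    using rng[of u] u g01 d0 by (intro sum_mono2) auto
  finally show "round_up a (h n) s \<omega> u \<le> (\<Sum>k=i..<j. g (uk s k) * ?d k)" using r by simp
  have "(\<Sum>k=i..<j. g (uk s k) * ?d k) = (\<Sum>k=i..<?m'. g (uk s k) * ?d k)"
  proof (rule sum.mono_neutral_right)
    show "\<forall>k\<in>{i..<j} - {i..<?m'}. g (uk s k) * ?d k = 0"
      using idx[of u'] u g0 by auto
  qed (use rng[of u'] u in auto)
  also have "\<dots> \<le> (\<Sum>k=i..<?m'. ?d k)" using g01 d0 by (intro sum_mono mult_left_le_one_le) auto
  finally show "(\<Sum>k=i..<j. g (uk s k) * ?d k) \<le> round_up a (h n) s \<omega> u'" using r by simp
qed

end

context mollify1
begin

lemma round_up_frac:
  assumes "h > 0" "a \<le> s - tinv u" "0 \<le> \<omega>" "\<omega> < 1"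
  shows "round_up a h s \<omega> u = tail (tinv u - h * frac (\<omega> + - ((s - tinv u - a) / h)))"
  unfolding round_up_def grid_point_index_frac[OF assms] by (simp add: algebra_simps)

text \<open>A Markov inequality over the phase. Overshoots in \<open>{\<delta>..<1}\<close> have
  measure \<open>1 - \<delta>\<close>, and for them \<open>round_up\<close> is at least the value at
  \<delta>; overshoots in \<open>{0..<\<delta>}\<close> have measure \<delta>, and for them it is at
  most that value. An average error of at most \<kappa> thus becomes a bound at each single
  \<delta>.\<close>

lemma phase_average_bounds:
  assumes h: "h > 0" and s: "a \<le> s - tinv u" and \<delta>: "0 < \<delta>" "\<delta> < 1"
    and A: "(\<integral>\<^sup>+\<omega>. indicator {0..<1} \<omega> * A \<omega> \<partial>lborel) \<le> ennreal \<kappa>" and \<kappa>: "0 \<le> \<kappa>"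
  shows "(\<And>\<omega>. 0 \<le> \<omega> \<Longrightarrow> \<omega> < 1 \<Longrightarrow> ennreal (round_up a h s \<omega> u - c) \<le> A \<omega>) \<Longrightarrow> tail (tinv u - h * \<delta>) \<le> c + \<kappa> / (1 - \<delta>)"
    and "(\<And>\<omega>. 0 \<le> \<omega> \<Longrightarrow> \<omega> < 1 \<Longrightarrow> ennreal (c - round_up a h s \<omega> u) \<le> A \<omega>) \<Longrightarrow> c - \<kappa> / \<delta> \<le> tail (tinv u - h * \<delta>)"
proof -
  let ?fr = "\<lambda>\<omega>. frac (\<omega> + - ((s - tinv u - a) / h))" and ?S = "tail (tinv u - h * \<delta>)"
  have main: "d * D \<le> \<kappa>" if D: "\<And>\<omega>. 0 \<le> \<omega> \<Longrightarrow> \<omega> < 1 \<Longrightarrow> ?fr \<omega> \<in> I \<Longrightarrow> ennreal D \<le> A \<omega>" and I [measurable]: "I \<in> sets borel"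
    and d: "(\<integral>\<^sup>+\<omega>. indicator {0..<1} \<omega> * indicator I \<omega> \<partial>lborel) = ennreal d" "0 \<le> d" for D d I
  proof (cases "0 \<le> D")
    case True
    have "ennreal (d * D) = (\<integral>\<^sup>+\<omega>. indicator {0..<1} \<omega> * indicator I \<omega> \<partial>lborel) * ennreal D"
      unfolding d(1) by (rule ennreal_mult[OF d(2) True])
    also have "\<dots> = (\<integral>\<^sup>+\<omega>. indicator {0..<1} \<omega> * indicator I (?fr \<omega>) \<partial>lborel) * ennreal D"
      by (subst nn_integral_frac_shift[symmetric, of "indicator I" "- ((s - tinv u - a) / h)"]) auto
    also have "\<dots> = (\<integral>\<^sup>+\<omega>. indicator {0..<1} \<omega> * indicator I (?fr \<omega>) * ennreal D \<partial>lborel)"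
      by (rule nn_integral_multc[symmetric]) measurable
    also have "\<dots> \<le> (\<integral>\<^sup>+\<omega>. indicator {0..<1} \<omega> * A \<omega> \<partial>lborel)"
      by (intro nn_integral_mono) (use D in \<open>auto split: split_indicator\<close>)
    also have "\<dots> \<le> ennreal \<kappa>" by (rule A)
    finally show ?thesis using \<kappa> by (simp add: ennreal_le_iff)
  next
    case False
    then show ?thesis using d(2) \<kappa> by (meson linear mult_nonneg_nonpos not_le order_trans)
  qed
  show "?S \<le> c + \<kappa> / (1 - \<delta>)" if up: "\<And>\<omega>. 0 \<le> \<omega> \<Longrightarrow> \<omega> < 1 \<Longrightarrow> ennreal (round_up a h s \<omega> u - c) \<le> A \<omega>"
  proof -
    have "(1 - \<delta>) * (?S - c) \<le> \<kappa>"
    proof (rule main[of "{\<delta>..<1}"])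
      fix \<omega> assume w: "0 \<le> \<omega>" "\<omega> < 1" "?fr \<omega> \<in> {\<delta>..<1}"
      have "?S \<le> round_up a h s \<omega> u" unfolding round_up_frac[OF h s w(1,2)]
        using w(3) h by (intro tail_antimono diff_left_mono mult_left_mono) auto
      then show "ennreal (?S - c) \<le> A \<omega>" using up[OF w(1,2)] by (meson diff_right_mono ennreal_leI order_trans)
    next
      show "(\<integral>\<^sup>+\<omega>. indicator {0..<1} \<omega> * indicator {\<delta>..<1} \<omega> \<partial>(lborel::real measure)) = ennreal (1 - \<delta>)"
      proof -
        have "(\<lambda>\<omega>::real. indicator {0..<1} \<omega> * indicator {\<delta>..<1} \<omega> :: ennreal) = indicator {\<delta>..<1}" using \<delta> by (auto split: split_indicator)
        then show ?thesis using \<delta> by simp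
      qed
    qed (use \<delta> in auto)
    then have "?S - c \<le> \<kappa> / (1 - \<delta>)" using \<delta> by (simp add: field_simps)
    then show ?thesis by simp
  qed
  show "c - \<kappa> / \<delta> \<le> ?S" if lo: "\<And>\<omega>. 0 \<le> \<omega> \<Longrightarrow> \<omega> < 1 \<Longrightarrow> ennreal (c - round_up a h s \<omega> u) \<le> A \<omega>"
  proof -
    have "\<delta> * (c - ?S) \<le> \<kappa>"
    proof (rule main[of "{0..<\<delta>}"])
      fix \<omega> assume w: "0 \<le> \<omega>" "\<omega> < 1" "?fr \<omega> \<in> {0..<\<delta>}"
      have "round_up a h s \<omega> u \<le> ?S" unfolding round_up_frac[OF h s w(1,2)]
        using w(3) h by (intro tail_antimono diff_left_mono mult_left_mono) auto
      then show "ennreal (c - ?S) \<le> A \<omega>" using lo[OF w(1,2)] by (meson diff_left_mono ennreal_leI order_trans)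
    next
      show "(\<integral>\<^sup>+\<omega>. indicator {0..<1} \<omega> * indicator {0..<\<delta>} \<omega> \<partial>(lborel::real measure)) = ennreal \<delta>"
      proof -
        have "(\<lambda>\<omega>::real. indicator {0..<1} \<omega> * indicator {0..<\<delta>} \<omega> :: ennreal) = indicator {0..<\<delta>}" using \<delta> by (auto split: split_indicator)
        then show ?thesis using \<delta> by simp
      qed
    qed (use \<delta> in auto)
    then have "c - ?S \<le> \<kappa> / \<delta>" using \<delta> by (simp add: field_simps)
    then show ?thesis by simp
  qed
qed

end

text \<open>By \<open>K\<close>, up to \<open>e\<close>, the values at \<open>u\<close> are finally
  below those at any larger \<open>u'\<close>, whichever \<delta> is used on either side. So
  \<delta> does not matter at continuity points, and \<sigma> may be built from \<open>1/2\<close>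
  alone, as a supremum of eventual lower bounds; taking them strictly to the left of
  \<open>u\<close> makes it left-continuous. \<open>shift\<close> composes two partial shifts into
  one, and this yields idempotence.\<close>

lemma gap_function_of_limits:
  fixes S :: "nat \<Rightarrow> real \<Rightarrow> real \<Rightarrow> real"
  assumes S01: "\<And>n \<delta> u. 1 \<le> n \<Longrightarrow> S n \<delta> u \<le> 1" and Sge: "\<And>n \<delta> u. 1 \<le> n \<Longrightarrow> 0 < \<delta> \<Longrightarrow> 0 < u \<Longrightarrow> u < 1 \<Longrightarrow> u \<le> S n \<delta> u"
    and K: "\<And>u u' \<delta> \<delta>' e. 0 < u \<Longrightarrow> u < u' \<Longrightarrow> u' < 1 \<Longrightarrow> 0 < \<delta> \<Longrightarrow> \<delta> < 1 \<Longrightarrow> 0 < \<delta>' \<Longrightarrow> \<delta>' < 1 \<Longrightarrow> 0 < e \<Longrightarrow>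
       \<exists>c. \<forall>\<^sub>F n in sequentially. S n \<delta> u \<le> c + e \<and> c - e \<le> S n \<delta>' u'"
    and shift: "\<And>n u v. 1 \<le> n \<Longrightarrow> 0 < u \<Longrightarrow> u < 1 \<Longrightarrow> 0 < v \<Longrightarrow> v < 1 \<Longrightarrow> v \<le> S n (1/2) u \<Longrightarrow> S n (1/4) v \<le> S n (3/4) u"
  shows "\<exists>\<sigma>. gap_function \<sigma> \<and> \<sigma> \<in> borel_measurable borel \<and>
    (\<forall>\<delta>\<in>{0<..<1}. \<forall>u\<in>{0<..<1}. continuous (at u within {0..1}) \<sigma> \<longrightarrow> (\<lambda>n. S n \<delta> u) \<longlonglongrightarrow> \<sigma> u)"
proof -
  \<comment> \<open>The inserted 0 keeps the set nonempty, also at \<open>u = 0\<close>, and makes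
    the supremum nonnegative.\<close>
  define Y where "Y u = insert 0 {y. \<exists>v. 0 < v \<and> v < u \<and> v < 1 \<and> (\<forall>\<^sub>F n in sequentially. y \<le> S n (1/2) v)}" for u
  define \<sigma> where "\<sigma> u = Sup (Y u)" for u
  have ev1: "\<forall>\<^sub>F n in sequentially. (1::nat) \<le> n" by (rule eventually_ge_at_top)
  have Y1: "y \<le> 1" if yY: "y \<in> Y u" for y u
  proof (cases "y = 0")
    case False
    then obtain v where "\<forall>\<^sub>F n in sequentially. y \<le> S n (1/2) v" using yY unfolding Y_def by blast
    then have "\<forall>\<^sub>F n in sequentially. y \<le> S n (1/2) v \<and> 1 \<le> n" using ev1 by (rule eventually_conj)
    then obtain n where "y \<le> S n (1/2) v" "1 \<le> n" using eventually_happens' sequentially_bot by blast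
    then show ?thesis using S01[of n "1/2" v] by linarith
  qed simp
  have bdd: "bdd_above (Y u)" for u by (rule bdd_aboveI[of _ 1]) (rule Y1)
  have ne: "Y u \<noteq> {}" for u by (simp add: Y_def)
  have up: "y \<le> \<sigma> u" if "0 < v" "v < u" "v < 1" "\<forall>\<^sub>F n in sequentially. y \<le> S n (1/2) v" for y u v
    unfolding \<sigma>_def using that by (intro cSup_upper bdd) (auto simp: Y_def)
  have lessD: "\<exists>v y'. y < y' \<and> 0 < v \<and> v < u \<and> v < 1 \<and> (\<forall>\<^sub>F n in sequentially. y' \<le> S n (1/2) v)" if yu: "y < \<sigma> u" "0 \<le> y" for y u
  proof -
    have "\<exists>y'\<in>Y u. y < y'" using yu(1) less_cSup_iff[OF ne bdd] unfolding \<sigma>_def by simp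
    then obtain y' where "y' \<in> Y u" "y < y'" by blast
    moreover from this have "y' \<noteq> 0" using yu(2) by simp
    ultimately have "\<exists>v. 0 < v \<and> v < u \<and> v < 1 \<and> (\<forall>\<^sub>F n in sequentially. y' \<le> S n (1/2) v)"
      unfolding Y_def by blast
    then show ?thesis using \<open>y < y'\<close> by blast
  qed
  have nonneg: "0 \<le> \<sigma> u" for u unfolding \<sigma>_def by (rule cSup_upper[OF _ bdd]) (simp add: Y_def)
  have le1: "\<sigma> u \<le> 1" for u unfolding \<sigma>_def by (rule cSup_least[OF ne Y1])
  have mono: "\<sigma> u \<le> \<sigma> v" if "u \<le> v" for u v
    unfolding \<sigma>_def
  proof (rule cSup_subset_mono[OF ne bdd], rule subsetI)
    fix y assume "y \<in> Y u"
    then consider "y = 0" | w where "0 < w" "w < u" "w < 1" "\<forall>\<^sub>F n in sequentially. y \<le> S n (1/2) w"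
      unfolding Y_def by blast
    then show "y \<in> Y v"
    proof cases
      case 2
      then have "w < v" using that by simp
      then show ?thesis using 2 unfolding Y_def by blast
    qed (simp add: Y_def)
  qed
  have s0: "\<sigma> 0 = 0"
  proof -
    have "Y 0 = {0}" by (auto simp: Y_def)
    then show ?thesis by (simp add: \<sigma>_def)
  qed
  have ge: "u \<le> \<sigma> u" if u: "0 \<le> u" "u \<le> 1" for u
  proof (rule dense_le)
    fix v assume v: "v < u"
    show "v \<le> \<sigma> u"
    proof (cases "0 < v")
      case True
      have "\<forall>\<^sub>F n in sequentially. v \<le> S n (1/2) v" using ev1 by eventually_elim (use True v u in \<open>auto intro: Sge\<close>)
      then show ?thesis using True v u by (intro up) auto
    qed (use nonneg[of u] in linarith)
  qed
  have left: "(\<sigma> \<longlongrightarrow> \<sigma> u) (at_left u)" for u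
  proof (rule order_tendstoI)
    fix y assume y: "y < \<sigma> u"
    show "\<forall>\<^sub>F t in at_left u. y < \<sigma> t"
    proof (cases "0 \<le> y")
      case True
      obtain v y' where v: "y < y'" "0 < v" "v < u" "v < 1" "\<forall>\<^sub>F n in sequentially. y' \<le> S n (1/2) v"
        using lessD[OF y True] by blast
      show ?thesis using eventually_at_left_real[OF v(3)]
      proof eventually_elim
        case (elim t)
        then have "y' \<le> \<sigma> t" using v by (intro up[of v]) auto
        then show ?case using v(1) by linarith
      qed
    next
      case False
      then show ?thesis using nonneg by (intro always_eventually allI) (meson less_le_trans not_le)
    qed
  next
    fix y assume y: "\<sigma> u < y"
    have "\<forall>\<^sub>F t in at_left u. t < u" by (auto simp: eventually_at_filter)
    then show "\<forall>\<^sub>F t in at_left u. \<sigma> t < y" by eventually_elim (use mono y in \<open>meson le_less_trans less_imp_le\<close>)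
  qed
  have S_upper: "\<forall>\<^sub>F n in sequentially. S n \<delta> u \<le> \<sigma> v + e" if uv: "0 < u" "u < v" "u < 1" and d: "0 < \<delta>" "\<delta> < 1" and e: "0 < e" for u v \<delta> e
  proof -
    define w where "w = (u + min v 1) / 2"
    have w: "u < w" "w < v" "w < 1" using uv by (auto simp: w_def min_def)
    obtain c where c: "\<forall>\<^sub>F n in sequentially. S n \<delta> u \<le> c + e/2 \<and> c - e/2 \<le> S n (1/2) w"
      using K[of u w \<delta> "1/2" "e/2"] uv w d e by auto
    have "c - e/2 \<le> \<sigma> v" using c uv w by (intro up[of w]) (auto elim: eventually_mono)
    then show ?thesis using c by (auto elim!: eventually_mono)
  qed
  have S_lower: "\<forall>\<^sub>F n in sequentially. y - e \<le> S n \<delta> u" if u: "0 < u" "u < 1" and d: "0 < \<delta>" "\<delta> < 1" and e: "0 < e" and y: "y < \<sigma> u" for u \<delta> e y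
  proof (cases "0 \<le> y")
    case True
    obtain v y' where v: "y < y'" "0 < v" "v < u" "v < 1" "\<forall>\<^sub>F n in sequentially. y' \<le> S n (1/2) v"
      using lessD[OF y True] by blast
    obtain c where c: "\<forall>\<^sub>F n in sequentially. S n (1/2) v \<le> c + e/2 \<and> c - e/2 \<le> S n \<delta> u"
      using K[of v u "1/2" \<delta> "e/2"] u v d e by auto
    show ?thesis using v(5) c by eventually_elim (use v(1) in linarith)
  next
    case False
    show ?thesis using ev1 by eventually_elim (use Sge[of _ \<delta> u] False u d e in fastforce)
  qed
  have idem: "\<sigma> (\<sigma> u) = \<sigma> u" if u: "0 \<le> u" "u \<le> 1" for u
  proof (rule antisym)
    show "\<sigma> u \<le> \<sigma> (\<sigma> u)" using ge nonneg le1 by blast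
    show "\<sigma> (\<sigma> u) \<le> \<sigma> u"
    proof (rule ccontr)
      assume "\<not> \<sigma> (\<sigma> u) \<le> \<sigma> u"
      then have "\<sigma> u < \<sigma> (\<sigma> u)" by simp
      then obtain c1 y where y: "\<sigma> u < y" "0 < c1" "c1 < \<sigma> u" "c1 < 1" "\<forall>\<^sub>F n in sequentially. y \<le> S n (1/2) c1"
        using lessD[OF _ nonneg] by blast
      \<comment> \<open>\<open>c2\<close> leaves room on both sides: \<open>K\<close> passes from
        \<open>c1\<close> to \<open>c2\<close> and from \<delta> = 1/2 to 1/4, and
        \<open>c2 < \<sigma> u\<close> is below the values at some \<open>v < u\<close>, so that
        \<open>shift\<close> applies. The losses add up to \<open>3 * e\<close>, less than the
        distance \<open>5 * e\<close> from \<open>\<sigma> u\<close> to \<open>y\<close>.\<close>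
      define c2 where "c2 = (c1 + \<sigma> u) / 2"
      have c2: "c1 < c2" "c2 < \<sigma> u" "c2 < 1" "0 < c2" using y le1[of u] by (auto simp: c2_def)
      obtain v y' where v: "c2 < y'" "0 < v" "v < u" "v < 1" "\<forall>\<^sub>F n in sequentially. y' \<le> S n (1/2) v"
        using lessD[of c2 u] c2 by auto
      define e where "e = (y - \<sigma> u) / 5"
      have e: "0 < e" using y by (simp add: e_def)
      have "c1 < 1" by (rule y(4))
      obtain c where c: "\<forall>\<^sub>F n in sequentially. S n (1/2) c1 \<le> c + e \<and> c - e \<le> S n (1/4) c2"
        using K[of c1 c2 "1/2" "1/4" e] y c2 e by auto
      have "\<forall>\<^sub>F n in sequentially. S n (3/4) v \<le> \<sigma> u + e" using v e by (intro S_upper) auto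
      with y(5) c v(5) ev1 have "\<forall>\<^sub>F n in sequentially. False"
      proof eventually_elim
        case (elim n)
        have "S n (1/4) c2 \<le> S n (3/4) v" using elim v c2 by (intro shift) auto
        moreover have "S n (1/2) c1 \<le> c + e" "c - e \<le> S n (1/4) c2" "y \<le> S n (1/2) c1" "S n (3/4) v \<le> \<sigma> u + e"
          using elim by auto
        moreover have "5 * e = y - \<sigma> u" by (simp add: e_def)
        ultimately show False using e by linarith
      qed
      then show False by simp
    qed
  qed
  have "gap_function \<sigma>"
    by unfold_locales (use mono left s0 ge le1 idem in auto)
  moreover have "\<sigma> \<in> borel_measurable borel" by (rule borel_measurable_mono) (auto simp: mono_def mono)
  moreover have "(\<lambda>n. S n \<delta> u) \<longlonglongrightarrow> \<sigma> u" if d: "0 < \<delta>" "\<delta> < 1" and u: "0 < u" "u < 1" and c: "continuous (at u within {0..1}) \<sigma>" for \<delta> u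
  proof (rule order_tendstoI)
    fix y assume y: "y < \<sigma> u"
    define e where "e = (\<sigma> u - y) / 3"
    have e: "0 < e" "3 * e = \<sigma> u - y" using y by (simp_all add: e_def)
    have "\<forall>\<^sub>F n in sequentially. (\<sigma> u - e) - e \<le> S n \<delta> u" using e by (intro S_lower u d) auto
    then show "\<forall>\<^sub>F n in sequentially. y < S n \<delta> u" by eventually_elim (use e in linarith)
  next
    fix y assume y: "\<sigma> u < y"
    define e where "e = (y - \<sigma> u) / 3"
    have e: "0 < e" "3 * e = y - \<sigma> u" using y by (simp_all add: e_def)
    obtain d' where d': "d' > 0" "\<And>t. t \<in> {0..1} \<Longrightarrow> dist t u < d' \<Longrightarrow> dist (\<sigma> t) (\<sigma> u) < e"
      using c e(1) unfolding continuous_within_eps_delta by blast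
    define v where "v = min 1 (u + d' / 2)"
    have v: "u < v" "v \<le> 1" "dist v u < d'" using u d' by (auto simp: v_def dist_real_def min_def)
    have "dist (\<sigma> v) (\<sigma> u) < e" using d'(2)[of v] v u by auto
    then have sv: "\<sigma> v < \<sigma> u + e" unfolding dist_real_def by linarith
    have "\<forall>\<^sub>F n in sequentially. S n \<delta> u \<le> \<sigma> v + e" using u v d e by (intro S_upper) auto
    then show "\<forall>\<^sub>F n in sequentially. S n \<delta> u < y" by eventually_elim (use sv e in linarith)
  qed
  ultimately show ?thesis by auto
qed

section \<open>Test coefficients that reveal the partition at a jump\<close>

context scheme_data
begin

text \<open>For \<open>0 < u < 1\<close> this is \<open>F_n (F_n^{-1} u - \<delta> h_n)\<close>. At
  0 and 1 it may differ, as \<open>tinv\<close> is not \<open>F_n^{-1}\<close> there.\<close>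

definition S :: "nat \<Rightarrow> real \<Rightarrow> real \<Rightarrow> real" where
  "S n \<delta> u = mollify1.tail n (\<rho> n) (mollify1.tinv n (\<rho> n) u - h n * \<delta>)"

lemma coefficient_admissible:
  assumes "coefficient a b L h \<rho> \<rho>2 X0 f C K" shows "admissible a b f"
proof -
  interpret coefficient a b L h \<rho> \<rho>2 X0 f C K by (rule assms)
  have "(2 * C)-lipschitz_on ({a..b} \<times> UNIV) f"
  proof (rule lipschitz_onI)
    fix p q :: "real \<times> real" assume pq: "p \<in> {a..b} \<times> UNIV" "q \<in> {a..b} \<times> UNIV"
    have "\<bar>f (fst p, snd p) - f (fst q, snd q)\<bar> \<le> C * (\<bar>fst p - fst q\<bar> + \<bar>snd p - snd q\<bar>)"
      using pq by (intro lip) auto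
    also have "\<dots> \<le> C * (dist p q + dist p q)"
      using dist_fst_le[of p q] dist_snd_le[of p q] C0 by (intro mult_left_mono add_mono) (auto simp: dist_real_def)
    finally show "dist (f p) (f q) \<le> 2 * C * dist p q" by (simp add: dist_real_def)
  qed (use C0 in simp)
  then show ?thesis unfolding admissible_def using growth by blast
qed

lemma admissible_coefficient:
  assumes "admissible a b f" shows "\<exists>C K. coefficient a b L h \<rho> \<rho>2 X0 f C K"
proof -
  obtain C K where C: "C-lipschitz_on ({a..b} \<times> UNIV) f" and K: "\<And>t x. t \<in> {a..b} \<Longrightarrow> \<bar>f (t, x)\<bar> \<le> K * (1 + \<bar>x\<bar>)"
    using assms unfolding admissible_def by blast
  have C0: "0 \<le> C" using C by (rule lipschitz_on_nonneg)
  have "coefficient a b L h \<rho> \<rho>2 X0 f C (max 0 K)"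
  proof
    fix s t x z :: real assume "s \<in> {a..b}" "t \<in> {a..b}"
    then have "dist (f (s, x)) (f (t, z)) \<le> C * dist (s, x) (t, z)" by (intro lipschitz_onD[OF C]) auto
    also have "\<dots> \<le> C * (\<bar>s - t\<bar> + \<bar>x - z\<bar>)"
      using C0 by (intro mult_left_mono) (auto simp: dist_Pair_Pair dist_real_def intro!: order_trans[OF sqrt_sum_squares_le_sum_abs])
    finally show "\<bar>f (s, x) - f (t, z)\<bar> \<le> C * (\<bar>s - t\<bar> + \<bar>x - z\<bar>)" by (simp add: dist_real_def)
  next
    fix t x :: real assume "t \<in> {a..b}"
    then have "\<bar>f (t, x)\<bar> \<le> K * (1 + \<bar>x\<bar>)" by (rule K)
    also have "\<dots> \<le> max 0 K * (1 + \<bar>x\<bar>)" by (intro mult_right_mono) auto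
    finally show "\<bar>f (t, x)\<bar> \<le> max 0 K * (1 + \<bar>x\<bar>)" .
  qed (use C0 in auto)
  then show ?thesis by blast
qed

text \<open>A tent of half-width \<open>r\<close> around \<open>s\<close> switches the coefficient
  off elsewhere, and dividing by \<open>j\<close>, the jump at \<open>s\<close>, leaves exactly
  \<open>1 + \<epsilon> g\<close> across it. In the Lipschitz constant, \<open>2 / r\<close> is the
  slope of the tent times the bound 2 of the second factor.\<close>

lemma test_coefficient:
  assumes g01: "\<And>v. 0 \<le> g v \<and> g v \<le> (1::real)" and gl: "\<And>p q. \<bar>g p - g q\<bar> \<le> G * \<bar>p - q\<bar>" and G: "0 \<le> G"
    and e: "0 \<le> \<epsilon>" "\<epsilon> \<le> 1" and r: "0 < r" and j: "j \<noteq> 0"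
  shows "coefficient a b L h \<rho> \<rho>2 X0 (\<lambda>p. max 0 (1 - \<bar>fst p - s\<bar> / r) * (1 + \<epsilon> * g (snd p - x0)) / j) ((2 / r + G) / \<bar>j\<bar>) (2 / \<bar>j\<bar>)"
    and "\<And>t v. \<bar>max 0 (1 - \<bar>t - s\<bar> / r) * (1 + \<epsilon> * g (v - x0)) / j\<bar> \<le> 2 / \<bar>j\<bar>"
proof -
  let ?\<eta> = "\<lambda>t. max 0 (1 - \<bar>t - s\<bar> / r)" and ?z = "\<lambda>v. 1 + \<epsilon> * g (v - x0)"
  have z: "0 \<le> ?z v" "?z v \<le> 2" for v
  proof -
    have "\<epsilon> * g (v - x0) \<le> 1 * 1" using e g01 by (intro mult_mono) auto
    then show "?z v \<le> 2" by simp
    show "0 \<le> ?z v" using e g01 by simp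
  qed
  have eta: "0 \<le> ?\<eta> t" "?\<eta> t \<le> 1" for t using r by auto
  have etal: "\<bar>?\<eta> t - ?\<eta> t'\<bar> \<le> \<bar>t - t'\<bar> / r" for t t'
  proof -
    have "\<bar>?\<eta> t - ?\<eta> t'\<bar> \<le> \<bar>\<bar>t - s\<bar> / r - \<bar>t' - s\<bar> / r\<bar>" by (auto simp: max_def)
    also have "\<dots> = \<bar>\<bar>t - s\<bar> - \<bar>t' - s\<bar>\<bar> / r" using r by (simp add: diff_divide_distrib[symmetric])
    also have "\<dots> \<le> \<bar>t - t'\<bar> / r" using r by (intro divide_right_mono) auto
    finally show ?thesis .
  qed
  have bound: "\<bar>?\<eta> t * ?z v\<bar> \<le> 2" for t v
  proof -
    have "?\<eta> t * ?z v \<le> 1 * 2" using eta z by (intro mult_mono) auto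
    then show ?thesis using eta[of t] z[of v] by simp
  qed
  show b: "\<bar>?\<eta> t * ?z v / j\<bar> \<le> 2 / \<bar>j\<bar>" for t v
    unfolding abs_divide using bound[of t v] by (intro divide_right_mono) auto
  show "coefficient a b L h \<rho> \<rho>2 X0 (\<lambda>p. ?\<eta> (fst p) * ?z (snd p) / j) ((2 / r + G) / \<bar>j\<bar>) (2 / \<bar>j\<bar>)"
  proof
    show "0 \<le> (2 / r + G) / \<bar>j\<bar>" using r G by simp
    fix t t' v v' :: real
    have "\<bar>?\<eta> t * ?z v - ?\<eta> t' * ?z v'\<bar> = \<bar>(?\<eta> t - ?\<eta> t') * ?z v + ?\<eta> t' * (\<epsilon> * (g (v - x0) - g (v' - x0)))\<bar>"
      by (simp add: algebra_simps)
    also have "\<dots> \<le> \<bar>?\<eta> t - ?\<eta> t'\<bar> * \<bar>?z v\<bar> + \<bar>?\<eta> t'\<bar> * (\<bar>\<epsilon>\<bar> * \<bar>g (v - x0) - g (v' - x0)\<bar>)"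
      unfolding abs_mult[symmetric] by (rule abs_triangle_ineq)
    also have "\<dots> \<le> \<bar>t - t'\<bar> / r * 2 + 1 * (1 * (G * \<bar>v - v'\<bar>))"
    proof (intro add_mono mult_mono)
      show "\<bar>g (v - x0) - g (v' - x0)\<bar> \<le> G * \<bar>v - v'\<bar>" using gl[of "v - x0" "v' - x0"] by simp
      show "\<bar>?z v\<bar> \<le> 2" using z[of v] by simp
      show "\<bar>?\<eta> t'\<bar> \<le> 1" using eta[of t'] by simp
    qed (use etal e r in auto)
    also have "\<dots> \<le> (2 / r + G) * (\<bar>t - t'\<bar> + \<bar>v - v'\<bar>)"
    proof -
      have "0 \<le> G * \<bar>t - t'\<bar> + 2 / r * \<bar>v - v'\<bar>" using G r by simp
      moreover have "\<bar>t - t'\<bar> / r * 2 = 2 / r * \<bar>t - t'\<bar>" by simp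
      ultimately show ?thesis unfolding distrib_left distrib_right mult_1 by linarith
    qed
    finally have "\<bar>?\<eta> t * ?z v - ?\<eta> t' * ?z v'\<bar> / \<bar>j\<bar> \<le> (2 / r + G) * (\<bar>t - t'\<bar> + \<bar>v - v'\<bar>) / \<bar>j\<bar>"
      by (rule divide_right_mono) simp
    then show "\<bar>?\<eta> (fst (t, v)) * ?z (snd (t, v)) / j - ?\<eta> (fst (t', v')) * ?z (snd (t', v')) / j\<bar> \<le> (2 / r + G) / \<bar>j\<bar> * (\<bar>t - t'\<bar> + \<bar>v - v'\<bar>)"
      by (simp add: diff_divide_distrib[symmetric] abs_divide)
  next
    fix t v :: real
    have "2 / \<bar>j\<bar> * 1 \<le> 2 / \<bar>j\<bar> * (1 + \<bar>v\<bar>)" by (intro mult_left_mono) auto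
    then show "\<bar>?\<eta> (fst (t, v)) * ?z (snd (t, v)) / j\<bar> \<le> 2 / \<bar>j\<bar> * (1 + \<bar>v\<bar>)" using b[of t v] by simp
  qed simp
qed

text \<open>Apart from its jump, \<open>V\<close> varies little near \<open>s\<close>. The tent
  occupies \<open>r\<close> on each side; one more \<open>r\<close> on the left absorbs the
  averaging window, and on the right the scheme is read off after \<open>s + 2 * r\<close>, with a
  further \<open>r\<close> for grid step and window.\<close>

lemma V_near_jump:
  assumes "0 < \<theta>" "a < s" "s < b"
  obtains r where "0 < r" "2 * r < s - a" "3 * r < b - s" "V (s + 3 * r) - \<bar>J s\<bar> - V (s - 2 * r) \<le> \<theta>"
proof -
  have "\<forall>\<^sub>F t in at_right s. dist (V t) (V s) < \<theta> / 2" using V_right assms by (intro tendstoD) auto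
  then obtain t2 where t2: "t2 > s" and t2': "\<forall>t>s. t < t2 \<longrightarrow> \<bar>V t - V s\<bar> < \<theta> / 2"
    unfolding eventually_at_right_field dist_real_def by blast
  have "\<forall>\<^sub>F t in at_left s. dist (V t) (V s - \<bar>J s\<bar>) < \<theta> / 2" using V_left assms by (intro tendstoD) auto
  then obtain t1 where t1: "t1 < s" and t1': "\<forall>t>t1. t < s \<longrightarrow> \<bar>V t - (V s - \<bar>J s\<bar>)\<bar> < \<theta> / 2"
    unfolding eventually_at_left_field dist_real_def by blast
  define r where "r = min (min (t2 - s) (s - t1)) (min (b - s) (s - a)) / 4"
  have m: "0 < min (min (t2 - s) (s - t1)) (min (b - s) (s - a))" using t1 t2 assms by simp
  have r: "0 < r" "4 * r \<le> t2 - s" "4 * r \<le> s - t1" "4 * r \<le> b - s" "4 * r \<le> s - a"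
    using m by (simp_all add: r_def)
  show ?thesis
  proof (rule that[of r])
    show "V (s + 3 * r) - \<bar>J s\<bar> - V (s - 2 * r) \<le> \<theta>"
    proof -
      have "\<bar>V (s + 3 * r) - V s\<bar> < \<theta> / 2" using t2' r by simp
      moreover have "\<bar>V (s - 2 * r) - (V s - \<bar>J s\<bar>)\<bar> < \<theta> / 2" using t1' r by simp
      ultimately show ?thesis by linarith
    qed
  qed (use r in linarith)+
qed

text \<open>Take a bump \<open>g\<close> descending from 1 at \<open>u\<close> to 0 at
  \<open>u'\<close> and the test coefficient at \<open>s\<close>. Before the jump the scheme still
  has its initial value, after it the scheme is constant along each phase, with a common limit
  \<open>cW\<close> by \<open>phase_constant\<close>. Solving \<open>bump_estimate\<close> for the
  Riemann sum gives a number \<open>c\<close> independent of the phase, and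
  \<open>riemann_squeeze\<close> with \<open>phase_average_bounds\<close> turns it into bounds at
  \<open>u\<close> and \<open>u'\<close>.\<close>

lemma S_squeeze:
  fixes X :: "(real \<times> real \<Rightarrow> real) \<Rightarrow> nat \<Rightarrow> real \<Rightarrow> real"
  assumes sol: "\<And>f n. admissible a b f \<Longrightarrow> n \<ge> 1 \<Longrightarrow> scheme_solution a b L h \<rho> \<rho>2 X0 f n (X f n)"
    and L1: "\<And>f. admissible a b f \<Longrightarrow> \<exists>x. L1_converges {a..b} (X f) x"
    and X0c: "(\<lambda>n. \<integral>\<^sup>+\<omega>. indicator {0..<1} \<omega> * ennreal \<bar>X0 n (a + h n * \<omega>) - x0\<bar> \<partial>lborel) \<longlonglongrightarrow> 0"
    and s: "a < s" "s < b" "J s \<noteq> 0" and u: "0 < u" "u < u'" "u' < 1" and \<kappa>: "0 < \<kappa>"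
  shows "\<exists>c. \<forall>\<^sub>F n in sequentially. \<forall>\<delta>\<in>{0<..<1}. S n \<delta> u \<le> c + \<kappa> / (1 - \<delta>) \<and> c - \<kappa> / \<delta> \<le> S n \<delta> u'"
proof -
  define G where "G = 1 / (u' - u)"
  have G: "0 < G" using u by (simp add: G_def)
  define g where "g v = max 0 (min 1 ((u' - v) * G))" for v
  have g01: "0 \<le> g v \<and> g v \<le> 1" for v by (simp add: g_def)
  have gl: "\<bar>g p - g q\<bar> \<le> G * \<bar>p - q\<bar>" for p q
  proof -
    have "\<bar>g p - g q\<bar> \<le> \<bar>(u' - p) * G - (u' - q) * G\<bar>" by (auto simp: g_def)
    also have "\<dots> = G * \<bar>p - q\<bar>" using G by (simp add: left_diff_distrib[symmetric] abs_mult abs_minus_commute)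
    finally show ?thesis .
  qed
  have g1: "g v = 1" if "v \<le> u" for v
  proof -
    have "(u' - u) * G \<le> (u' - v) * G" using that G by (intro mult_right_mono) auto
    then show ?thesis using u by (simp add: g_def G_def)
  qed
  have g0: "g v = 0" if "u' \<le> v" for v
  proof -
    have "(u' - v) * G \<le> 0" using that G by (intro mult_nonpos_nonneg) auto
    then show ?thesis by (simp add: g_def)
  qed
  \<comment> \<open>After division by \<epsilon> the second-order error of the bump is
    \<open>G * \<epsilon>\<close>, at most a quarter of \<kappa>.\<close>
  define \<epsilon> where "\<epsilon> = min 1 (\<kappa> / (4 * G))"
  have e: "0 < \<epsilon>" "\<epsilon> \<le> 1" "\<epsilon> \<le> \<kappa> / (4 * G)" using \<kappa> G by (auto simp: \<epsilon>_def)
  have dv: "\<bar>D\<bar> \<le> Y / \<epsilon>" if "\<bar>\<epsilon> * D\<bar> \<le> Y" for D Y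
    using that e by (simp add: abs_mult pos_le_divide_eq mult.commute)
  have Ge: "G * \<epsilon> \<le> \<kappa> / 4" using mult_left_mono[OF e(3), of G] G by simp
  \<comment> \<open>The factor that division by \<epsilon> puts on the initial error and on the
    accumulated jump errors. With \<open>\<theta>\<close> below, the variation near \<open>s\<close>
    contributes another quarter of \<kappa>.\<close>
  define M where "M = 1 / \<epsilon> + G"
  have M: "0 < M" using e G by (simp add: M_def add_pos_pos)
  define B where "B = 2 / \<bar>J s\<bar>"
  have B: "0 < B" using s by (simp add: B_def)
  define \<theta> where "\<theta> = \<kappa> / (4 * B * M)"
  have th: "0 < \<theta>" "B * \<theta> * M = \<kappa> / 4" using \<kappa> B M by (simp_all add: \<theta>_def)
  obtain r where r: "0 < r" "2 * r < s - a" "3 * r < b - s" "V (s + 3 * r) - \<bar>J s\<bar> - V (s - 2 * r) \<le> \<theta>"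
    by (rule V_near_jump[OF th(1) s(1,2)]) blast
  define f :: "real \<times> real \<Rightarrow> real" where "f = (\<lambda>p. max 0 (1 - \<bar>fst p - s\<bar> / r) * (1 + \<epsilon> * g (snd p - x0)) / J s)"
  define C where "C = (2 / r + G) / \<bar>J s\<bar>"
  have coeff: "coefficient a b L h \<rho> \<rho>2 X0 f C B"
    unfolding f_def C_def B_def using e by (intro test_coefficient(1) g01 gl r s) (use G in auto)
  interpret c: coefficient a b L h \<rho> \<rho>2 X0 f C B by (rule coeff)
  have fB: "\<bar>f (t, v)\<bar> \<le> B" for t v
    unfolding f_def B_def fst_conv snd_conv using e by (intro test_coefficient(2)[OF g01 gl] r s) (use G in auto)
  have f_far: "f (t, v) = 0" if "r \<le> \<bar>t - s\<bar>" for t v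
    using that r by (simp add: f_def max_def)
  have fs: "J s * f (s, v) = 1 + \<epsilon> * g (v - x0)" for v using s by (simp add: f_def)
  have adm: "admissible a b f" by (rule coefficient_admissible[OF coeff])
  obtain x where x: "L1_converges {a..b} (X f) x" using L1[OF adm] by blast
  have grid: "grid a b L h \<rho> \<rho>2 X0 f C B n \<omega> (X f n)" if "1 \<le> n" "0 \<le> \<omega>" "\<omega> < 1" for n \<omega>
    using coeff that sol[OF adm] by (intro grid.intro grid_axioms.intro) auto
  let ?c0 = "s + 2 * r"
  have fn_right: "mollify_f b \<rho>2 f n t v = 0" if "1 \<le> n" "s + r \<le> t" for n t v
  proof (rule antisym)
    have *: "0 \<le> f (min (t + p) b, q) \<and> f (min (t + p) b, q) \<le> 0" if "0 \<le> p" for p q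
      using f_far[of "min (t + p) b" q] that \<open>s + r \<le> t\<close> r by auto
    show "mollify_f b \<rho>2 f n t v \<le> 0" "0 \<le> mollify_f b \<rho>2 f n t v"
      using c.mollify_f_range[OF that(1), of t 0 v 0] * that r s by auto
  qed
  have fn_left: "mollify_f b \<rho>2 f n t v = 0" if "1 \<le> n" "a \<le> t" "t \<le> s - 2 * r" "1 / real n \<le> r" for n t v
  proof (rule antisym)
    have *: "0 \<le> f (min (t + p) b, q) \<and> f (min (t + p) b, q) \<le> 0" if "0 \<le> p" "p \<le> 1 / real n" for p q
      using f_far[of "min (t + p) b" q] that \<open>t \<le> s - 2 * r\<close> \<open>1 / real n \<le> r\<close> r s by auto
    show "mollify_f b \<rho>2 f n t v \<le> 0" "0 \<le> mollify_f b \<rho>2 f n t v"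
      using c.mollify_f_range[OF that(1,2), of 0 v 0] * by auto
  qed
  have "X f n (Gp n \<omega> t) = X f n (Gp n \<omega> ?c0)" if n: "1 \<le> n" and w: "0 \<le> \<omega>" "\<omega> < 1" and t: "?c0 \<le> t" for n \<omega> t
  proof -
    interpret g: grid a b L h \<rho> \<rho>2 X0 f C B n \<omega> "X f n" by (rule grid[OF n w])
    have "\<bar>X f n (Gp n \<omega> t) - X f n (Gp n \<omega> ?c0)\<bar> \<le> 0 * (V (Gp n \<omega> t + 1 / real n) - V (Gp n \<omega> ?c0))"
    proof (rule g.w_osc)
      show "grid_index a (h n) \<omega> ?c0 \<le> grid_index a (h n) \<omega> t" by (rule grid_index_mono[OF g.hn t])
      fix k assume "grid_index a (h n) \<omega> ?c0 \<le> k"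
      then have "?c0 \<le> g.tk k" using grid_index_le_iff[OF g.hn] by blast
      then show "\<bar>mollify_f b \<rho>2 f n (g.tk k) (X f n (g.tk k))\<bar> \<le> 0" using fn_right[OF n, of "g.tk k"] r by simp
    qed simp
    then show ?thesis by simp
  qed
  from phase_constant[OF x, of ?c0 1, OF _ _ this] s r
  obtain cW where cW: "(\<lambda>n. \<integral>\<^sup>+\<omega>. indicator {0..<1} \<omega> * ennreal \<bar>X f n (Gp n \<omega> ?c0) - cW\<bar> \<partial>lborel) \<longlonglongrightarrow> 0"
    and cWm: "\<forall>\<^sub>F n in sequentially. (\<lambda>\<omega>. indicator {0..<1} \<omega> * ennreal \<bar>X f n (Gp n \<omega> ?c0) - cW\<bar>) \<in> borel_measurable borel"
    by auto
  \<comment> \<open>The terminal value is \<open>x0 + 1 + \<epsilon>\<close> times the Riemann sum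
    to first order; solved for the sum, with the terminal value replaced by its limit.\<close>
  define c' where "c' = (cW - x0 - 1) / \<epsilon>"
  define E where "E n = B * \<theta> + \<bar>J s\<bar> * C * (h n + 3 / real n)" for n
  define R where "R n = E n * M + G * \<epsilon>" for n
  define A where "A n \<omega> = ennreal (1 / \<epsilon>) * ennreal \<bar>X f n (Gp n \<omega> ?c0) - cW\<bar> + (ennreal M * ennreal \<bar>X0 n (a + h n * \<omega>) - x0\<bar> + ennreal (R n))" for n \<omega>
  have C0: "0 \<le> C" by (rule c.C0)
  have h3: "(\<lambda>n. h n + 3 / real n) \<longlonglongrightarrow> 0"
    using tendsto_add[OF h_lim lim_const_over_n[of 3]] by simp
  have ev1: "\<forall>\<^sub>F n in sequentially. h n + 3 / real n < r" using order_tendstoD(2)[OF h3 r(1)] .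
  have ev2: "\<forall>\<^sub>F n in sequentially. R n < 3 * \<kappa> / 4"
  proof (rule order_tendstoD(2))
    have "R \<longlonglongrightarrow> (B * \<theta> + \<bar>J s\<bar> * C * 0) * M + G * \<epsilon>"
      unfolding R_def[abs_def] E_def by (intro tendsto_intros h3)
    then show "R \<longlonglongrightarrow> B * \<theta> * M + G * \<epsilon>" by simp
    show "B * \<theta> * M + G * \<epsilon> < 3 * \<kappa> / 4" using th Ge \<kappa> by linarith
  qed
  have "(\<lambda>n. ennreal (1 / \<epsilon>) * (\<integral>\<^sup>+\<omega>. indicator {0..<1} \<omega> * ennreal \<bar>X f n (Gp n \<omega> ?c0) - cW\<bar> \<partial>lborel)) \<longlonglongrightarrow> ennreal (1 / \<epsilon>) * 0"
    by (intro tendsto_mult_ennreal cW tendsto_const) auto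
  then have ev3: "\<forall>\<^sub>F n in sequentially. ennreal (1 / \<epsilon>) * (\<integral>\<^sup>+\<omega>. indicator {0..<1} \<omega> * ennreal \<bar>X f n (Gp n \<omega> ?c0) - cW\<bar> \<partial>lborel) < ennreal (\<kappa> / 8)"
    using \<kappa> by (intro order_tendstoD(2)) auto
  have "(\<lambda>n. ennreal M * (\<integral>\<^sup>+\<omega>. indicator {0..<1} \<omega> * ennreal \<bar>X0 n (a + h n * \<omega>) - x0\<bar> \<partial>lborel)) \<longlonglongrightarrow> ennreal M * 0"
    by (intro tendsto_mult_ennreal X0c tendsto_const) auto
  then have ev4: "\<forall>\<^sub>F n in sequentially. ennreal M * (\<integral>\<^sup>+\<omega>. indicator {0..<1} \<omega> * ennreal \<bar>X0 n (a + h n * \<omega>) - x0\<bar> \<partial>lborel) < ennreal (\<kappa> / 8)"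
    using \<kappa> by (intro order_tendstoD(2)) auto
  have ev5: "\<forall>\<^sub>F n in sequentially. (1::nat) \<le> n" by (rule eventually_ge_at_top)
  have "\<forall>\<^sub>F n in sequentially. \<forall>\<delta>\<in>{0<..<1}. S n \<delta> u \<le> c' + \<kappa> / (1 - \<delta>) \<and> c' - \<kappa> / \<delta> \<le> S n \<delta> u'"
    using ev1 ev2 ev3 ev4 ev5 cWm
  proof eventually_elim
    case (elim n)
    note n = elim(5)
    have hn: "0 < h n" by (rule h_pos[OF n])
    have n3: "0 < 1 / real n" "3 / real n = 3 * (1 / real n)" using n by simp_all
    have small: "h n + 1 / real n < r" "1 / real n < r" using elim(1) n3 hn by linarith+
    have C3: "0 \<le> \<bar>J s\<bar> * C * (h n + 3 / real n)" using C0 hn by simp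
    have E0: "0 \<le> E n" unfolding E_def using B th(1) C3 by (intro add_nonneg_nonneg) auto
    have R0: "0 \<le> R n" unfolding R_def using E0 M G e by (intro add_nonneg_nonneg mult_nonneg_nonneg) auto
    interpret M1: mollify1 n "\<rho> n" by (rule mollify1[OF n])
    have intA: "(\<integral>\<^sup>+\<omega>. indicator {0..<1} \<omega> * A n \<omega> \<partial>lborel) \<le> ennreal \<kappa>"
    proof -
      let ?P = "\<lambda>\<omega>. indicator {0..<1} \<omega> * ennreal \<bar>X f n (Gp n \<omega> ?c0) - cW\<bar>"
      let ?Q = "\<lambda>\<omega>. indicator {0..<1} \<omega> * ennreal \<bar>X0 n (a + h n * \<omega>) - x0\<bar>"
      have [measurable]: "?P \<in> borel_measurable borel" by (rule elim(6))
      have [measurable]: "?Q \<in> borel_measurable borel" by (rule X0_phase_measurable[OF n])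
      have "(\<integral>\<^sup>+\<omega>. indicator {0..<1} \<omega> * A n \<omega> \<partial>lborel) = (\<integral>\<^sup>+\<omega>. ennreal (1 / \<epsilon>) * ?P \<omega> + (ennreal M * ?Q \<omega> + indicator {0..<1} \<omega> * ennreal (R n)) \<partial>lborel)"
        by (intro nn_integral_cong) (simp add: A_def distrib_left mult.left_commute)
      also have "\<dots> = (\<integral>\<^sup>+\<omega>. ennreal (1 / \<epsilon>) * ?P \<omega> \<partial>lborel) + (\<integral>\<^sup>+\<omega>. ennreal M * ?Q \<omega> + indicator {0..<1} \<omega> * ennreal (R n) \<partial>lborel)"
        by (rule nn_integral_add) measurable
      also have "(\<integral>\<^sup>+\<omega>. ennreal M * ?Q \<omega> + indicator {0..<1} \<omega> * ennreal (R n) \<partial>lborel) = (\<integral>\<^sup>+\<omega>. ennreal M * ?Q \<omega> \<partial>lborel) + (\<integral>\<^sup>+\<omega>. indicator {0..<1::real} \<omega> * ennreal (R n) \<partial>lborel)"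
        by (rule nn_integral_add) measurable
      also have "(\<integral>\<^sup>+\<omega>. ennreal (1 / \<epsilon>) * ?P \<omega> \<partial>lborel) = ennreal (1 / \<epsilon>) * (\<integral>\<^sup>+\<omega>. ?P \<omega> \<partial>lborel)" by (rule nn_integral_cmult) measurable
      also have "(\<integral>\<^sup>+\<omega>. ennreal M * ?Q \<omega> \<partial>lborel) = ennreal M * (\<integral>\<^sup>+\<omega>. ?Q \<omega> \<partial>lborel)" by (rule nn_integral_cmult) measurable
      also have "(\<integral>\<^sup>+\<omega>. indicator {0..<1::real} \<omega> * ennreal (R n) \<partial>lborel) = ennreal (R n)" by (subst nn_integral_multc) auto
      also have "ennreal (1 / \<epsilon>) * (\<integral>\<^sup>+\<omega>. ?P \<omega> \<partial>lborel) + (ennreal M * (\<integral>\<^sup>+\<omega>. ?Q \<omega> \<partial>lborel) + ennreal (R n))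
         \<le> ennreal (\<kappa> / 8) + (ennreal (\<kappa> / 8) + ennreal (3 * \<kappa> / 4))"
        using elim(2,3,4) by (intro add_mono ennreal_leI) auto
      also have "\<dots> = ennreal \<kappa>" using \<kappa> by (simp flip: ennreal_plus)
      finally show ?thesis .
    qed
    have key: "M1.round_up a (h n) s \<omega> u \<le> c' + (1 / \<epsilon> * \<bar>X f n (Gp n \<omega> ?c0) - cW\<bar> + (M * \<bar>X0 n (a + h n * \<omega>) - x0\<bar> + R n)) \<and>
        c' - (1 / \<epsilon> * \<bar>X f n (Gp n \<omega> ?c0) - cW\<bar> + (M * \<bar>X0 n (a + h n * \<omega>) - x0\<bar> + R n)) \<le> M1.round_up a (h n) s \<omega> u'"
      if w: "0 \<le> \<omega>" "\<omega> < 1" for \<omega>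
    proof -
      interpret g: grid a b L h \<rho> \<rho>2 X0 f C B n \<omega> "X f n" by (rule grid[OF n w])
      let ?i = "grid_index a (h n) \<omega> (s - 2 * r)" and ?j = "grid_index a (h n) \<omega> ?c0"
      have gi: "s - 2 * r \<le> g.tk ?i" "g.tk ?i < s - 2 * r + h n"
        using grid_index_bounds[OF hn _ w, of a "s - 2 * r"] r by auto
      have gj: "?c0 \<le> g.tk ?j" "g.tk ?j < ?c0 + h n"
        using grid_index_bounds[OF hn _ w, of a ?c0] r s by auto
      have ij: "?i \<le> ?j" using r by (intro grid_index_mono[OF hn]) auto
      have ui: "g.uk s ?i = 0" using gi small r by (intro M1.tail_0) linarith
      have uj: "g.uk s ?j = 1" using gj r by (intro M1.tail_1) linarith
      have fnB: "\<bar>g.fn (g.tk k) (g.w k)\<bar> \<le> B" for k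
      proof -
        have "- B \<le> f p \<and> f p \<le> B" for p using fB[of "fst p" "snd p"] by (auto simp: abs_le_iff)
        then show ?thesis using c.mollify_f_range[OF n g.tk_ge[of k], of "- B" "g.w k" B] by (auto simp: abs_le_iff)
      qed
      have wi: "g.w ?i = X0 n (a + h n * \<omega>)"
      proof -
        have "\<bar>g.w ?i - g.w 0\<bar> \<le> 0 * (V (g.tk ?i + 1 / real n) - V (g.tk 0))"
        proof (rule g.w_osc)
          fix k assume "k < ?i"
          then have "g.tk k \<le> s - 2 * r" using grid_index_le_iff[OF hn, of a \<omega> "s - 2 * r" k] by (simp add: not_le)
          then show "\<bar>g.fn (g.tk k) (g.w k)\<bar> \<le> 0" using fn_left[OF n g.tk_ge] small(2) by simp
        qed auto
        then show ?thesis using g.w_0 by simp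
      qed
      have Esum: "(\<Sum>k=?i..<?j. g.jump_error B s k) \<le> E n"
      proof -
        have "(\<Sum>k=?i..<?j. g.jump_error B s k) \<le> B * (g.Zs s (g.tk ?j + 1 / real n) - g.Zs s (g.tk ?i)) + \<bar>J s\<bar> * C * (h n + 3 / real n)"
          by (rule g.sum_jump_error[OF ij]) (use B in simp)
        also have "\<dots> \<le> E n" unfolding E_def
        proof (intro add_right_mono mult_left_mono)
          have "s \<le> g.tk ?j + 1 / real n" using gj r n3 by linarith
          then have "g.Zs s (g.tk ?j + 1 / real n) = V (g.tk ?j + 1 / real n) - \<bar>J s\<bar>" by (simp add: g.Zs_def)
          moreover have "V (g.tk ?j + 1 / real n) \<le> V (s + 3 * r)" using gj small by (intro V_mono) linarith
          moreover have "g.tk ?i < s" using gi small r n3 by linarith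
          then have "g.Zs s (g.tk ?i) = V (g.tk ?i)" by (simp add: g.Zs_def)
          moreover have "V (s - 2 * r) \<le> V (g.tk ?i)" using gi by (intro V_mono)
          ultimately show "g.Zs s (g.tk ?j + 1 / real n) - g.Zs s (g.tk ?i) \<le> \<theta>" using r(4) by linarith
        qed (use B in simp)
        finally show ?thesis .
      qed
      let ?\<Gamma> = "\<Sum>k=?i..<?j. g (g.uk s k) * (g.uk s (Suc k) - g.uk s k)"
      let ?e0 = "\<bar>X0 n (a + h n * \<omega>) - x0\<bar>" and ?W = "X f n (Gp n \<omega> ?c0)"
      have b: "\<bar>?W - x0 - 1 - \<epsilon> * ?\<Gamma>\<bar> \<le> ?e0 + E n + \<epsilon> * G * (\<epsilon> + E n + ?e0)"
        using g.bump_estimate[OF s(1) less_imp_le[OF s(2)] fnB fs g01 gl _ _ ij ui uj Esum] e G wi by simp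
      have "\<bar>\<epsilon> * (?\<Gamma> - c')\<bar> \<le> \<bar>?W - cW\<bar> + (?e0 + E n + \<epsilon> * G * (\<epsilon> + E n + ?e0))"
      proof -
        have "\<epsilon> * c' = cW - x0 - 1" using e by (simp add: c'_def)
        then show ?thesis using b unfolding right_diff_distrib by linarith
      qed
      then have "\<bar>?\<Gamma> - c'\<bar> \<le> (\<bar>?W - cW\<bar> + (?e0 + E n + \<epsilon> * G * (\<epsilon> + E n + ?e0))) / \<epsilon>"
        by (rule dv)
      also have "\<dots> = 1 / \<epsilon> * \<bar>?W - cW\<bar> + (M * ?e0 + R n)"
        using e by (simp add: M_def R_def field_simps)
      finally have \<Gamma>: "\<bar>?\<Gamma> - c'\<bar> \<le> 1 / \<epsilon> * \<bar>?W - cW\<bar> + (M * ?e0 + R n)" .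
      show ?thesis using g.riemann_squeeze[where g=g, OF u ij ui uj g01 g1 g0] \<Gamma> by linarith
    qed
    have Aeq: "A n \<omega> = ennreal (1 / \<epsilon> * \<bar>X f n (Gp n \<omega> ?c0) - cW\<bar> + (M * \<bar>X0 n (a + h n * \<omega>) - x0\<bar> + R n))" for \<omega>
      unfolding A_def using e M R0 by (simp add: ennreal_mult'[symmetric] ennreal_plus[symmetric] del: ennreal_plus)
    have sa: "a \<le> s - M1.tinv v" for v using M1.tinv_bounds(2)[of v] small(2) r by linarith
    show ?case
    proof (intro ballI conjI)
      fix \<delta> :: real assume d: "\<delta> \<in> {0<..<1}"
      then have d': "0 < \<delta>" "\<delta> < 1" by auto
      show "S n \<delta> u \<le> c' + \<kappa> / (1 - \<delta>)" unfolding S_def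
      proof (rule M1.phase_average_bounds(1)[OF hn sa d' intA less_imp_le[OF \<kappa>]])
        fix \<omega> :: real assume "0 \<le> \<omega>" "\<omega> < 1"
        then show "ennreal (M1.round_up a (h n) s \<omega> u - c') \<le> A n \<omega>"
          unfolding Aeq using key[of \<omega>] by (intro ennreal_leI) linarith
      qed
      show "c' - \<kappa> / \<delta> \<le> S n \<delta> u'" unfolding S_def
      proof (rule M1.phase_average_bounds(2)[OF hn sa d' intA less_imp_le[OF \<kappa>]])
        fix \<omega> :: real assume "0 \<le> \<omega>" "\<omega> < 1"
        then show "ennreal (c' - M1.round_up a (h n) s \<omega> u') \<le> A n \<omega>"
          unfolding Aeq using key[of \<omega>] by (intro ennreal_leI) linarith
      qed
    qed
  qed
  then show ?thesis by blast
qed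

lemma S_bounds:
  assumes n: "1 \<le> n" shows "0 \<le> S n \<delta> u" "S n \<delta> u \<le> 1" "0 < \<delta> \<Longrightarrow> 0 < u \<Longrightarrow> u < 1 \<Longrightarrow> u \<le> S n \<delta> u"
proof -
  interpret M1: mollify1 n "\<rho> n" by (rule mollify1[OF n])
  show "0 \<le> S n \<delta> u" "S n \<delta> u \<le> 1" unfolding S_def by (rule M1.tail_bounds)+
  assume "0 < \<delta>" "0 < u" "u < 1"
  then show "u \<le> S n \<delta> u" unfolding S_def using h_pos[OF n] by (subst M1.le_tail_iff) auto
qed

text \<open>By adjointness \<open>v \<le> S n (1/2) u\<close> means that \<open>tinv v\<close> is at
  least \<open>tinv u - h n / 2\<close>; moving another quarter of a step to the left loses at most
  three quarters in all.\<close>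

lemma S_shift:
  assumes n: "1 \<le> n" and u: "0 < v" "v < 1" and le: "v \<le> S n (1/2) u"
  shows "S n (1/4) v \<le> S n (3/4) u"
proof -
  interpret M1: mollify1 n "\<rho> n" by (rule mollify1[OF n])
  have "M1.tinv u - h n * (1/2) \<le> M1.tinv v" using le unfolding S_def M1.le_tail_iff[OF u] .
  then show ?thesis unfolding S_def by (intro M1.tail_antimono) linarith
qed

lemma sigma_exists:
  fixes X :: "(real \<times> real \<Rightarrow> real) \<Rightarrow> nat \<Rightarrow> real \<Rightarrow> real"
  assumes sol: "\<And>f n. admissible a b f \<Longrightarrow> n \<ge> 1 \<Longrightarrow> scheme_solution a b L h \<rho> \<rho>2 X0 f n (X f n)"
    and L1: "\<And>f. admissible a b f \<Longrightarrow> \<exists>x. L1_converges {a..b} (X f) x"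
    and X0c: "(\<lambda>n. \<integral>\<^sup>+\<omega>. indicator {0..<1} \<omega> * ennreal \<bar>X0 n (a + h n * \<omega>) - x0\<bar> \<partial>lborel) \<longlonglongrightarrow> 0"
    and s: "a < s" "s < b" "J s \<noteq> 0"
  shows "\<exists>\<sigma>. gap_function \<sigma> \<and> \<sigma> \<in> borel_measurable borel \<and>
    (\<forall>\<delta>\<in>{0<..<1}. \<forall>u\<in>{0<..<1}. continuous (at u within {0..1}) \<sigma> \<longrightarrow> (\<lambda>n. S n \<delta> u) \<longlonglongrightarrow> \<sigma> u)"
proof (rule gap_function_of_limits)
  fix u u' \<delta> \<delta>' e :: real
  assume u: "0 < u" "u < u'" "u' < 1" and d: "0 < \<delta>" "\<delta> < 1" "0 < \<delta>'" "\<delta>' < 1" and e: "0 < e"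
  define \<kappa> where "\<kappa> = e * min (1 - \<delta>) \<delta>'"
  have "\<kappa> \<le> e * (1 - \<delta>)" "\<kappa> \<le> e * \<delta>'" unfolding \<kappa>_def using e by (intro mult_left_mono; simp)+
  then have \<kappa>: "0 < \<kappa>" "\<kappa> / (1 - \<delta>) \<le> e" "\<kappa> / \<delta>' \<le> e"
    using d e by (simp_all add: \<kappa>_def pos_divide_le_eq)
  obtain c where c: "\<forall>\<^sub>F n in sequentially. \<forall>\<delta>\<in>{0<..<1}. S n \<delta> u \<le> c + \<kappa> / (1 - \<delta>) \<and> c - \<kappa> / \<delta> \<le> S n \<delta> u'"
    using S_squeeze[OF sol L1 X0c s u \<kappa>(1)] by blast
  have "\<forall>\<^sub>F n in sequentially. S n \<delta> u \<le> c + e \<and> c - e \<le> S n \<delta>' u'"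
    using c
  proof eventually_elim
    case (elim n)
    have "S n \<delta> u \<le> c + \<kappa> / (1 - \<delta>)" "c - \<kappa> / \<delta>' \<le> S n \<delta>' u'" using elim d by auto
    then show ?case using \<kappa> by linarith
  qed
  then show "\<exists>c. \<forall>\<^sub>F n in sequentially. S n \<delta> u \<le> c + e \<and> c - e \<le> S n \<delta>' u'" by blast
qed (use S_bounds S_shift in auto)

text \<open>Dominated convergence, first in \<delta> and then in \<open>u\<close>: a monotone
  function has countably many discontinuities, and the remaining exceptional points 0 and 1 of the
  ranges are null as well.\<close>

lemma phase_error_tendsto:
  assumes \<sigma>: "gap_function \<sigma>" "\<sigma> \<in> borel_measurable borel"
    and conv: "\<forall>\<delta>\<in>{0<..<1}. \<forall>u\<in>{0<..<1}. continuous (at u within {0..1}) \<sigma> \<longrightarrow> (\<lambda>n. S n \<delta> u) \<longlonglongrightarrow> \<sigma> u"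
  shows "phase_error \<sigma> \<longlonglongrightarrow> 0"
proof -
  interpret gap_function \<sigma> by (rule \<sigma>(1))
  note [measurable] = \<sigma>(2)
  \<comment> \<open>Nothing is known about the mollifier of index 0, so that index is replaced by a
    measurable dummy.\<close>
  define S' where "S' n \<delta> u = (if 1 \<le> n then S n \<delta> u else 0)" for n \<delta> u
  have S'm: "(\<lambda>p. S' n (fst p) (snd p)) \<in> borel_measurable (borel \<Otimes>\<^sub>M borel)" for n
  proof (cases "1 \<le> n")
    case True
    interpret M1: mollify1 n "\<rho> n" by (rule mollify1[OF True])
    have [measurable]: "M1.tail \<in> borel_measurable borel" by (rule borel_measurable_continuous_onI[OF M1.tail_continuous])
    show ?thesis using True unfolding S'_def S_def by simp
  qed (simp add: S'_def)
  then have [measurable]: "(\<lambda>(u, \<delta>). S' n \<delta> u) \<in> borel_measurable (borel \<Otimes>\<^sub>M borel)" for n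
    using measurable_compose[OF measurable_pair_swap' S'm] by (simp add: split_beta')
  have [measurable]: "(\<lambda>\<delta>. S' n \<delta> u) \<in> borel_measurable borel" for n u
    using measurable_compose[OF measurable_Pair1'[of u borel borel] \<open>(\<lambda>(u, \<delta>). S' n \<delta> u) \<in> _\<close>] by simp
  have S'01: "0 \<le> S' n \<delta> u" "S' n \<delta> u \<le> 1" for n \<delta> u using S_bounds[of n \<delta> u] by (auto simp: S'_def)
  have diff1: "ennreal \<bar>S' n \<delta> u - \<sigma> u\<bar> \<le> 1" if "u \<in> {0<..<1}" for n \<delta> u
  proof -
    have "\<bar>S' n \<delta> u - \<sigma> u\<bar> \<le> 1" using S'01[of n \<delta> u] \<sigma>_nonneg[of u] \<sigma>_le[of u] that by auto
    then show ?thesis using ennreal_leI[of _ 1] by simp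
  qed
  define I where "I n u = (\<integral>\<^sup>+\<delta>. indicator {0..<1} \<delta> * ennreal \<bar>S' n \<delta> u - \<sigma> u\<bar> \<partial>lborel)" for n u
  have Im [measurable]: "I n \<in> borel_measurable borel" for n unfolding I_def[abs_def] by measurable
  have one: "(\<integral>\<^sup>+\<delta>. indicator {0..<1::real} \<delta> \<partial>lborel) = 1" "(\<integral>\<^sup>+\<delta>. indicator {0<..<1::real} \<delta> \<partial>lborel) = 1" by simp_all
  have I1: "I n u \<le> 1" if u: "u \<in> {0<..<1}" for n u
  proof -
    have "I n u \<le> (\<integral>\<^sup>+\<delta>. indicator {0..<1::real} \<delta> \<partial>lborel)"
      unfolding I_def using diff1[OF u] by (intro nn_integral_mono) (auto split: split_indicator)
    then show ?thesis using one by simp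
  qed
  have Ilim: "(\<lambda>n. I n u) \<longlonglongrightarrow> 0" if u: "u \<in> {0<..<1}" and c: "continuous (at u within {0..1}) \<sigma>" for u
  proof -
    have "(\<lambda>n. I n u) \<longlonglongrightarrow> (\<integral>\<^sup>+\<delta>. 0 \<partial>(lborel :: real measure))" unfolding I_def
    proof (rule nn_integral_dominated_convergence[where w="indicator {0..<1}"])
      have "AE \<delta> in lborel. \<delta> \<noteq> (0::real)" by (rule AE_lborel_singleton)
      then show "AE \<delta> in lborel. (\<lambda>n. indicator {0..<1} \<delta> * ennreal \<bar>S' n \<delta> u - \<sigma> u\<bar>) \<longlonglongrightarrow> 0"
      proof eventually_elim
        case (elim \<delta>)
        show ?case
        proof (cases "\<delta> \<in> {0..<1}")
          case True
          then have "(\<lambda>n. S n \<delta> u) \<longlonglongrightarrow> \<sigma> u" using conv elim u c by auto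
          moreover have "\<forall>\<^sub>F n in sequentially. S n \<delta> u = S' n \<delta> u"
            using eventually_ge_at_top[of 1] by eventually_elim (simp add: S'_def)
          ultimately have "(\<lambda>n. S' n \<delta> u) \<longlonglongrightarrow> \<sigma> u" by (rule Lim_transform_eventually)
          then have "(\<lambda>n. \<bar>S' n \<delta> u - \<sigma> u\<bar>) \<longlonglongrightarrow> \<bar>\<sigma> u - \<sigma> u\<bar>" by (intro tendsto_intros)
          then have "(\<lambda>n. ennreal \<bar>S' n \<delta> u - \<sigma> u\<bar>) \<longlonglongrightarrow> ennreal 0" by (intro tendsto_ennrealI) simp
          then show ?thesis using True by simp
        qed simp
      qed
      show "AE \<delta> in lborel. indicator {0..<1} \<delta> * ennreal \<bar>S' n \<delta> u - \<sigma> u\<bar> \<le> indicator {0..<1} \<delta>" for n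
        using diff1[OF u] by (intro AE_I2) (auto split: split_indicator)
    qed (use one in auto)
    then show ?thesis by simp
  qed
  have cnt: "countable {u \<in> {0..1}. \<not> continuous (at u within {0..1}) \<sigma>}"
    by (rule mono_on_ctble_discont) (auto simp: mono_on_def intro!: mono_\<sigma>)
  then have "AE u in lborel. u \<notin> {u \<in> {0..1}. \<not> continuous (at u within {0..1}) \<sigma>}"
    by (intro AE_not_in countable_imp_null_set_lborel)
  then have ae: "AE u in lborel. (\<lambda>n. indicator {0<..<1} u * I n u) \<longlonglongrightarrow> 0"
  proof eventually_elim
    case (elim u)
    then show ?case using Ilim[of u] by (cases "u \<in> {0<..<1}") auto
  qed
  have "(\<lambda>n. \<integral>\<^sup>+u. indicator {0<..<1} u * I n u \<partial>lborel) \<longlonglongrightarrow> (\<integral>\<^sup>+u. 0 \<partial>(lborel :: real measure))"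
  proof (rule nn_integral_dominated_convergence[where w="indicator {0<..<1}", OF _ _ _ _ _ ae])
    show "AE u in lborel. indicator {0<..<1} u * I n u \<le> indicator {0<..<1} u" for n
      using I1 by (intro AE_I2) (auto split: split_indicator)
  qed (use one in auto)
  then have lim: "(\<lambda>n. \<integral>\<^sup>+u. indicator {0<..<1} u * I n u \<partial>lborel) \<longlonglongrightarrow> 0" by simp
  have ev: "\<forall>\<^sub>F n in sequentially. (\<integral>\<^sup>+u. indicator {0<..<1} u * I n u \<partial>lborel) = phase_error \<sigma> n"
    using eventually_ge_at_top[of 1] by eventually_elim (simp add: phase_error_def I_def S'_def S_def)
  show ?thesis by (rule Lim_transform_eventually[OF lim ev])
qed

end

section \<open>Assembly: the case without interior jumps, end points of \<open>F_n\<close>, and the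
  theorem\<close>

lemma gap_function_id: "gap_function (\<lambda>u. u)"
  by unfold_locales auto

context scheme_data
begin

lemma jump_0_of_continuous:
  assumes c: "continuous_on T L" and T: "s \<in> T" "{a..<s} \<subseteq> T" and s: "a < s" "s \<le> b"
  shows "J s = 0"
proof (rule jump_eqI)
  have "(L \<longlongrightarrow> L s) (at s within T)" using c T by (auto simp: continuous_on_def)
  then have "(L \<longlongrightarrow> L s) (at s within {a..<s})" by (rule tendsto_within_subset) (use T in auto)
  moreover have "{a..s} - {s} = {a..<s} - {s}" by auto
  then have "at s within {a..<s} = at_left s"
    using at_within_Icc_at_left[OF s(1)] by (simp add: at_within_def)
  ultimately have "(L \<longlongrightarrow> L s) (at_left s)" by simp
  moreover have "\<forall>\<^sub>F t in at_left s. L t = extend a b L t"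
    using eventually_at_left_real[OF s(1)] by eventually_elim (use s in \<open>auto simp: extend_def\<close>)
  ultimately show "(extend a b L \<longlongrightarrow> extend a b L s) (at_left s)"
    using s by (auto simp: extend_def elim: Lim_transform_eventually)
qed

text \<open>By right-continuity a discontinuity in \<open>{a..<b}\<close> can only come from the
  left, so it is a jump, and it is not at \<open>a\<close>.\<close>

lemma interior_jump_exists:
  assumes "\<not> continuous_on {a..<b} L" shows "\<exists>s. a < s \<and> s < b \<and> J s \<noteq> 0"
proof (rule ccontr)
  assume no: "\<not> ?thesis"
  have "(L \<longlongrightarrow> L s) (at s within {a..<b})" if s: "a \<le> s" "s < b" for s
  proof -
    have r: "(L \<longlongrightarrow> L s) (at_right s)" using L_right[of s] s by (simp add: continuous_within)
    show ?thesis
    proof (cases "s = a")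
      case True
      have "(L \<longlongrightarrow> L s) (at s within {a..})"
        using r True by (auto simp: at_within_Ici_at_right)
      then show ?thesis by (rule tendsto_within_subset) auto
    next
      case False
      have "(extend a b L \<longlongrightarrow> extend a b L s - J s) (at_left s)" by (rule left_lim)
      moreover have "J s = 0" using no s False by auto
      moreover have "\<forall>\<^sub>F t in at_left s. extend a b L t = L t"
        using eventually_at_left_real[of a s] s False by (auto elim!: eventually_mono simp: extend_def)
      ultimately have "(L \<longlongrightarrow> L s) (at_left s)"
        using s by (auto simp: extend_def elim: Lim_transform_eventually)
      then have "(L \<longlongrightarrow> L s) (at s)" using r by (simp add: filterlim_split_at)
      then show ?thesis by (rule tendsto_within_subset) auto
    qed
  qed
  then have "continuous_on {a..<b} L" by (auto simp: continuous_on_def)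
  then show False using assms by simp
qed

lemma F_fun_real: "1 \<le> n \<Longrightarrow> F_fun \<rho> n (ereal y) = mollify1.tail n (\<rho> n) y"
  unfolding F_fun_def by (rule mollify1.F_fun_eq[OF mollify1])

lemma F_fun_infinity: assumes n: "1 \<le> n" shows "F_fun \<rho> n \<infinity> = 0"
proof -
  have "\<rho> n s = 0" if "1 / real n < s" for s using mollifierD(3)[OF \<rho>_moll[OF n], of s] that by auto
  then have "(\<lambda>s. indicator (einterval (ereal (1 / real n)) \<infinity>) s *\<^sub>R \<rho> n s) = (\<lambda>_. 0)"
    by (auto simp: einterval_def split: split_indicator)
  then show ?thesis by (simp add: F_fun_def interval_lebesgue_integral_def set_lebesgue_integral_def)
qed

text \<open>At 0 the inverse is infinite and absorbs the shift, so the value stays 0. At 1 it is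
  finite, and every point strictly to its left lies below a point where \<open>F_n\<close> is 1,
  hence has value 1 too.\<close>

lemma F_fun_F_inv:
  assumes n: "1 \<le> n" and d: "0 < \<delta>"
  shows "0 < u \<Longrightarrow> u < 1 \<Longrightarrow> F_fun \<rho> n (F_inv \<rho> n u - ereal (\<delta> * h n)) = S n \<delta> u"
    "F_fun \<rho> n (F_inv \<rho> n 0 - ereal (\<delta> * h n)) = 0"
    "F_fun \<rho> n (F_inv \<rho> n 1 - ereal (\<delta> * h n)) = 1"
proof -
  interpret M1: mollify1 n "\<rho> n" by (rule mollify1[OF n])
  note F = F_fun_real[OF n] F_fun_infinity[OF n]
  have hn: "0 < h n" by (rule h_pos[OF n])
  show "F_fun \<rho> n (F_inv \<rho> n u - ereal (\<delta> * h n)) = S n \<delta> u" if u: "0 < u" "u < 1"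
  proof -
    have "F_inv \<rho> n u = ereal (M1.tinv u)" unfolding F_inv_def
    proof (rule antisym)
      show "Sup {x. F_fun \<rho> n x = u} \<le> ereal (M1.tinv u)"
      proof (rule Sup_least)
        fix x assume "x \<in> {x. F_fun \<rho> n x = u}"
        then show "x \<le> ereal (M1.tinv u)" using F u M1.le_tail_iff[OF u] by (cases x) auto
      qed
      show "ereal (M1.tinv u) \<le> Sup {x. F_fun \<rho> n x = u}"
        by (rule Sup_upper) (use F M1.tail_tinv[OF u] in simp)
    qed
    then show ?thesis by (simp add: F S_def mult.commute)
  qed
  have "F_inv \<rho> n 0 = \<infinity>" unfolding F_inv_def
    using Sup_upper[of \<infinity> "{x. F_fun \<rho> n x = 0}"] F(2) by simp
  then show "F_fun \<rho> n (F_inv \<rho> n 0 - ereal (\<delta> * h n)) = 0" using F(2) by simp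
  define q where "q = F_inv \<rho> n 1"
  have q0: "0 \<le> q" unfolding q_def F_inv_def by (rule Sup_upper) (use F(1)[of 0] M1.tail_1[of 0] in \<open>simp add: zero_ereal_def\<close>)
  have q1: "q \<le> ereal (1 / real n)" unfolding q_def F_inv_def
  proof (rule Sup_least)
    fix x assume x: "x \<in> {x. F_fun \<rho> n x = 1}"
    show "x \<le> ereal (1 / real n)"
    proof (cases x)
      case (real y)
      then show ?thesis using x F(1)[of y] M1.tail_0[of y] by (cases "1 / real n < y") auto
    qed (use x F(2) in auto)
  qed
  obtain y where y: "q = ereal y" using q0 q1 by (cases q) auto
  have "0 < \<delta> * h n" using d hn by simp
  then have "ereal (y - \<delta> * h n) < q" unfolding y by simp
  then obtain x where x: "F_fun \<rho> n x = 1" "ereal (y - \<delta> * h n) < x"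
    unfolding q_def F_inv_def less_Sup_iff by blast
  have "M1.tail (y - \<delta> * h n) = 1"
  proof (cases x)
    case (real z)
    then have "1 = M1.tail z" "y - \<delta> * h n < z" using x F(1)[of z] by auto
    then show ?thesis using M1.tail_antimono[of "y - \<delta> * h n" z] M1.tail_bounds(2)[of "y - \<delta> * h n"] by simp
  qed (use x F(2) in auto)
  then show "F_fun \<rho> n (F_inv \<rho> n 1 - ereal (\<delta> * h n)) = 1"
    unfolding q_def[symmetric] y using F(1) by simp
qed

text \<open>The last conjunct serves the continuous case: without jumps the coefficient of the jump
  equation is 0, whose solution is constant for every measure, so one and the same \<open>y\<close>
  works for all of them.\<close>

lemma limit_is_solution:
  assumes sol: "\<And>n. n \<ge> 1 \<Longrightarrow> scheme_solution a b L h \<rho> \<rho>2 X0 f n (X n)"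
    and adm: "admissible a b f" and L1: "L1_converges {a..b} X x"
    and X0c: "(\<lambda>n. \<integral>\<^sup>+\<omega>. indicator {0..<1} \<omega> * ennreal \<bar>X0 n (a + h n * \<omega>) - x0\<bar> \<partial>lborel) \<longlonglongrightarrow> 0"
    and \<sigma>: "gap_function \<sigma>" "\<sigma> \<in> borel_measurable borel"
    and err: "\<exists>s. a < s \<and> s < b \<and> J s \<noteq> 0 \<Longrightarrow> phase_error \<sigma> \<longlonglongrightarrow> 0"
  shows "\<exists>y. (AE t in lborel. t \<in> {a..b} \<longrightarrow> x t = y t) \<and>
     limit_solution a b L (gap_function.\<mu> \<sigma>) f x0 y \<and>
     ((\<forall>s. a < s \<and> s \<le> b \<longrightarrow> J s = 0) \<longrightarrow> (\<forall>\<mu>. prob_on_unit \<mu> \<longrightarrow> limit_solution a b L \<mu> f x0 y))"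
proof -
  interpret g: gap_function \<sigma> by (rule \<sigma>(1))
  obtain C K where "coefficient a b L h \<rho> \<rho>2 X0 f C K" using admissible_coefficient[OF adm] by blast
  then interpret c: coefficient a b L h \<rho> \<rho>2 X0 f C K .
  have \<sigma>01: "\<sigma> u \<in> {0..1}" if "u \<in> {0<..<1}" for u using that g.\<sigma>_le[of u] g.\<sigma>_nonneg[of u] by auto
  obtain \<omega> r where pl: "phase_limit a b L h \<rho> \<rho>2 X0 f C K \<omega> r X x x0"
    and conv: "\<And>s. a < s \<Longrightarrow> s < b \<Longrightarrow> J s \<noteq> 0 \<Longrightarrow>
      (\<lambda>j. LINT u:{0<..<1}|lborel. \<bar>mollify1.round_up (r j) (\<rho> (r j)) a (h (r j)) s \<omega> u - \<sigma> u\<bar>) \<longlonglongrightarrow> 0"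
  proof (rule c.phase_selection[OF L1 _ X0c \<sigma>(2)])
    fix \<omega> r
    assume 1: "phase_limit a b L h \<rho> \<rho>2 X0 f C K \<omega> r X x x0"
      and 2: "\<And>s. a < s \<Longrightarrow> s < b \<Longrightarrow> J s \<noteq> 0 \<Longrightarrow>
        (\<lambda>j. LINT u:{0<..<1}|lborel. \<bar>mollify1.round_up (r j) (\<rho> (r j)) a (h (r j)) s \<omega> u - \<sigma> u\<bar>) \<longlonglongrightarrow> 0"
    show ?thesis by (rule that[OF 1 2])
  qed (erule sol \<sigma>01 err)+
  interpret p: phase_limit a b L h \<rho> \<rho>2 X0 f C K \<omega> r X x x0 by (rule pl)
  have P: "prob_on_unit g.\<mu>" using g.\<mu>_generated by (simp add: generated_by_def)
  let ?y = "\<lambda>\<mu>. p.bend(b := phi \<mu> (\<lambda>v. J b * f (b, v)) (Lim (at_left b) p.bend) 1)"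
  have 1: "limit_solution a b L g.\<mu> f x0 (?y g.\<mu>)"
    by (rule p.solution[OF _ P]) (rule p.jump_limit[OF \<sigma>(1)], use conv in auto)
  have 2: "limit_solution a b L \<mu> f x0 (?y g.\<mu>)" if J0: "\<forall>s. a < s \<and> s \<le> b \<longrightarrow> J s = 0" and mu: "prob_on_unit \<mu>" for \<mu>
  proof -
    have "limit_solution a b L \<mu> f x0 (?y \<mu>)" by (rule p.solution[OF _ mu]) (use J0 in auto)
    moreover have "?y \<mu> = ?y g.\<mu>" using J0 ab' phi_zero[OF mu] phi_zero[OF P] by simp
    ultimately show ?thesis by simp
  qed
  show ?thesis using 1 2 p.solution_ae by blast
qed

end

theorem theorem3p3:
  fixes a b :: real
    and L :: "real \<Rightarrow> real"
    and h :: "nat \<Rightarrow> real"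
    and \<rho> :: "nat \<Rightarrow> real \<Rightarrow> real"
    and \<rho>2 :: "nat \<Rightarrow> real \<times> real \<Rightarrow> real"
    and X0 :: "nat \<Rightarrow> real \<Rightarrow> real"
    and X :: "(real \<times> real \<Rightarrow> real) \<Rightarrow> nat \<Rightarrow> real \<Rightarrow> real"
  assumes "a < b"
    and "\<And>t. t \<in> {a..<b} \<Longrightarrow> continuous (at_right t) L"
    and "finite_variation_on {a..b} L"
    and "\<And>n. n \<ge> 1 \<Longrightarrow> h n > 0"
    and "h \<longlonglongrightarrow> 0"
    and "\<And>n. n \<ge> 1 \<Longrightarrow> mollifier {0..1 / real n} (\<rho> n)"
    and "\<And>n. n \<ge> 1 \<Longrightarrow> mollifier ({0..1 / real n} \<times> {0..1 / real n}) (\<rho>2 n)"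
    and "\<And>n. n \<ge> 1 \<Longrightarrow> \<exists>g. C_infinity g \<and> (\<forall>t\<in>{a..<a + h n}. X0 n t = g t)"
    and "\<And>f n. admissible a b f \<Longrightarrow> n \<ge> 1 \<Longrightarrow> scheme_solution a b L h \<rho> \<rho>2 X0 f n (X f n)"
    and "\<And>f. admissible a b f \<Longrightarrow> \<exists>x. L1_converges {a..b} (X f) x"
  shows "\<exists>x0.
    (\<lambda>n. LINT t:{a..b}|lborel. \<bar>X0 n (tau a (h n) t) - x0\<bar>) \<longlonglongrightarrow> 0 \<and>
    (continuous_on {a..b} L \<longrightarrow>
      (\<forall>f x. admissible a b f \<longrightarrow> L1_converges {a..b} (X f) x \<longrightarrow>
        (\<exists>y. (AE t in lborel. t \<in> {a..b} \<longrightarrow> x t = y t) \<and>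
             (\<forall>\<mu>. prob_on_unit \<mu> \<longrightarrow> limit_solution a b L \<mu> f x0 y)))) \<and>
    (\<not> continuous_on {a..b} L \<longrightarrow>
      (\<exists>\<sigma>. class_G \<sigma> \<and>
        (\<not> continuous_on {a..<b} L \<longrightarrow>
          (\<forall>\<delta>\<in>{0<..<1}. \<forall>u\<in>{0..1}. continuous (at u within {0..1}) \<sigma> \<longrightarrow>
             (\<lambda>n. F_fun \<rho> n (F_inv \<rho> n u - ereal (\<delta> * h n))) \<longlonglongrightarrow> \<sigma> u)) \<and>
        (\<exists>\<mu>. generated_by \<sigma> \<mu> \<and>
          (\<forall>f x. admissible a b f \<longrightarrow> L1_converges {a..b} (X f) x \<longrightarrow>
            (\<exists>y. (AE t in lborel. t \<in> {a..b} \<longrightarrow> x t = y t) \<and>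
                 limit_solution a b L \<mu> f x0 y)))))"
proof -
  interpret scheme_data a b L h \<rho> \<rho>2 X0 using assms(1-8) by unfold_locales
  have "coefficient a b L h \<rho> \<rho>2 X0 (\<lambda>_. 0) 0 0" by unfold_locales auto
  then have adm0: "admissible a b (\<lambda>_. 0)" by (rule coefficient_admissible)
  obtain xz where xz: "L1_converges {a..b} (X (\<lambda>_. 0)) xz" using assms(10)[OF adm0] by blast
  obtain x0 where x0: "(\<lambda>n. \<integral>\<^sup>+\<omega>. indicator {0..<1} \<omega> * ennreal \<bar>X0 n (a + h n * \<omega>) - x0\<bar> \<partial>lborel) \<longlonglongrightarrow> 0"
    "(\<lambda>n. LINT t:{a..b}|lborel. \<bar>X0 n (tau a (h n) t) - x0\<bar>) \<longlonglongrightarrow> 0"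
    using initial_limit[OF assms(9)[OF adm0] xz] by blast
  \<comment> \<open>Without interior jumps no rounding function has to converge, and the identity,
    which is in class G, may be taken for \<sigma>.\<close>
  have ident: "\<exists>y. (AE t in lborel. t \<in> {a..b} \<longrightarrow> x t = y t) \<and>
     limit_solution a b L (gap_function.\<mu> (\<lambda>u. u)) f x0 y \<and>
     ((\<forall>s. a < s \<and> s \<le> b \<longrightarrow> J s = 0) \<longrightarrow> (\<forall>\<mu>. prob_on_unit \<mu> \<longrightarrow> limit_solution a b L \<mu> f x0 y))"
    if no: "\<nexists>s. a < s \<and> s < b \<and> J s \<noteq> 0"
      and f: "admissible a b f" "L1_converges {a..b} (X f) x" for f x
    by (rule limit_is_solution[OF assms(9)[OF f(1)] f x0(1) gap_function_id]) (use no in auto)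
  have part1: "\<exists>y. (AE t in lborel. t \<in> {a..b} \<longrightarrow> x t = y t) \<and> (\<forall>\<mu>. prob_on_unit \<mu> \<longrightarrow> limit_solution a b L \<mu> f x0 y)"
    if c: "continuous_on {a..b} L" and f: "admissible a b f" "L1_converges {a..b} (X f) x" for f x
  proof -
    have J0: "\<forall>s. a < s \<and> s \<le> b \<longrightarrow> J s = 0" using jump_0_of_continuous[OF c] by (simp add: subset_eq)
    then have "\<nexists>s. a < s \<and> s < b \<and> J s \<noteq> 0" by auto
    then show ?thesis using ident f J0 by blast
  qed
  have part2: "\<exists>\<sigma>. class_G \<sigma> \<and>
        (\<not> continuous_on {a..<b} L \<longrightarrow>
          (\<forall>\<delta>\<in>{0<..<1}. \<forall>u\<in>{0..1}. continuous (at u within {0..1}) \<sigma> \<longrightarrow>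
             (\<lambda>n. F_fun \<rho> n (F_inv \<rho> n u - ereal (\<delta> * h n))) \<longlonglongrightarrow> \<sigma> u)) \<and>
        (\<exists>\<mu>. generated_by \<sigma> \<mu> \<and>
          (\<forall>f x. admissible a b f \<longrightarrow> L1_converges {a..b} (X f) x \<longrightarrow>
            (\<exists>y. (AE t in lborel. t \<in> {a..b} \<longrightarrow> x t = y t) \<and> limit_solution a b L \<mu> f x0 y)))"
  proof (cases "continuous_on {a..<b} L")
    \<comment> \<open>The only discontinuity is at \<open>b\<close>, out of reach of convergence in
      L1. The value at \<open>b\<close> is prescribed by the equation with the measure of the
      identity.\<close>
    case True
    have no: "\<nexists>s. a < s \<and> s < b \<and> J s \<noteq> 0" using jump_0_of_continuous[OF True] by (auto simp: subset_eq)
    have "\<exists>y. (AE t in lborel. t \<in> {a..b} \<longrightarrow> x t = y t) \<and> limit_solution a b L (gap_function.\<mu> (\<lambda>u. u)) f x0 y"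
      if f: "admissible a b f" "L1_converges {a..b} (X f) x" for f x
      using ident[OF no f] by blast
    then show ?thesis
      using True gap_function.class_G[OF gap_function_id] gap_function.\<mu>_generated[OF gap_function_id] by blast
  next
    case False
    then obtain s where s: "a < s" "s < b" "J s \<noteq> 0" using interior_jump_exists by blast
    obtain \<sigma> where \<sigma>: "gap_function \<sigma>" "\<sigma> \<in> borel_measurable borel"
      and conv: "\<forall>\<delta>\<in>{0<..<1}. \<forall>u\<in>{0<..<1}. continuous (at u within {0..1}) \<sigma> \<longrightarrow> (\<lambda>n. S n \<delta> u) \<longlonglongrightarrow> \<sigma> u"
      using sigma_exists[OF assms(9,10) x0(1) s] by blast
    interpret g: gap_function \<sigma> by (rule \<sigma>(1))
    have "\<exists>y. (AE t in lborel. t \<in> {a..b} \<longrightarrow> x t = y t) \<and> limit_solution a b L g.\<mu> f x0 y"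
      if f: "admissible a b f" "L1_converges {a..b} (X f) x" for f x
    proof -
      have "\<exists>y. (AE t in lborel. t \<in> {a..b} \<longrightarrow> x t = y t) \<and> limit_solution a b L g.\<mu> f x0 y \<and>
        ((\<forall>s. a < s \<and> s \<le> b \<longrightarrow> J s = 0) \<longrightarrow> (\<forall>\<mu>. prob_on_unit \<mu> \<longrightarrow> limit_solution a b L \<mu> f x0 y))"
        by (rule limit_is_solution[OF assms(9)[OF f(1)] f x0(1) \<sigma>]) (use phase_error_tendsto[OF \<sigma> conv] in auto)
      then show ?thesis by blast
    qed
    moreover have "(\<lambda>n. F_fun \<rho> n (F_inv \<rho> n u - ereal (\<delta> * h n))) \<longlonglongrightarrow> \<sigma> u"
      if d: "\<delta> \<in> {0<..<1}" and u: "u \<in> {0..1}" and c: "continuous (at u within {0..1}) \<sigma>" for \<delta> u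
    proof -
      \<comment> \<open>The end points are separate because \<open>S\<close> represents the sequence
        of the theorem for \<open>0 < u < 1\<close> only; at 0 and 1 that sequence is constant for
        \<open>n \<ge> 1\<close>.\<close>
      consider "u = 0" | "u = 1" | "u \<in> {0<..<1}" using u by fastforce
      then show ?thesis
      proof cases
        case 1
        have "\<forall>\<^sub>F n in sequentially. F_fun \<rho> n (F_inv \<rho> n u - ereal (\<delta> * h n)) = \<sigma> u"
          using eventually_ge_at_top[of 1] by eventually_elim (use F_fun_F_inv(2)[of _ \<delta>] d 1 g.\<sigma>_0 in auto)
        then show ?thesis by (rule tendsto_eventually)
      next
        case 2
        have "\<forall>\<^sub>F n in sequentially. F_fun \<rho> n (F_inv \<rho> n u - ereal (\<delta> * h n)) = \<sigma> u"
          using eventually_ge_at_top[of 1] by eventually_elim (use F_fun_F_inv(3)[of _ \<delta>] d 2 g.\<sigma>_1 in auto)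
        then show ?thesis by (rule tendsto_eventually)
      next
        case 3
        have "\<forall>\<^sub>F n in sequentially. S n \<delta> u = F_fun \<rho> n (F_inv \<rho> n u - ereal (\<delta> * h n))"
          using eventually_ge_at_top[of 1] by eventually_elim (use F_fun_F_inv(1)[of _ \<delta> u] d 3 in auto)
        moreover have "(\<lambda>n. S n \<delta> u) \<longlonglongrightarrow> \<sigma> u" using conv d 3 c by blast
        ultimately show ?thesis by (rule Lim_transform_eventually[rotated])
      qed
    qed
    ultimately show ?thesis using g.class_G g.\<mu>_generated by blast
  qed
  show ?thesis using x0(2) part1 part2 by blast
qed

end
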